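(* Let $Q\simeq\mathbb{R}^4$ be equipped with its flat hyperkahler structure, and let $\hat\Gamma\subset \mathrm{Aff}(Q)$ act linearly (in the sense of the context) with $\Gamma\subset Sp(Q)$. Then, for any $r/2<s\le\infty$, the hyperkahler quotient at zero moment map parameters, $$\mathcal{A}^s_{\hat\Gamma}/\!/\!/\mathcal{G}^{s+1}_{\hat\Gamma} := \{A\in\mathcal{A}^s_{\hat\Gamma} : \mu^1(A)=\mu^2(A)=\mu^3(A)=0\}/\mathcal{G}^{s+1}_{\hat\Gamma},$$ may be identified with the flat orbifold $Q/\hat\Gamma\simeq (T_\Lambda\times\Lambda_{\mathbb{R}}^\perp)/\Gamma$, where $T_\Lambda=\Lambda_{\mathbb{R}}/\Lambda$. Here the identification is a bijection of sets, which is compatible with the natural hyperkahler structures away from the points with nontrivial stabilizer in $\hat\Gamma$.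
   Context: Setup. $Q$ is a finite-dimensional real inner product space and $\mathrm{Aff}(Q)=Q\rtimes O(Q)$. $\hat\Gamma\subset\mathrm{Aff}(Q)$ is a discrete subgroup, $\Lambda\subset\hat\Gamma$ is a finite-index normal subgroup consisting of translations, so $\Lambda\subset Q$ is a lattice of some rank $r$, and $\Gamma=\hat\Gamma/\Lambda$. The action is linear: $\hat\Gamma=\Gamma\ltimes\Lambda$ with $\Gamma\subset O(Q)$ acting by linear automorphisms and $\Lambda$ by translations. Put $\Lambda_{\mathbb{R}}=\Lambda\otimes\mathbb{R}\subset Q$, with orthogonal complement $\Lambda_{\mathbb{R}}^\perp$; both are $\Gamma$-invariant. Throughout, when $Q\simeq\mathbb{R}^4$ and $\Gamma\subset Sp(Q)\simeq SU(2)$, one assumes $\Gamma\neq\{1\}$. Dual torus. $\Lambda^\vee=\mathrm{Hom}(\Lambda,2\pi\mathbb{Z})$ and $T^\vee_\Lambda=\Lambda_{\mathbb{R}}^*/\Lambda^\vee$, with the $\Gamma$-action induced from that on $\Lambda_{\mathbb{R}}$ via the inner product identification $\Lambda_{\mathbb{R}}^*\simeq\Lambda_{\mathbb{R}}$. One-forms on $T^\vee_\Lambda$ are identified with $\Lambda_{\mathbb{R}}$-valued functions. $R_\Gamma=\mathbb{C}[\Gamma]$ is the regular representation with its standard Hermitian structure, and $j(\gamma)$ denotes left multiplication by $\gamma$ on it. $U(R_\Gamma)$ is its unitary group and $\mathfrak{u}(R_\Gamma)$ is the skew-Hermitian matrices. Function spaces. $H^s$ is the $L^2$-Sobolev space of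 order $s$ ($H^\infty=C^\infty$). $\mathcal{A}^s_{\hat\Gamma}$ is the affine space of pairs $(\nabla,\phi)$, where $\nabla=d+a$ is an $H^s$ Hermitian connection on the trivial bundle $R_\Gamma\times T^\vee_\Lambda$ and $\phi\in H^s(T^\vee_\Lambda,\mathfrak{u}(R_\Gamma)\otimes\Lambda_{\mathbb{R}}^\perp)$, which are $\Gamma$-equivariant: viewing $(a,\phi)$ as a function $X$ valued in $\mathfrak{u}(R_\Gamma)\otimes_{\mathbb{R}} Q$, one has $X(\gamma\theta)=(\mathrm{Ad}_{j(\gamma)}\otimes\gamma)X(\theta)$ for $\gamma\in\Gamma$. $\mathcal{G}^{s+1}_{\hat\Gamma}=\{g\in H^{s+1}(T^\vee_\Lambda,U(R_\Gamma)): g(\gamma\theta)=j(\gamma)g(\theta)j(\gamma)^{-1}\}/U(1)$, where $U(1)$ is the constant scalars; it acts by $(\nabla,\phi)\mapsto(g^{-1}\nabla g,g^{-1}\phi g)$. Moment maps. The curvature is $\mathscr{F}(a,\phi)=(da+\frac12[a,a],\,d\phi+[a,\phi],\,\frac12[\phi,\phi])$, valued in $\mathfrak{u}(R_\Gamma)\otimes\Lambda^2Q$, with $\Lambda^2 Q=\Lambda^2(\Lambda_{\mathbb{R}})\oplus(\Lambda_{\mathbb{R}}\otimes\Lambda_{\mathbb{R}}^\perp)\oplus\Lambda^2(\Lambda_{\mathbb{R}}^\perp)$. With $\omega^1,\omega^2,\omega^3$ the Kahler forms on $Q$, $\mu^i=\iota_{\omega^i}\circ\mathscr{F}$ is the contraction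 of $\mathscr{F}$ with $\omega^i$. Hyperkahler structure. The tangent space to $\mathcal{A}^s_{\hat\Gamma}$ is the space of equivariant $H^s$ functions valued in $\mathfrak{u}(R_\Gamma)\otimes Q$; its complex structures are those of $Q$, and its metric and Kahler forms are $g(a,b)=-\frac{1}{|\Gamma|\hat V}\int_{T^\vee_\Lambda}\mathrm{Tr}\langle a,b\rangle\,d\mathrm{Vol}$ and $\omega^i(a,b)=-\frac{1}{|\Gamma|\hat V}\int_{T^\vee_\Lambda}\mathrm{Tr}\,\omega^i(a,b)\,d\mathrm{Vol}$, where $\hat V=\mathrm{vol}(T^\vee_\Lambda)$. The hyperkahler structure on the stabilizer-free locus of the quotient is the one that descends from it. *)

theory Defs
  imports "HOL-Analysis.Analysis" "HOL-Algebra.Coset"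
begin

section \<open>Affine isometries, linear actions and the flat orbifold\<close>

text \<open>A pair \<open>(v, A)\<close> stands for the affine isometry \<open>x \<mapsto> A x + v\<close>; the topology of
  \<open>Aff(Q) = Q \<rtimes> O(Q)\<close> is the one of the metric space \<open>Q \<times> L(Q, Q)\<close>.\<close>

type_synonym 'q aff = "'q \<times> ('q \<Rightarrow>\<^sub>L 'q)"

definition ortho_group :: "('q::euclidean_space \<Rightarrow>\<^sub>L 'q) set" where
  "ortho_group = {A. orthogonal_transformation (blinfun_apply A)}"

definition Aff :: "('q::euclidean_space) aff monoid" where
  "Aff = \<lparr>carrier = UNIV \<times> ortho_group,
          mult = (\<lambda>(v, A) (w, B). (v + blinfun_apply A w, A o\<^sub>L B)),
          one = (0, id_blinfun)\<rparr>"

definition aff_act :: "('q::euclidean_space) aff \<Rightarrow> 'q \<Rightarrow> 'q" where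
  "aff_act g x = blinfun_apply (snd g) x + fst g"

definition aff_orbit :: "('q::euclidean_space) aff set \<Rightarrow> 'q \<Rightarrow> 'q set" where
  "aff_orbit \<Gamma>h x = {aff_act g x | g. g \<in> \<Gamma>h}"

definition orbifold :: "('q::euclidean_space) aff set \<Rightarrow> 'q set set" where
  "orbifold \<Gamma>h = range (aff_orbit \<Gamma>h)"

definition free_locus :: "('q::euclidean_space) aff set \<Rightarrow> 'q set" where
  "free_locus \<Gamma>h = {x. \<forall>g\<in>\<Gamma>h. aff_act g x = x \<longrightarrow> g = \<one>\<^bsub>Aff\<^esub>}"

text \<open>\<open>\<Gamma>h\<close> is a discrete subgroup of \<open>Aff(Q)\<close>, its translations by \<open>\<Lambda>\<close> form a normal subgroup of
  finite index, and \<open>\<Gamma>h = \<Gamma> \<ltimes> \<Lambda>\<close> with \<open>\<Gamma> \<subseteq> O(Q)\<close>.\<close>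

definition linear_action ::
    "('q::euclidean_space) aff set \<Rightarrow> ('q \<Rightarrow>\<^sub>L 'q) set \<Rightarrow> 'q set \<Rightarrow> bool" where
  "linear_action \<Gamma>h \<Gamma> \<Lambda> \<longleftrightarrow>
     subgroup \<Gamma>h Aff \<and> discrete \<Gamma>h \<and>
     normal (\<Lambda> \<times> {id_blinfun}) (Aff\<lparr>carrier := \<Gamma>h\<rparr>) \<and>
     finite (rcosets\<^bsub>Aff\<lparr>carrier := \<Gamma>h\<rparr>\<^esub> (\<Lambda> \<times> {id_blinfun})) \<and>
     \<Gamma> \<subseteq> ortho_group \<and> \<Gamma>h = \<Lambda> \<times> \<Gamma>"

text \<open>\<open>T\<^sub>\<Lambda> = \<Lambda>\<^sub>\<real> / \<Lambda>\<close> as a set of cosets, and the orbits of \<open>\<Gamma>\<close> on \<open>T\<^sub>\<Lambda> \<times> \<Lambda>\<^sub>\<real>\<^sup>\<bottom>\<close>.\<close>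

definition torus_coset :: "('q::euclidean_space) set \<Rightarrow> 'q \<Rightarrow> 'q set" where
  "torus_coset \<Lambda> u = (\<lambda>l. u + l) ` \<Lambda>"

definition torus :: "('q::euclidean_space) set \<Rightarrow> 'q set set" where
  "torus \<Lambda> = torus_coset \<Lambda> ` span \<Lambda>"

definition split_orbit ::
    "('q::euclidean_space \<Rightarrow>\<^sub>L 'q) set \<Rightarrow> 'q set \<times> 'q \<Rightarrow> ('q set \<times> 'q) set" where
  "split_orbit \<Gamma> p = {(blinfun_apply \<gamma> ` fst p, blinfun_apply \<gamma> (snd p)) | \<gamma>. \<gamma> \<in> \<Gamma>}"

definition split_orbifold ::
    "('q::euclidean_space \<Rightarrow>\<^sub>L 'q) set \<Rightarrow> 'q set \<Rightarrow> ('q set \<times> 'q) set set" where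
  "split_orbifold \<Gamma> \<Lambda> = split_orbit \<Gamma> ` (torus \<Lambda> \<times> orthogonal_comp (span \<Lambda>))"


section \<open>Flat hyperkaehler structures\<close>

text \<open>The three complex structures are \<open>J 1\<close>, \<open>J 2\<close>, \<open>J 3\<close>; other values of \<open>J\<close> play no role.
  The relations imply \<open>J 2 \<circ> J 1 = - J 3\<close>.\<close>

definition hyperkaehler :: "(nat \<Rightarrow> 'q::euclidean_space \<Rightarrow>\<^sub>L 'q) \<Rightarrow> bool" where
  "hyperkaehler J \<longleftrightarrow>
     (\<forall>i\<in>{1,2,3}. J i \<in> ortho_group \<and> J i o\<^sub>L J i = - id_blinfun) \<and> J 1 o\<^sub>L J 2 = J 3"

definition Sp :: "(nat \<Rightarrow> 'q::euclidean_space \<Rightarrow>\<^sub>L 'q) \<Rightarrow> ('q \<Rightarrow>\<^sub>L 'q) set" where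
  "Sp J = {A \<in> ortho_group. \<forall>i\<in>{1,2,3}. A o\<^sub>L J i = J i o\<^sub>L A}"

definition kaehler_form ::
    "(nat \<Rightarrow> 'q::euclidean_space \<Rightarrow>\<^sub>L 'q) \<Rightarrow> nat \<Rightarrow> 'q \<Rightarrow> 'q \<Rightarrow> real" where
  "kaehler_form J i u v = blinfun_apply (J i) u \<bullet> v"


section \<open>Functions on the dual torus\<close>

text \<open>\<open>\<Lambda>\<^sub>\<real>\<^sup>*\<close> is identified with \<open>\<Lambda>\<^sub>\<real> = span \<Lambda>\<close> by the inner product, which turns
  \<open>\<Lambda>\<^sup>\<or> = Hom(\<Lambda>, 2\<pi>\<int>)\<close> into the following set.\<close>

definition dual_lattice :: "('q::euclidean_space) set \<Rightarrow> 'q set" where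
  "dual_lattice \<Lambda> = {\<xi> \<in> span \<Lambda>. \<forall>l\<in>\<Lambda>. \<exists>n::int. \<xi> \<bullet> l = 2 * pi * of_int n}"

text \<open>A function on \<open>T\<^sup>\<or> = \<Lambda>\<^sub>\<real> / \<Lambda>\<^sup>\<or>\<close> is represented by its pullback along
  \<open>Q \<rightarrow> \<Lambda>\<^sub>\<real> \<rightarrow> T\<^sup>\<or>\<close>, the first map being the orthogonal projection. The \<open>\<Gamma>\<close>-action on \<open>T\<^sup>\<or>\<close> is
  thereby induced by the one on \<open>Q\<close>, and derivatives in directions normal to \<open>\<Lambda>\<^sub>\<real>\<close> vanish.\<close>

definition torus_fun :: "('q::euclidean_space) set \<Rightarrow> ('q \<Rightarrow> 'b) \<Rightarrow> bool" where
  "torus_fun \<Lambda> f \<longleftrightarrow>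
     (\<forall>\<theta>. \<forall>\<xi>\<in>dual_lattice \<Lambda>. f (\<theta> + \<xi>) = f \<theta>) \<and>
     (\<forall>\<theta>. \<forall>w\<in>orthogonal_comp (span \<Lambda>). f (\<theta> + w) = f \<theta>)"

text \<open>The Dirichlet cell of \<open>\<Lambda>\<^sup>\<or>\<close> in \<open>\<Lambda>\<^sub>\<real>\<close> is a fundamental domain up to a null set. It is thickened
  by the unit ball of \<open>\<Lambda>\<^sub>\<real>\<^sup>\<bottom>\<close>, whose volume is divided out in \<open>torus_integral\<close>, in order to
  integrate against Lebesgue measure on \<open>Q\<close>.\<close>

definition dirichlet_domain :: "('q::euclidean_space) set \<Rightarrow> 'q set" where
  "dirichlet_domain \<Lambda> =
     {u + w | u w. u \<in> span \<Lambda> \<and> (\<forall>\<xi>\<in>dual_lattice \<Lambda>. norm u \<le> norm (u - \<xi>)) \<and>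
                   w \<in> orthogonal_comp (span \<Lambda>) \<and> norm w \<le> 1}"

definition torus_integral ::
    "('q::euclidean_space) set \<Rightarrow> ('q \<Rightarrow> 'b::{banach,second_countable_topology}) \<Rightarrow> 'b" where
  "torus_integral \<Lambda> f =
     (1 / unit_ball_vol (real (DIM('q)) - real (dim \<Lambda>))) *\<^sub>R
       (LINT \<theta>:dirichlet_domain \<Lambda>|lborel. f \<theta>)"

definition torus_vol :: "('q::euclidean_space) set \<Rightarrow> real" where
  "torus_vol \<Lambda> = torus_integral \<Lambda> (\<lambda>_. 1)"

text \<open>The characters of \<open>T\<^sup>\<or>\<close> are \<open>\<theta> \<mapsto> exp(i \<langle>l, \<theta>\<rangle>)\<close> for \<open>l \<in> \<Lambda>\<close>.\<close>

definition fourier :: "('q::euclidean_space) set \<Rightarrow> ('q \<Rightarrow> complex) \<Rightarrow> 'q \<Rightarrow> complex" where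
  "fourier \<Lambda> f l = (1 / torus_vol \<Lambda>) *\<^sub>R torus_integral \<Lambda> (\<lambda>\<theta>. f \<theta> * cis (- (l \<bullet> \<theta>)))"

text \<open>\<open>H\<^sup>s\<close> for \<open>r/2 < s \<le> \<infinity>\<close>. In this range the Sobolev embedding provides a unique continuous
  representative in each class, and \<open>H\<^sup>s\<close> is taken to consist of these representatives.
  For \<open>s = \<infinity>\<close> one gets the smooth functions.\<close>

definition sobolev :: "('q::euclidean_space) set \<Rightarrow> ereal \<Rightarrow> ('q \<Rightarrow> complex) \<Rightarrow> bool" where
  "sobolev \<Lambda> s f \<longleftrightarrow>
     torus_fun \<Lambda> f \<and> continuous_on UNIV f \<and>
     (\<forall>t::real. ereal t \<le> s \<longrightarrow>
        (\<lambda>l. (1 + (norm l)\<^sup>2) powr t * (cmod (fourier \<Lambda> f l))\<^sup>2) summable_on \<Lambda>)"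

definition test_fun :: "('q::euclidean_space) set \<Rightarrow> ('q \<Rightarrow> real) \<Rightarrow> bool" where
  "test_fun \<Lambda> \<psi> \<longleftrightarrow> sobolev \<Lambda> \<infinity> (\<lambda>\<theta>. complex_of_real (\<psi> \<theta>))"

definition dir_deriv ::
    "'q::euclidean_space \<Rightarrow> ('q \<Rightarrow> 'b::real_normed_vector) \<Rightarrow> 'q \<Rightarrow> 'b" where
  "dir_deriv v f \<theta> = frechet_derivative f (at \<theta>) v"


section \<open>Equivariant fields and gauge transformations\<close>

text \<open>The finite group \<open>\<Gamma>\<close> is enumerated by a bijection \<open>e\<close> from a finite type, so that
  \<open>R\<^sub>\<Gamma> = \<complex>[\<Gamma>]\<close> has the orthonormal basis \<open>e h\<close> and \<open>End(R\<^sub>\<Gamma>)\<close> is a matrix type.\<close>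

definition adj :: "complex^'g^'g \<Rightarrow> complex^'g^'g" where
  "adj M = (\<chi> h k. cnj (M $ k $ h))"

definition commutator :: "complex^'g^'g \<Rightarrow> complex^'g^'g \<Rightarrow> complex^'g^'g" where
  "commutator M N = M ** N - N ** M"

definition left_mult ::
    "('g::finite \<Rightarrow> 'q::euclidean_space \<Rightarrow>\<^sub>L 'q) \<Rightarrow> ('q \<Rightarrow>\<^sub>L 'q) \<Rightarrow> complex^'g^'g" where
  "left_mult e \<gamma> = (\<chi> h k. if e h = \<gamma> o\<^sub>L e k then 1 else 0)"

text \<open>An element \<open>x\<close> of \<open>End(R\<^sub>\<Gamma>) \<otimes>\<^sub>\<real> Q\<close> is represented by the real linear map sending \<open>v \<in> Q\<close> to the
  component \<open>\<langle>x, v\<rangle>\<close> of \<open>x\<close> along \<open>v\<close>. Accordingly \<open>(id \<otimes> A) x\<close> has the component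
  \<open>\<langle>x, A\<^sup>T v\<rangle>\<close> along \<open>v\<close>.\<close>

type_synonym ('q, 'g) matvec = "'q \<Rightarrow>\<^sub>L (complex^'g^'g)"
type_synonym ('q, 'g) field = "'q \<Rightarrow> ('q, 'g) matvec"

definition vec_act ::
    "('q::euclidean_space \<Rightarrow>\<^sub>L 'q) \<Rightarrow> ('q, 'g::finite) matvec \<Rightarrow> ('q, 'g) matvec" where
  "vec_act A x = x o\<^sub>L Blinfun (adjoint (blinfun_apply A))"

definition Ad :: "complex^'g^'g \<Rightarrow> complex^'g^'g \<Rightarrow> complex^'g^'g" where
  "Ad M N = M ** N ** matrix_inv M"

definition equivariant ::
    "('g::finite \<Rightarrow> 'q::euclidean_space \<Rightarrow>\<^sub>L 'q) \<Rightarrow> ('q, 'g) field \<Rightarrow> bool" where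
  "equivariant e X \<longleftrightarrow>
     (\<forall>\<gamma>\<in>range e. \<forall>\<theta> v. blinfun_apply (X (blinfun_apply \<gamma> \<theta>)) v =
        Ad (left_mult e \<gamma>) (blinfun_apply (vec_act \<gamma> (X \<theta>)) v))"

definition equivariant_End ::
    "('g::finite \<Rightarrow> 'q::euclidean_space \<Rightarrow>\<^sub>L 'q) \<Rightarrow> ('q \<Rightarrow> complex^'g^'g) \<Rightarrow> bool" where
  "equivariant_End e g \<longleftrightarrow>
     (\<forall>\<gamma>\<in>range e. \<forall>\<theta>. g (blinfun_apply \<gamma> \<theta>) = Ad (left_mult e \<gamma>) (g \<theta>))"

text \<open>A pair \<open>(d + a, \<phi>)\<close> is represented by \<open>X = (a, \<phi>)\<close>: the component of \<open>X\<close> along \<open>v\<close> is \<open>a(v)\<close>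
  for \<open>v \<in> \<Lambda>\<^sub>\<real>\<close> and \<open>\<langle>\<phi>, v\<rangle>\<close> for \<open>v \<in> \<Lambda>\<^sub>\<real>\<^sup>\<bottom>\<close>. With \<open>d\<close> as base point, the same set is the affine
  space of configurations and its tangent space.\<close>

definition fields ::
    "('q::euclidean_space) set \<Rightarrow> ('g::finite \<Rightarrow> 'q \<Rightarrow>\<^sub>L 'q) \<Rightarrow> ereal \<Rightarrow> ('q, 'g) field set" where
  "fields \<Lambda> e s =
     {X. (\<forall>v h k. sobolev \<Lambda> s (\<lambda>\<theta>. blinfun_apply (X \<theta>) v $ h $ k)) \<and>
         (\<forall>\<theta> v. adj (blinfun_apply (X \<theta>) v) = - blinfun_apply (X \<theta>) v) \<and>
         equivariant e X}"

definition gauge_maps ::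
    "('q::euclidean_space) set \<Rightarrow> ('g::finite \<Rightarrow> 'q \<Rightarrow>\<^sub>L 'q) \<Rightarrow> ereal \<Rightarrow>
     ('q \<Rightarrow> complex^'g^'g) set" where
  "gauge_maps \<Lambda> e s =
     {g. (\<forall>h k. sobolev \<Lambda> s (\<lambda>\<theta>. g \<theta> $ h $ k)) \<and>
         (\<forall>\<theta>. adj (g \<theta>) ** g \<theta> = mat 1) \<and> equivariant_End e g}"

text \<open>The elements of the gauge group are cosets of the constant scalars \<open>U(1)\<close>.\<close>

definition scalar_coset :: "('q \<Rightarrow> complex^'g^'g) \<Rightarrow> ('q \<Rightarrow> complex^'g^'g) set" where
  "scalar_coset g = {(\<lambda>\<theta>. mat c ** g \<theta>) | c. cmod c = 1}"

definition gauge_group ::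
    "('q::euclidean_space) set \<Rightarrow> ('g::finite \<Rightarrow> 'q \<Rightarrow>\<^sub>L 'q) \<Rightarrow> ereal \<Rightarrow>
     ('q \<Rightarrow> complex^'g^'g) set set" where
  "gauge_group \<Lambda> e s = scalar_coset ` gauge_maps \<Lambda> e s"

text \<open>\<open>g\<^sup>-\<^sup>1 (d + a) g = d + g\<^sup>-\<^sup>1 a g + g\<^sup>-\<^sup>1 dg\<close> and \<open>g\<^sup>-\<^sup>1 \<phi> g\<close> in one formula, since \<open>g\<close> is constant
  in the directions normal to \<open>\<Lambda>\<^sub>\<real>\<close>. For \<open>s > r/2\<close> elements of \<open>H\<^sup>s\<^sup>+\<^sup>1\<close> are continuously
  differentiable, so the derivative is a classical one.\<close>

definition gauge_act ::
    "('q::euclidean_space \<Rightarrow> complex^'g::finite^'g) \<Rightarrow> ('q, 'g) field \<Rightarrow> ('q, 'g) field" where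
  "gauge_act g X = (\<lambda>\<theta>. Blinfun (\<lambda>v.
     matrix_inv (g \<theta>) ** blinfun_apply (X \<theta>) v ** g \<theta> + matrix_inv (g \<theta>) ** dir_deriv v g \<theta>))"

text \<open>\<open>s\<close> is the regularity of the fields, gauge transformations have regularity \<open>s + 1\<close>.\<close>

definition gauge_orbit ::
    "('q::euclidean_space) set \<Rightarrow> ('g::finite \<Rightarrow> 'q \<Rightarrow>\<^sub>L 'q) \<Rightarrow> ereal \<Rightarrow> ('q, 'g) field \<Rightarrow>
     ('q, 'g) field set" where
  "gauge_orbit \<Lambda> e s X = {gauge_act g X | g G. G \<in> gauge_group \<Lambda> e (s + 1) \<and> g \<in> G}"

definition gauge_stabilizer ::
    "('q::euclidean_space) set \<Rightarrow> ('g::finite \<Rightarrow> 'q \<Rightarrow>\<^sub>L 'q) \<Rightarrow> ereal \<Rightarrow> ('q, 'g) field \<Rightarrow>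
     ('q \<Rightarrow> complex^'g^'g) set set" where
  "gauge_stabilizer \<Lambda> e s X = {G \<in> gauge_group \<Lambda> e (s + 1). \<exists>g\<in>G. gauge_act g X = X}"


section \<open>Moment maps and the hyperkaehler quotient\<close>

text \<open>The component of \<open>\<F>(a, \<phi>)\<close> along \<open>v \<and> w\<close>, as a distribution (\<open>\<F>\<close> lies in \<open>H\<^sup>s\<^sup>-\<^sup>1\<close>, which need
  not consist of functions) evaluated on \<open>\<psi>\<close>: the pairing of
  \<open>\<partial>\<^sub>v X\<^sub>w - \<partial>\<^sub>w X\<^sub>v + [X\<^sub>v, X\<^sub>w]\<close> with \<open>\<psi>\<close>. As derivatives normal to \<open>\<Lambda>\<^sub>\<real>\<close> vanish, this is
  \<open>(da + [a,a]/2)(v,w)\<close> for \<open>v, w \<in> \<Lambda>\<^sub>\<real>\<close>, it is \<open>\<langle>d\<phi> + [a,\<phi>], w\<rangle>(v)\<close> for \<open>v \<in> \<Lambda>\<^sub>\<real>\<close> and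
  \<open>w \<in> \<Lambda>\<^sub>\<real>\<^sup>\<bottom>\<close>, and \<open>[\<phi>\<^sub>v, \<phi>\<^sub>w]\<close> for \<open>v, w \<in> \<Lambda>\<^sub>\<real>\<^sup>\<bottom>\<close>.\<close>

definition curvature ::
    "('q::euclidean_space) set \<Rightarrow> ('q, 'g::finite) field \<Rightarrow> 'q \<Rightarrow> 'q \<Rightarrow> ('q \<Rightarrow> real) \<Rightarrow>
     complex^'g^'g" where
  "curvature \<Lambda> X v w \<psi> = torus_integral \<Lambda> (\<lambda>\<theta>.
     - dir_deriv v \<psi> \<theta> *\<^sub>R blinfun_apply (X \<theta>) w + dir_deriv w \<psi> \<theta> *\<^sub>R blinfun_apply (X \<theta>) v
     + \<psi> \<theta> *\<^sub>R commutator (blinfun_apply (X \<theta>) v) (blinfun_apply (X \<theta>) w))"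

definition curvature_lin ::
    "('q::euclidean_space) set \<Rightarrow> ('q, 'g::finite) field \<Rightarrow> ('q, 'g) field \<Rightarrow> 'q \<Rightarrow> 'q \<Rightarrow>
     ('q \<Rightarrow> real) \<Rightarrow> complex^'g^'g" where
  "curvature_lin \<Lambda> X Y v w \<psi> = torus_integral \<Lambda> (\<lambda>\<theta>.
     - dir_deriv v \<psi> \<theta> *\<^sub>R blinfun_apply (Y \<theta>) w + dir_deriv w \<psi> \<theta> *\<^sub>R blinfun_apply (Y \<theta>) v
     + \<psi> \<theta> *\<^sub>R (commutator (blinfun_apply (X \<theta>) v) (blinfun_apply (Y \<theta>) w)
               + commutator (blinfun_apply (Y \<theta>) v) (blinfun_apply (X \<theta>) w)))"

text \<open>Contraction of a 2-vector with \<open>\<omega>\<^sup>i\<close>: the sum over pairs \<open>b < c\<close> of an orthonormal basis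
  is half the sum over all pairs.\<close>

definition contract ::
    "(nat \<Rightarrow> 'q::euclidean_space \<Rightarrow>\<^sub>L 'q) \<Rightarrow> nat \<Rightarrow> ('q \<Rightarrow> 'q \<Rightarrow> 'b::real_vector) \<Rightarrow> 'b" where
  "contract J i F = (1/2) *\<^sub>R (\<Sum>b\<in>Basis. \<Sum>c\<in>Basis. kaehler_form J i b c *\<^sub>R F b c)"

definition moment_map ::
    "(nat \<Rightarrow> 'q::euclidean_space \<Rightarrow>\<^sub>L 'q) \<Rightarrow> 'q set \<Rightarrow> nat \<Rightarrow> ('q, 'g::finite) field \<Rightarrow>
     ('q \<Rightarrow> real) \<Rightarrow> complex^'g^'g" where
  "moment_map J \<Lambda> i X \<psi> = contract J i (\<lambda>v w. curvature \<Lambda> X v w \<psi>)"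

definition moment_map_lin ::
    "(nat \<Rightarrow> 'q::euclidean_space \<Rightarrow>\<^sub>L 'q) \<Rightarrow> 'q set \<Rightarrow> nat \<Rightarrow> ('q, 'g::finite) field \<Rightarrow>
     ('q, 'g) field \<Rightarrow> ('q \<Rightarrow> real) \<Rightarrow> complex^'g^'g" where
  "moment_map_lin J \<Lambda> i X Y \<psi> = contract J i (\<lambda>v w. curvature_lin \<Lambda> X Y v w \<psi>)"

definition zero_level ::
    "(nat \<Rightarrow> 'q::euclidean_space \<Rightarrow>\<^sub>L 'q) \<Rightarrow> 'q set \<Rightarrow> ('g::finite \<Rightarrow> 'q \<Rightarrow>\<^sub>L 'q) \<Rightarrow> ereal \<Rightarrow>
     ('q, 'g) field set" where
  "zero_level J \<Lambda> e s =
     {X \<in> fields \<Lambda> e s. \<forall>i\<in>{1,2,3}. \<forall>\<psi>. test_fun \<Lambda> \<psi> \<longrightarrow> moment_map J \<Lambda> i X \<psi> = 0}"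

definition hk_quotient ::
    "(nat \<Rightarrow> 'q::euclidean_space \<Rightarrow>\<^sub>L 'q) \<Rightarrow> 'q set \<Rightarrow> ('g::finite \<Rightarrow> 'q \<Rightarrow>\<^sub>L 'q) \<Rightarrow> ereal \<Rightarrow>
     ('q, 'g) field set set" where
  "hk_quotient J \<Lambda> e s = gauge_orbit \<Lambda> e s ` zero_level J \<Lambda> e s"


section \<open>The hyperkaehler structure of the quotient\<close>

definition field_metric ::
    "('q::euclidean_space) set \<Rightarrow> ('q, 'g::finite) field \<Rightarrow> ('q, 'g) field \<Rightarrow> real" where
  "field_metric \<Lambda> Y Z = - (1 / (real (CARD('g)) * torus_vol \<Lambda>)) *
     torus_integral \<Lambda> (\<lambda>\<theta>. Re (\<Sum>b\<in>Basis.
       trace (blinfun_apply (Y \<theta>) b ** blinfun_apply (Z \<theta>) b)))"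

definition field_kaehler_form ::
    "(nat \<Rightarrow> 'q::euclidean_space \<Rightarrow>\<^sub>L 'q) \<Rightarrow> 'q set \<Rightarrow> nat \<Rightarrow> ('q, 'g::finite) field \<Rightarrow>
     ('q, 'g) field \<Rightarrow> real" where
  "field_kaehler_form J \<Lambda> i Y Z = - (1 / (real (CARD('g)) * torus_vol \<Lambda>)) *
     torus_integral \<Lambda> (\<lambda>\<theta>. Re (\<Sum>b\<in>Basis. \<Sum>c\<in>Basis.
       kaehler_form J i b c *\<^sub>R trace (blinfun_apply (Y \<theta>) b ** blinfun_apply (Z \<theta>) c)))"

text \<open>The tangent space at \<open>X\<close> to the gauge orbit consists of the \<open>d\<^sub>X \<xi>\<close> with \<open>\<xi>\<close> in the Lie algebra
  of the gauge group. The tangent space to the quotient at a stabilizer-free point \<open>[X]\<close> is the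
  tangent space to the zero level modulo it, identified with the horizontal space (its
  orthogonal complement in the tangent space to the zero level) on which the quotient metric,
  complex structures and Kaehler forms are the restrictions of those on fields.\<close>

definition orbit_tangent ::
    "('q::euclidean_space) set \<Rightarrow> ('g::finite \<Rightarrow> 'q \<Rightarrow>\<^sub>L 'q) \<Rightarrow> ereal \<Rightarrow> ('q, 'g) field \<Rightarrow>
     ('q, 'g) field set" where
  "orbit_tangent \<Lambda> e s X =
     {(\<lambda>\<theta>. Blinfun (\<lambda>v. dir_deriv v \<xi> \<theta> + commutator (blinfun_apply (X \<theta>) v) (\<xi> \<theta>))) | \<xi>.
        (\<forall>h k. sobolev \<Lambda> (s + 1) (\<lambda>\<theta>. \<xi> \<theta> $ h $ k)) \<and>
        (\<forall>\<theta>. adj (\<xi> \<theta>) = - \<xi> \<theta>) \<and> equivariant_End e \<xi>}"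

definition horizontal ::
    "(nat \<Rightarrow> 'q::euclidean_space \<Rightarrow>\<^sub>L 'q) \<Rightarrow> 'q set \<Rightarrow> ('g::finite \<Rightarrow> 'q \<Rightarrow>\<^sub>L 'q) \<Rightarrow> ereal \<Rightarrow>
     ('q, 'g) field \<Rightarrow> ('q, 'g) field set" where
  "horizontal J \<Lambda> e s X =
     {Y \<in> fields \<Lambda> e s.
        (\<forall>i\<in>{1,2,3}. \<forall>\<psi>. test_fun \<Lambda> \<psi> \<longrightarrow> moment_map_lin J \<Lambda> i X Y \<psi> = 0) \<and>
        (\<forall>Z\<in>orbit_tangent \<Lambda> e s X. field_metric \<Lambda> Y Z = 0)}"

text \<open>\<open>D\<close> induces an isomorphism from \<open>Q\<close> to the tangent space of the quotient at \<open>[X]\<close>, with its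
  metric, complex structures and Kaehler forms; \<open>H v\<close> is the horizontal part of \<open>D v\<close>.\<close>

definition hk_isomorphism ::
    "(nat \<Rightarrow> 'q::euclidean_space \<Rightarrow>\<^sub>L 'q) \<Rightarrow> 'q set \<Rightarrow> ('g::finite \<Rightarrow> 'q \<Rightarrow>\<^sub>L 'q) \<Rightarrow> ereal \<Rightarrow>
     ('q, 'g) field \<Rightarrow> ('q \<Rightarrow> ('q, 'g) field) \<Rightarrow> bool" where
  "hk_isomorphism J \<Lambda> e s X D \<longleftrightarrow>
     (\<exists>H. (\<forall>\<theta>. linear (\<lambda>v. H v \<theta>)) \<and>
          bij_betw H UNIV (horizontal J \<Lambda> e s X) \<and>
          (\<forall>v. (\<lambda>\<theta>. D v \<theta> - H v \<theta>) \<in> orbit_tangent \<Lambda> e s X) \<and>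
          (\<forall>v w. field_metric \<Lambda> (H v) (H w) = v \<bullet> w) \<and>
          (\<forall>i\<in>{1,2,3}.
             (\<forall>v. H (blinfun_apply (J i) v) = (\<lambda>\<theta>. vec_act (J i) (H v \<theta>))) \<and>
             (\<forall>v w. field_kaehler_form J \<Lambda> i (H v) (H w) = kaehler_form J i v w)))"

text \<open>The topology on fields is given by the norms of \<open>H\<^sup>t\<close> for all real \<open>t \<le> s\<close>; for \<open>s < \<infinity>\<close> this
  is the norm topology of \<open>H\<^sup>s\<close>, for \<open>s = \<infinity>\<close> the Frechet topology. The norm is meaningful only for
  fields of class \<open>H\<^sup>t\<close>, which is why membership in \<open>fields\<close> is demanded wherever it is used.\<close>

definition sobolev_norm ::
    "('q::euclidean_space) set \<Rightarrow> real \<Rightarrow> ('q, 'g::finite) field \<Rightarrow> real" where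
  "sobolev_norm \<Lambda> t Y = sqrt (\<Sum>b\<in>Basis. \<Sum>h\<in>UNIV. \<Sum>k\<in>UNIV. \<Sum>\<^sub>\<infinity>l\<in>\<Lambda>.
     (1 + (norm l)\<^sup>2) powr t * (cmod (fourier \<Lambda> (\<lambda>\<theta>. blinfun_apply (Y \<theta>) b $ h $ k) l))\<^sup>2)"

definition family_continuous ::
    "('q::euclidean_space) set \<Rightarrow> ('g::finite \<Rightarrow> 'q \<Rightarrow>\<^sub>L 'q) \<Rightarrow> ereal \<Rightarrow>
     ('q \<Rightarrow> ('q, 'g) field) \<Rightarrow> 'q \<Rightarrow> bool" where
  "family_continuous \<Lambda> e s F x \<longleftrightarrow>
     (\<forall>\<^sub>F y in nhds x. F y \<in> fields \<Lambda> e s) \<and>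
     (\<forall>t::real. ereal t \<le> s \<longrightarrow>
        ((\<lambda>y. sobolev_norm \<Lambda> t (\<lambda>\<theta>. F y \<theta> - F x \<theta>)) \<longlongrightarrow> 0) (at x))"

definition family_has_deriv ::
    "('q::euclidean_space) set \<Rightarrow> ('g::finite \<Rightarrow> 'q \<Rightarrow>\<^sub>L 'q) \<Rightarrow> ereal \<Rightarrow>
     ('q \<Rightarrow> ('q, 'g) field) \<Rightarrow> ('q \<Rightarrow> ('q, 'g) field) \<Rightarrow> 'q \<Rightarrow> bool" where
  "family_has_deriv \<Lambda> e s F D x \<longleftrightarrow>
     (\<forall>\<^sub>F y in nhds x. F y \<in> fields \<Lambda> e s) \<and>
     (\<forall>v. D v \<in> fields \<Lambda> e s) \<and> (\<forall>\<theta>. linear (\<lambda>v. D v \<theta>)) \<and>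
     (\<forall>t::real. ereal t \<le> s \<longrightarrow>
        ((\<lambda>y. sobolev_norm \<Lambda> t (\<lambda>\<theta>. F y \<theta> - F x \<theta> - D (y - x) \<theta>) / norm (y - x))
           \<longlongrightarrow> 0) (at x))"

primrec family_Ck ::
    "('q::euclidean_space) set \<Rightarrow> ('g::finite \<Rightarrow> 'q \<Rightarrow>\<^sub>L 'q) \<Rightarrow> ereal \<Rightarrow> 'q set \<Rightarrow> nat \<Rightarrow>
     ('q \<Rightarrow> ('q, 'g) field) \<Rightarrow> bool" where
  "family_Ck \<Lambda> e s U 0 F \<longleftrightarrow> (\<forall>x\<in>U. family_continuous \<Lambda> e s F x)"
| "family_Ck \<Lambda> e s U (Suc n) F \<longleftrightarrow>
     (\<exists>D. (\<forall>x\<in>U. family_has_deriv \<Lambda> e s F (D x) x) \<and>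
          (\<forall>v. family_Ck \<Lambda> e s U n (\<lambda>x. D x v)))"

definition smooth_family ::
    "('q::euclidean_space) set \<Rightarrow> ('g::finite \<Rightarrow> 'q \<Rightarrow>\<^sub>L 'q) \<Rightarrow> ereal \<Rightarrow> 'q set \<Rightarrow>
     ('q \<Rightarrow> ('q, 'g) field) \<Rightarrow> bool" where
  "smooth_family \<Lambda> e s U F \<longleftrightarrow> (\<forall>n. family_Ck \<Lambda> e s U n F)"

text \<open>A map \<open>\<Phi>\<close> from the orbifold to the quotient is compatible with the hyperkaehler structures if
  it matches the stabilizer-free loci, on them lifts locally to smooth families in the zero level
  whose differentials are isomorphisms of hyperkaehler tangent spaces, and is open for the quotient
  topology. A bijection with these properties restricts to a diffeomorphism of the
  stabilizer-free loci that preserves the hyperkaehler structures.\<close>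

definition hk_compatible ::
    "(nat \<Rightarrow> 'q::euclidean_space \<Rightarrow>\<^sub>L 'q) \<Rightarrow> 'q aff set \<Rightarrow> 'q set \<Rightarrow> ('g::finite \<Rightarrow> 'q \<Rightarrow>\<^sub>L 'q) \<Rightarrow>
     ereal \<Rightarrow> ('q set \<Rightarrow> ('q, 'g) field set) \<Rightarrow> bool" where
  "hk_compatible J \<Gamma>h \<Lambda> e s \<Phi> \<longleftrightarrow>
     (\<forall>x. x \<in> free_locus \<Gamma>h \<longleftrightarrow>
        (\<forall>X\<in>\<Phi> (aff_orbit \<Gamma>h x). gauge_stabilizer \<Lambda> e s X = {scalar_coset (\<lambda>_. mat 1)})) \<and>
     (\<forall>x\<in>free_locus \<Gamma>h. \<exists>U \<sigma>.
        open U \<and> x \<in> U \<and> U \<subseteq> free_locus \<Gamma>h \<and> smooth_family \<Lambda> e s U \<sigma> \<and>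
        (\<forall>y\<in>U. \<sigma> y \<in> zero_level J \<Lambda> e s \<and> \<Phi> (aff_orbit \<Gamma>h y) = gauge_orbit \<Lambda> e s (\<sigma> y) \<and>
           (\<exists>D. family_has_deriv \<Lambda> e s \<sigma> D y \<and> hk_isomorphism J \<Lambda> e s (\<sigma> y) D))) \<and>
     (\<forall>U. open U \<and> U \<subseteq> free_locus \<Gamma>h \<longrightarrow>
        (\<forall>x\<in>U. \<forall>X\<in>\<Phi> (aff_orbit \<Gamma>h x). \<exists>(t::real) \<delta>. ereal t \<le> s \<and> \<delta> > 0 \<and>
           (\<forall>Y\<in>zero_level J \<Lambda> e s. sobolev_norm \<Lambda> t (\<lambda>\<theta>. Y \<theta> - X \<theta>) < \<delta> \<longrightarrow>
              (\<exists>y\<in>U. Y \<in> \<Phi> (aff_orbit \<Gamma>h y)))))"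

end

theory Submission imports Defs begin

text \<open>A zero of the three moment maps on the four-dimensional space \<open>Q\<close> is an equivariant connection with
 anti-self-dual curvature, constant along the orthogonal complement of \<open>La\<close>. Convolution with trigonometric
 kernels and exactness of \<open>tr F \<and> F\<close> show that it is flat. Its holonomy commutes, and equivariance forces
 \<open>tr (hol * j(h)) = 0\<close> for \<open>h \<noteq> 1\<close>; so a common eigenprojection of the holonomy
 and its translates split off a regular representation, and the connection is gauge equivalent to the constant connection
 \<open>sig x = diag (\<i> (e h x))\<close> for some \<open>x\<close> in \<open>Q\<close>. Comparing Fourier coefficients of gauge transformations between
 model connections shows that \<open>sig x\<close> and \<open>sig y\<close> are equivalent exactly when \<open>x\<close> and \<open>y\<close> lie in one orbit, gives
 continuity of the inverse, and shows that at points with trivial stabilizer the horizontal space is \<open>sig Q\<close>, on which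
 metric and complex structures are those of \<open>Q\<close>.\<close>

section \<open>Matrices with the Frobenius inner product\<close>

text \<open>Above \<open>r/2\<close> the Sobolev scale yields only continuity, so a curvature is a
  distribution and fields cannot be differentiated. Smoothing by nonnegative trigonometric
  polynomials turns weak equations into pointwise ones; its only error is that it does not commute
  with products.

  Functions live on \<open>Q\<close> and normal vectors are periods, so the Higgs field is a
  connection form along directions with arbitrarily small periods. Hence it is never separated from
  the connection: there is one curvature, one parallel frame, and a holonomy that contains the
  exponentials of the Higgs field.

  The vanishing traces are quaternionic in origin. A group element that fixes a nonzero vector fixes
  its images under the three complex structures, hence everything. So \<open>h - 1\<close> is onto
  for \<open>h\<close> not the unit, and every period is a difference \<open>h th - th\<close>,
  where frames can be compared. A character that vanishes off the unit is the mark of the regular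
  representation, so traces alone carry the decomposition. Spectral theory is replaced by
  compactness: least projections and largest contractions.\<close>

lemma adj_nth [simp]: "adj M $ h $ k = cnj (M $ k $ h)"
 by (simp add: adj_def)

lemma adj_adj [simp]: "adj (adj M) = M"
 by (simp add: vec_eq_iff)

lemma adj_add: "adj (M + N) = adj M + adj N"
 and adj_diff: "adj (M - N) = adj M - adj N"
 and adj_uminus: "adj (- M) = - adj M"
 and adj_scaleR: "adj (r *\<^sub>R M) = r *\<^sub>R adj M"
 and adj_0 [simp]: "adj 0 = 0"
 by (simp_all add: vec_eq_iff)

lemma adj_sum: "adj (sum f A) = (\<Sum>x\<in>A. adj (f x))"
 by (induction A rule: infinite_finite_induct) (simp_all add: adj_add)

lemma adj_mat: "adj (mat c :: complex^'n::finite^'n) = mat (cnj c)"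
 by (simp add: vec_eq_iff mat_def)

lemma adj_mult: "adj (M ** N) = adj N ** adj (M :: complex^'n::finite^'n)"
 by (simp add: vec_eq_iff matrix_matrix_mult_def mult.commute)

lemma bounded_linear_adj: "bounded_linear (adj :: complex^'n::finite^'n => _)"
 by (intro linear_conv_bounded_linear[THEN iffD1] linearI) (simp_all add: adj_add adj_scaleR)

lemma bounded_linear_entry: "bounded_linear (%M :: complex^'n::finite^'m::finite. M $ h $ k)"
 by (intro bounded_linear_compose[OF bounded_linear_vec_nth] bounded_linear_vec_nth)

lemma trace_mult_commute: "trace (A ** B) = trace (B ** (A :: complex^'n::finite^'n))"
 by (simp add: trace_def matrix_matrix_mult_def) (subst sum.swap, simp add: mult.commute)

lemma inner_complex_cnj: "x \<bullet> y = Re (cnj x * y)"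
 by (simp add: inner_complex_def)

text \<open>The Euclidean structure of the matrix type is the Frobenius one, so adjoints,
  orthogonality and all compactness arguments below refer to a single norm.\<close>

lemma inner_matrix: "(A :: complex^'n::finite^'n) \<bullet> B = Re (trace (adj A ** (B :: complex^'n::finite^'n)))"
proof -
 have "(A :: complex^'n^'n) \<bullet> B = (\<Sum>h\<in>UNIV. \<Sum>k\<in>UNIV. Re (cnj (A $ h $ k) * B $ h $ k))"
  by (simp only: inner_vec_def inner_complex_cnj)
 also have "... = (\<Sum>k\<in>UNIV. \<Sum>h\<in>UNIV. Re (cnj (A $ h $ k) * B $ h $ k))"
  by (rule sum.swap)
 finally show ?thesis
  by (simp only: trace_def matrix_matrix_mult_def adj_nth vec_lambda_beta Re_sum)
qed

lemma inner_mult_left: "(U ** A) \<bullet> B = A \<bullet> (adj U ** (B :: complex^'n::finite^'n))"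
 by (simp add: inner_matrix adj_mult matrix_mul_assoc)

lemma inner_mult_right: "((A :: complex^'n::finite^'n) ** U) \<bullet> B = A \<bullet> (B ** adj (U :: complex^'n::finite^'n))"
proof -
 have "trace (adj U ** (adj A ** B)) = trace ((adj A ** B) ** adj U)"
  by (rule trace_mult_commute)
 thus ?thesis by (simp add: inner_matrix adj_mult matrix_mul_assoc)
qed

lemma norm_matrix_sq: "(norm M)^2 = Re (trace (adj M ** (M :: complex^'n::finite^'n)))"
 by (simp add: power2_norm_eq_inner inner_matrix)

lemma norm_matrix_sq_sum:
 "(norm (M :: complex^'n::finite^'n))^2 = (\<Sum>h\<in>UNIV. \<Sum>k\<in>UNIV. (cmod (M $ h $ k))\<^sup>2)"
 by (simp add: power2_norm_eq_inner inner_vec_def)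

lemma inner_adj: "adj (A :: complex^'n::finite^'n) \<bullet> adj B = A \<bullet> B"
proof -
 have "adj A \<bullet> adj B = (\<Sum>i\<in>UNIV. \<Sum>j\<in>UNIV. A $ j $ i \<bullet> B $ j $ i)"
  by (simp add: inner_vec_def inner_complex_def)
 also have "... = A \<bullet> B" unfolding inner_vec_def by (rule sum.swap)
 finally show ?thesis .
qed

lemma norm_adj [simp]: "norm (adj A) = norm (A :: complex^'n::finite^'n)"
 by (simp add: norm_eq_sqrt_inner inner_adj)

text \<open>Cauchy-Schwarz for each row of \<open>A\<close> against each column of \<open>B\<close>.
  It makes multiplication a bounded bilinear map, and the interpretation \<open>mm\<close> then
  supplies limits and derivatives of products.\<close>

lemma norm_matrix_mult_le: "norm ((A :: complex^'n::finite^'n) ** B) \<le> norm A * norm (B :: complex^'n::finite^'n)"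
proof (rule power2_le_imp_le)
 let ?a = "%h. \<Sum>l\<in>UNIV. (cmod (A $ h $ l))\<^sup>2" and ?b = "%k. \<Sum>l\<in>UNIV. (cmod (B $ l $ k))\<^sup>2"
 have *: "(cmod ((A ** B) $ h $ k))^2 \<le> ?a h * ?b k" for h k
 proof -
  have "cmod ((A ** B) $ h $ k) \<le> (\<Sum>l\<in>UNIV. cmod (A $ h $ l) * cmod (B $ l $ k))"
   by (simp add: matrix_matrix_mult_def sum_norm_le norm_mult)
  hence "(cmod ((A ** B) $ h $ k))^2 \<le> (\<Sum>l\<in>UNIV. cmod (A $ h $ l) * cmod (B $ l $ k))^2"
   by (simp add: power_mono)
  also have "... \<le> ?a h * ?b k" by (rule Cauchy_Schwarz_ineq_sum)
  finally show ?thesis .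
 qed
 have "(norm (A ** B))^2 \<le> (\<Sum>h\<in>UNIV. \<Sum>k\<in>UNIV. ?a h * ?b k)"
  unfolding norm_matrix_sq_sum[of "A ** B"] by (intro sum_mono *)
 also have "... = (norm A)^2 * (\<Sum>k\<in>UNIV. ?b k)"
  unfolding norm_matrix_sq_sum[of A] by (rule sum_product[symmetric])
 also have "(\<Sum>k\<in>UNIV. ?b k) = (norm B)^2"
  unfolding norm_matrix_sq_sum by (rule sum.swap)
 finally show "(norm (A ** B))^2 \<le> (norm A * norm B)^2" by (simp add: power_mult_distrib)
qed simp

lemma scaleR_mult_left: "(r *\<^sub>R A) ** B = r *\<^sub>R (A ** (B :: complex^'n::finite^'n))"
 and scaleR_mult_right: "A ** (r *\<^sub>R B) = r *\<^sub>R (A ** (B :: complex^'n::finite^'n))"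
 by (simp_all add: vec_eq_iff matrix_matrix_mult_def scaleR_sum_right)

lemma matrix_mult_add_right: "(A + B) ** C = A ** C + B ** (C :: complex^'n::finite^'n)"
 by (simp add: vec_eq_iff matrix_matrix_mult_def algebra_simps sum.distrib)

lemma bounded_bilinear_matrix_mult:
 "bounded_bilinear ((**) :: complex^'n::finite^'n => complex^'n^'n => complex^'n^'n)"
 by (rule bounded_bilinear.intro)
  (auto simp: matrix_mult_add_right matrix_add_ldistrib scaleR_mult_left scaleR_mult_right
    intro!: exI[of _ 1] norm_matrix_mult_le)

interpretation mm: bounded_bilinear
 "(**) :: complex^'n::finite^'n => complex^'n^'n => complex^'n^'n"
 by (rule bounded_bilinear_matrix_mult)

lemma mat_mult_entry [simp]:
 "(mat z ** M) $ h $ k = z * M $ h $ k" "(M ** mat z) $ h $ k = M $ h $ k * z"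
 for M :: "complex^'n::finite^'n"
 by (simp_all add: matrix_matrix_mult_def mat_def if_distrib if_distribR cong: if_cong)

lemma mat_commute: "mat z ** M = M ** mat (z :: complex)"
 for M :: "complex^'n::finite^'n"
 unfolding vec_eq_iff mat_mult_entry by (simp add: mult.commute)

lemma norm_mat_mult: "norm (mat z ** M) = cmod z * norm (M :: complex^'n::finite^'n)"
proof (rule power2_eq_imp_eq)
 show "(norm (mat z ** M))^2 = (cmod z * norm M)^2"
  by (simp add: norm_matrix_sq_sum power_mult_distrib norm_mult sum_distrib_left)
qed auto

lemma trace_mat_mult: "trace (mat z ** M) = z * trace (M :: complex^'n::finite^'n)"
 by (simp add: trace_def sum_distrib_left)

lemma trace_scaleR: "trace (r *\<^sub>R M) = r *\<^sub>R trace (M :: complex^'n::finite^'n)"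
 by (simp add: trace_def scaleR_sum_right)

lemma trace_adj: "trace (adj M) = cnj (trace M)"
 by (simp add: trace_def)

lemma trace_sum: "trace (sum f A) = (\<Sum>x\<in>A. trace (f x :: complex^'n::finite^'n))"
 by (induction A rule: infinite_finite_induct) (simp_all add: trace_def sum.distrib)

lemma bounded_linear_trace: "bounded_linear (trace :: complex^'n::finite^'n => complex)"
 by (intro linear_conv_bounded_linear[THEN iffD1] linearI)
  (simp_all add: trace_add trace_scaleR)

section \<open>Unitary matrices\<close>

definition unitary :: "complex^'n::finite^'n => bool" where
 "unitary U \<longleftrightarrow> adj U ** U = mat 1"

lemma unitaryD: "unitary U ==> adj U ** U = mat 1" "unitary U ==> U ** adj U = mat 1"
 by (simp_all add: unitary_def matrix_left_right_inverse)

lemma matrix_inv_eqI: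
 assumes "A ** B = mat 1" "B ** A = mat 1"
 shows "matrix_inv A = (B :: complex^'n::finite^'n)"
proof -
 have "matrix_inv A ** A = mat 1"
  unfolding matrix_inv_def by (rule someI2[of _ B]) (simp_all add: assms)
 hence "matrix_inv A ** (A ** B) = B" by (simp add: matrix_mul_assoc)
 thus ?thesis by (simp add: assms)
qed

lemma matrix_inv_unitary: "unitary U ==> matrix_inv U = adj U"
 by (intro matrix_inv_eqI unitaryD)

lemma unitary_adj: "unitary U ==> unitary (adj U)"
 by (simp add: unitary_def matrix_left_right_inverse)

lemma unitary_mult: "unitary U ==> unitary V ==> unitary (U ** V)"
 unfolding unitary_def adj_mult
 by (metis matrix_mul_assoc matrix_mul_lid)

lemma unitary_mat: "cmod c = 1 ==> unitary (mat c)"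
 by (simp add: unitary_def adj_mat vec_eq_iff) (simp add: mat_def complex_norm_square[symmetric] mult.commute)

lemma unitary_cancel:
 assumes "unitary U"
 shows "adj U ** (U ** A) = A" "U ** (adj U ** A) = A" "A ** U ** adj U = A" "A ** adj U ** U = A"
 by (simp_all add: matrix_mul_assoc unitaryD[OF assms])
  (simp_all add: matrix_mul_assoc[symmetric] unitaryD[OF assms])

lemma norm_unitary_mult:
 assumes "unitary U"
 shows "norm (U ** A) = norm A" "norm (A ** U) = norm A"
 using assms
 by (simp_all only: norm_eq_sqrt_inner inner_mult_left[of U] inner_mult_right[of _ U] unitary_cancel)

lemma norm_unitary_sq: "unitary (U :: complex^'n::finite^'n) ==> (norm U)\<^sup>2 = CARD('n)"
 by (simp add: norm_matrix_sq unitaryD trace_I)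

section \<open>Commutative *-algebras of matrices\<close>

definition projection :: "complex^'n::finite^'n => bool" where
 "projection P \<longleftrightarrow> adj P = P \<and> P ** P = P"

lemma projectionD: "projection P ==> adj P = P" "projection P ==> P ** P = P"
 by (simp_all add: projection_def)

lemma projection_norm_sq: "projection P ==> (norm P)\<^sup>2 = Re (trace P)"
 by (simp add: norm_matrix_sq projection_def)

text \<open>Submultiplicativity applied to \<open>P ** P = P\<close>. The gap above 0 is what makes
  the set of nonzero projections closed.\<close>

lemma projection_norm_ge_1:
 assumes "projection P" "P \<noteq> 0" shows "1 \<le> norm P"
 using norm_matrix_mult_le[of P P] assms by (simp add: projection_def)

lemma projection_norm_le:
 fixes P :: "complex^'n::finite^'n"
 assumes "projection P" shows "norm P \<le> norm (mat 1 :: complex^'n^'n)" (is "_ \<le> norm ?I")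
proof -
 have "(norm P)^2 = ?I \<bullet> P"
  by (simp add: projection_norm_sq[OF assms] inner_matrix adj_mat)
 also have "... \<le> norm ?I * norm P" by (rule norm_cauchy_schwarz)
 finally have "norm P * norm P \<le> norm ?I * norm P" by (simp add: power2_eq_square)
 thus ?thesis by (cases "P = 0") (auto simp: mult_le_cancel_right)
qed

text \<open>Commutativity is built in. As \<open>subspace\<close> refers to real scalars, closure
  under complex scalars is a separate clause, with \<open>mat z\<close> in the role of
  \<open>z\<close>.\<close>

definition star_algebra :: "(complex^'n::finite^'n) set => bool" where
 "star_algebra \<A> \<longleftrightarrow> subspace \<A> \<and> mat 1 \<in> \<A> \<and> (\<forall>M\<in>\<A>. adj M \<in> \<A>) \<and>
   (\<forall>M\<in>\<A>. \<forall>N\<in>\<A>. M ** N \<in> \<A> \<and> M ** N = N ** M) \<and> (\<forall>M\<in>\<A>. \<forall>z. mat z ** M \<in> \<A>)"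

text \<open>Power iteration. After division by its operator norm \<open>M\<close> is a Hermitian
  contraction, and its even powers converge to the projection onto the eigenvalues 1 and -1; the
  limit stays in the closed algebra. Odd powers could oscillate, which is why only the square of
  \<open>M\<close> is diagonalised.\<close>

lemma hermitian_top_projection:
 assumes A: "star_algebra \<A>" and M: "M \<in> \<A>" "adj M = M" "M \<noteq> (0 :: complex^'n::finite^'n)"
 obtains E \<mu> where "E \<in> \<A>" "projection E" "E \<noteq> 0" "\<mu> \<noteq> 0" "(M ** M) ** E = \<mu> *\<^sub>R E"
proof -
 let ?I = "mat 1 :: complex^'n^'n"
 have "compact (sphere (0 :: complex^'n^'n) 1)" "sphere (0 :: complex^'n^'n) 1 \<noteq> {}"
  by auto
 moreover have "continuous_on (sphere 0 1) (%V :: complex^'n^'n. norm (M ** V))"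
  by (intro continuous_intros mm.continuous_on)
 ultimately obtain V0 :: "complex^'n^'n" where V0: "norm V0 = 1"
  and max: "\<And>V :: complex^'n^'n. norm V = 1 ==> norm (M ** V) \<le> norm (M ** V0)"
  using continuous_attains_sup by (metis mem_sphere_0)
 \<comment> \<open>The operator norm of \<open>M\<close>, attained at \<open>V0\<close>; it is
   measured on matrices instead of vectors.\<close>
 define c where "c = norm (M ** V0)"
 have le: "norm (M ** V) \<le> c * norm V" for V :: "complex^'n^'n"
 proof (cases "V = 0")
  case False
  have "norm (M ** ((1 / norm V) *\<^sub>R V)) \<le> c"
   unfolding c_def by (rule max) (use False in simp)
  thus ?thesis using False by (simp add: scaleR_mult_right field_simps)
 qed simp
 have "c > 0"
 proof -
  have "0 < norm M" using M(3) by simp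
  also have "... \<le> c * norm ?I" using le[of ?I] by simp
  finally show ?thesis using norm_ge_zero[of ?I] by (simp add: zero_less_mult_iff)
 qed
 define M1 where "M1 = (1 / c) *\<^sub>R M"
 have M1: "M1 \<in> \<A>" "adj M1 = M1"
  using A M by (auto simp: M1_def star_algebra_def adj_scaleR subspace_scale)
 have contr: "norm (M1 ** V) \<le> norm V" for V :: "complex^'n^'n"
  using le[of V] \<open>c > 0\<close> by (simp add: M1_def scaleR_mult_left field_simps)
 have V1: "norm (M1 ** V0) = 1"
  using \<open>c > 0\<close> by (simp add: M1_def scaleR_mult_left c_def[symmetric])
 define N where "N = M1 ** M1"
 \<comment> \<open>Equality case of the contraction estimate: the expanded square is at most 1 - 2 +
   1.\<close>
 have NV0: "N ** V0 = V0"
 proof -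
  have "(norm (N ** V0 - V0))^2 = (norm (N ** V0))^2 - 2 * ((N ** V0) \<bullet> V0) + (norm V0)^2"
   by (simp add: power2_norm_eq_inner inner_diff inner_commute)
  also have "(N ** V0) \<bullet> V0 = (norm (M1 ** V0))^2"
   by (simp add: N_def power2_norm_eq_inner matrix_mul_assoc[symmetric] inner_mult_left[of M1] M1)
  also have "norm (N ** V0) \<le> 1"
   using contr[of "M1 ** V0"] by (simp add: N_def matrix_mul_assoc V1)
  hence "(norm (N ** V0))^2 \<le> 1" by (simp add: power_le_one)
  finally show ?thesis using V0 V1 by simp
 qed
 define g where "g = rec_nat ?I (%_. (**) M1)"
 have g0: "g 0 = ?I" and gS: "g (Suc k) = M1 ** g k" for k
  by (simp_all add: g_def)
 have gadd: "g j ** g k = g (j + k)" for j k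
  by (induction j) (simp_all add: g0 gS matrix_mul_assoc[symmetric])
 have gcomm: "g j ** g k = g k ** g j" for j k by (simp add: gadd add.commute)
 have "g 1 = M1" using gS[of 0] by (simp add: g0)
 have gadj: "adj (g k) = g k" for k
 proof (induction k)
  case (Suc k)
  have "g k ** M1 = M1 ** g k" using gcomm[of k 1] \<open>g 1 = M1\<close> by simp
  with Suc show ?case by (simp only: gS adj_mult M1)
 qed (simp add: g0 adj_mat)
 have gA: "g k \<in> \<A>" for k
  by (induction k) (use A M1 in \<open>auto simp: star_algebra_def g0 gS\<close>)
 define a where "a k = (norm (g k))^2" for k
 have inner: "g j \<bullet> g k = ?I \<bullet> g (j + k)" for j k
  using inner_mult_left[of "g j" ?I "g k"] by (simp add: gadj gadd)
 have "a (Suc k) \<le> a k" for k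
  by (simp add: a_def gS contr power_mono)
 hence "decseq a" by (rule decseq_SucI)
 moreover have "bounded (range a)"
  using \<open>decseq a\<close> by (intro boundedI[of _ "a 0"]) (auto simp: a_def decseq_def)
 ultimately have "Cauchy a"
  by (intro convergent_Cauchy Bseq_monoseq_convergent) (auto simp: monoseq_iff Bseq_eq_bounded)
 \<comment> \<open>The powers are Hermitian and multiplicative, so the inner product of
   \<open>g (2 * j)\<close> and \<open>g (2 * k)\<close> is \<open>a (j + k)\<close>, which is at
   least \<open>a (2 * k)\<close>. Thus the Cauchy property passes from the numbers \<open>a\<close>
   to the powers.\<close>
 have diff: "(norm (g (2 * j) - g (2 * k)))^2 \<le> a (2 * j) - a (2 * k)" if "j \<le> k" for j k
 proof -
  have "(norm (g (2 * j) - g (2 * k)))^2 = a (2 * j) - 2 * a (j + k) + a (2 * k)"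
  proof -
   have "g (2 * j) \<bullet> g (2 * k) = a (j + k)"
    unfolding a_def power2_norm_eq_inner inner[of "2 * j" "2 * k"] inner[of "j + k" "j + k"]
    by (rule arg_cong[where f = "%i. ?I \<bullet> g i"]) simp
   thus ?thesis
    by (simp add: a_def power2_norm_eq_inner inner_diff_left inner_diff_right inner_commute)
  qed
  moreover have "a (2 * k) \<le> a (j + k)"
   using \<open>decseq a\<close> that by (simp add: decseq_def)
  ultimately show ?thesis by linarith
 qed
 have "Cauchy (%k. g (2 * k))"
 proof (rule metric_CauchyI)
  fix eps :: real assume "eps > 0"
  then obtain K where K: "\<And>m n. m \<ge> K ==> n \<ge> K ==> dist (a m) (a n) < eps\<^sup>2"
   using metric_CauchyD[OF \<open>Cauchy a\<close>, of "eps\<^sup>2"] by auto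
  have *: "dist (g (2 * m)) (g (2 * n)) < eps" if "m \<ge> K" "n \<ge> K" "m \<le> n" for m n
  proof -
   have "(norm (g (2 * m) - g (2 * n)))^2 < eps\<^sup>2"
    using diff[OF that(3)] K[of "2 * m" "2 * n"] that by (simp add: dist_real_def)
   thus ?thesis using \<open>eps > 0\<close> by (simp add: dist_norm power2_less_imp_less)
  qed
  show "\<exists>K. \<forall>m\<ge>K. \<forall>n\<ge>K. dist (g (2 * m)) (g (2 * n)) < eps"
   using * by (metis dist_commute nle_le)
 qed
 then obtain E where E: "(%k. g (2 * k)) \<longlonglongrightarrow> E"
  using Cauchy_convergent_iff convergent_def by blast
 have "closed \<A>" using A by (auto simp: star_algebra_def closed_subspace)
 hence "E \<in> \<A>" using closed_sequentially[OF _ _ E] gA by blast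
 moreover have "adj E = E"
  using LIMSEQ_unique[OF bounded_linear.tendsto[OF bounded_linear_adj E]] E by (simp add: gadj)
 moreover have "E ** E = E"
 proof (rule LIMSEQ_unique)
  show "(%k. g (2 * k) ** g (2 * k)) \<longlonglongrightarrow> E ** E" by (intro mm.tendsto E)
  show "(%k. g (2 * k) ** g (2 * k)) \<longlonglongrightarrow> E"
  proof -
   have "g (2 * k) ** g (2 * k) = g (2 * (2 * k))" for k by (simp add: gadd)
   thus ?thesis
    using LIMSEQ_subseq_LIMSEQ[OF E, of "%k. 2 * k"] by (simp add: strict_mono_def comp_def)
  qed
 qed
 moreover have NE: "N ** E = E"
 proof (rule LIMSEQ_unique)
  show "(%k. N ** g (2 * k)) \<longlonglongrightarrow> N ** E" by (intro mm.tendsto E tendsto_const)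
  show "(%k. N ** g (2 * k)) \<longlonglongrightarrow> E"
  proof -
   have "N ** g (2 * k) = g (2 * Suc k)" for k
    by (simp add: N_def gS matrix_mul_assoc[symmetric])
   thus ?thesis using LIMSEQ_Suc[OF E] by simp
  qed
 qed
 \<comment> \<open>All even powers fix \<open>V0\<close>, hence so does their limit.\<close>
 moreover have "E \<noteq> 0"
 proof
  assume "E = 0"
  have "g (2 * k) ** V0 = V0" for k
   using NV0 by (induction k) (simp_all add: g0 gS N_def matrix_mul_assoc[symmetric])
  hence "E ** V0 = V0"
   using LIMSEQ_unique[OF mm.tendsto[OF E tendsto_const[of V0]]] by simp
  thus False using \<open>E = 0\<close> V0 by auto
 qed
 moreover have "(M ** M) ** E = c\<^sup>2 *\<^sub>R E"
 proof -
  have "M ** M = c\<^sup>2 *\<^sub>R N"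
   using \<open>c > 0\<close> by (simp add: N_def M1_def scaleR_mult_left scaleR_mult_right power2_eq_square)
  thus ?thesis by (simp only: scaleR_mult_left NE)
 qed
 ultimately show thesis
  using that[of E "c\<^sup>2"] \<open>c > 0\<close> by (simp add: projection_def)
qed

text \<open>A nonzero projection of least norm exists by compactness and has no proper nonzero
  subprojection in the algebra. For Hermitian \<open>M\<close> the top projection of
  \<open>M ** P\<close> lies below \<open>P\<close>, hence equals \<open>P\<close>, so
  \<open>M ** P\<close> squares to a multiple of \<open>P\<close>; polarisation removes the
  square.\<close>

lemma minimal_projection:
 assumes A: "star_algebra (\<A> :: (complex^'n::finite^'n) set)"
 obtains P where "P \<in> \<A>" "projection P" "P \<noteq> 0" "\<And>M. M \<in> \<A> ==> \<exists>z. M ** P = mat z ** P"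
proof -
 let ?I = "mat 1 :: complex^'n^'n"
 have sub: "subspace \<A>" and comm: "\<And>M N. M \<in> \<A> ==> N \<in> \<A> ==> M ** N = N ** M"
  and closed: "\<And>M N. M \<in> \<A> ==> N \<in> \<A> ==> M ** N \<in> \<A>" "\<And>M. M \<in> \<A> ==> adj M \<in> \<A>"
   "\<And>M z. M \<in> \<A> ==> mat z ** M \<in> \<A>" "?I \<in> \<A>"
  using A unfolding star_algebra_def by blast+
 \<comment> \<open>Being nonzero is expressed by \<open>1 \<le> norm P\<close>, a closed
   condition.\<close>
 define C where "C = {P \<in> \<A>. adj P = P \<and> P ** P = P \<and> 1 \<le> norm P}"
 have Ciff: "P \<in> C \<longleftrightarrow> P \<in> \<A> \<and> projection P \<and> P \<noteq> 0" for P
  using projection_norm_ge_1[of P] by (auto simp: C_def projection_def)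
 have "compact C"
 proof -
  have "closed C"
   unfolding C_def
   by (intro closed_Collect_conj closed_Collect_eq closed_Collect_le continuous_intros
     mm.continuous_on bounded_linear.continuous_on[OF bounded_linear_adj])
    (simp add: closed_subspace[OF sub])
  moreover have "bounded C"
   by (intro boundedI[of _ "norm ?I"]) (auto simp: Ciff projection_norm_le)
  ultimately show ?thesis by (simp add: compact_eq_bounded_closed)
 qed
 moreover have "?I \<in> C"
  by (simp add: Ciff closed projection_def adj_mat) (simp add: vec_eq_iff mat_def)
 ultimately obtain P where P: "P \<in> C" and min: "\<And>E. E \<in> C ==> norm P \<le> norm E"
  using continuous_attains_inf[of C norm] by (auto intro: continuous_intros)
 have PA: "P \<in> \<A>" and PP: "adj P = P" "P ** P = P" "projection P" "P \<noteq> 0"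
  using P by (auto simp: C_def Ciff projection_def)
 \<comment> \<open>Pythagoras: otherwise \<open>P - E\<close> is a nonzero projection, and the
   squared norm of \<open>E\<close> drops by at least 1 below the minimum.\<close>
 have below: "E = P" if E: "E \<in> \<A>" "projection E" "E \<noteq> 0" "P ** E = E" for E
 proof (rule ccontr)
  assume ne: "E \<noteq> P"
  have EP: "E ** P = E" using comm[OF E(1) PA] E(4) by simp
  have "projection (P - E)"
   using E PP EP by (simp add: projection_def adj_diff mm.diff_left mm.diff_right)
  hence "1 \<le> norm (P - E)" using ne by (intro projection_norm_ge_1) auto
  moreover have "(norm P)^2 = (norm E)^2 + (norm (P - E))^2"
   using \<open>projection (P - E)\<close> PP(3) E(2) by (simp add: projection_norm_sq trace_sub)
  moreover have "norm P \<le> norm E" by (rule min) (simp add: Ciff E)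
  hence "(norm P)^2 \<le> (norm E)^2" by (simp add: power_mono)
  ultimately show False by (smt (verit) one_le_power)
 qed
 have sq: "\<exists>\<mu>. (M ** P) ** (M ** P) = \<mu> *\<^sub>R P" if M: "M \<in> \<A>" "adj M = M" for M
 proof (cases "M ** P = 0")
  case False
  have MP: "M ** P \<in> \<A>" "adj (M ** P) = M ** P"
   using M PA PP closed by (auto simp: adj_mult comm[OF PA M(1)])
  obtain E \<mu> where E: "E \<in> \<A>" "projection E" "E \<noteq> 0" "\<mu> \<noteq> 0"
   "((M ** P) ** (M ** P)) ** E = \<mu> *\<^sub>R E"
   by (rule hermitian_top_projection[OF A MP False])
  have "P ** (M ** P) = M ** P"
   using comm[OF PA MP(1)] PP(2) by (simp add: matrix_mul_assoc[symmetric])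
  hence "P ** (\<mu> *\<^sub>R E) = \<mu> *\<^sub>R E"
   unfolding E(5)[symmetric] by (simp add: matrix_mul_assoc)
  hence "P ** E = E" using E(4) by (simp add: scaleR_mult_right)
  hence "E = P" using below E by blast
  thus ?thesis using E(5) PP(2) by (intro exI[of _ \<mu>]) (simp add: matrix_mul_assoc[symmetric])
 qed (auto intro: exI[of _ 0])
 \<comment> \<open>\<open>sq\<close> for \<open>M\<close> and for \<open>M + 1\<close>: the
   difference of the two squares is linear in \<open>M ** P\<close>.\<close>
 have herm: "\<exists>r. M ** P = r *\<^sub>R P" if M: "M \<in> \<A>" "adj M = M" for M
 proof -
  obtain \<mu> where \<mu>: "(M ** P) ** (M ** P) = \<mu> *\<^sub>R P" using sq[OF M] by blast
  have "\<exists>\<nu>. ((M + ?I) ** P) ** ((M + ?I) ** P) = \<nu> *\<^sub>R P"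
   by (rule sq) (use M closed sub in \<open>auto simp: adj_add adj_mat subspace_add\<close>)
  then obtain \<nu> where "((M + ?I) ** P) ** ((M + ?I) ** P) = \<nu> *\<^sub>R P" by blast
  moreover have "P ** (M ** P) = M ** P"
   using comm[OF PA M(1)] PP(2) by (metis matrix_mul_assoc)
  ultimately have "\<mu> *\<^sub>R P + M ** P + (M ** P + P) = \<nu> *\<^sub>R P"
   using \<mu> PP(2) by (simp add: mm.add_left mm.add_right matrix_mul_assoc[symmetric] algebra_simps)
  hence "2 *\<^sub>R (M ** P) = (\<nu> - \<mu> - 1) *\<^sub>R P" by (simp add: algebra_simps scaleR_2)
  hence "(1 / 2) *\<^sub>R 2 *\<^sub>R (M ** P) = (1 / 2) *\<^sub>R (\<nu> - \<mu> - 1) *\<^sub>R P" by (rule arg_cong)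
  thus ?thesis by (intro exI[of _ "(1 / 2) * (\<nu> - \<mu> - 1)"]) (simp only: scaleR_scaleR, simp)
 qed
 have "\<exists>z. M ** P = mat z ** P" if M: "M \<in> \<A>" for M
 proof -
  \<comment> \<open>Cartesian decomposition: \<open>M\<close> is half of \<open>?B\<close> minus i
    times \<open>?C\<close>, with \<open>?B\<close> and \<open>?C\<close> Hermitian.\<close>
  let ?B = "M + adj M" and ?C = "mat \<i> ** (M - adj M)"
  obtain r where r: "?B ** P = r *\<^sub>R P"
   using herm[of ?B] M closed sub by (auto simp: adj_add subspace_add add.commute)
  have "adj ?C = ?C" by (simp add: vec_eq_iff algebra_simps)
  then obtain t where t: "?C ** P = t *\<^sub>R P"
   using herm[of ?C] M closed sub by (auto simp: subspace_diff)
  have "(M ** P) $ h $ k = (mat ((of_real r - \<i> * of_real t) / 2) ** P) $ h $ k" for h k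
  proof -
   have e1: "(?B ** P) $ h $ k = of_real r * P $ h $ k" "(?C ** P) $ h $ k = of_real t * P $ h $ k"
    unfolding r t by (simp_all only: vector_scaleR_component) (simp_all add: scaleR_conv_of_real)
   have e2: "(?C ** P) $ h $ k = \<i> * ((M - adj M) ** P) $ h $ k"
    by (simp only: matrix_mul_assoc[symmetric] mat_mult_entry)
   have e3: "(?B ** P) $ h $ k + ((M - adj M) ** P) $ h $ k = 2 * (M ** P) $ h $ k"
    by (simp add: mm.add_left mm.diff_left)
   have "\<i> * (\<i> * ((M - adj M) ** P) $ h $ k) = \<i> * (of_real t * P $ h $ k)"
    using e1(2) unfolding e2 by (rule arg_cong)
   hence "((M - adj M) ** P) $ h $ k = - (\<i> * of_real t * P $ h $ k)"
    by (simp add: mult.assoc[symmetric]) (metis minus_minus)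
   hence "2 * (M ** P) $ h $ k = (of_real r - \<i> * of_real t) * P $ h $ k"
    using e1(1) e3 by (simp add: algebra_simps)
   thus ?thesis by (simp add: mult.commute)
  qed
  thus ?thesis by (intro exI) (simp only: vec_eq_iff, blast)
 qed
 thus thesis using that PA PP by blast
qed

section \<open>Cyclic vectors for the regular representation\<close>

lemma matrix_mult_nth: "(A ** B) $ i $ j = (\<Sum>k\<in>UNIV. A $ i $ k * B $ k $ j)"
 by (simp add: matrix_matrix_mult_def)

text \<open>A matrix identity that holds for every middle factor becomes an identity between
  products of characters when the middle factor runs through the matrix units. This is Schur
  orthogonality without a decomposition into irreducibles.\<close>

lemma trace_matrix_units:
 fixes A B :: "complex^'n::finite^'n"
 shows "(\<Sum>a\<in>UNIV. \<Sum>b\<in>UNIV. (A ** (\<chi> i j. if i = a \<and> j = b then 1 else 0) ** B) $ a $ b) =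
  trace A * trace B"
proof -
 have "(A ** (\<chi> i j. if i = a \<and> j = b then 1 else 0) ** B) $ a $ b = A $ a $ a * B $ b $ b" for a b
 proof -
  have e: "(A ** (\<chi> i j. if i = a \<and> j = b then 1 else 0)) $ a $ l = (if l = b then A $ a $ a else 0)" for l
   by (auto simp: matrix_matrix_mult_def if_distrib cong: if_cong)
  thus ?thesis
   by (simp only: matrix_mult_nth[of "A ** _"] e) (simp add: if_distribR if_distrib cong: if_cong)
 qed
 thus ?thesis by (simp add: trace_def sum_product)
qed

locale regular_rep = Groups.group mul u iv
 for mul :: "'g::finite => 'g => 'g" and u :: 'g and iv :: "'g => 'g"
begin

text \<open>The left regular representation by permutation matrices; for the group of the theorem it
  is \<open>left_mult e\<close>.\<close>

definition L :: "'g => complex^'g^'g" where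
 "L h = (\<chi> a b. if a = mul h b then 1 else 0)"

lemma mul_eq_iff: "a = mul h b \<longleftrightarrow> b = mul (iv h) a"
 by (metis assoc group_left_neutral left_inverse right_inverse)

lemma L_mult_nth: "(L h ** M) $ a $ b = M $ mul (iv h) a $ b"
 by (simp add: L_def matrix_matrix_mult_def mul_eq_iff[of a h] if_distrib if_distribR cong: if_cong)

lemma mult_L_nth: "(M ** L h) $ a $ b = M $ a $ mul h b"
 by (simp add: L_def matrix_matrix_mult_def if_distrib if_distribR cong: if_cong)

lemma L_mult: "L h ** L k = L (mul h k)"
proof -
 have "mul (iv h) a = mul k b \<longleftrightarrow> a = mul (mul h k) b" for a b
  unfolding assoc mul_eq_iff[of a h] by auto
 thus ?thesis by (simp add: vec_eq_iff L_mult_nth) (simp add: L_def)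
qed

lemma L_u: "L u = mat 1"
 by (auto simp: vec_eq_iff L_def mat_def group_left_neutral)

lemma adj_L: "adj (L h) = L (iv h)"
 by (auto simp: vec_eq_iff L_def) (metis mul_eq_iff inverse_inverse)+

lemma unitary_L: "unitary (L h)"
 by (simp add: unitary_def adj_L L_mult L_u)

lemma L_adj_L: "L h ** adj (L h) = mat 1" "adj (L h) ** L h = mat 1"
 using unitaryD[OF unitary_L] by auto

text \<open>Left multiplication by \<open>h \<noteq> u\<close> moves every group element, so the
  product has zero diagonal.\<close>

lemma trace_L_diag:
 assumes "h \<noteq> u" shows "trace (L h ** (\<chi> a b. if a = b then if a \<in> S then 1 else 0 else 0)) = 0"
proof -
 have "mul (iv h) a \<noteq> a" for a
  using assms by (metis assoc group_left_neutral left_inverse right_inverse right_neutral inverse_inverse)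
 thus ?thesis by (simp add: trace_def L_mult_nth)
qed

lemma sum_UNIV_mul: "(\<Sum>h\<in>UNIV. f (mul k h)) = (\<Sum>h\<in>UNIV. f h)"
 by (rule sum.reindex_bij_witness[where j = "mul k" and i = "mul (iv k)"])
  (auto simp: assoc[symmetric] group_left_neutral)

text \<open>A maximal contraction that intertwines \<open>im Q\<close>, the copy of the regular representation of the
 stabilizer \<open>S\<close> of \<open>P\<close>, with \<open>im P\<close> is unitary: otherwise it could be enlarged by an intertwiner between the
 defects, and one exists because the two characters agree away from the unit.\<close>

lemma regular_rep_unitary_intertwiner:
 fixes P :: "complex^'g^'g"
 assumes P: "projection P" "P \<noteq> 0"
  and dich: "\<And>h. L h ** P = P ** L h \<or> P ** L h ** P = 0"
  and tr: "\<And>h. h \<noteq> u ==> trace (L h ** P) = 0"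
 obtains U where "unitary U" "\<And>h. L h ** U = U ** L h" "\<And>a. (P ** U) $ a $ u = U $ a $ u"
proof -
 let ?I = "mat 1 :: complex^'g^'g"
 \<comment> \<open>The stabilizer of \<open>P\<close>; by \<open>dich\<close> all other group
   elements move the image of \<open>P\<close> to an orthogonal subspace.\<close>
 define S where "S = {h. L h ** P = P ** L h}"
 have S_u: "u \<in> S" by (simp add: S_def L_u)
 have S_mul: "mul h k \<in> S" if "h \<in> S" "k \<in> S" for h k
  using that by (simp add: S_def L_mult[symmetric] matrix_mul_assoc) (metis matrix_mul_assoc)
 have S_iv: "iv h \<in> S" if "h \<in> S" for h
 proof -
  have "L (iv h) ** (L h ** P) ** L (iv h) = L (iv h) ** (P ** L h) ** L (iv h)"
   using that by (simp add: S_def)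
  hence "P ** L (iv h) = L (iv h) ** P"
   by (simp only: adj_L[symmetric] matrix_mul_assoc L_adj_L matrix_mul_lid)
    (simp add: matrix_mul_assoc[symmetric] L_adj_L)
  thus ?thesis by (simp add: S_def)
 qed
 have S_out: "P ** L h ** P = 0" if "h \<notin> S" for h
  using dich[of h] that by (auto simp: S_def)
 \<comment> \<open>The projection onto the span of the basis vectors in \<open>S\<close>, that is,
   onto the regular representation of \<open>S\<close>. Its translates behave like those of
   \<open>P\<close>.\<close>
 define Q :: "complex^'g^'g" where "Q = (\<chi> a b. if a = b then if a \<in> S then 1 else 0 else 0)"
 have Qm: "(Q ** M) $ a $ b = (if a \<in> S then M $ a $ b else 0)"
  and mQ: "(M ** Q) $ a $ b = (if b \<in> S then M $ a $ b else 0)" for M :: "complex^'g^'g" and a b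
 proof -
  have "(Q ** M) $ a $ b = (\<Sum>k\<in>UNIV. if k = a then if a \<in> S then M $ a $ b else 0 else 0)"
   "(M ** Q) $ a $ b = (\<Sum>k\<in>UNIV. if k = b then if b \<in> S then M $ a $ b else 0 else 0)"
   unfolding matrix_mult_nth by (intro sum.cong; simp add: Q_def)+
  thus "(Q ** M) $ a $ b = (if a \<in> S then M $ a $ b else 0)"
   "(M ** Q) $ a $ b = (if b \<in> S then M $ a $ b else 0)" by simp_all
 qed
 have Q: "projection Q"
  unfolding projection_def by (auto simp: vec_eq_iff Qm) (auto simp: Q_def split: if_splits)
 have QL: "L h ** Q = Q ** L h" if "h \<in> S" for h
 proof -
  have "mul h b \<in> S \<longleftrightarrow> b \<in> S" for b
   using S_mul[OF S_iv[OF that], of "mul h b"] S_mul[OF that, of b]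
   by (auto simp: assoc[symmetric] group_left_neutral)
  thus ?thesis by (auto simp: vec_eq_iff Qm mQ L_def)
 qed
 have Q_out: "Q ** L h ** Q = 0" if "h \<notin> S" for h
 proof -
  have "a \<noteq> mul h b" if "a \<in> S" "b \<in> S" for a b
  proof
   assume "a = mul h b"
   hence "h = mul a (iv b)" by (simp add: assoc)
   thus False using S_mul[OF that(1) S_iv[OF that(2)]] \<open>h \<notin> S\<close> by simp
  qed
  thus ?thesis by (auto simp: vec_eq_iff mQ Qm) (auto simp: L_def)
 qed
 \<comment> \<open>An equivariant \<open>U\<close> with \<open>U ** Q = P ** U\<close> is determined
   by its restriction to the image of \<open>Q\<close>, an \<open>S\<close>-intertwiner into the
   image of \<open>P\<close>.\<close>
 define \<T> where "\<T> = {U :: complex^'g^'g. (\<forall>h. L h ** U = U ** L h) \<and> U ** Q = P ** U}"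
 define C where "C = {U \<in> \<T>. \<forall>M :: complex^'g^'g. norm (U ** M) \<le> norm M}"
 have "closed C"
  unfolding C_def \<T>_def mem_Collect_eq
  by (intro closed_Collect_conj closed_Collect_all closed_Collect_eq closed_Collect_le
    continuous_intros mm.continuous_on)
 moreover have "bounded C"
 proof (rule boundedI)
  show "norm U \<le> norm ?I" if "U \<in> C" for U
   using that unfolding C_def by (auto dest!: spec[of _ ?I])
 qed
 ultimately have "compact C" by (simp add: compact_eq_bounded_closed)
 moreover have "0 \<in> C" by (simp add: C_def \<T>_def)
 ultimately obtain U where U: "U \<in> C" and max: "\<And>V. V \<in> C ==> norm V \<le> norm U"
  using continuous_attains_sup[of C norm] by (auto intro: continuous_intros)
 have UL: "L h ** U = U ** L h" and UQ: "U ** Q = P ** U"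
  and contr: "norm (U ** M) \<le> norm M" for h and M :: "complex^'g^'g"
  using U by (auto simp: C_def \<T>_def)
 have UaL: "L h ** adj U = adj U ** L h" for h
 proof -
  have "adj (L (iv h) ** U) = adj (U ** L (iv h))" by (simp add: UL)
  thus ?thesis by (simp add: adj_mult adj_L)
 qed
 have UaP: "adj U ** P = Q ** adj U"
  using arg_cong[OF UQ, of adj] by (simp add: adj_mult projectionD[OF P(1)] projectionD[OF Q])
 \<comment> \<open>The defects of \<open>U\<close> and of its adjoint. They commute with the group
   and with \<open>Q\<close> and \<open>P\<close> respectively, and \<open>U\<close> is unitary once
   \<open>D\<close> vanishes.\<close>
 define D where "D = ?I - adj U ** U"
 define D' where "D' = ?I - U ** adj U"
 have DL: "L h ** D = D ** L h" and D'L: "L h ** D' = D' ** L h" for h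
  by (simp_all add: D_def D'_def mm.diff_left mm.diff_right matrix_mul_assoc UL UaL)
   (simp_all add: matrix_mul_assoc[symmetric] UL UaL)
 have DQ: "D ** Q = Q ** D"
  by (simp add: D_def mm.diff_left mm.diff_right matrix_mul_assoc[symmetric] UQ)
   (simp add: matrix_mul_assoc UaP)
 have D'P: "D' ** P = P ** D'"
  by (simp add: D'_def mm.diff_left mm.diff_right matrix_mul_assoc[symmetric] UaP)
   (simp add: matrix_mul_assoc UQ)
 have adjD: "adj D = D" by (simp add: D_def adj_diff adj_mult adj_mat)
 have D'U: "adj D' ** U = U ** D"
  by (simp add: D_def D'_def adj_diff adj_mult adj_mat mm.diff_left mm.diff_right matrix_mul_assoc)
 \<comment> \<open>\<open>D ** M\<close> is \<open>M\<close> minus \<open>adj U ** (U ** M)\<close>,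
   and the latter has norm at most that of \<open>U ** M\<close>. Expanding the square sharpens the
   contraction property by exactly the defect.\<close>
 have defect: "(norm (U ** M))^2 + (norm (D ** M))^2 \<le> (norm M)^2" for M :: "complex^'g^'g"
 proof -
  let ?V = "adj U ** (U ** M)"
  have "(norm ?V)^2 = (U ** ?V) \<bullet> (U ** M)"
   using inner_mult_left[of "adj U" "U ** M" ?V] by (simp add: power2_norm_eq_inner inner_commute)
  also have "... \<le> norm (U ** ?V) * norm (U ** M)" by (rule norm_cauchy_schwarz)
  also have "... \<le> norm ?V * norm (U ** M)" by (intro mult_right_mono contr) auto
  finally have "norm ?V \<le> norm (U ** M)"
   by (cases "norm ?V = 0") (auto simp: power2_eq_square mult_le_cancel_left)
  hence *: "(norm ?V)^2 \<le> (norm (U ** M))^2" by (simp add: power_mono)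
  have "D ** M = M - ?V" by (simp add: D_def mm.diff_left matrix_mul_assoc)
  hence "(norm (D ** M))^2 = (norm M)^2 - 2 * (M \<bullet> ?V) + (norm ?V)^2"
   by (simp add: power2_norm_eq_inner inner_diff_left inner_diff_right inner_commute)
  also have "M \<bullet> ?V = (norm (U ** M))^2"
   by (simp add: power2_norm_eq_inner inner_mult_left[of U])
  finally show ?thesis using * by simp
 qed
 \<comment> \<open>An intertwiner squeezed between the defects is a direction in which
   \<open>U\<close> can be enlarged. Adding a small multiple of \<open>T\<close> keeps
   \<open>U\<close> a contraction, because the cross term and the square are both controlled by
   \<open>norm (D ** M)\<close>, the room left by \<open>defect\<close>; yet the norm would exceed
   the maximum.\<close>
 have perturb: "D' ** N ** D = 0"
  if N: "\<And>h. L h ** N = N ** L h" "N ** Q = P ** N" for N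
 proof (rule ccontr)
  define T where "T = D' ** N ** D"
  assume "D' ** N ** D \<noteq> 0"
  hence "T \<noteq> 0" by (simp add: T_def)
  have TL: "L h ** T = T ** L h" for h
  proof -
   have "L h ** T = (L h ** D') ** N ** D" by (simp add: T_def matrix_mul_assoc)
   also have "... = D' ** (L h ** N) ** D" by (simp only: D'L matrix_mul_assoc)
   also have "... = D' ** N ** (L h ** D)" by (simp only: N(1) matrix_mul_assoc)
   also have "... = T ** L h" by (simp only: DL T_def matrix_mul_assoc)
   finally show ?thesis .
  qed
  have TQ: "T ** Q = P ** T"
  proof -
   have "T ** Q = D' ** N ** (D ** Q)" by (simp add: T_def matrix_mul_assoc)
   also have "... = D' ** (N ** Q) ** D" by (simp only: DQ matrix_mul_assoc)
   also have "... = (D' ** P) ** N ** D" by (simp only: N(2) matrix_mul_assoc)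
   also have "... = P ** T" by (simp only: D'P T_def matrix_mul_assoc)
   finally show ?thesis .
  qed
  define n where "n = norm N + norm (D' ** N) + 1"
  have n: "n > 0" "norm N \<le> n" "norm (D' ** N) \<le> n" by (auto simp: n_def add_nonneg_pos)
  \<comment> \<open>Chosen so that the cross term and the square together consume at most the
    defect.\<close>
  define eps where "eps = 1 / (2 * n + n\<^sup>2 + 1)"
  have eps: "0 < eps" "eps \<le> 1" "2 * eps * n + eps\<^sup>2 * n\<^sup>2 \<le> 1"
  proof -
   have pos: "2 * n + n\<^sup>2 + 1 > 0" using n by (simp add: add_pos_pos)
   thus "0 < eps" "eps \<le> 1" using n by (auto simp: eps_def)
   hence "eps\<^sup>2 \<le> eps" by (simp add: power2_eq_square mult_left_le)
   hence "2 * eps * n + eps\<^sup>2 * n\<^sup>2 \<le> 2 * eps * n + eps * n\<^sup>2" by (simp add: mult_right_mono)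
   also have "... = eps * (2 * n + n\<^sup>2)" by (simp add: algebra_simps)
   also have "... \<le> 1" using pos by (simp add: eps_def)
   finally show "2 * eps * n + eps\<^sup>2 * n\<^sup>2 \<le> 1" .
  qed
  \<comment> \<open>The sign makes the first-order change of the norm nonnegative, so the
    second-order term forces growth.\<close>
  define \<sigma> :: real where "\<sigma> = (if U \<bullet> T \<ge> 0 then 1 else - 1)"
  define V where "V = U + (\<sigma> * eps) *\<^sub>R T"
  have exp: "(norm (X + (\<sigma> * eps) *\<^sub>R Y))^2 = (norm X)^2 + 2 * eps * (\<sigma> * (X \<bullet> Y)) + eps\<^sup>2 * (norm Y)^2"
   for X Y :: "complex^'g^'g"
   unfolding power2_norm_eq_inner
   by (auto simp: inner_add_left inner_add_right inner_commute \<sigma>_def power2_eq_square algebra_simps)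
  have "norm (V ** M) \<le> norm M" for M :: "complex^'g^'g"
  proof -
   have "(U ** M) \<bullet> (T ** M) = (U ** (D ** M)) \<bullet> (N ** (D ** M))"
    using inner_mult_left[of "adj D'" "U ** M" "N ** (D ** M)"]
    by (simp add: T_def matrix_mul_assoc D'U)
   moreover have "\<bar>(U ** (D ** M)) \<bullet> (N ** (D ** M))\<bar> \<le> norm (D ** M) * (norm N * norm (D ** M))"
    by (rule order_trans[OF Cauchy_Schwarz_ineq2]) (intro mult_mono contr norm_matrix_mult_le, auto)
   moreover have "... \<le> n * (norm (D ** M))^2"
    using mult_right_mono[OF n(2), of "(norm (D ** M))^2"] by (simp add: power2_eq_square ac_simps)
   ultimately have i: "\<sigma> * ((U ** M) \<bullet> (T ** M)) \<le> n * (norm (D ** M))^2"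
    by (auto simp: \<sigma>_def)
   have "norm (T ** M) \<le> norm (D' ** N) * norm (D ** M)"
    using norm_matrix_mult_le[of "D' ** N" "D ** M"] by (simp add: T_def matrix_mul_assoc)
   also have "... \<le> n * norm (D ** M)" by (intro mult_right_mono n) auto
   finally have "(norm (T ** M))^2 \<le> (n * norm (D ** M))^2" by (intro power_mono) auto
   hence ii: "(norm (T ** M))^2 \<le> n\<^sup>2 * (norm (D ** M))^2" by (simp add: power_mult_distrib)
   have "(norm (V ** M))^2 = (norm (U ** M))^2 + 2 * eps * (\<sigma> * ((U ** M) \<bullet> (T ** M))) + eps\<^sup>2 * (norm (T ** M))^2"
    by (simp add: V_def mm.add_left scaleR_mult_left exp)
   also have "... \<le> (norm (U ** M))^2 + 2 * eps * (n * (norm (D ** M))^2) + eps\<^sup>2 * (n\<^sup>2 * (norm (D ** M))^2)"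
    using eps by (intro add_mono mult_left_mono i ii) auto
   also have "... = (norm (U ** M))^2 + (2 * eps * n + eps\<^sup>2 * n\<^sup>2) * (norm (D ** M))^2"
    by (simp add: algebra_simps)
   also have "... \<le> (norm (U ** M))^2 + 1 * (norm (D ** M))^2"
    by (intro add_mono mult_right_mono eps) auto
   also have "... \<le> (norm M)^2" using defect by simp
   finally show ?thesis by (rule power2_le_imp_le) simp
  qed
  moreover have "V \<in> \<T>"
   by (simp add: V_def \<T>_def mm.add_left mm.add_right scaleR_mult_left scaleR_mult_right UL UQ TL TQ)
  ultimately have "norm V \<le> norm U" by (intro max) (simp add: C_def)
  hence "(norm V)^2 \<le> (norm U)^2" by (simp add: power_mono)
  moreover have "(norm V)^2 = (norm U)^2 + 2 * eps * (\<sigma> * (U \<bullet> T)) + eps\<^sup>2 * (norm T)^2"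
   by (simp add: V_def exp)
  moreover have "eps * (\<sigma> * (U \<bullet> T)) \<ge> 0" using eps by (auto simp: \<sigma>_def mult_nonneg_nonpos)
  moreover have "eps\<^sup>2 * (norm T)\<^sup>2 > 0" using eps \<open>T \<noteq> 0\<close> by simp
  ultimately show False by linarith
 qed
 define a where "a h = trace (L h ** D ** Q)" for h
 \<comment> \<open>Averaging an arbitrary \<open>M\<close> over the group yields an admissible
   \<open>N\<close>; letting \<open>M\<close> run through the matrix units turns
   \<open>perturb\<close> into orthogonality between the characters of the two defects.\<close>
 have "(\<Sum>h\<in>UNIV. trace (L h ** D' ** P) * cnj (a h)) = 0"
 proof -
  have "(\<Sum>h\<in>UNIV. L h ** D' ** P ** M ** (Q ** D ** adj (L h))) = 0" for M :: "complex^'g^'g"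
  proof -
   define N where "N = (\<Sum>h\<in>UNIV. L h ** P ** M ** Q ** adj (L h))"
   have "L k ** N = N ** L k" for k
   proof -
    have "L k ** N = (\<Sum>h\<in>UNIV. L (mul k h) ** P ** M ** Q ** adj (L (mul k h)) ** L k)"
     unfolding N_def mm.sum_right
    proof (rule sum.cong[OF refl])
     fix h
     have "adj (L (mul k h)) ** L k = adj (L h)"
      by (simp add: L_mult[symmetric] adj_mult matrix_mul_assoc[symmetric] L_adj_L)
     thus "L k ** (L h ** P ** M ** Q ** adj (L h)) =
       L (mul k h) ** P ** M ** Q ** adj (L (mul k h)) ** L k"
      by (simp add: L_mult[symmetric] matrix_mul_assoc[symmetric])
    qed
    also have "... = (\<Sum>h\<in>UNIV. L h ** P ** M ** Q ** adj (L h) ** L k)" by (rule sum_UNIV_mul)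
    also have "... = N ** L k" by (simp add: N_def mm.sum_left)
    finally show ?thesis .
   qed
   moreover have "N ** Q = P ** N"
    unfolding N_def mm.sum_left mm.sum_right
   proof (rule sum.cong[OF refl])
    fix h
    show "L h ** P ** M ** Q ** adj (L h) ** Q = P ** (L h ** P ** M ** Q ** adj (L h))"
    proof (cases "h \<in> S")
     case True
     hence 1: "adj (L h) ** Q = Q ** adj (L h)" and 2: "P ** L h = L h ** P"
      using QL[OF S_iv] by (auto simp: adj_L S_def)
     have "L h ** P ** M ** Q ** adj (L h) ** Q = L h ** P ** M ** (Q ** Q) ** adj (L h)"
      using 1 by (simp add: matrix_mul_assoc[symmetric])
     also have "... = P ** (L h ** P ** M ** Q ** adj (L h))"
      unfolding projectionD(2)[OF Q] matrix_mul_assoc 2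
      by (simp add: matrix_mul_assoc[symmetric]) (simp add: matrix_mul_assoc projectionD(2)[OF P(1)])
     finally show ?thesis .
    next
     case False
     hence "iv h \<notin> S" using S_iv[of "iv h"] by auto
     hence 1: "Q ** adj (L h) ** Q = 0" and 2: "P ** L h ** P = 0"
      using Q_out[of "iv h"] S_out[OF False] by (auto simp: adj_L)
     have "L h ** P ** M ** Q ** adj (L h) ** Q = L h ** P ** M ** (Q ** adj (L h) ** Q)"
      by (simp add: matrix_mul_assoc)
     moreover have "P ** (L h ** P ** M ** Q ** adj (L h)) = (P ** L h ** P) ** M ** Q ** adj (L h)"
      by (simp add: matrix_mul_assoc)
     ultimately show ?thesis unfolding 1 2 by simp
    qed
   qed
   ultimately have "D' ** N ** D = 0" by (rule perturb)
   moreover have "D' ** N ** D = (\<Sum>h\<in>UNIV. L h ** D' ** P ** M ** (Q ** D ** adj (L h)))"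
    unfolding N_def mm.sum_left mm.sum_right
   proof (rule sum.cong[OF refl])
    fix h
    have "adj (L h) ** D = D ** adj (L h)" using DL[of "iv h"] by (simp add: adj_L)
    thus "D' ** (L h ** P ** M ** Q ** adj (L h)) ** D =
      L h ** D' ** P ** M ** (Q ** D ** adj (L h))"
     by (simp add: D'L matrix_mul_assoc[symmetric])
   qed
   ultimately show ?thesis by simp
  qed
  hence "(\<Sum>h\<in>UNIV. \<Sum>a\<in>UNIV. \<Sum>b\<in>UNIV. (L h ** D' ** P ** (\<chi> i j. if i = a \<and> j = b then 1 else 0)
    ** (Q ** D ** adj (L h))) $ a $ b) = (\<Sum>a\<in>UNIV. \<Sum>b\<in>UNIV. (0 :: complex^'g^'g) $ a $ b)"
   by (subst sum.swap, subst sum.swap[where A = UNIV and B = UNIV and g = "%h b. _ h b"])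
    (simp flip: sum_component)
  hence "(\<Sum>h\<in>UNIV. trace (L h ** D' ** P) * trace (Q ** D ** adj (L h))) = 0"
   by (simp add: trace_matrix_units)
  moreover have "trace (Q ** D ** adj (L h)) = cnj (a h)" for h
   unfolding a_def trace_adj[symmetric] by (simp add: adj_mult adjD projectionD[OF Q] matrix_mul_assoc)
  ultimately show ?thesis by simp
 qed
 \<comment> \<open>Moving \<open>U\<close> around inside the trace shows that the parts containing
   \<open>U\<close> agree. What remains is the difference of the characters of \<open>P\<close> and
   \<open>Q\<close>, and both vanish off the unit.\<close>
 moreover have "trace (L h ** D' ** P) = a h + (if h = u then trace P - of_nat (card S) else 0)" for h
 proof -
  have "trace (L h ** (U ** adj U) ** P) = trace (L h ** U ** (Q ** adj U))"
   by (simp add: matrix_mul_assoc[symmetric] UaP)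
  also have "... = trace (U ** (L h ** Q ** adj U))" by (simp add: UL matrix_mul_assoc)
  also have "... = trace (L h ** Q ** adj U ** U)" by (rule trace_mult_commute)
  also have "... = trace (L h ** (adj U ** U) ** Q)"
   by (simp add: matrix_mul_assoc[symmetric] UQ) (simp add: matrix_mul_assoc UaP)
  finally have "trace (L h ** D' ** P) = trace (L h ** P) - trace (L h ** Q) + a h"
   by (simp add: a_def D_def D'_def mm.diff_left mm.diff_right trace_sub)
  moreover have "trace (L h ** P) - trace (L h ** Q) = (if h = u then trace P - of_nat (card S) else 0)"
  proof (cases "h = u")
   case True
   have "trace Q = of_nat (card S)"
    by (simp add: trace_def Q_def flip: sum.inter_filter)
   thus ?thesis using True by (simp add: L_u)
  qed (use tr trace_L_diag[of h S] in \<open>simp add: Q_def\<close>)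
  ultimately show ?thesis by simp
 qed
 ultimately have sum0: "(\<Sum>h\<in>UNIV. (if h = u then trace P - of_nat (card S) else 0) * cnj (a h) + a h * cnj (a h)) = 0"
  by (simp add: algebra_simps)
 have a_u: "a u = of_real ((norm Q)^2 - (norm (U ** Q))\<^sup>2)"
 proof -
  have tr_sq: "trace (adj M ** M) = of_real ((norm M)^2)" for M :: "complex^'g^'g"
  proof -
   have "cnj (trace (adj M ** M)) = trace (adj M ** M)"
    unfolding trace_adj[symmetric] by (simp add: adj_mult)
   thus ?thesis by (simp add: norm_matrix_sq complex_eq_iff)
  qed
  have "a u = trace (D ** (Q ** Q))" by (simp add: a_def L_u projectionD[OF Q])
  also have "... = trace (Q ** D ** Q)" by (simp add: DQ[symmetric] matrix_mul_assoc)
  also have "Q ** D ** Q = adj Q ** Q - adj (U ** Q) ** (U ** Q)"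
   by (simp add: D_def mm.diff_left mm.diff_right adj_mult matrix_mul_assoc projectionD(1)[OF Q])
  finally show ?thesis by (simp add: trace_sub tr_sq)
 qed
 \<comment> \<open>\<open>R\<close> projects onto the \<open>S\<close>-invariants in the image of
   \<open>P\<close>. Its trace is that of \<open>P\<close> divided by \<open>card S\<close>, since
   the other characters vanish, and a nonzero projection has trace at least 1.\<close>
 have trP: "real (card S) \<le> Re (trace P)"
 proof -
  have cS: "card S > 0" using S_u by (auto simp: card_gt_0_iff)
  define R where "R = (1 / card S) *\<^sub>R (\<Sum>h\<in>S. L h ** P)"
  have reix: "(\<Sum>h\<in>S. f (mul k h)) = (\<Sum>h\<in>S. f h)" if "k \<in> S" for k and f :: "'g => complex^'g^'g"
   by (rule sum.reindex_bij_witness[where j = "mul k" and i = "mul (iv k)"])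
    (use that S_mul S_iv in \<open>auto simp: assoc[symmetric] group_left_neutral\<close>)
  have LR: "L k ** P ** R = R" if "k \<in> S" for k
  proof -
   have "L k ** P ** (L h ** P) = L (mul k h) ** P" if "h \<in> S" for h
   proof -
    have "L k ** P ** (L h ** P) = L k ** (P ** L h) ** P" by (simp add: matrix_mul_assoc)
    also have "P ** L h = L h ** P" using that by (simp add: S_def)
    finally show ?thesis
     by (simp add: matrix_mul_assoc[symmetric] projectionD[OF P(1)] L_mult[symmetric])
   qed
   thus ?thesis using reix[OF that, of "%h. L h ** P"]
    by (simp add: R_def scaleR_mult_right mm.sum_right)
  qed
  have "R ** R = (1 / card S) *\<^sub>R (\<Sum>h\<in>S. L h ** P ** R)"
   by (subst (1) R_def) (simp add: scaleR_mult_left mm.sum_left)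
  also have "... = R" using cS S_u by (auto simp: LR sum_constant_scaleR simp del: sum_constant)
  finally have "R ** R = R" .
  moreover have "adj R = R"
  proof -
   have "adj (L h ** P) = L (iv h) ** P" if "h \<in> S" for h
    using S_iv[OF that] by (simp add: adj_mult adj_L projectionD[OF P(1)] S_def)
   hence "adj R = (1 / card S) *\<^sub>R (\<Sum>h\<in>S. L (iv h) ** P)"
    by (simp add: R_def adj_scaleR adj_sum)
   also have "(\<Sum>h\<in>S. L (iv h) ** P) = (\<Sum>h\<in>S. L h ** P)"
    by (rule sum.reindex_bij_witness[where j = iv and i = iv]) (use S_iv in auto)
   finally show ?thesis by (simp add: R_def)
  qed
  moreover have trR: "trace R = trace P / card S"
  proof -
   have "(\<Sum>h\<in>S. trace (L h ** P)) = (\<Sum>h\<in>{u}. trace (L h ** P))"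
    by (rule sum.mono_neutral_right) (use S_u tr in auto)
   thus ?thesis by (simp only: R_def trace_scaleR trace_sum) (simp add: L_u scaleR_conv_of_real)
  qed
  ultimately have R: "projection R" by (simp add: projection_def)
  have "Re (trace P) > 0" using P by (simp add: projection_norm_sq[symmetric])
  hence "R \<noteq> 0" using trR cS by (auto simp: trace_def[of 0])
  hence "1 \<le> (norm R)^2" using projection_norm_ge_1[OF R] by simp
  thus ?thesis using cS by (simp add: projection_norm_sq[OF R] trR field_simps)
 qed
 \<comment> \<open>Real part of the orthogonality relation. Both summands are nonnegative, so
   \<open>a\<close> vanishes; at the unit it is the trace of \<open>Q ** D ** Q\<close>.\<close>
 have "(\<Sum>h\<in>UNIV. (cmod (a h))\<^sup>2) + (Re (trace P) - card S) * Re (a u) = 0"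
 proof -
  have "Im (a u) = 0" by (simp add: a_u)
  hence re: "Re ((if h = u then trace P - of_nat (card S) else 0) * cnj (a h) + a h * cnj (a h)) =
    (cmod (a h))\<^sup>2 + (if h = u then (Re (trace P) - card S) * Re (a u) else 0)" for h
   by (auto simp: complex_mult_cnj cmod_power2)
  thus ?thesis using arg_cong[OF sum0, of Re] by (simp only: Re_sum re) (simp add: sum.distrib)
 qed
 moreover have "Re (a u) \<ge> 0" using contr[of Q] by (simp add: a_u power_mono)
 ultimately have "(\<Sum>h\<in>UNIV. (cmod (a h))\<^sup>2) \<le> 0" using trP by (smt (verit) mult_nonneg_nonneg)
 hence "(cmod (a u))^2 \<le> 0" using sum_nonneg_leq_bound[of UNIV "%h. (cmod (a h))\<^sup>2" 0 u]
  by (metis (no_types, lifting) UNIV_I finite member_le_sum order_trans zero_le_power2)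
 hence "a u = 0" by simp
 hence "(norm (D ** Q))^2 \<le> 0" using defect[of Q] by (simp add: a_u flip: of_real_diff of_real_power)
 hence "D ** Q = 0" by simp
 hence D_u: "D $ a $ u = 0" for a using mQ[of D a u] S_u by simp
 \<comment> \<open>Column \<open>h\<close> is a translate of column \<open>u\<close>, because
   \<open>D\<close> commutes with the group.\<close>
 have "D $ a $ h = 0" for a h
 proof -
  have "D $ a $ h = (D ** L h) $ a $ u" by (simp add: mult_L_nth)
  also have "... = 0" by (simp add: DL[symmetric] L_mult_nth D_u)
  finally show ?thesis .
 qed
 hence "D = 0" by (simp add: vec_eq_iff)
 hence "unitary U" by (simp add: D_def unitary_def)
 moreover have "(P ** U) $ a $ u = U $ a $ u" for a
  using S_u by (simp add: UQ[symmetric] mQ)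
 ultimately show thesis using that UL by blast
qed

end

section \<open>Discrete subgroups and their duals\<close>

locale discrete_subgroup =
 fixes La :: "'q::euclidean_space set"
 assumes zero_mem: "0 \<in> La"
  and diff_mem: "\<And>x y. x \<in> La ==> y \<in> La ==> x - y \<in> La"
  and separated: "\<exists>eps>0. \<forall>l\<in>La. l \<noteq> 0 \<longrightarrow> eps \<le> norm l"
begin

lemma uminus_mem: "x \<in> La ==> - x \<in> La"
 using diff_mem[OF zero_mem] by simp

lemma add_mem: "x \<in> La ==> y \<in> La ==> x + y \<in> La"
 using diff_mem[of x "- y"] uminus_mem by simp

lemma scaleR_nat_mem: "x \<in> La ==> of_nat n *\<^sub>R x \<in> La"
 by (induction n) (simp_all add: zero_mem add_mem scaleR_add_left)

lemma scaleR_int_mem: "x \<in> La ==> of_int n *\<^sub>R x \<in> La"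
 by (cases n rule: int_diff_cases) (simp add: scaleR_diff_left diff_mem scaleR_nat_mem)

lemma sum_mem: "(\<And>i. i \<in> I ==> f i \<in> La) ==> sum f I \<in> La"
 by (induction I rule: infinite_finite_induct) (simp_all add: zero_mem add_mem)

text \<open>An infinite bounded subset would accumulate, and two of its points close to the limit
  would differ by a nonzero vector shorter than the separation constant.\<close>

lemma finite_bounded_subset:
 assumes "\<And>l. l \<in> F ==> l \<in> La \<and> norm l \<le> R" shows "finite F"
proof (rule ccontr)
 assume "infinite F"
 moreover have "F \<subseteq> cball 0 R" using assms by auto
 ultimately obtain x where x: "x islimpt F"
  using Heine_Borel_imp_Bolzano_Weierstrass[OF compact_cball] by blast
 obtain eps where eps: "eps > 0" "\<And>l. l \<in> La ==> l \<noteq> 0 ==> eps \<le> norm l" using separated by blast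
 obtain y where y: "y \<in> F" "y \<noteq> x" "dist y x < eps / 2"
  using x eps(1) unfolding islimpt_approachable by (meson half_gt_zero)
 obtain z where z: "z \<in> F" "z \<noteq> x" "dist z x < min (eps / 2) (dist y x)"
  using x eps(1) y(2) unfolding islimpt_approachable
  by (metis dist_pos_lt half_gt_zero min_less_iff_conj)
 have "norm (y - z) < eps" using y(3) z(3) dist_triangle_half_l[of y x eps z] by (simp add: dist_norm)
 moreover have "y - z \<noteq> 0" using z(3) by auto
 ultimately show False using eps(2)[of "y - z"] assms y(1) z(1) diff_mem by force
qed

lemma closed_mem: "closed La"
proof -
 obtain eps where eps: "eps > 0" "\<And>l. l \<in> La ==> l \<noteq> 0 ==> eps \<le> norm l" using separated by blast
 show ?thesis
  by (rule discrete_imp_closed[OF eps(1)]) (use eps(2) diff_mem in \<open>force simp: dist_norm\<close>)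
qed

lemma countable_mem: "countable La"
proof -
 have "La = (\<Union>n::nat. {l \<in> La. norm l \<le> n})" (is "_ = ?U") using real_arch_simple by blast
 moreover have "finite {l \<in> La. norm l \<le> real n}" for n
  by (rule finite_bounded_subset[of _ "real n"]) simp
 hence "countable ?U" by (intro countable_UN) (auto intro: countable_finite)
 ultimately show ?thesis by metis
qed

end

lemma span_coordinates:
 assumes "finite B" "x \<in> span B" obtains c where "x = (\<Sum>b\<in>B. c b *\<^sub>R (b :: 'q::real_vector))"
 using assms(2) unfolding span_finite[OF assms(1)] by blast

text \<open>A basis of the part inside \<open>span S\<close> is completed by a lattice vector
  \<open>l0\<close> with the least positive coordinate along the new direction \<open>a\<close>.
  Discreteness enters through the existence of that minimum.\<close>

lemma discrete_subgroup_integral_basis_aux: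
 assumes "finite S" "independent S" "discrete_subgroup La" "S \<subseteq> La" "La \<subseteq> span S"
 shows "\<exists>B. finite B \<and> independent B \<and> B \<subseteq> La \<and>
  (\<forall>l\<in>La. \<exists>n::'q::euclidean_space => int. l = (\<Sum>b\<in>B. of_int (n b) *\<^sub>R b))"
 using assms
proof (induction S arbitrary: La rule: finite_induct)
 case empty
 thus ?case by (intro exI[of _ "{}"]) auto
next
 case (insert a S)
 interpret discrete_subgroup La by fact
 have a: "a \<notin> span S" "independent S" and S: "S \<subseteq> La" "a \<in> La"
  using insert.prems insert.hyps by (auto simp: independent_insert)
 define La' where "La' = La \<inter> span S"
 have "discrete_subgroup La'"
  using separated by unfold_locales (auto simp: La'_def zero_mem diff_mem span_zero span_diff)
 moreover have "S \<subseteq> La'" using S by (auto simp: La'_def span_base)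
 ultimately obtain B where B: "finite B" "independent B" "B \<subseteq> La'"
  and comb: "\<And>l. l \<in> La' ==> \<exists>n::'q => int. l = (\<Sum>b\<in>B. of_int (n b) *\<^sub>R b)"
  using insert.IH[OF a(2), of La'] by (auto simp: La'_def)
 have "l \<in> span B" if "l \<in> La'" for l
  using comb[OF that] by (auto simp: span_sum span_scale span_base)
 hence spanB: "span B = span S"
  unfolding span_eq using \<open>S \<subseteq> La'\<close> B(3) by (auto simp: La'_def)
 have coord: "\<exists>t. l - t *\<^sub>R a \<in> span S" if "l \<in> La" for l
  using span_breakdown[of a "insert a S" l] insert.prems(4) insert.hyps(2) that by auto
 have uniq: "t = t'" if "l - t *\<^sub>R a \<in> span S" "l - t' *\<^sub>R a \<in> span S" for l t t'
 proof (rule ccontr)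
  assume "t \<noteq> t'"
  have "(t' - t) *\<^sub>R a \<in> span S" using span_diff[OF that] by (simp add: algebra_simps)
  hence "(1 / (t' - t)) *\<^sub>R ((t' - t) *\<^sub>R a) \<in> span S" by (rule span_scale)
  thus False using \<open>t \<noteq> t'\<close> a(1) by simp
 qed
 define A where "A = {t. 0 < t \<and> t \<le> 1 \<and> (\<exists>l\<in>La. l - t *\<^sub>R a \<in> span S)}"
 define R where "R = (\<Sum>b\<in>B. norm b) + norm a"
 \<comment> \<open>Subtracting integral parts in the old basis leaves the coordinate along
   \<open>a\<close> unchanged, so each value in \<open>A\<close> occurs on a vector of norm at most
   \<open>R\<close>.\<close>
 have red: "\<exists>l\<in>La. norm l \<le> R \<and> l - t *\<^sub>R a \<in> span S" if t: "t \<in> A" for t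
 proof -
  obtain l where l: "l \<in> La" "l - t *\<^sub>R a \<in> span S" using t by (auto simp: A_def)
  obtain c where c: "l - t *\<^sub>R a = (\<Sum>b\<in>B. c b *\<^sub>R b)"
   using span_coordinates[OF B(1)] l(2) spanB by metis
  define m where "m = (\<Sum>b\<in>B. of_int \<lfloor>c b\<rfloor> *\<^sub>R b)"
  have m: "m \<in> La" "m \<in> span S" unfolding m_def
   using B(3) by (auto intro!: sum_mem scaleR_int_mem span_sum span_scale simp: La'_def)
  have e: "l - m - t *\<^sub>R a = (\<Sum>b\<in>B. frac (c b) *\<^sub>R b)"
   using c by (simp add: m_def frac_def sum_subtractf scaleR_diff_left algebra_simps)
  have "norm (\<Sum>b\<in>B. frac (c b) *\<^sub>R b) \<le> (\<Sum>b\<in>B. norm b)"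
   by (rule sum_norm_le) (simp add: mult_left_le_one_le frac_ge_0 less_imp_le[OF frac_lt_1])
  moreover have "norm (t *\<^sub>R a) \<le> norm a" using t by (simp add: A_def mult_left_le_one_le)
  ultimately have "norm (l - m) \<le> R"
   using norm_triangle_ineq[of "l - m - t *\<^sub>R a" "t *\<^sub>R a"] by (simp add: e[symmetric] R_def)
  moreover have "l - m - t *\<^sub>R a \<in> span S"
   using span_diff[OF l(2) m(2)] by (simp add: algebra_simps)
  ultimately show ?thesis using diff_mem[OF l(1) m(1)] by blast
 qed
 have "finite A"
 proof -
  define F where "F = {l \<in> La. norm l \<le> R}"
  have "finite F" by (rule finite_bounded_subset[of _ R]) (simp add: F_def)
  moreover have "A \<subseteq> (%l. THE t. l - t *\<^sub>R a \<in> span S) ` F"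
  proof
   fix t assume "t \<in> A"
   then obtain l where l: "l \<in> F" "l - t *\<^sub>R a \<in> span S" using red by (auto simp: F_def)
   hence "(THE t. l - t *\<^sub>R a \<in> span S) = t" using uniq by blast
   thus "t \<in> (%l. THE t. l - t *\<^sub>R a \<in> span S) ` F" using l(1) by force
  qed
  ultimately show ?thesis by (rule finite_surj)
 qed
 moreover have "1 \<in> A" using S by (auto simp: A_def intro!: bexI[of _ a] span_zero)
 ultimately have t0: "Min A \<in> A" and t0_le: "\<And>t. t \<in> A ==> Min A \<le> t"
  using Min_in by (auto intro!: Min_le)
 define t0 where "t0 = Min A"
 obtain l0 where l0: "l0 \<in> La" "l0 - t0 *\<^sub>R a \<in> span S" and t0_pos: "0 < t0" "t0 \<le> 1"
  using t0 by (auto simp: A_def t0_def)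
 have l0_notin: "l0 \<notin> span S" using uniq[of l0 0 t0] l0(2) t0_pos by auto
 show ?case
 proof (intro exI[of _ "insert l0 B"] conjI ballI)
  have l0B: "l0 \<notin> B" using l0_notin span_base spanB by metis
  show "independent (insert l0 B)" using l0_notin l0B B(2) spanB by (simp add: independent_insert)
  show "insert l0 B \<subseteq> La" using l0(1) B(3) by (auto simp: La'_def)
  fix l assume l: "l \<in> La"
  then obtain t where t: "l - t *\<^sub>R a \<in> span S" using coord by blast
  \<comment> \<open>Division with remainder: the remaining coordinate lies in
    \<open>[0, t0)\<close>, hence is 0 by minimality.\<close>
  define k where "k = \<lfloor>t / t0\<rfloor>"
  define l' where "l' = l - of_int k *\<^sub>R l0"
  have l': "l' \<in> La" unfolding l'_def by (intro diff_mem l scaleR_int_mem l0)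
  have t': "l' - (t - of_int k * t0) *\<^sub>R a \<in> span S"
  proof -
   have "l' - (t - of_int k * t0) *\<^sub>R a = (l - t *\<^sub>R a) - of_int k *\<^sub>R (l0 - t0 *\<^sub>R a)"
    by (simp add: l'_def algebra_simps)
   thus ?thesis using span_diff[OF t span_scale[OF l0(2)]] by simp
  qed
  have "of_int k * t0 \<le> t" "t < (of_int k + 1) * t0"
   unfolding k_def using t0_pos by (intro floor_divide_lower floor_divide_upper; simp)+
  hence r: "0 \<le> t - of_int k * t0" "t - of_int k * t0 < t0" by (simp_all add: algebra_simps)
  have "t - of_int k * t0 = 0"
  proof (rule ccontr)
   assume "t - of_int k * t0 \<noteq> 0"
   hence "t - of_int k * t0 \<in> A" using r t' l' t0_pos by (auto simp: A_def)
   thus False using t0_le r(2) by (force simp: t0_def)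
  qed
  hence "l' \<in> La'" using t' l' by (simp add: La'_def)
  then obtain n where n: "l' = (\<Sum>b\<in>B. of_int (n b) *\<^sub>R b)" using comb by blast
  have "l = (\<Sum>b\<in>insert l0 B. of_int ((n(l0 := k)) b) *\<^sub>R b)"
  proof -
   have "(\<Sum>b\<in>B. of_int ((n(l0 := k)) b) *\<^sub>R b) = (\<Sum>b\<in>B. of_int (n b) *\<^sub>R b)"
    by (rule sum.cong) (use l0B in auto)
   thus ?thesis using B(1) l0B n by (simp add: l'_def algebra_simps)
  qed
  thus "\<exists>n::'q => int. l = (\<Sum>b\<in>insert l0 B. of_int (n b) *\<^sub>R b)" by blast
 qed (use B in auto)
qed

context discrete_subgroup begin

definition basis :: "'q set" where
 "basis = (SOME B. finite B \<and> independent B \<and> B \<subseteq> La \<and>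
  (\<forall>l\<in>La. \<exists>n::'q => int. l = (\<Sum>b\<in>B. of_int (n b) *\<^sub>R b)))"

lemma basis:
 shows finite_basis: "finite basis" and independent_basis: "independent basis"
  and basis_mem: "basis \<subseteq> La"
  and integral_combination: "l \<in> La ==> \<exists>n::'q => int. l = (\<Sum>b\<in>basis. of_int (n b) *\<^sub>R b)"
proof -
 obtain S where S: "S \<subseteq> La" "independent S" "La \<subseteq> span S" using maximal_independent_subset by blast
 have "\<exists>B. finite B \<and> independent B \<and> B \<subseteq> La \<and>
  (\<forall>l\<in>La. \<exists>n::'q => int. l = (\<Sum>b\<in>B. of_int (n b) *\<^sub>R b))"
  by (rule discrete_subgroup_integral_basis_aux[OF independent_imp_finite[OF S(2)] S(2)
     discrete_subgroup_axioms S(1,3)])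
 from someI_ex[OF this, folded basis_def]
 show "finite basis" "independent basis" "basis \<subseteq> La"
  "l \<in> La ==> \<exists>n::'q => int. l = (\<Sum>b\<in>basis. of_int (n b) *\<^sub>R b)" by auto
qed

lemma span_basis: "span basis = span La"
proof -
 have "l \<in> span basis" if "l \<in> La" for l
  using integral_combination[OF that] by (auto simp: span_sum span_scale span_base)
 thus ?thesis unfolding span_eq using basis_mem span_base by blast
qed

lemma card_basis: "card basis = dim La"
 using dim_eq_card[of basis La] independent_basis span_basis by simp

text \<open>The dual basis inside \<open>span La\<close>, scaled by 2 pi so that it lies in the dual
  lattice. It exists because the component of \<open>b\<close> orthogonal to the other basis vectors
  is nonzero.\<close>

definition dual :: "'q => 'q" where
 "dual b = (SOME \<beta>. \<beta> \<in> span La \<and> (\<forall>b'\<in>basis. \<beta> \<bullet> b' = (if b' = b then 2 * pi else 0)))"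

lemma dual:
 assumes b: "b \<in> basis"
 shows dual_span: "dual b \<in> span La"
  and inner_dual: "b' \<in> basis ==> dual b \<bullet> b' = (if b' = b then 2 * pi else 0)"
proof -
 obtain y z where yz: "y \<in> span (basis - {b})" "\<And>w. w \<in> span (basis - {b}) ==> orthogonal z w" "b = y + z"
  using orthogonal_subspace_decomp_exists[of "basis - {b}" b] by blast
 have "b \<notin> span (basis - {b})" using independent_basis b by (auto simp: dependent_def)
 hence "z \<noteq> 0" using yz by auto
 have "z \<bullet> b = z \<bullet> z" using yz by (simp add: inner_add_right orthogonal_def)
 have "y \<in> span La" using yz(1) span_mono[of "basis - {b}" basis] span_basis by auto
 hence "z \<in> span La" using yz(3) span_diff[of b La y] span_base[of b] basis_mem b
  by (metis add_diff_cancel_left' subsetD span_base)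
 moreover have "z \<bullet> b' = 0" if "b' \<in> basis" "b' \<noteq> b" for b'
  using yz(2)[OF span_base[of b']] that by (simp add: orthogonal_def)
 ultimately have "\<exists>\<beta>. \<beta> \<in> span La \<and> (\<forall>b'\<in>basis. \<beta> \<bullet> b' = (if b' = b then 2 * pi else 0))"
  using \<open>z \<noteq> 0\<close> \<open>z \<bullet> b = z \<bullet> z\<close>
  by (intro exI[of _ "(2 * pi / (z \<bullet> z)) *\<^sub>R z"]) (auto simp: span_scale)
 from someI_ex[OF this, folded dual_def]
 show "dual b \<in> span La" "b' \<in> basis ==> dual b \<bullet> b' = (if b' = b then 2 * pi else 0)" by auto
qed

text \<open>Orthogonal projection onto \<open>span La\<close>, expanded in the dual basis so that
  reduction modulo the dual lattice is rounding of coefficients.\<close>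

definition proj :: "'q => 'q" where
 "proj th = (\<Sum>b\<in>basis. ((th \<bullet> b) / (2 * pi)) *\<^sub>R dual b)"

lemma proj_span: "proj th \<in> span La"
 by (auto simp: proj_def dual_span intro!: span_sum span_scale)

lemma inner_span_eqI:
 assumes "\<And>b. b \<in> basis ==> x \<bullet> b = y \<bullet> b" "u \<in> span La" shows "x \<bullet> u = y \<bullet> u"
proof -
 have "u \<in> span basis" using assms(2) span_basis by simp
 thus ?thesis
  by (induction rule: span_induct_alt) (simp_all add: inner_add_right assms(1))
qed

lemma inner_proj: "u \<in> span La ==> proj th \<bullet> u = th \<bullet> u"
proof (rule inner_span_eqI)
 fix b assume b: "b \<in> basis"
 have "proj th \<bullet> b = (\<Sum>b'\<in>basis. if b' = b then th \<bullet> b else 0)"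
  unfolding proj_def inner_sum_left by (rule sum.cong) (auto simp: inner_dual b)
 thus "proj th \<bullet> b = th \<bullet> b" using b finite_basis by simp
qed

lemma inner_perp: "w \<in> orthogonal_comp (span La) ==> u \<in> span La ==> w \<bullet> u = 0"
 by (simp add: orthogonal_comp_def orthogonal_def inner_commute)

lemma orthogonal_comp_iff: "w \<in> orthogonal_comp (span La) \<longleftrightarrow> (\<forall>b\<in>basis. w \<bullet> b = 0)"
proof
 assume w: "w \<in> orthogonal_comp (span La)"
 show "\<forall>b\<in>basis. w \<bullet> b = 0"
  using inner_perp[OF w] basis_mem span_base by blast
next
 assume "\<forall>b\<in>basis. w \<bullet> b = 0"
 hence "w \<bullet> u = 0" if "u \<in> span La" for u
  using inner_span_eqI[of w 0 u] that by simp
 thus "w \<in> orthogonal_comp (span La)"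
  by (simp add: orthogonal_comp_def orthogonal_def inner_commute)
qed

lemma proj_perp: "th - proj th \<in> orthogonal_comp (span La)"
proof -
 have "proj th \<bullet> b = th \<bullet> b" if "b \<in> basis" for b
  using inner_proj span_base basis_mem that by blast
 thus ?thesis by (simp add: orthogonal_comp_iff inner_diff_left)
qed

lemma proj_eqI:
 assumes "u \<in> span La" "th - u \<in> orthogonal_comp (span La)" shows "proj th = u"
proof -
 have "u - proj th \<in> span La" using assms(1) proj_span by (rule span_diff)
 moreover have "(u - proj th) \<bullet> v = 0" if "v \<in> span La" for v
  using inner_perp[OF assms(2) that] inner_proj[OF that, of th] by (simp add: inner_diff_left)
 ultimately show ?thesis by (metis inner_eq_zero_iff eq_iff_diff_eq_0)
qed

lemma proj_of_span: "u \<in> span La ==> proj u = u"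
 by (rule proj_eqI) (simp_all add: orthogonal_comp_iff)

lemma linear_proj: "linear proj"
 unfolding proj_def
 by (rule linearI) (simp_all add: inner_add_left add_divide_distrib scaleR_add_left sum.distrib
   scaleR_sum_right)

text \<open>Functions on the dual torus live on the whole space, hence the orthogonal complement of the lattice
 consists of periods.\<close>

definition periods :: "'q set" where
 "periods = {kp. \<forall>l\<in>La. \<exists>n::int. kp \<bullet> l = 2 * pi * of_int n}"

lemma periods_iff: "kp \<in> periods \<longleftrightarrow> (\<forall>b\<in>basis. \<exists>n::int. kp \<bullet> b = 2 * pi * of_int n)"
proof
 assume "\<forall>b\<in>basis. \<exists>n::int. kp \<bullet> b = 2 * pi * of_int n"
 then obtain m :: "'q => int" where m: "\<And>b. b \<in> basis ==> kp \<bullet> b = 2 * pi * of_int (m b)" by metis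
 have "\<exists>n::int. kp \<bullet> l = 2 * pi * of_int n" if l: "l \<in> La" for l
 proof -
  obtain n :: "'q => int" where n: "l = (\<Sum>b\<in>basis. of_int (n b) *\<^sub>R b)"
   using integral_combination[OF l] by blast
  have "kp \<bullet> l = 2 * pi * of_int (\<Sum>b\<in>basis. n b * m b)"
   by (simp add: n inner_sum_right m sum_distrib_left ac_simps)
  thus ?thesis by blast
 qed
 thus "kp \<in> periods" by (simp add: periods_def)
qed (use basis_mem in \<open>auto simp: periods_def\<close>)

lemma dual_lattice_eq: "dual_lattice La = periods \<inter> span La"
 by (auto simp: dual_lattice_def periods_def)

lemma perp_periods: "w \<in> orthogonal_comp (span La) ==> w \<in> periods"
 by (auto simp: periods_iff orthogonal_comp_iff intro!: exI[of _ 0])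

lemma add_periods: "kp \<in> periods ==> kp' \<in> periods ==> kp + kp' \<in> periods"
 unfolding periods_iff inner_add_left by (metis distrib_left of_int_add)

lemma uminus_periods: "kp \<in> periods ==> - kp \<in> periods"
 unfolding periods_iff inner_minus_left by (metis mult_minus_right of_int_minus)

lemma diff_periods: "kp \<in> periods ==> kp' \<in> periods ==> kp - kp' \<in> periods"
 using add_periods[of kp "- kp'"] uminus_periods by simp

lemma proj_periods: "kp \<in> periods ==> proj kp \<in> dual_lattice La"
 using diff_periods[OF _ perp_periods[OF proj_perp], of kp kp] proj_span by (simp add: dual_lattice_eq)

lemma dual_in_lattice: "b \<in> basis ==> dual b \<in> dual_lattice La"
proof -
 assume b: "b \<in> basis"
 have "\<exists>n::int. dual b \<bullet> b' = 2 * pi * of_int n" if "b' \<in> basis" for b'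
  by (rule exI[of _ "if b' = b then 1 else 0"]) (simp add: inner_dual b that)
 thus ?thesis using b by (simp add: dual_lattice_eq dual_span periods_iff)
qed

text \<open>A period is the sum of its projection, a dual lattice vector, and a normal vector; the
  two invariances in \<open>torus_fun\<close> thus merge into one.\<close>

lemma torus_fun_iff: "torus_fun La f \<longleftrightarrow> (\<forall>th. \<forall>kp\<in>periods. f (th + kp) = f th)"
proof
 assume f: "torus_fun La f"
 show "\<forall>th. \<forall>kp\<in>periods. f (th + kp) = f th"
 proof (intro allI ballI)
  fix th kp assume "kp \<in> periods"
  hence "f (th + proj kp + (kp - proj kp)) = f th"
   using f proj_periods proj_perp unfolding torus_fun_def by metis
  thus "f (th + kp) = f th" by simp
 qed
qed (auto simp: torus_fun_def dual_lattice_eq perp_periods)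

lemma torus_funD: "torus_fun La f ==> kp \<in> periods ==> f (th + kp) = f th"
 by (simp add: torus_fun_iff)

text \<open>A nonzero dual vector pairs with some basis vector to a nonzero multiple of 2 pi, which
  bounds its norm from below.\<close>

lemma discrete_subgroup_dual: "discrete_subgroup (dual_lattice La)"
proof
 define M where "M = (\<Sum>b\<in>basis. norm b) + 1"
 have M: "M > 0" by (simp add: M_def add_nonneg_pos sum_nonneg)
 have "2 * pi / M \<le> norm xi" if xi: "xi \<in> dual_lattice La" "xi \<noteq> 0" for xi
 proof -
  have "proj xi = xi" using xi by (simp add: proj_of_span dual_lattice_eq)
  have "\<exists>b\<in>basis. xi \<bullet> b \<noteq> 0"
  proof (rule ccontr)
   assume "\<not> (\<exists>b\<in>basis. xi \<bullet> b \<noteq> 0)"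
   hence "proj xi = 0" by (simp add: proj_def)
   thus False using \<open>proj xi = xi\<close> xi(2) by simp
  qed
  then obtain b where b: "b \<in> basis" "xi \<bullet> b \<noteq> 0" by blast
  obtain n :: int where n: "xi \<bullet> b = 2 * pi * of_int n" using xi b(1) by (auto simp: dual_lattice_eq periods_iff)
  have "1 \<le> \<bar>of_int n :: real\<bar>" using b(2) n by (cases "n = 0") (auto simp flip: of_int_abs)
  hence "2 * pi \<le> \<bar>xi \<bullet> b\<bar>" by (simp add: n abs_mult)
  also have "... \<le> norm xi * norm b" by (rule Cauchy_Schwarz_ineq2)
  also have "... \<le> norm xi * M"
  proof (rule mult_left_mono)
   have "norm b \<le> (\<Sum>b\<in>basis. norm b)" by (rule member_le_sum) (use b finite_basis in auto)
   thus "norm b \<le> M" by (simp add: M_def)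
  qed simp
  finally show ?thesis using M by (simp add: field_simps)
 qed
 thus "\<exists>eps>0. \<forall>l\<in>dual_lattice La. l \<noteq> 0 \<longrightarrow> eps \<le> norm l"
  using M by (intro exI[of _ "2 * pi / M"]) auto
next
 show "0 \<in> dual_lattice La" by (auto simp: dual_lattice_def span_zero intro: exI[of _ 0])
 show "x - y \<in> dual_lattice La" if "x \<in> dual_lattice La" "y \<in> dual_lattice La" for x y
  using that by (simp add: dual_lattice_eq diff_periods span_diff)
qed

lemma nearest_dual_lattice:
 obtains xi where "xi \<in> dual_lattice La" "\<And>xi'. xi' \<in> dual_lattice La ==> norm (u - xi) \<le> norm (u - xi')"
proof -
 interpret D: discrete_subgroup "dual_lattice La" by (rule discrete_subgroup_dual)
 show ?thesis using distance_attains_inf[OF D.closed_mem, of u] D.zero_mem that by (auto simp: dist_norm)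
qed

lemma dual_reduce:
 assumes "u \<in> span La"
 obtains xi where "xi \<in> dual_lattice La" "norm (u - xi) \<le> (\<Sum>b\<in>basis. norm (dual b))"
proof -
 interpret D: discrete_subgroup "dual_lattice La" by (rule discrete_subgroup_dual)
 define c where "c b = (u \<bullet> b) / (2 * pi)" for b
 define xi where "xi = (\<Sum>b\<in>basis. of_int \<lfloor>c b\<rfloor> *\<^sub>R dual b)"
 have "xi \<in> dual_lattice La" unfolding xi_def by (intro D.sum_mem D.scaleR_int_mem dual_in_lattice)
 moreover have "norm (u - xi) \<le> (\<Sum>b\<in>basis. norm (dual b))"
 proof -
  have "u - xi = (\<Sum>b\<in>basis. frac (c b) *\<^sub>R dual b)"
   using proj_of_span[OF assms]
   by (simp add: proj_def c_def[symmetric] xi_def frac_def sum_subtractf scaleR_diff_left)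
  also have "norm ... \<le> (\<Sum>b\<in>basis. norm (dual b))"
   by (rule sum_norm_le) (simp add: mult_left_le_one_le frac_ge_0 less_imp_le[OF frac_lt_1])
  finally show ?thesis .
 qed
 ultimately show ?thesis by (rule that)
qed

text \<open>The phases of \<open>\<rho>\<close> on the dual basis are, up to 2 pi, the coordinates
  of \<open>x\<close> in \<open>basis\<close>; multiplicativity extends the formula to all integral
  combinations.\<close>

lemma dual_lattice_character:
 assumes hom: "\<And>xi xi'. xi \<in> dual_lattice La ==> xi' \<in> dual_lattice La ==> \<rho> (xi + xi') = \<rho> xi * \<rho> xi'"
  and norm1: "\<And>xi. xi \<in> dual_lattice La ==> cmod (\<rho> xi) = 1"
 obtains x where "x \<in> span La" "\<And>xi. xi \<in> dual_lattice La ==> \<rho> xi = cis (x \<bullet> xi)"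
proof -
 interpret D: discrete_subgroup "dual_lattice La" by (rule discrete_subgroup_dual)
 have "\<rho> 0 = \<rho> 0 * \<rho> 0" using hom[OF D.zero_mem D.zero_mem] by simp
 hence \<rho>0: "\<rho> 0 = 1" using norm1[OF D.zero_mem] by auto
 define \<alpha> where "\<alpha> b = Arg (\<rho> (dual b))" for b
 have \<alpha>: "\<rho> (dual b) = cis (\<alpha> b)" if "b \<in> basis" for b
 proof -
  have "\<rho> (dual b) \<noteq> 0" using norm1[OF dual_in_lattice[OF that]] by auto
  thus ?thesis
   using cis_Arg[of "\<rho> (dual b)"] norm1[OF dual_in_lattice[OF that]] by (simp add: \<alpha>_def sgn_div_norm)
 qed
 define x where "x = (\<Sum>b\<in>basis. (\<alpha> b / (2 * pi)) *\<^sub>R b)"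
 have x_dual: "x \<bullet> dual b = \<alpha> b" if "b \<in> basis" for b
 proof -
  have "x \<bullet> dual b = (\<Sum>b'\<in>basis. if b' = b then \<alpha> b else 0)"
   unfolding x_def inner_sum_left by (rule sum.cong) (auto simp: inner_commute[of _ "dual b"] inner_dual that)
  thus ?thesis using that finite_basis by simp
 qed
 define good where "good xi \<longleftrightarrow> xi \<in> dual_lattice La \<and> \<rho> xi = cis (x \<bullet> xi)" for xi
 have g0: "good 0" by (simp add: good_def \<rho>0 D.zero_mem)
 have gadd: "good (xi + xi')" if "good xi" "good xi'" for xi xi'
  using that by (simp add: good_def hom D.add_mem inner_add_right cis_mult)
 have gneg: "good (- xi)" if "good xi" for xi
 proof -
  have "1 = cis (x \<bullet> xi) * \<rho> (- xi)"
   using that hom[of xi "- xi"] by (simp add: good_def \<rho>0 D.uminus_mem)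
  hence "cis (- (x \<bullet> xi)) * 1 = cis (- (x \<bullet> xi)) * (cis (x \<bullet> xi) * \<rho> (- xi))" by (rule arg_cong)
  thus ?thesis using that by (simp add: good_def D.uminus_mem mult.assoc[symmetric] cis_mult)
 qed
 have gnat: "good (of_nat n *\<^sub>R xi)" if "good xi" for n xi
  by (induction n) (simp_all add: g0 gadd that scaleR_add_left)
 have gint: "good (of_int n *\<^sub>R xi)" if "good xi" for n xi
 proof (cases n rule: int_diff_cases)
  case (diff p q)
  thus ?thesis
   using gadd[OF gnat[OF that, of p] gneg[OF gnat[OF that, of q]]] by (simp add: scaleR_diff_left)
 qed
 have gsum: "good (\<Sum>b\<in>I. f b)" if "\<And>b. b \<in> I ==> good (f b)" for I :: "'q set" and f
  using that by (induction I rule: infinite_finite_induct) (simp_all add: g0 gadd)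
 have "\<rho> xi = cis (x \<bullet> xi)" if xi: "xi \<in> dual_lattice La" for xi
 proof -
  have "\<forall>b\<in>basis. \<exists>m::int. xi \<bullet> b = 2 * pi * of_int m"
   using xi by (simp add: dual_lattice_eq periods_iff)
  then obtain m :: "'q => int" where m: "\<And>b. b \<in> basis ==> xi \<bullet> b = 2 * pi * of_int (m b)" by metis
  have "xi = proj xi" using xi by (simp add: proj_of_span dual_lattice_eq)
  also have "... = (\<Sum>b\<in>basis. of_int (m b) *\<^sub>R dual b)"
   unfolding proj_def by (rule sum.cong) (simp_all add: m)
  finally have e: "xi = (\<Sum>b\<in>basis. of_int (m b) *\<^sub>R dual b)" .
  have "good (dual b)" if "b \<in> basis" for b
   using that by (simp add: good_def dual_in_lattice \<alpha> x_dual)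
  hence "good xi" unfolding e by (intro gsum gint)
  thus ?thesis by (simp add: good_def)
 qed
 moreover have "x \<in> span La"
  unfolding x_def by (intro span_sum span_scale span_base) (use basis_mem in auto)
 ultimately show thesis using that by blast
qed

text \<open>Integral coordinates map the lattice into a power of the integers, where the weight is
  dominated by a product of one-dimensional weights. The exponent \<open>t\<close> is shared equally
  among the coordinates, and each share exceeds 1/2, the threshold in dimension one.\<close>

lemma summable_lattice_powr:
 assumes t: "real (dim La) / 2 < t"
 shows "(%l. (1 + (norm l)^2) powr (- t)) summable_on La"
proof (cases "basis = {}")
 case True
 hence "La = {0}" using integral_combination zero_mem by fastforce
 thus ?thesis by simp
next
 case False
 define r where "r = real (card basis)"
 have r: "r > 0" using False finite_basis by (simp add: r_def card_gt_0_iff)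
 define a where "a = t / r"
 have a: "a > 1 / 2" using t r by (simp add: a_def card_basis r_def field_simps)
 define f where "f n = (1 + (of_int n)\<^sup>2 :: real) powr (- a)" for n :: int
 have f_nonneg: "f n \<ge> 0" for n by (simp add: f_def)
 have "f summable_on UNIV"
 proof -
  have nat: "(%n::nat. (1 + (real n)^2) powr (- a)) summable_on UNIV"
  proof (rule summable_nonneg_imp_summable_on)
   have "summable (%n::nat. real n powr (- 2 * a))" using a by (simp add: summable_real_powr_iff)
   thus "summable (%n::nat. (1 + (real n)^2) powr (- a))"
   proof (rule summable_comparison_test_ev[rotated])
    have "norm ((1 + (real n)^2) powr (- a)) \<le> real n powr (- 2 * a)" if "n \<ge> 1" for n :: nat
    proof -
     have "(1 + (real n)^2) powr (- a) \<le> ((real n)^2) powr (- a)"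
      using that a by (intro powr_mono2') auto
     also have "... = (real n powr 2) powr (- a)" using that by simp
     also have "... = real n powr (- 2 * a)" unfolding powr_powr by simp
     finally show ?thesis by simp
    qed
    thus "\<forall>\<^sub>F n in sequentially. norm ((1 + (real n)^2) powr (- a)) \<le> real n powr (- 2 * a)"
     by (auto simp: eventually_at_top_linorder)
   qed
  qed simp
  have "(f \<circ> int) summable_on UNIV" "(f \<circ> (%n. - int n)) summable_on UNIV"
   using nat by (simp_all add: f_def comp_def)
  hence "f summable_on range int" "f summable_on range (%n. - int n)"
   by (simp_all add: summable_on_reindex inj_on_def)
  moreover from this(2) have "f summable_on (range (%n. - int n) - range int)"
   by (rule summable_on_subset_banach) blast
  ultimately have "f summable_on range int \<union> (range (%n. - int n) - range int)"
   by (intro summable_on_Un_disjoint) blast+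
  moreover have "x \<in> range int \<union> range (%n. - int n)" for x
   by (cases x rule: int_cases2) auto
  hence "range int \<union> (range (%n. - int n) - range int) = UNIV" by blast
  ultimately show ?thesis by simp
 qed
 then obtain C where C: "\<And>F. finite F ==> sum f F \<le> C"
  using finite_sum_le_infsum[of f UNIV] by (force simp: f_def)
 have C0: "C \<ge> 0" using C[of "{}"] by simp
 \<comment> \<open>Cauchy-Schwarz against a dual vector bounds the coordinate \<open>n l b\<close>
   by \<open>norm l\<close> times \<open>M / (2 * pi)\<close>. The summand 2 pi ensures
   \<open>c \<le> 1\<close>, so that the constant term of the weight is covered as well.\<close>
 define M where "M = (\<Sum>b\<in>basis. norm (dual b)) + 2 * pi"
 have M: "M \<ge> 2 * pi" "M > 0" by (auto simp: M_def sum_nonneg add_nonneg_pos)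
 define n where "n l b = (SOME m::int. l \<bullet> dual b = 2 * pi * of_int m)" for l b
 have n: "l \<bullet> dual b = 2 * pi * of_int (n l b)" if "l \<in> La" "b \<in> basis" for l b
 proof -
  have "\<exists>m::int. l \<bullet> dual b = 2 * pi * of_int m"
   using dual_in_lattice[OF that(2)] that(1) by (auto simp: dual_lattice_def inner_commute)
  from someI_ex[OF this] show ?thesis by (simp add: n_def)
 qed
 have expand: "l = (\<Sum>b\<in>basis. of_int (n l b) *\<^sub>R b)" if "l \<in> La" for l
 proof -
  obtain m :: "'q => int" where m: "l = (\<Sum>b\<in>basis. of_int (m b) *\<^sub>R b)" using integral_combination[OF \<open>l \<in> La\<close>] by blast
  have "m b = n l b" if "b \<in> basis" for b
  proof -
   have "l \<bullet> dual b = (\<Sum>b'\<in>basis. if b' = b then 2 * pi * of_int (m b) else 0)"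
    unfolding m inner_sum_left by (rule sum.cong) (auto simp: inner_commute[of _ "dual b"] inner_dual that)
   thus ?thesis using n[OF \<open>l \<in> La\<close> that] that finite_basis by simp
  qed
  thus ?thesis using m by (metis (mono_tags, lifting) sum.cong)
 qed
 define c where "c = (2 * pi / M)^2"
 have c: "0 < c" "c \<le> 1" using M by (auto simp: c_def power_le_one)
 have bound: "(1 + (norm l)^2) powr (- t) \<le> c powr (- t) * (\<Prod>b\<in>basis. f (n l b))" if l: "l \<in> La" for l
 proof -
  have "c * (1 + (of_int (n l b))^2) \<le> 1 + (norm l)^2" if b: "b \<in> basis" for b
  proof -
   have "norm (dual b) \<le> (\<Sum>b\<in>basis. norm (dual b))" by (rule member_le_sum) (use b finite_basis in auto)
   hence "norm (dual b) \<le> M" using pi_gt_zero unfolding M_def by linarith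
   hence "\<bar>l \<bullet> dual b\<bar> \<le> norm l * M"
    using Cauchy_Schwarz_ineq2[of l "dual b"] mult_left_mono[of "norm (dual b)" M "norm l"] by simp
   hence "(2 * pi / M) * \<bar>of_int (n l b)\<bar> \<le> norm l"
    using M by (simp add: n[OF l b] abs_mult field_simps)
   hence "((2 * pi / M) * \<bar>of_int (n l b)\<bar>)^2 \<le> (norm l)^2"
    using M by (intro power_mono) auto
   hence "c * (of_int (n l b))^2 \<le> (norm l)^2" by (simp add: c_def power_mult_distrib power_divide)
   thus ?thesis using c by (simp add: algebra_simps)
  qed
  hence *: "(1 + (norm l)^2) powr (- a) \<le> c powr (- a) * f (n l b)" if "b \<in> basis" for b
   using powr_mono2'[of "- a" "c * (1 + (of_int (n l b))^2)" "1 + (norm l)^2"] a c that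
   by (simp add: f_def powr_mult add_pos_nonneg)
  have "real (card basis) * (- a) = - t" using r by (simp add: a_def r_def)
  hence pw: "X powr (- t) = (X powr (- a)) ^ card basis" if "X > 0" for X :: real
   using that by (simp only: powr_power)
  have "1 + (norm l)\<^sup>2 > 0" by (simp add: add_pos_nonneg)
  from pw[OF this] have "(1 + (norm l)^2) powr (- t) = (\<Prod>b\<in>basis. (1 + (norm l)^2) powr (- a))"
   by simp
  also have "... \<le> (\<Prod>b\<in>basis. c powr (- a) * f (n l b))" by (rule prod_mono) (use * in auto)
  also have "... = c powr (- t) * (\<Prod>b\<in>basis. f (n l b))"
   using pw[OF c(1)] by (simp add: prod.distrib)
  finally show ?thesis .
 qed
 show ?thesis
 proof (rule nonneg_bdd_above_summable_on)
  show "bdd_above (sum (%l. (1 + (norm l)^2) powr - t) ` {F. F \<subseteq> La \<and> finite F})"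
  proof (rule bdd_aboveI, clarify)
   fix F assume F: "F \<subseteq> La" "finite F"
   define G where "G = (\<Union>l\<in>F. n l ` basis)"
   have fG: "finite G" using F finite_basis by (simp add: G_def)
   define \<nu> where "\<nu> l = restrict (n l) basis" for l
   have inj: "inj_on \<nu> F"
   proof (rule inj_onI)
    fix l l' assume ll: "l \<in> F" "l' \<in> F" "\<nu> l = \<nu> l'"
    have "n l b = n l' b" if "b \<in> basis" for b
     using fun_cong[OF ll(3), of b] that by (simp add: \<nu>_def)
    hence "(\<Sum>b\<in>basis. of_int (n l b) *\<^sub>R b) = (\<Sum>b\<in>basis. of_int (n l' b) *\<^sub>R b)" by simp
    moreover have "l \<in> La" "l' \<in> La" using ll F by auto
    ultimately show "l = l'" using expand by metis
   qed
   have sub: "\<nu> ` F \<subseteq> PiE basis (%_. G)" by (auto simp: \<nu>_def G_def)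
   have "(\<Sum>l\<in>F. (1 + (norm l)^2) powr - t) \<le> (\<Sum>l\<in>F. c powr (- t) * (\<Prod>b\<in>basis. f (\<nu> l b)))"
   proof (rule sum_mono)
    fix l assume "l \<in> F"
    thus "(1 + (norm l)^2) powr - t \<le> c powr (- t) * (\<Prod>b\<in>basis. f (\<nu> l b))"
     using bound[of l] F by (auto simp: \<nu>_def)
   qed
   also have "... = c powr (- t) * (\<Sum>g\<in>\<nu> ` F. \<Prod>b\<in>basis. f (g b))"
    by (simp add: sum_distrib_left sum.reindex[OF inj])
   also have "... \<le> c powr (- t) * (\<Sum>g\<in>PiE basis (%_. G). \<Prod>b\<in>basis. f (g b))"
    by (intro mult_left_mono sum_mono2 sub finite_PiE) (auto simp: finite_basis fG f_nonneg prod_nonneg)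
   also have "... = c powr (- t) * (\<Prod>b\<in>basis. sum f G)"
    using prod_sum_PiE[OF finite_basis, of "%_. G" "%_. f"] fG by simp
   also have "... \<le> c powr (- t) * (\<Prod>b\<in>basis. C)"
    by (intro mult_left_mono prod_mono) (auto simp: C fG f_nonneg sum_nonneg)
   finally show "(\<Sum>l\<in>F. (1 + (norm l)^2) powr - t) \<le> c powr (- t) * (\<Prod>b\<in>basis. C)" .
  qed
 qed simp
qed

end

section \<open>Averages over the dual torus\<close>

lemma hyperplane_null_lborel: "a \<noteq> 0 ==> {x. a \<bullet> x = b} \<in> null_sets (lborel :: 'a::euclidean_space measure)"
proof -
 assume "a \<noteq> 0"
 hence "{x. a \<bullet> x = b} \<in> null_sets lebesgue"
  using negligible_hyperplane[of a b] by (simp add: negligible_iff_null_sets)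
 moreover have "{x. a \<bullet> x = b} \<in> sets lborel" using closed_hyperplane by auto
 ultimately show ?thesis using null_sets_completion_iff[of "{x. a \<bullet> x = b}" lborel] by simp
qed

context discrete_subgroup begin

text \<open>To be at least as close to 0 as to \<open>xi\<close> is a half-space condition that sees
  only the projection. In this form the cell is visibly closed, and overlaps of its translates lie
  in hyperplanes.\<close>

lemma dirichlet_domain_iff:
 "th \<in> dirichlet_domain La \<longleftrightarrow>
  norm (th - proj th) \<le> 1 \<and> (\<forall>xi\<in>dual_lattice La. 2 * (th \<bullet> xi) \<le> (norm xi)^2)"
proof -
 have *: "norm u \<le> norm (u - xi) \<longleftrightarrow> 2 * (u \<bullet> xi) \<le> (norm xi)^2" for u xi :: 'q
  unfolding norm_le power2_norm_eq_inner by (simp add: inner_diff inner_commute algebra_simps)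
 have **: "proj th \<bullet> xi = th \<bullet> xi" if "xi \<in> dual_lattice La" for xi
  using that inner_proj by (simp add: dual_lattice_eq)
 show ?thesis
 proof
  assume "th \<in> dirichlet_domain La"
  then obtain u w where uw: "th = u + w" "u \<in> span La" "\<forall>xi\<in>dual_lattice La. norm u \<le> norm (u - xi)"
   "w \<in> orthogonal_comp (span La)" "norm w \<le> 1"
   unfolding dirichlet_domain_def by auto
  have "proj th = u" using uw by (intro proj_eqI) auto
  thus "norm (th - proj th) \<le> 1 \<and> (\<forall>xi\<in>dual_lattice La. 2 * (th \<bullet> xi) \<le> (norm xi)^2)"
   using uw(1,3,5) ** by (auto simp: *)
 next
  assume "norm (th - proj th) \<le> 1 \<and> (\<forall>xi\<in>dual_lattice La. 2 * (th \<bullet> xi) \<le> (norm xi)^2)"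
  thus "th \<in> dirichlet_domain La"
   unfolding dirichlet_domain_def
   by (intro CollectI exI[of _ "proj th"] exI[of _ "th - proj th"])
    (simp add: proj_span proj_perp * **)
 qed
qed

lemma continuous_on_proj: "continuous_on S proj"
 using linear_proj by (simp add: linear_continuous_on linear_linear)

lemma compact_dirichlet_domain: "compact (dirichlet_domain La)"
proof -
 have "dirichlet_domain La = {th. norm (th - proj th) \<le> 1} \<inter>
   (\<Inter>xi\<in>dual_lattice La. {th. 2 * (th \<bullet> xi) \<le> (norm xi)\<^sup>2})"
  by (auto simp: dirichlet_domain_iff)
 hence "closed (dirichlet_domain La)"
  by (auto intro!: closed_Int closed_INT closed_Collect_le continuous_intros continuous_on_proj)
 moreover have "norm th \<le> (\<Sum>b\<in>basis. norm (dual b)) + 1" if th: "th \<in> dirichlet_domain La" for th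
 proof -
  obtain u w where uw: "th = u + w" "u \<in> span La" "\<forall>xi\<in>dual_lattice La. norm u \<le> norm (u - xi)"
   "norm w \<le> 1"
   using th unfolding dirichlet_domain_def by auto
  obtain xi where "xi \<in> dual_lattice La" "norm (u - xi) \<le> (\<Sum>b\<in>basis. norm (dual b))"
   using dual_reduce[OF uw(2)] by blast
  hence "norm u \<le> (\<Sum>b\<in>basis. norm (dual b))" using uw(3) by force
  thus ?thesis using uw(1,4) norm_triangle_ineq[of u w] by simp
 qed
 hence "bounded (dirichlet_domain La)" by (rule boundedI)
 ultimately show ?thesis by (simp add: compact_eq_bounded_closed)
qed

lemma dirichlet_domain_ball: obtains dl where "dl > 0" "ball 0 dl \<subseteq> dirichlet_domain La"
proof -
 interpret D: discrete_subgroup "dual_lattice La" by (rule discrete_subgroup_dual)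
 obtain eps where eps: "eps > 0" "\<And>xi. xi \<in> dual_lattice La ==> xi \<noteq> 0 ==> eps \<le> norm xi"
  using D.separated by blast
 have "th \<in> dirichlet_domain La" if th: "norm th < min 1 (eps / 2)" for th
  unfolding dirichlet_domain_iff
 proof (intro conjI ballI)
  have "(norm th)^2 = (norm (th - proj th))^2 + (norm (proj th))^2"
   using inner_perp[OF proj_perp proj_span, of th th]
   by (simp add: power2_norm_eq_inner inner_diff inner_commute algebra_simps)
  hence "(norm (th - proj th))^2 \<le> (norm th)^2" by simp
  thus "norm (th - proj th) \<le> 1" using th power2_le_imp_le[of "norm (th - proj th)" "norm th"] by simp
  show "2 * (th \<bullet> xi) \<le> (norm xi)^2" if "xi \<in> dual_lattice La" for xi
  proof (cases "xi = 0")
   case False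
   have "2 * (th \<bullet> xi) \<le> 2 * norm th * norm xi" using norm_cauchy_schwarz[of th xi] by simp
   also have "... \<le> norm xi * norm xi" using eps(2)[OF that False] th by (intro mult_right_mono) auto
   finally show ?thesis by (simp add: power2_eq_square)
  qed simp
 qed
 thus ?thesis using eps(1) by (intro that[of "min 1 (eps / 2)"]) auto
qed

lemma dirichlet_domain_covers:
 assumes "a \<in> span La" "norm (th - proj th) \<le> 1"
 obtains xi where "xi \<in> dual_lattice La" "th - a - xi \<in> dirichlet_domain La"
proof -
 interpret D: discrete_subgroup "dual_lattice La" by (rule discrete_subgroup_dual)
 define u where "u = proj th - a"
 obtain xi where xi: "xi \<in> dual_lattice La" "\<And>xi'. xi' \<in> dual_lattice La ==> norm (u - xi) \<le> norm (u - xi')"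
  using nearest_dual_lattice[of u] by blast
 have "norm (u - xi) \<le> norm (u - xi - et)" if "et \<in> dual_lattice La" for et
  using xi(2)[of "xi + et"] D.add_mem[OF xi(1) that] by (simp add: diff_diff_eq)
 moreover have "u - xi \<in> span La"
  using assms(1) xi(1) proj_span by (auto simp: u_def dual_lattice_eq intro!: span_diff)
 moreover have "th - a - xi = (u - xi) + (th - proj th)" by (simp add: u_def)
 ultimately have "th - a - xi \<in> dirichlet_domain La"
  unfolding dirichlet_domain_def using assms(2) proj_perp by blast
 thus ?thesis using xi(1) that by blast
qed

text \<open>A point in two translates of the cell is equidistant from two lattice points, hence lies
  on one of countably many hyperplanes.\<close>

lemma AE_dirichlet_domain_unique:
 "AE th in lborel. \<forall>xi\<in>dual_lattice La. \<forall>xi'\<in>dual_lattice La.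
  th - a - xi \<in> dirichlet_domain La \<and> th - a - xi' \<in> dirichlet_domain La \<longrightarrow> xi = xi'"
proof -
 interpret D: discrete_subgroup "dual_lattice La" by (rule discrete_subgroup_dual)
 have "AE th in lborel. xi \<noteq> xi' \<longrightarrow> (xi - xi') \<bullet> th \<noteq> (norm (xi - xi'))\<^sup>2 / 2 + (xi - xi') \<bullet> (a + xi')" for xi xi'
 proof (cases "xi = xi'")
  case False
  thus ?thesis
   using AE_not_in[OF hyperplane_null_lborel[of "xi - xi'" "(norm (xi - xi'))^2 / 2 + (xi - xi') \<bullet> (a + xi')"]]
   by simp
 qed simp
 hence "AE th in lborel. \<forall>xi\<in>dual_lattice La. \<forall>xi'\<in>dual_lattice La.
   xi \<noteq> xi' \<longrightarrow> (xi - xi') \<bullet> th \<noteq> (norm (xi - xi'))\<^sup>2 / 2 + (xi - xi') \<bullet> (a + xi')"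
  by (simp add: AE_ball_countable D.countable_mem)
 thus ?thesis
 proof eventually_elim
  case (elim th)
  show ?case
  proof (intro ballI impI, elim conjE, rule ccontr)
   fix xi xi' assume xi: "xi \<in> dual_lattice La" "xi' \<in> dual_lattice La" "xi \<noteq> xi'"
    "th - a - xi \<in> dirichlet_domain La" "th - a - xi' \<in> dirichlet_domain La"
   have "2 * ((th - a - xi') \<bullet> (xi - xi')) \<le> (norm (xi - xi'))^2"
    using xi D.diff_mem unfolding dirichlet_domain_iff by blast
   moreover have "2 * ((th - a - xi) \<bullet> (xi' - xi)) \<le> (norm (xi' - xi))^2"
    using xi D.diff_mem unfolding dirichlet_domain_iff by blast
   moreover have "(th - a - xi) \<bullet> (xi' - xi) = (norm (xi - xi'))^2 - (th - a - xi') \<bullet> (xi - xi')"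
    by (simp add: power2_norm_eq_inner inner_diff inner_commute algebra_simps)
   moreover have "(th - a - xi') \<bullet> (xi - xi') = (xi - xi') \<bullet> th - (xi - xi') \<bullet> (a + xi')"
    by (simp add: inner_diff inner_add inner_commute algebra_simps)
   ultimately have "(xi - xi') \<bullet> th = (norm (xi - xi'))^2 / 2 + (xi - xi') \<bullet> (a + xi')"
    by (simp add: norm_minus_commute)
   thus False using elim xi by blast
  qed
 qed
qed

definition tcont :: "('q => 'b::topological_space) => bool" where
 "tcont f \<longleftrightarrow> torus_fun La f \<and> continuous_on UNIV f"

lemma tcontD:
 "tcont f ==> kp \<in> periods ==> f (th + kp) = f th"
 "tcont f ==> continuous_on S f"
 by (auto simp: tcont_def torus_funD intro: continuous_on_subset)

lemma tcontI:
 "(\<And>th kp. kp \<in> periods ==> f (th + kp) = f th) ==> continuous_on UNIV f ==> tcont f"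
 by (simp add: tcont_def torus_fun_iff)

lemma tcont_const: "tcont (%_. c)"
 by (simp add: tcontI)

lemma tcont_compose:
 "tcont f ==> continuous_on UNIV h ==> tcont (%th. h (f th))"
 using continuous_on_compose2[of UNIV h UNIV f] by (simp add: tcont_def torus_fun_iff)

lemma tcont_shift: "tcont f ==> tcont (%th. f (th + c))"
proof (rule tcontI)
 fix th kp assume "tcont f" "kp \<in> periods"
 thus "f (th + kp + c) = f (th + c)"
  using tcontD(1)[of f kp "th + c"] by (simp add: ac_simps)
next
 assume "tcont f"
 thus "continuous_on UNIV (%th. f (th + c))"
  by (intro continuous_on_compose2[OF tcontD(2)[of f UNIV]] continuous_intros) auto
qed

text \<open>Every point is equivalent to one in a fixed ball, which lends the compactness of the
  torus to periodic functions on \<open>Q\<close>.\<close>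

lemma reduce_periods:
 obtains kp where "kp \<in> periods" "norm (th - kp) \<le> (\<Sum>b\<in>basis. norm (dual b))"
proof -
 obtain xi where xi: "xi \<in> dual_lattice La" "norm (proj th - xi) \<le> (\<Sum>b\<in>basis. norm (dual b))"
  using dual_reduce[OF proj_span] by blast
 have "xi + (th - proj th) \<in> periods"
  using xi(1) by (intro add_periods[OF _ perp_periods[OF proj_perp]]) (simp add: dual_lattice_eq)
 moreover have "th - (xi + (th - proj th)) = proj th - xi" by simp
 ultimately show ?thesis using that xi(2) by metis
qed

lemma tcont_uniformly_continuous:
 fixes f :: "'q => 'b::metric_space"
 assumes "tcont f" shows "uniformly_continuous_on UNIV f"
proof -
 define R where "R = (\<Sum>b\<in>basis. norm (dual b))"
 have "uniformly_continuous_on (cball 0 (R + 1)) f"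
  by (intro compact_uniformly_continuous tcontD(2) assms) simp
 show ?thesis unfolding uniformly_continuous_on_def
 proof (intro allI impI)
  fix eps :: real assume "eps > 0"
  then obtain dl where dl: "dl > 0" "\<And>x y. x \<in> cball 0 (R + 1) ==> y \<in> cball 0 (R + 1) ==>
    dist y x < dl ==> dist (f y) (f x) < eps"
   using \<open>uniformly_continuous_on (cball 0 (R + 1)) f\<close> unfolding uniformly_continuous_on_def by metis
  have "dist (f y) (f x) < eps" if d: "dist y x < min dl 1" for x y
  proof -
   obtain kp where kp: "kp \<in> periods" "norm (x - kp) \<le> R"
    unfolding R_def using reduce_periods[of x] by blast
   have "norm (y - kp) \<le> norm (x - kp) + norm (y - x)"
    using norm_triangle_ineq[of "x - kp" "y - x"] by (simp add: algebra_simps)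
   hence "norm (y - kp) \<le> R + 1" using kp(2) d by (simp add: dist_norm)
   hence "dist (f (y - kp)) (f (x - kp)) < eps"
    using kp(2) d by (intro dl(2)) (auto simp: dist_norm norm_minus_commute)
   thus ?thesis
    using tcontD(1)[OF assms kp(1), of "y - kp"] tcontD(1)[OF assms kp(1), of "x - kp"] by simp
  qed
  thus "\<exists>dl>0. \<forall>x\<in>UNIV. \<forall>y\<in>UNIV. dist y x < dl \<longrightarrow> dist (f y) (f x) < eps"
   using dl(1) by (intro exI[of _ "min dl 1"]) auto
 qed
qed

lemma tcont_bounded:
 fixes f :: "'q => 'b::real_normed_vector"
 assumes "tcont f" obtains M where "M \<ge> 0" "\<And>th. norm (f th) \<le> M"
proof -
 define R where "R = (\<Sum>b\<in>basis. norm (dual b))"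
 have "compact (f ` cball 0 R)" by (intro compact_continuous_image tcontD(2) assms compact_cball)
 from compact_imp_bounded[OF this] obtain M where M: "\<And>th. norm th \<le> R ==> norm (f th) \<le> M"
  unfolding bounded_iff by (metis imageI mem_cball_0)
 have b: "norm (f th) \<le> M" for th
 proof -
  obtain kp where "kp \<in> periods" "norm (th - kp) \<le> R" unfolding R_def using reduce_periods[of th] by blast
  thus ?thesis using M[of "th - kp"] tcontD(1)[OF assms, of kp "th - kp"] by simp
 qed
 thus ?thesis using that[of M] order_trans[OF norm_ge_zero b] by blast
qed

text \<open>Normalised so that constants are their own averages. The factor
  \<open>torus_vol La\<close> relating it to \<open>torus_integral\<close> is positive, so equations
  such as vanishing moment maps transfer.\<close>

definition avg :: "('q => 'b::{banach,second_countable_topology}) => 'b" where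
 "avg f = (1 / torus_vol La) *\<^sub>R torus_integral La f"

lemma integrable_dirichlet:
 fixes f :: "'q => 'b::{banach,second_countable_topology}"
 assumes "tcont f" shows "set_integrable lborel (dirichlet_domain La) f"
 unfolding set_integrable_def
 using assms by (intro borel_integrable_compact compact_dirichlet_domain tcontD(2))

lemma dim_le_DIM: "dim La \<le> DIM('q)" by (rule dim_subset_UNIV)

lemma unit_ball_factor_pos: "1 / unit_ball_vol (real (DIM('q)) - real (dim La)) > 0"
 using dim_le_DIM by (simp add: unit_ball_vol_pos)

lemma measure_dirichlet_ball:
 assumes "dl > 0" shows "measure lborel (ball (0 :: 'q) dl) > 0"
 using content_ball_pos[OF assms, of "0 :: 'q"] by (simp add: measure_completion)

lemma torus_vol_pos: "torus_vol La > 0"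
proof -
 obtain dl where dl: "dl > 0" "ball 0 dl \<subseteq> dirichlet_domain La" by (rule dirichlet_domain_ball)
 have fin: "emeasure lborel (dirichlet_domain La) < \<infinity>"
  using compact_dirichlet_domain by (rule emeasure_compact_finite)
 have "measure lborel (ball (0 :: 'q) dl) \<le> measure lborel (dirichlet_domain La)"
  using dl(2) fin compact_dirichlet_domain
  by (intro measure_mono_fmeasurable) (auto simp: fmeasurable_def compact_imp_closed)
 with measure_dirichlet_ball[OF dl(1)] have "measure lborel (dirichlet_domain La) > 0"
  by (rule less_le_trans)
 thus ?thesis
  using unit_ball_factor_pos fin unfolding torus_vol_def torus_integral_def set_lebesgue_integral_def by simp
qed

lemma torus_integral_add:
 "tcont f ==> tcont g ==>
  torus_integral La (%th. f th + g th) = torus_integral La f + torus_integral La g"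
 by (simp add: torus_integral_def set_integral_add integrable_dirichlet scaleR_add_right)

lemma torus_integral_bounded_linear:
 assumes "bounded_linear T" "tcont f"
 shows "torus_integral La (%th. T (f th)) = T (torus_integral La f)"
proof -
 interpret T: bounded_linear T by fact
 show ?thesis
  using integral_bounded_linear[OF assms(1) integrable_dirichlet[OF assms(2), unfolded set_integrable_def]]
  by (simp add: torus_integral_def set_lebesgue_integral_def T.scaleR)
qed

lemma avg_const: "avg (%_. c) = c"
proof -
 have "torus_integral La (%_. c) = torus_vol La *\<^sub>R c"
  using torus_integral_bounded_linear[OF bounded_linear_scaleR_left tcont_const[of "1 :: real"]]
  by (simp add: torus_vol_def)
 thus ?thesis using torus_vol_pos by (simp add: avg_def)
qed

lemma avg_add: "tcont f ==> tcont g ==> avg (%th. f th + g th) = avg f + avg g"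
 by (simp add: avg_def torus_integral_add scaleR_add_right)

lemma avg_bounded_linear:
 assumes "bounded_linear T" "tcont f" shows "avg (%th. T (f th)) = T (avg f)"
 using torus_integral_bounded_linear[OF assms] by (simp add: avg_def linear_simps(5)[OF assms(1)])

lemma tcont_bounded_linear:
 "bounded_linear T ==> tcont f ==> tcont (%th. T (f th))"
 using tcont_compose linear_continuous_on by blast

lemma tcont_add: "tcont f ==> tcont g ==> tcont (%th. f th + g th :: 'b::real_normed_vector)"
 and tcont_diff: "tcont f ==> tcont g ==> tcont (%th. f th - g th :: 'b::real_normed_vector)"
 and tcont_mult: "tcont p ==> tcont q ==> tcont (%th. p th * q th :: 'c::real_normed_algebra)"
 and tcont_scaleR: "tcont r ==> tcont f ==> tcont (%th. r th *\<^sub>R f th :: 'b::real_normed_vector)"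
 by (auto simp: tcont_def torus_fun_iff intro!: continuous_intros)

lemma tcont_uminus: "tcont f ==> tcont (%th. - f th :: 'b::real_normed_vector)"
 and tcont_norm: "tcont f ==> tcont (%th. norm (f th :: 'b::real_normed_vector))"
 and tcont_power: "tcont p ==> tcont (%th. p th ^ n :: 'c::real_normed_algebra_1)"
 and tcont_cnj: "tcont z ==> tcont (%th. cnj (z th))"
 by (auto simp: tcont_def torus_fun_iff intro!: continuous_intros continuous_on_power')

lemma tcont_sum:
 "(\<And>i. i \<in> I ==> tcont (f i)) ==> tcont (%th. \<Sum>i\<in>I. f i th :: 'b::real_normed_vector)"
 by (induction I rule: infinite_finite_induct) (auto intro: tcont_add tcont_const)

lemma avg_scaleR: "tcont f ==> avg (%th. r *\<^sub>R f th) = r *\<^sub>R avg f"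
 by (rule avg_bounded_linear[OF bounded_linear_scaleR_right])

lemma avg_uminus: "tcont f ==> avg (%th. - f th) = - avg f"
 using avg_scaleR[of f "- 1"] by simp

lemma avg_diff: "tcont f ==> tcont g ==> avg (%th. f th - g th) = avg f - avg g"
 using avg_add[of f "%th. - g th"] by (simp add: avg_uminus tcont_uminus)

lemma avg_mult: "tcont f ==> avg (%th. c * f th) = c * avg (f :: 'q => complex)"
 by (rule avg_bounded_linear[OF bounded_linear_mult_right])

lemma avg_sum: "(\<And>i. i \<in> I ==> tcont (f i)) ==> avg (%th. \<Sum>i\<in>I. f i th) = (\<Sum>i\<in>I. avg (f i))"
 by (induction I rule: infinite_finite_induct) (simp_all add: avg_const avg_add tcont_sum)

lemma avg_mono:
 fixes f g :: "'q => real"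
 assumes "tcont f" "tcont g" "\<And>th. f th \<le> g th" shows "avg f \<le> avg g"
 unfolding avg_def torus_integral_def
 using torus_vol_pos unit_ball_factor_pos
 by (intro scaleR_left_mono set_integral_mono integrable_dirichlet assms) auto

lemma norm_avg_le_avg: 
 fixes f :: "'q => 'b::{banach,second_countable_topology}"
 assumes "tcont f" shows "norm (avg f) \<le> avg (%th. norm (f th))"
proof -
 have "norm (LINT th:dirichlet_domain La|lborel. f th) \<le> (LINT th:dirichlet_domain La|lborel. norm (f th))"
  using set_integral_norm_bound[OF integrable_dirichlet[OF assms]] .
 thus ?thesis
  using torus_vol_pos unit_ball_factor_pos
  by (simp add: avg_def torus_integral_def divide_right_mono)
qed

lemma norm_avg_le:
 fixes f :: "'q => 'b::{banach,second_countable_topology}"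
 assumes "tcont f" "\<And>th. norm (f th) \<le> B" shows "norm (avg f) \<le> B"
 using norm_avg_le_avg[OF assms(1)] avg_mono[OF tcont_norm[OF assms(1)] tcont_const assms(2)]
 by (simp add: avg_const)

text \<open>The cell and its translate by \<open>c\<close> are both fundamental domains. Each is cut
  into pieces by the dual lattice translates of the other, and corresponding pieces differ by
  periods, over which \<open>f\<close> has the same integral.\<close>

lemma avg_shift_span:
 fixes f :: "'q => 'b::{banach,second_countable_topology}"
 assumes f: "tcont f" and c: "c \<in> span La"
 shows "torus_integral La (%th. f (th + c)) = torus_integral La f"
proof -
 interpret D: discrete_subgroup "dual_lattice La" by (rule discrete_subgroup_dual)
 let ?D = "dirichlet_domain La"
 have shift: "(LINT th|lborel. g (th + a)) = (LINT th|lborel. g th)"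
  if "g \<in> borel_measurable borel" for g :: "'q => 'b" and a
  using integral_distr[of "(+) a" lborel borel g] that by (simp add: lborel_distr_plus add.commute)
 define A where "A a xi = (%th. th + (a + xi)) ` ?D" for a xi
 have A_iff: "th \<in> A a xi \<longleftrightarrow> th - a - xi \<in> ?D" for th a xi
  by (force simp: A_def image_iff algebra_simps)
 have compact: "compact (A a xi)" for a xi
  unfolding A_def by (intro compact_continuous_image compact_dirichlet_domain continuous_intros)
 define J where "J K = (LINT th|lborel. indicator K th *\<^sub>R f th)" for K
 have J_int: "integrable lborel (%th. indicator K th *\<^sub>R f th)" if "compact K" for K
  using that f by (intro borel_integrable_compact tcontD(2))
 obtain R where R: "\<And>th. th \<in> ?D ==> norm th \<le> R"
  using compact_imp_bounded[OF compact_dirichlet_domain] unfolding bounded_iff by blast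
 \<comment> \<open>Only these translates can meet: the cell lies in a ball of radius
   \<open>R\<close>, and the centres \<open>a\<close> and \<open>b\<close> differ by at most
   \<open>norm c\<close>.\<close>
 define \<Xi> where "\<Xi> = {xi \<in> dual_lattice La. norm xi \<le> 2 * R + norm c}"
 have fin: "finite \<Xi>" by (rule D.finite_bounded_subset[of _ "2 * R + norm c"]) (simp add: \<Xi>_def)
 have decomp: "J (A a 0) = (\<Sum>xi\<in>\<Xi>. J (A a 0 \<inter> A b xi))"
  if a: "a \<in> span La" and b: "b \<in> span La" and ab: "norm (a - b) \<le> norm c" for a b
 proof -
  have "J (A a 0) = (LINT th|lborel. (\<Sum>xi\<in>\<Xi>. indicator (A a 0 \<inter> A b xi) th *\<^sub>R f th))"
   unfolding J_def
  proof (rule integral_cong_AE)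
   show "(%th. indicator (A a 0) th *\<^sub>R f th) \<in> borel_measurable lborel"
    using J_int[OF compact] by auto
   show "(%th. \<Sum>xi\<in>\<Xi>. indicator (A a 0 \<inter> A b xi) th *\<^sub>R f th) \<in> borel_measurable lborel"
    using J_int[OF compact_Int[OF compact compact]] by (intro borel_measurable_sum) auto
   show "AE th in lborel. indicator (A a 0) th *\<^sub>R f th = (\<Sum>xi\<in>\<Xi>. indicator (A a 0 \<inter> A b xi) th *\<^sub>R f th)"
    using AE_dirichlet_domain_unique[of b]
   proof eventually_elim
    case (elim th)
    show ?case
    proof (cases "th \<in> A a 0")
     case True
     hence th: "th - a \<in> ?D" by (simp add: A_iff)
     have pd: "proj (th - a) = proj th - a"
      using linear_proj a by (simp add: linear_diff proj_of_span)
     have "norm (th - proj th) \<le> 1" using th by (simp add: dirichlet_domain_iff pd)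
     then obtain xi where xi: "xi \<in> dual_lattice La" "th - b - xi \<in> ?D"
      using dirichlet_domain_covers[OF b] by blast
     have "norm xi \<le> norm (th - a) + norm (th - b - xi) + norm (a - b)"
     proof -
      have "xi = (th - a) - (th - b - xi) + (a - b)" by simp
      thus ?thesis
       using norm_triangle_ineq[of "(th - a) - (th - b - xi)" "a - b"]
        norm_triangle_ineq4[of "th - a" "th - b - xi"] by simp
     qed
     hence "xi \<in> \<Xi>" using R[OF th] R[OF xi(2)] ab xi(1) by (simp add: \<Xi>_def)
     moreover have "th \<in> A a 0 \<inter> A b xi' \<longleftrightarrow> xi' = xi" if "xi' \<in> \<Xi>" for xi'
      using elim xi that True by (auto simp: A_iff \<Xi>_def)
     ultimately have "(\<Sum>xi\<in>\<Xi>. indicator (A a 0 \<inter> A b xi) th *\<^sub>R f th) =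
       (\<Sum>xi'\<in>\<Xi>. if xi' = xi then f th else 0)"
      by (intro sum.cong refl) (simp add: indicator_def)
     thus ?thesis using True \<open>xi \<in> \<Xi>\<close> fin by simp
    qed (simp add: indicator_def)
   qed
  qed
  also have "... = (\<Sum>xi\<in>\<Xi>. J (A a 0 \<inter> A b xi))"
   unfolding J_def by (rule Bochner_Integration.integral_sum) (intro J_int compact_Int compact)
  finally show ?thesis .
 qed
 have "J (A 0 0) = (\<Sum>xi\<in>\<Xi>. J (A 0 0 \<inter> A c xi))"
  using c by (intro decomp) (auto simp: span_zero)
 \<comment> \<open>Translation by a period matches piece \<open>xi\<close> of one decomposition with
   piece \<open>- xi\<close> of the other.\<close>
 also have "... = (\<Sum>xi\<in>\<Xi>. J (A c 0 \<inter> A 0 (- xi)))"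
 proof (rule sum.cong[OF refl])
  fix xi assume "xi \<in> \<Xi>"
  hence per: "xi \<in> periods" by (simp add: \<Xi>_def dual_lattice_eq)
  have "J (A 0 0 \<inter> A c xi) = (LINT th|lborel. indicator (A 0 0 \<inter> A c xi) (th + xi) *\<^sub>R f (th + xi))"
   unfolding J_def using J_int[OF compact_Int[OF compact compact], of 0 0 c xi]
   by (intro shift[symmetric]) (auto dest: borel_measurable_integrable)
  also have "... = J (A c 0 \<inter> A 0 (- xi))"
   unfolding J_def
   by (rule Bochner_Integration.integral_cong[OF refl])
    (auto simp: tcontD(1)[OF f per] indicator_def A_iff algebra_simps)
  finally show "J (A 0 0 \<inter> A c xi) = J (A c 0 \<inter> A 0 (- xi))" .
 qed
 also have "... = (\<Sum>xi\<in>\<Xi>. J (A c 0 \<inter> A 0 xi))"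
  by (rule sum.reindex_bij_witness[where i = uminus and j = uminus]) (auto simp: \<Xi>_def D.uminus_mem)
 also have "... = J (A c 0)"
  using c by (intro decomp[symmetric]) (auto simp: span_zero)
 also have "J (A c 0) = (LINT th|lborel. indicator (A c 0) (th + c) *\<^sub>R f (th + c))"
  unfolding J_def using J_int[OF compact, of c 0]
  by (intro shift[symmetric]) (auto dest: borel_measurable_integrable)
 also have "... = (LINT th|lborel. indicator ?D th *\<^sub>R f (th + c))"
  by (rule Bochner_Integration.integral_cong[OF refl]) (simp add: indicator_def A_iff)
 finally have "(LINT th|lborel. indicator ?D th *\<^sub>R f th) = (LINT th|lborel. indicator ?D th *\<^sub>R f (th + c))"
  by (simp add: J_def A_def)
 thus ?thesis by (simp add: torus_integral_def set_lebesgue_integral_def)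
qed

lemma avg_shift:
 assumes "tcont f" shows "avg (%th. f (th + c)) = avg f"
proof -
 have "f (th + c) = f (th + proj c)" for th
  using tcontD(1)[OF assms perp_periods[OF proj_perp], of "th + proj c" c] by simp
 thus ?thesis using avg_shift_span[OF assms proj_span] by (simp add: avg_def)
qed

text \<open>Translation invariance moves the point to 0, around which the cell contains a
  ball.\<close>

lemma avg_eq_0_imp:
 fixes f :: "'q => real"
 assumes f: "tcont f" "\<And>th. 0 \<le> f th" "avg f = 0" shows "f p = 0"
proof (rule ccontr)
 assume "f p \<noteq> 0"
 hence pos: "f p > 0" using f(2)[of p] by simp
 define h where "h th = f (th + p)" for th
 have h: "tcont h" "avg h = 0" "h 0 > 0" "\<And>th. h th \<ge> 0"
  unfolding h_def using tcont_shift[OF f(1), of p] avg_shift[OF f(1), of p] f pos by simp_all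
 obtain dl' where dl': "dl' > 0" "\<And>th. dist th 0 < dl' ==> dist (h th) (h 0) < h 0 / 2"
  using tcontD(2)[OF h(1), of UNIV] h(3) unfolding continuous_on_iff
  by (metis UNIV_I half_gt_zero)
 obtain dl where dl: "dl > 0" "ball 0 dl \<subseteq> dirichlet_domain La" by (rule dirichlet_domain_ball)
 define r where "r = min dl dl'"
 have "(LINT th:ball (0::'q) r|lborel. h 0 / 2) \<le> (LINT th:dirichlet_domain La|lborel. h th)"
  unfolding set_lebesgue_integral_def
 proof (rule integral_mono)
  show "integrable lborel (%th. indicator (ball (0::'q) r) th *\<^sub>R (h 0 / 2))"
   using emeasure_bounded_finite[OF bounded_ball, of "0::'q" r] by auto
  show "integrable lborel (%th. indicator (dirichlet_domain La) th *\<^sub>R h th)"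
   using integrable_dirichlet[OF h(1)] by (simp add: set_integrable_def)
  fix th
  show "indicator (ball 0 r) th *\<^sub>R (h 0 / 2) \<le> indicator (dirichlet_domain La) th *\<^sub>R h th"
  proof -
   have "h 0 / 2 \<le> h th" if "dist th 0 < dl'"
    using dl'(2)[OF that] unfolding dist_real_def by linarith
   thus ?thesis using dl(2) h(4)[of th] by (auto simp: indicator_def r_def)
  qed
 qed
 moreover have "(LINT th:ball (0::'q) r|lborel. h 0 / 2) > 0"
  using measure_dirichlet_ball[of r] dl(1) dl'(1) h(3) by (simp add: set_lebesgue_integral_def r_def)
 ultimately show False
  using h(2) torus_vol_pos unit_ball_factor_pos by (simp add: avg_def torus_integral_def)
qed

end

section \<open>Trigonometric polynomials and approximate identities\<close>

lemma cis_add: "cis (a + b) = cis a * cis b"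
 by (simp add: cis_mult)

lemma has_derivative_cis_inner:
 "((%th. cis (l \<bullet> th)) has_derivative (%v. \<i> * of_real (l \<bullet> v) * cis (l \<bullet> th))) (at th)"
proof -
 have "((%th. exp (\<i> * of_real (l \<bullet> th))) has_derivative
   (%v. exp (\<i> * of_real (l \<bullet> th)) * (\<i> * of_real (l \<bullet> v)))) (at th)"
  by (rule has_derivative_compose[OF _ DERIV_exp[unfolded has_field_derivative_def]])
   (auto intro!: derivative_eq_intros)
 thus ?thesis by (simp add: cis_conv_exp mult.commute)
qed

context discrete_subgroup begin

abbreviation "fc \<equiv> fourier La"

lemma tcont_cis: "l \<in> La ==> tcont (%th. cis (l \<bullet> th))"
proof (rule tcontI)
 fix th kp assume "l \<in> La" "kp \<in> periods"
 then obtain n :: int where n: "l \<bullet> kp = 2 * pi * of_int n" by (auto simp: periods_def inner_commute)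
 have "cis (l \<bullet> (th + kp)) = cis (l \<bullet> th) * cis (2 * pi * of_int n)"
  by (simp only: inner_add_right cis_add n)
 also have "cis (2 * pi * of_int n) = 1" by (rule cis_multiple_2pi) simp
 finally show "cis (l \<bullet> (th + kp)) = cis (l \<bullet> th)" by simp
qed (auto simp: cis.ctr intro!: continuous_intros)

text \<open>A shift by \<open>c\<close> with \<open>l \<bullet> c = pi\<close> changes the sign of
  the character but not its average.\<close>

lemma avg_cis:
 assumes l: "l \<in> La" shows "avg (%th. cis (l \<bullet> th)) = (if l = 0 then 1 else 0)"
proof (cases "l = 0")
 case False
 define c where "c = (pi / (l \<bullet> l)) *\<^sub>R l"
 have "l \<bullet> c = pi" using False by (simp add: c_def)
 hence "cis (l \<bullet> (th + c)) = (- 1) * cis (l \<bullet> th)" for th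
  by (simp add: inner_add_right cis_mult[symmetric] cis_pi)
 hence "avg (%th. (- 1) * cis (l \<bullet> th)) = avg (%th. cis (l \<bullet> th))"
  using avg_shift[OF tcont_cis[OF l], of c] by simp
 thus ?thesis using False avg_mult[OF tcont_cis[OF l], of "- 1"] by simp
qed (simp add: avg_const)

inductive trig :: "('q => complex) => bool" where
 trig_cis: "l \<in> La ==> trig (%th. c * cis (l \<bullet> th))"
| trig_add: "trig f ==> trig g ==> trig (%th. f th + g th)"

lemma trig_const: "trig (%_. c)"
 using trig_cis[OF zero_mem, of c] by simp

lemma trig_tcont: "trig f ==> tcont f"
 by (induction rule: trig.induct) (auto intro: tcont_add tcont_mult tcont_const tcont_cis)

lemma trig_mult: assumes "trig f" "trig g" shows "trig (%th. f th * g th)"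
 using assms(1)
proof (induction rule: trig.induct)
 case (trig_cis l c)
 show ?case using assms(2)
 proof (induction rule: trig.induct)
  case (trig_cis m d)
  have "(%th. c * cis (l \<bullet> th) * (d * cis (m \<bullet> th))) = (%th. (c * d) * cis ((l + m) \<bullet> th))"
   by (simp add: inner_add_left cis_mult[symmetric] ac_simps)
  thus ?case using trig.trig_cis[OF add_mem[OF \<open>l \<in> La\<close> trig_cis]] by metis
 qed (simp add: trig.trig_add distrib_left)
qed (simp add: trig.trig_add distrib_right)

lemma trig_cmult: "trig f ==> trig (%th. c * f th)"
 using trig_mult[OF trig_const] .

lemma trig_uminus: "trig f ==> trig (%th. - f th)"
 using trig_cmult[of f "- 1"] by simp

lemma trig_diff: "trig f ==> trig g ==> trig (%th. f th - g th)"
 using trig_add[OF _ trig_uminus] by simp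

lemma trig_sum: "(\<And>i. i \<in> I ==> trig (f i)) ==> trig (%th. \<Sum>i\<in>I. f i th)"
 by (induction I rule: infinite_finite_induct) (auto intro: trig_add trig_const)

lemma trig_power: "trig f ==> trig (%th. f th ^ n)"
 by (induction n) (auto intro: trig_mult trig_const)

lemma trig_cos: "l \<in> La ==> trig (%th. of_real (cos (l \<bullet> th)))"
proof -
 assume l: "l \<in> La"
 have "(%th. complex_of_real (cos (l \<bullet> th))) = (%th. 1 / 2 * cis (l \<bullet> th) + 1 / 2 * cis ((- l) \<bullet> th))"
  by (simp add: fun_eq_iff complex_eq_iff)
 thus ?thesis using trig_add[OF trig_cis[OF l] trig_cis[OF uminus_mem[OF l]]] by metis
qed

lemma trig_sin: "l \<in> La ==> trig (%th. of_real (sin (l \<bullet> th)))"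
proof -
 assume l: "l \<in> La"
 have "(%th. complex_of_real (sin (l \<bullet> th))) = (%th. (- \<i> / 2) * cis (l \<bullet> th) + (\<i> / 2) * cis ((- l) \<bullet> th))"
  by (simp add: fun_eq_iff complex_eq_iff)
 thus ?thesis using trig_add[OF trig_cis[OF l] trig_cis[OF uminus_mem[OF l]]] by metis
qed

lemma trig_cnj: "trig f ==> trig (%th. cnj (f th))"
proof (induction rule: trig.induct)
 case (trig_cis l c)
 thus ?case
  using trig.trig_cis[OF uminus_mem, of l "cnj c"] by (simp add: cis_cnj)
qed (simp add: trig.trig_add)

lemma trig_shift: "trig f ==> trig (%th. f (th + c))"
proof (induction rule: trig.induct)
 case (trig_cis l d)
 have "(%th. d * cis (l \<bullet> (th + c))) = (%th. (d * cis (l \<bullet> c)) * cis (l \<bullet> th))"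
  by (simp add: fun_eq_iff inner_add_right mult.assoc cis_mult add.commute)
 thus ?case using trig.trig_cis[OF trig_cis] by metis
qed (simp add: trig.trig_add)

lemma trig_linear:
 assumes "linear \<gamma>" "\<And>l. l \<in> La ==> adjoint \<gamma> l \<in> La" "trig f" shows "trig (%th. f (\<gamma> th))"
 using assms(3)
proof (induction rule: trig.induct)
 case (trig_cis l c)
 have "l \<bullet> \<gamma> th = adjoint \<gamma> l \<bullet> th" for th
  using adjoint_works[OF assms(1), of th l] by (simp add: inner_commute)
 thus ?case using trig.trig_cis[OF assms(2)[OF trig_cis], of c] by simp
qed (simp add: trig.trig_add)

lemma trig_deriv:
 assumes "trig f"
 obtains f' where "\<And>v. trig (f' v)" "\<And>th. (f has_derivative (%v. f' v th)) (at th)" "\<And>v. avg (f' v) = 0"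
proof -
 have "\<exists>f'. (\<forall>v. trig (f' v)) \<and> (\<forall>th. (f has_derivative (%v. f' v th)) (at th)) \<and> (\<forall>v. avg (f' v) = 0)"
  using assms
 proof (induction rule: trig.induct)
  case (trig_cis l c)
  define f' where "f' v th = (c * (\<i> * of_real (l \<bullet> v))) * cis (l \<bullet> th)" for v th
  have "trig (f' v)" for v unfolding f'_def by (rule trig.trig_cis[OF trig_cis])
  moreover have "((%th. c * cis (l \<bullet> th)) has_derivative (%v. f' v th)) (at th)" for th
   unfolding f'_def by (auto intro!: derivative_eq_intros has_derivative_cis_inner
    simp: scaleR_conv_of_real algebra_simps)
  moreover have "avg (f' v) = 0" for v
   unfolding f'_def by (simp add: avg_mult tcont_cis trig_cis avg_cis)
  ultimately show ?case by blast
 next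
  case (trig_add f g)
  then obtain f' g' where
   f': "\<And>v. trig (f' v)" "\<And>th. (f has_derivative (%v. f' v th)) (at th)" "\<And>v. avg (f' v) = 0" and
   g': "\<And>v. trig (g' v)" "\<And>th. (g has_derivative (%v. g' v th)) (at th)" "\<And>v. avg (g' v) = 0"
   by blast
  show ?case
   by (intro exI[of _ "%v th. f' v th + g' v th"] conjI allI trig.trig_add f' g' has_derivative_add)
    (simp add: avg_add f' g' trig_tcont)
 qed
 thus ?thesis using that by blast
qed

lemma dir_deriv_eq: "(f has_derivative f') (at th) ==> dir_deriv v f th = f' v"
 by (simp add: dir_deriv_def frechet_derivative_at[symmetric])

lemma trig_has_derivative: "trig f ==> (f has_derivative (%v. dir_deriv v f th)) (at th)"
proof -
 assume "trig f"
 then obtain f' where f': "\<And>th. (f has_derivative (%v. f' v th)) (at th)" by (rule trig_deriv) blast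
 thus ?thesis using dir_deriv_eq[OF f'[of th]] by simp
qed

lemma trig_dir_deriv: assumes "trig f" shows "trig (dir_deriv v f)" "avg (dir_deriv v f) = 0"
proof -
 obtain f' where f': "\<And>v. trig (f' v)" "\<And>th. (f has_derivative (%v. f' v th)) (at th)" "\<And>v. avg (f' v) = 0"
  by (rule trig_deriv[OF assms]) blast
 hence "dir_deriv v f = f' v" using dir_deriv_eq[OF f'(2)] by blast
 thus "trig (dir_deriv v f)" "avg (dir_deriv v f) = 0" using f' by auto
qed

lemma dir_deriv_add:
 assumes "f differentiable at th" "g differentiable at th"
 shows "dir_deriv v (%th. f th + g th) th = dir_deriv v f th + dir_deriv v g th"
 using dir_deriv_eq[OF has_derivative_add[OF assms[unfolded frechet_derivative_works]], of v]
 by (simp add: dir_deriv_def)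

lemma trig_dir_deriv_cis: "dir_deriv v (%th. c * cis (l \<bullet> th)) th = \<i> * of_real (l \<bullet> v) * (c * cis (l \<bullet> th))"
proof -
 have "((%th. c * cis (l \<bullet> th)) has_derivative (%v. \<i> * of_real (l \<bullet> v) * (c * cis (l \<bullet> th)))) (at th)"
  by (auto intro!: derivative_eq_intros has_derivative_cis_inner
    simp: scaleR_conv_of_real algebra_simps)
 thus ?thesis by (rule dir_deriv_eq)
qed

lemma trig_differentiable: "trig f ==> f differentiable at th"
 using trig_has_derivative by (auto simp: differentiable_def)

lemma trig_dir_deriv_commute:
 assumes "trig f" shows "dir_deriv v (dir_deriv w f) th = dir_deriv w (dir_deriv v f) th"
 using assms
proof (induction rule: trig.induct)
 case (trig_cis l c)
 show ?case
  unfolding trig_dir_deriv_cis[abs_def] using trig_dir_deriv_cis[of _ "\<i> * of_real (l \<bullet> _) * c" l th]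
  by (simp add: mult.assoc)
next
 case (trig_add f g)
 have "dir_deriv w (%th. f th + g th) = (%th. dir_deriv w f th + dir_deriv w g th)" for w
  using trig_add by (simp add: fun_eq_iff dir_deriv_add trig_differentiable)
 thus ?case using trig_add by (simp add: dir_deriv_add trig_differentiable trig_dir_deriv)
qed

lemma fourier_eq: "fc f l = avg (%th. f th * cis (- (l \<bullet> th)))"
 by (simp add: fourier_def avg_def)

lemma tcont_cis_minus: "l \<in> La ==> tcont (%th. cis (- (l \<bullet> th)))"
 using tcont_cis[OF uminus_mem] by simp

lemma fourier_cis: "l \<in> La ==> m \<in> La ==> fc (%th. c * cis (m \<bullet> th)) l = (if l = m then c else 0)"
proof -
 assume lm: "l \<in> La" "m \<in> La"
 have "(%th. c * cis (m \<bullet> th) * cis (- (l \<bullet> th))) = (%th. c * cis ((m - l) \<bullet> th))"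
  by (simp add: fun_eq_iff mult.assoc cis_mult inner_diff_left)
 thus ?thesis
  using lm by (simp add: fourier_eq avg_mult tcont_cis diff_mem avg_cis)
qed

lemma fourier_add:
 "tcont f ==> tcont g ==> l \<in> La ==>
  fc (%th. f th + g th) l = fc f l + fc g l"
 by (simp add: fourier_eq distrib_right avg_add tcont_mult tcont_cis_minus)

lemma fourier_cmult:
 "tcont f ==> l \<in> La ==> fc (%th. c * f th) l = c * fc f l"
 by (simp add: fourier_eq mult.assoc avg_mult tcont_mult tcont_cis_minus)

lemma trig_fourier_finite:
 "trig f ==> \<exists>A. finite A \<and> (\<forall>l\<in>La - A. fc f l = 0)"
proof (induction rule: trig.induct)
 case (trig_cis l c)
 thus ?case by (intro exI[of _ "{l}"]) (auto simp: fourier_cis)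
next
 case (trig_add f g)
 then obtain A B where "finite A" "\<forall>l\<in>La - A. fc f l = 0" "finite B" "\<forall>l\<in>La - B. fc g l = 0"
  by blast
 thus ?case using trig_add(1,2)
  by (intro exI[of _ "A \<union> B"]) (auto simp: fourier_add trig_tcont)
qed

lemma trig_sobolev: assumes "trig f" shows "sobolev La s f"
proof -
 obtain A where A: "finite A" "\<And>l. l \<in> La - A ==> fc f l = 0"
  using trig_fourier_finite[OF assms] by blast
 have "(%l. (1 + (norm l)^2) powr t * (cmod (fc f l))^2) summable_on La" for t
  by (rule summable_on_cong_neutral[THEN iffD1, OF _ _ _ summable_on_finite[of "La \<inter> A"]])
   (use A in auto)
 thus ?thesis using trig_tcont[OF assms] by (simp add: sobolev_def tcont_def)
qed

lemma trig_real_has_derivative: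
 assumes "trig (%th. of_real (ps th))"
 shows "(ps has_derivative (%v. dir_deriv v ps th)) (at th)"
  "of_real (dir_deriv v ps th) = dir_deriv v (%th. complex_of_real (ps th)) th"
proof -
 have "((%th. Re (complex_of_real (ps th))) has_derivative (%v. Re (dir_deriv v (%th. of_real (ps th)) th))) (at th)"
  by (intro has_derivative_Re trig_has_derivative assms)
 hence d: "(ps has_derivative (%v. Re (dir_deriv v (%th. of_real (ps th)) th))) (at th)" by simp
 thus d': "(ps has_derivative (%v. dir_deriv v ps th)) (at th)"
  by (simp add: dir_deriv_eq)
 show "of_real (dir_deriv v ps th) = dir_deriv v (%th. complex_of_real (ps th)) th"
  by (rule dir_deriv_eq[OF has_derivative_of_real[OF d'], symmetric])
qed

section \<open>Approximate identities of trigonometric polynomials\<close>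

definition bump :: "'q => real" where
 "bump th = (1 + (\<Sum>b\<in>basis. 1 + cos (b \<bullet> th))) / (1 + 2 * real (card basis))"

text \<open>A cosine equals 1 only at multiples of 2 pi, so the normalised sum reaches its maximum 1
  only at periods. The additional 1 keeps the denominator positive when the lattice is
  trivial.\<close>

lemma bump: "0 \<le> bump th" "bump th \<le> 1" "bump 0 = 1" "bump th = 1 ==> th \<in> periods"
 "trig (%th. of_real (bump th))"
proof -
 have n: "1 + 2 * real (card basis) > 0" by simp
 have c: "0 \<le> 1 + cos (b \<bullet> th)" "1 + cos (b \<bullet> th) \<le> 2" for b
  using cos_ge_minus_one[of "b \<bullet> th"] cos_le_one[of "b \<bullet> th"] by linarith+
 have s: "0 \<le> (\<Sum>b\<in>basis. 1 + cos (b \<bullet> th))" "(\<Sum>b\<in>basis. 1 + cos (b \<bullet> th)) \<le> (\<Sum>b\<in>basis. 2)"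
  by (intro sum_nonneg sum_mono c)+
 show "0 \<le> bump th" "bump th \<le> 1" using s n by (auto simp: bump_def)
 show "bump 0 = 1" using n by (simp add: bump_def)
 show "th \<in> periods" if "bump th = 1"
 proof -
  have "(\<Sum>b\<in>basis. 2 - (1 + cos (b \<bullet> th))) = 0"
   using that n by (simp add: bump_def sum_subtractf sum.distrib field_simps)
  hence "cos (b \<bullet> th) = 1" if "b \<in> basis" for b
   using sum_nonneg_eq_0_iff[of basis "%b. 2 - (1 + cos (b \<bullet> th))"] c that finite_basis by auto
  thus ?thesis
   by (auto simp: periods_iff cos_one_2pi_int inner_commute ac_simps)
 qed
 have "trig (%th. of_real (1 / (1 + 2 * real (card basis))) * (1 + (\<Sum>b\<in>basis. 1 + of_real (cos (b \<bullet> th)))))"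
  using basis_mem by (intro trig_cmult trig_add trig_const trig_sum trig_cos) auto
 thus "trig (%th. of_real (bump th))" by (simp add: bump_def)
qed

lemma tcont_trig_real: "trig (%th. of_real (ps th)) ==> tcont ps"
 using tcont_compose[OF trig_tcont, of "%th. of_real (ps th)" Re]
 by (simp add: continuous_on_Re)

lemmas tcont_bump = tcont_trig_real[OF bump(5)]

text \<open>Near a period the increment is small by uniform continuity; away from all periods
  compactness gives \<open>bump \<le> q < 1\<close>, and a multiple of \<open>1 - bump\<close>
  dominates the trivial bound \<open>2 * M\<close>. Concentration of a kernel therefore only has to
  be measured against \<open>1 - bump\<close>.\<close>

lemma tcont_modulus:
 fixes f :: "'q => 'b::real_normed_vector"
 assumes f: "tcont f" and "eps > 0"
 obtains C where "C \<ge> 0" "\<And>th et. norm (f (th + et) - f th) \<le> eps + C * (1 - bump et)"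
proof -
 obtain dl where dl: "dl > 0" "\<And>x y. dist y x < dl ==> dist (f y) (f x) < eps"
  using tcont_uniformly_continuous[OF f] \<open>eps > 0\<close> unfolding uniformly_continuous_on_def by auto
 obtain M where M: "M \<ge> 0" "\<And>th. norm (f th) \<le> M" using tcont_bounded[OF f] by blast
 define R where "R = (\<Sum>b\<in>basis. norm (dual b))"
 define K where "K = cball 0 R \<inter> (\<Inter>kp\<in>periods. {et. dl \<le> norm (et - kp)})"
 have "compact K" unfolding K_def
  by (intro compact_Int_closed closed_INT ballI closed_Collect_le continuous_intros) auto
 have "\<exists>q<1. \<forall>et\<in>K. bump et \<le> q"
 proof (cases "K = {}")
  case False
  then obtain et where et: "et \<in> K" "\<forall>et'\<in>K. bump et' \<le> bump et"
   using continuous_attains_sup[OF \<open>compact K\<close> False tcontD(2)[OF tcont_bump]] by blast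
  have "et \<notin> periods" using et(1) dl(1) by (auto simp: K_def)
  hence "bump et < 1" using bump(2,4)[of et] by fastforce
  thus ?thesis using et(2) by blast
 qed (auto intro: exI[of _ 0])
 then obtain q where q: "q < 1" "\<And>et. et \<in> K ==> bump et \<le> q" by blast
 define C where "C = 2 * M / (1 - q)"
 have "C \<ge> 0" using M q by (simp add: C_def)
 moreover have "norm (f (th + et) - f th) \<le> eps + C * (1 - bump et)" for th et
 proof (cases "\<exists>kp\<in>periods. norm (et - kp) < dl")
  case True
  then obtain kp where kp: "kp \<in> periods" "norm (et - kp) < dl" by blast
  have "norm (f (th + et) - f th) = norm (f (th + (et - kp)) - f th)"
   using tcontD(1)[OF f kp(1), of "th + (et - kp)"] by simp
  also have "... \<le> eps" using dl(2)[of "th + (et - kp)" th] kp(2) by (simp add: dist_norm)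
  finally show ?thesis using \<open>C \<ge> 0\<close> bump(2)[of et] by (smt (verit) mult_nonneg_nonneg)
 next
  case False
  obtain kp where kp: "kp \<in> periods" "norm (et - kp) \<le> R" using reduce_periods unfolding R_def by blast
  have "et - kp \<in> K"
  proof -
   have "dl \<le> norm (et - kp - kp')" if "kp' \<in> periods" for kp'
    using False add_periods[OF kp(1) that] by (force simp: diff_diff_eq)
   thus ?thesis using kp(2) by (simp add: K_def)
  qed
  hence "bump et \<le> q"
   using q(2)[of "et - kp"] tcontD(1)[OF tcont_bump kp(1), of "et - kp"] by simp
  hence "C * (1 - q) \<le> C * (1 - bump et)" using \<open>C \<ge> 0\<close> by (intro mult_left_mono) auto
  moreover have "C * (1 - q) = 2 * M" using q by (simp add: C_def)
  moreover have "norm (f (th + et) - f th) \<le> 2 * M"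
   using norm_triangle_ineq4[of "f (th + et)" "f th"] M(2)[of "th + et"] M(2)[of th] by simp
  ultimately show ?thesis using \<open>eps > 0\<close> by linarith
 qed
 ultimately show ?thesis by (rule that)
qed

text \<open>The last clause measures concentration near the periods by a single average, which
  \<open>tcont_modulus\<close> converts into uniform approximation.\<close>

definition kernel :: "real => ('q => real) => bool" where
 "kernel dl k \<longleftrightarrow> trig (%th. of_real (k th)) \<and> (\<forall>th. 0 \<le> k th) \<and> avg k = 1 \<and>
  avg (%th. k th * (1 - bump th)) \<le> dl"

text \<open>The kernel is a normalised power of \<open>bump\<close>; in terms of the moments
  \<open>a N\<close> its concentration is \<open>1 - a (Suc N) / a N\<close>. If this always
  exceeded \<open>eps\<close>, the moments would decay at least like powers of
  \<open>1 - eps\<close>, whereas the region where \<open>bump\<close> exceeds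
  \<open>1 - eps / 2\<close> makes them decay more slowly.\<close>

lemma kernel_exists:
 assumes "dl > 0" shows "\<exists>k. kernel dl k"
proof -
 define eps where "eps = min dl (1 / 2)"
 have eps: "0 < eps" "eps < 1" "eps \<le> dl" using assms by (auto simp: eps_def)
 define a where "a N = avg (%th. bump th ^ N)" for N
 have tc: "tcont (%th. bump th ^ N)" for N by (intro tcont_power tcont_bump)
 have apos: "a N > 0" for N
 proof (rule ccontr)
  assume "\<not> a N > 0"
  moreover have "a N \<ge> 0"
   using avg_mono[OF tcont_const[of "0 :: real"] tc[of N]] bump(1) by (simp add: a_def avg_const)
  ultimately have "a N = 0" by simp
  thus False using avg_eq_0_imp[OF tc[of N], of 0] bump(1,3) by (simp add: a_def)
 qed
 have ex: "\<exists>N. a N - a (Suc N) \<le> eps * a N"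
 proof (rule ccontr)
  assume "\<not> ?thesis"
  hence "eps * a N < a N - a (Suc N)" for N by (simp add: not_le)
  hence step: "a (Suc N) \<le> (1 - eps) * a N" for N
   by (simp add: left_diff_distrib less_imp_le) (smt (verit))
  have up: "a N \<le> (1 - eps) ^ N * a 0" for N
  proof (induction N)
   case (Suc N)
   hence "(1 - eps) * a N \<le> (1 - eps) * ((1 - eps) ^ N * a 0)" using eps by (intro mult_left_mono) auto
   thus ?case using step[of N] by (simp add: mult.assoc)
  qed simp
  define q where "q = 1 - eps / 2"
  have q: "0 < q" "q < 1" "1 - eps < q" using eps by (auto simp: q_def)
  \<comment> \<open>A continuous substitute for the indicator function of the region
    \<open>bump > q\<close>.\<close>
  define \<phi> where "\<phi> th = max 0 (bump th - q)" for th
  have \<phi>: "tcont \<phi>"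
   unfolding \<phi>_def by (rule tcont_compose[OF tcont_bump]) (intro continuous_intros)
  have "avg \<phi> \<ge> 0"
   using avg_mono[OF tcont_const[of "0 :: real"] \<phi>] by (simp add: avg_const \<phi>_def)
  moreover have "avg \<phi> \<noteq> 0"
   using avg_eq_0_imp[OF \<phi>, of 0] bump(3) q by (auto simp: \<phi>_def)
  ultimately have \<phi>pos: "avg \<phi> > 0" by simp
  have low: "q ^ N * avg \<phi> \<le> a N" for N
  proof -
   have "q ^ N *\<^sub>R \<phi> th \<le> bump th ^ N" for th
   proof (cases "bump th \<le> q")
    case False
    hence "q ^ N \<le> bump th ^ N" using q by (intro power_mono) auto
    moreover have "q ^ N * \<phi> th \<le> q ^ N" using bump(2)[of th] q by (intro mult_left_le) (auto simp: \<phi>_def)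
    ultimately show ?thesis by simp
   qed (use bump(1)[of th] in \<open>simp add: \<phi>_def\<close>)
   hence "avg (%th. q ^ N *\<^sub>R \<phi> th) \<le> a N"
    unfolding a_def by (intro avg_mono tc tcont_scaleR tcont_const \<phi>)
   thus ?thesis using avg_scaleR[OF \<phi>, of "q ^ N"] by simp
  qed
  have "(%N. ((1 - eps) / q) ^ N * a 0) \<longlonglongrightarrow> 0 * a 0"
   using eps q by (intro tendsto_mult tendsto_const LIMSEQ_realpow_zero) auto
  moreover have "avg \<phi> \<le> ((1 - eps) / q) ^ N * a 0" for N
   using low[of N] up[of N] q by (simp add: power_divide field_simps)
  ultimately have "avg \<phi> \<le> 0" by (intro LIMSEQ_le_const) auto
  thus False using \<phi>pos by simp
 qed
 then obtain N where N: "a N - a (Suc N) \<le> eps * a N" by blast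
 define k where "k th = (1 / a N) *\<^sub>R bump th ^ N" for th
 have "trig (%th. of_real (1 / a N) * of_real (bump th) ^ N)" by (intro trig_cmult trig_power bump)
 hence "trig (%th. of_real (k th))" by (simp add: k_def)
 moreover have "0 \<le> k th" for th using bump(1)[of th] apos[of N] by (simp add: k_def)
 moreover have "avg k = 1" unfolding k_def using avg_scaleR[OF tc, of "1 / a N" N] apos[of N] by (simp add: a_def)
 moreover have "avg (%th. k th * (1 - bump th)) \<le> dl"
 proof -
  have "(%th. k th * (1 - bump th)) = (%th. (1 / a N) *\<^sub>R (bump th ^ N - bump th ^ Suc N))"
   by (simp add: k_def right_diff_distrib diff_divide_distrib fun_eq_iff)
  hence "avg (%th. k th * (1 - bump th)) = (1 / a N) * (a N - a (Suc N))"
   using avg_scaleR[OF tcont_diff[OF tc[of N] tc[of "Suc N"]], of "1 / a N"]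
    avg_diff[OF tc[of N] tc[of "Suc N"]] by (simp add: a_def)
  also have "... \<le> eps" using N apos[of N] by (simp add: field_simps)
  finally show ?thesis using eps by simp
 qed
 ultimately show ?thesis by (auto simp: kernel_def)
qed

text \<open>Convolution with the reflected kernel. \<open>conv_eq\<close> shifts the variable into
  the kernel, where smoothness in \<open>th\<close> becomes visible.\<close>

definition conv :: "('q => real) => ('q => 'b::{banach,second_countable_topology}) => 'q => 'b" where
 "conv k f th = avg (%et. k et *\<^sub>R f (th + et))"

lemma tcont_shift_left: "tcont f ==> tcont (%et. f (th + et))"
 using tcont_shift[of f th] by (simp add: add.commute)

lemma conv_eq:
 assumes "tcont k" "tcont f" shows "conv k f th = avg (%et. k (et - th) *\<^sub>R f et)"
 using avg_shift[OF tcont_scaleR[OF assms(1) tcont_shift_left[OF assms(2), of th]], of "- th"]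
 by (simp add: conv_def)

lemma conv_bounded_linear:
 assumes "bounded_linear T" "tcont k" "tcont f" shows "T (conv k f th) = conv k (%th. T (f th)) th"
 using avg_bounded_linear[OF assms(1) tcont_scaleR[OF assms(2) tcont_shift_left[OF assms(3)]], of th]
 by (simp add: conv_def linear_simps(5)[OF assms(1)])

text \<open>The bound \<open>C * (1 - bump)\<close> averages against a kernel to at most
  \<open>C * dl\<close>, so \<open>dl\<close> depends on \<open>f\<close> only through
  \<open>C\<close>.\<close>

lemma conv_uniform:
 fixes f :: "'q => 'b::{banach,second_countable_topology}"
 assumes f: "tcont f" and "eps > 0"
 obtains dl where "dl > 0" "\<And>k th. kernel dl k ==> norm (conv k f th - f th) \<le> eps"
proof -
 obtain C where C: "C \<ge> 0" "\<And>th et. norm (f (th + et) - f th) \<le> eps / 2 + C * (1 - bump et)"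
  using tcont_modulus[OF f, of "eps / 2"] \<open>eps > 0\<close> by auto
 define dl where "dl = eps / (2 * (C + 1))"
 have "dl > 0" using C \<open>eps > 0\<close> by (simp add: dl_def)
 moreover have "norm (conv k f th - f th) \<le> eps" if k: "kernel dl k" for k th
 proof -
  have tk: "tcont k" using k by (auto simp: kernel_def intro: tcont_trig_real)
  have tb: "tcont (%et. k et * (1 - bump et))"
   by (intro tcont_mult tk tcont_diff tcont_const tcont_bump)
  have tf: "tcont (%et. k et *\<^sub>R (f (th + et) - f th))"
   by (intro tcont_scaleR tk tcont_diff tcont_const tcont_shift_left f)
  have "conv k f th - f th = avg (%et. k et *\<^sub>R f (th + et)) - avg (%et. k et *\<^sub>R f th)"
   using k avg_bounded_linear[OF bounded_linear_scaleR_left tk, of "f th"] by (simp add: conv_def kernel_def)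
  also have "... = avg (%et. k et *\<^sub>R (f (th + et) - f th))"
   by (subst avg_diff[symmetric])
    (auto intro!: tcont_scaleR tk tcont_shift_left f tcont_const simp: scaleR_diff_right)
  also have "norm ... \<le> avg (%et. (eps / 2) *\<^sub>R k et + C *\<^sub>R (k et * (1 - bump et)))"
  proof (rule order_trans[OF norm_avg_le_avg[OF tf] avg_mono])
   show "norm (k et *\<^sub>R (f (th + et) - f th)) \<le> (eps / 2) *\<^sub>R k et + C *\<^sub>R (k et * (1 - bump et))" for et
   proof -
    have k0: "k et \<ge> 0" using k by (simp add: kernel_def)
    have "norm (k et *\<^sub>R (f (th + et) - f th)) = k et * norm (f (th + et) - f th)" using k0 by simp
    also have "... \<le> k et * (eps / 2 + C * (1 - bump et))" by (intro mult_left_mono C(2) k0)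
    finally show ?thesis by (simp add: algebra_simps)
   qed
  qed (intro tcont_norm tf tcont_add tcont_scaleR tcont_const tk tb)+
  also have "... = eps / 2 * avg k + C * avg (%et. k et * (1 - bump et))"
   unfolding avg_add[OF tcont_scaleR[OF tcont_const tk] tcont_scaleR[OF tcont_const tb]]
    avg_scaleR[OF tk] avg_scaleR[OF tb] by simp
  also have "... \<le> eps / 2 + C * dl" using k C by (intro add_mono mult_left_mono) (auto simp: kernel_def)
  also have "... \<le> eps" using C \<open>eps > 0\<close> by (simp add: dl_def field_simps)
  finally show ?thesis .
 qed
 ultimately show ?thesis by (rule that)
qed

text \<open>A character of \<open>et - th\<close> factorises, and the integral over
  \<open>et\<close> contributes only a coefficient.\<close>

lemma trig_conv:
 assumes k: "trig (%th. of_real (k th))" and f: "tcont f" shows "trig (conv k f)"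
proof -
 have "trig (%th. avg (%et. K (et - th) * f et))" if "trig K" for K
  using that
 proof (induction rule: trig.induct)
  case (trig_cis l c)
  have "avg (%et. c * cis (l \<bullet> (et - th)) * f et) = (c * avg (%et. cis (l \<bullet> et) * f et)) * cis ((- l) \<bullet> th)" for th
  proof -
   have "(%et. c * cis (l \<bullet> (et - th)) * f et) = (%et. (c * cis ((- l) \<bullet> th)) * (cis (l \<bullet> et) * f et))"
   proof
    fix et
    have "cis (l \<bullet> (et - th)) = cis ((- l) \<bullet> th) * cis (l \<bullet> et)" by (simp add: cis_mult inner_diff_right)
    thus "c * cis (l \<bullet> (et - th)) * f et = (c * cis ((- l) \<bullet> th)) * (cis (l \<bullet> et) * f et)" by simp
   qed
   thus ?thesis by (simp add: avg_mult tcont_mult tcont_cis trig_cis f)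
  qed
  thus ?case by (simp only: trig.trig_cis[OF uminus_mem[OF trig_cis]])
 next
  case (trig_add K K')
  have "avg (%et. (K (et - th) + K' (et - th)) * f et) =
    avg (%et. K (et - th) * f et) + avg (%et. K' (et - th) * f et)" for th
   using tcont_shift[OF trig_tcont[OF trig_add(1)], of "- th"]
    tcont_shift[OF trig_tcont[OF trig_add(2)], of "- th"]
   by (simp add: distrib_right avg_add tcont_mult f)
  thus ?case using trig.trig_add[OF trig_add(3,4)] by simp
 qed
 moreover have "conv k f = (%th. avg (%et. of_real (k (et - th)) * f et))"
  using conv_eq[OF tcont_trig_real[OF k] f] by (simp add: fun_eq_iff scaleR_conv_of_real)
 ultimately show ?thesis using k by simp
qed

text \<open>Trigonometric kernels see only Fourier coefficients, so all smoothings of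
  \<open>f\<close> vanish; but they approximate \<open>f\<close>.\<close>

lemma fourier_eq_0_imp:
 assumes f: "tcont f" and 0: "\<And>l. l \<in> La ==> fc f l = 0"
 shows "f th = 0"
proof -
 have z: "avg (%et. K (et - th) * f et) = 0" if "trig K" for K th
  using that
 proof (induction rule: trig.induct)
  case (trig_cis l c)
  have "avg (%et. cis (l \<bullet> et) * f et) = 0"
   using 0[OF uminus_mem[OF trig_cis]] by (simp add: fourier_eq mult.commute)
  moreover have "(%et. c * cis (l \<bullet> (et - th)) * f et) = (%et. (c * cis (- (l \<bullet> th))) * (cis (l \<bullet> et) * f et))"
  proof
   fix et
   have "cis (l \<bullet> (et - th)) = cis (- (l \<bullet> th)) * cis (l \<bullet> et)" by (simp add: cis_mult inner_diff_right)
   thus "c * cis (l \<bullet> (et - th)) * f et = (c * cis (- (l \<bullet> th))) * (cis (l \<bullet> et) * f et)" by simp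
  qed
  ultimately show ?case by (simp add: avg_mult tcont_mult tcont_cis trig_cis f)
 next
  case (trig_add K K')
  thus ?case
   using tcont_shift[OF trig_tcont[OF trig_add(1)], of "- th"]
    tcont_shift[OF trig_tcont[OF trig_add(2)], of "- th"]
   by (simp add: distrib_right avg_add tcont_mult f)
 qed
 have "norm (f th) \<le> 0 + eps" if eps: "eps > 0" for eps
 proof -
  obtain dl where dl: "dl > 0" "\<And>k th. kernel dl k ==> norm (conv k f th - f th) \<le> eps"
   using conv_uniform[OF f eps] by blast
  obtain k where k: "kernel dl k" using kernel_exists[OF dl(1)] by blast
  have tk: "trig (%th. of_real (k th))" using k by (simp add: kernel_def)
  have "conv k f th = 0"
   using conv_eq[OF tcont_trig_real[OF tk] f] z[OF tk] by (simp add: scaleR_conv_of_real)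
  thus ?thesis using dl(2)[OF k, of th] by simp
 qed
 hence "norm (f th) \<le> 0" by (rule field_le_epsilon)
 thus ?thesis by simp
qed

text \<open>Difference quotients in direction \<open>v\<close> average to zero by translation
  invariance, and uniform continuity of \<open>D\<close> makes them uniformly close to
  \<open>D\<close>.\<close>

lemma avg_deriv_eq_0:
 fixes f :: "'q => 'b::{banach,second_countable_topology}"
 assumes f: "tcont f" and D: "tcont D"
  and deriv: "\<And>th. (f has_derivative f' th) (at th)" and f'v: "\<And>th. f' th v = D th"
 shows "avg D = 0"
proof -
 have "norm (avg D) \<le> 0 + eps" if eps: "eps > 0" for eps
 proof -
  obtain dl where dl: "dl > 0" "\<And>x y. dist y x < dl ==> dist (D y) (D x) < eps"
   using tcont_uniformly_continuous[OF D] eps unfolding uniformly_continuous_on_def by auto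
  define t where "t = dl / (norm v + 1)"
  have t: "t > 0" "t * norm v < dl"
   using dl(1) by (auto simp: t_def field_simps add_pos_nonneg add_nonneg_pos)
  have est: "norm (f (th + t *\<^sub>R v) - f th - t *\<^sub>R D th) \<le> t * eps" for th
  proof -
   define \<phi> where "\<phi> s = f (th + s *\<^sub>R v) - s *\<^sub>R D th" for s
   have d: "(\<phi> has_vector_derivative (D (th + s *\<^sub>R v) - D th)) (at s)" for s
   proof -
    have "((%s. f (th + s *\<^sub>R v)) has_derivative (%h. f' (th + s *\<^sub>R v) (h *\<^sub>R v))) (at s)"
     by (rule has_derivative_compose[OF _ deriv]) (auto intro!: derivative_eq_intros)
    moreover have "f' (th + s *\<^sub>R v) (h *\<^sub>R v) = h *\<^sub>R D (th + s *\<^sub>R v)" for h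
     using has_derivative_linear[OF deriv] f'v by (simp add: linear_scale)
    ultimately have "((%s. f (th + s *\<^sub>R v)) has_vector_derivative D (th + s *\<^sub>R v)) (at s)"
     by (simp add: has_vector_derivative_def)
    thus ?thesis unfolding \<phi>_def by (auto intro!: derivative_eq_intros)
   qed
   have "norm (\<phi> t - \<phi> 0) \<le> eps * t - eps * 0"
   proof (rule differentiable_bound_general[OF t(1) _ _ d])
    show "continuous_on {0..t} \<phi>"
     using d by (intro continuous_at_imp_continuous_on) (auto intro: has_vector_derivative_continuous)
    show "((%s. eps * s) has_vector_derivative eps) (at s)" for s
     by (auto intro!: derivative_eq_intros simp flip: has_real_derivative_iff_has_vector_derivative)
    show "norm (D (th + s *\<^sub>R v) - D th) \<le> eps" if "0 < s" "s < t" for s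
    proof -
     have "dist (th + s *\<^sub>R v) th \<le> t * norm v" using that by (simp add: dist_norm mult_right_mono)
     hence "dist (D (th + s *\<^sub>R v)) (D th) < eps" using t by (intro dl(2)) simp
     thus ?thesis by (simp add: dist_norm)
    qed
   qed (intro continuous_intros)
   thus ?thesis by (simp add: \<phi>_def algebra_simps)
  qed
  have tc: "tcont (%th. f (th + t *\<^sub>R v) - f th)" by (intro tcont_diff tcont_shift f)
  have tD: "tcont (%th. t *\<^sub>R D th)" by (intro tcont_scaleR tcont_const D)
  have "avg (%th. f (th + t *\<^sub>R v) - f th - t *\<^sub>R D th) = - (t *\<^sub>R avg D)"
   using avg_diff[OF tc tD] avg_diff[OF tcont_shift[OF f] f, of "t *\<^sub>R v"] avg_shift[OF f] avg_scaleR[OF D]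
   by simp
  moreover have "norm (avg (%th. f (th + t *\<^sub>R v) - f th - t *\<^sub>R D th)) \<le> t * eps"
   by (intro norm_avg_le tcont_diff tc tD est)
  ultimately show ?thesis using t by simp
 qed
 hence "norm (avg D) \<le> 0" by (rule field_le_epsilon)
 thus ?thesis by simp
qed

end

section \<open>Sobolev spaces on the dual torus\<close>

lemma cmod_cis_diff_le: "cmod (cis a - cis b) \<le> \<bar>a - b\<bar>"
proof -
 have "cmod (cis a - cis b) = cmod (cis b * (cis (a - b) - 1))"
  by (simp add: cis_mult right_diff_distrib)
 also have "... = cmod (cis (a - b) - 1)" by (simp add: norm_mult)
 also have "... = 2 * \<bar>sin ((a - b) / 2)\<bar>"
  using dist_exp_i_1[of "a - b"] by (simp only: cis_conv_exp)
 also have "... \<le> \<bar>a - b\<bar>" using abs_sin_x_le_abs_x[of "(a - b) / 2"] by simp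
 finally show ?thesis .
qed

lemma has_sum_sum:
 fixes f :: "'i => 'a => 'b::real_normed_vector"
 shows "(\<And>i. i \<in> I ==> (f i has_sum S i) A) ==> ((%x. \<Sum>i\<in>I. f i x) has_sum (\<Sum>i\<in>I. S i)) A"
 by (induction I rule: infinite_finite_induct) (auto intro: has_sum_add has_sum_0)

lemma summable_on_sum:
 fixes f :: "'i => 'a => 'b::real_normed_vector"
 shows "(\<And>i. i \<in> I ==> f i summable_on A) ==> (%x. \<Sum>i\<in>I. f i x) summable_on A"
 using has_sum_sum[of I f A "%i. infsum (f i) A"] by (auto simp: summable_on_def)

lemma infsum_sum:
 fixes f :: "'i => 'a => 'b::real_normed_vector"
 shows "(\<And>i. i \<in> I ==> f i summable_on A) ==> (\<Sum>\<^sub>\<infinity>x\<in>A. \<Sum>i\<in>I. f i x) = (\<Sum>i\<in>I. infsum (f i) A)"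
 using has_sum_sum[of I f A "%i. infsum (f i) A"] by (simp add: infsumI)

lemma has_sum_diff:
 fixes f g :: "'a => 'b::real_normed_vector"
 assumes "(f has_sum a) A" "(g has_sum b) A" shows "((%x. f x - g x) has_sum (a - b)) A"
 using has_sum_add[OF assms(1) has_sum_uminus[THEN iffD2, of g A "- b"]] assms(2) by simp

lemma powr_half_sq: "0 < (x :: real) ==> (x powr (y / 2))\<^sup>2 = x powr y"
 by (simp add: powr_power)

context discrete_subgroup begin

abbreviation weight :: "'q => real" where "weight l \<equiv> 1 + (norm l)^2"

lemma weight_pos: "0 < weight l" by (simp add: add_pos_nonneg)

text \<open>One real order at a time; \<open>sobolev\<close> is the intersection over all real
  orders up to \<open>s\<close>, which may be infinite.\<close>

definition Hs :: "real => ('q => complex) => bool" where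
 "Hs t f \<longleftrightarrow> tcont f \<and> (%l. weight l powr t * (cmod (fc f l))^2) summable_on La"

lemma sobolev_iff: "sobolev La s f \<longleftrightarrow> tcont f \<and> (\<forall>t. ereal t \<le> s \<longrightarrow> Hs t f)"
 by (auto simp: sobolev_def tcont_def Hs_def)

lemma Hs_mono: assumes "Hs t f" "t' \<le> t" shows "Hs t' f"
proof -
 have "(%l. weight l powr t' * (cmod (fc f l))^2) summable_on La"
  by (rule summable_on_comparison_test[of "%l. weight l powr t * (cmod (fc f l))^2"])
   (use assms in \<open>auto simp: Hs_def intro!: mult_right_mono powr_mono\<close>)
 thus ?thesis using assms by (simp add: Hs_def)
qed

lemma avg_mult_cnj: "tcont f ==> avg (%th. f th * cnj (f th)) = of_real (avg (%th. (cmod (f th))\<^sup>2))"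
 by (simp add: complex_norm_square[symmetric] avg_bounded_linear[OF bounded_linear_of_real]
   tcont_power tcont_norm flip: of_real_power)

text \<open>With \<open>S\<close> the partial Fourier sum over \<open>A\<close>, the difference
  \<open>f - S\<close> is orthogonal to \<open>S\<close> and its mean square is nonnegative.\<close>

lemma bessel_finite:
 assumes f: "tcont f" and A: "finite A" "A \<subseteq> La"
 shows "(\<Sum>l\<in>A. (cmod (fc f l))\<^sup>2) \<le> avg (%th. (cmod (f th))\<^sup>2)"
proof -
 define S where "S th = (\<Sum>l\<in>A. fc f l * cis (l \<bullet> th))" for th
 define g where "g th = f th - S th" for th
 have tS: "tcont S" unfolding S_def
  using A by (intro tcont_sum tcont_mult tcont_const tcont_cis) auto
 have tg: "tcont g" unfolding g_def by (intro tcont_diff f tS)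
 have tl: "tcont (%th. h th * cnj (S th))" if "tcont h" for h
  by (intro tcont_mult that tcont_cnj tS)
 have avgS: "avg (%th. h th * cnj (S th)) = (\<Sum>l\<in>A. cnj (fc f l) * fc h l)"
  if h: "tcont h" for h
 proof -
  have "avg (%th. h th * cnj (S th)) = avg (%th. \<Sum>l\<in>A. cnj (fc f l) * (h th * cis (- (l \<bullet> th))))"
   by (simp add: S_def sum_distrib_left cis_cnj ac_simps)
  also have "... = (\<Sum>l\<in>A. cnj (fc f l) * fc h l)"
   using A h by (subst avg_sum)
    (auto intro!: tcont_mult tcont_const tcont_cis_minus sum.cong avg_mult simp: fourier_eq)
  finally show ?thesis .
 qed
 have fS: "fc S m = (if m \<in> A then fc f m else 0)" if m: "m \<in> La" for m
 proof -
  have "fc S m = (\<Sum>l\<in>A. fc (%th. fc f l * cis (l \<bullet> th)) m)"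
   unfolding fourier_eq[of S] S_def sum_distrib_right
   using A m by (subst avg_sum)
    (auto intro!: tcont_mult tcont_const tcont_cis tcont_cis_minus simp: fourier_eq)
  also have "... = (\<Sum>l\<in>A. if l = m then fc f m else 0)"
   using A m by (intro sum.cong) (auto simp: fourier_cis)
  finally show ?thesis using A(1) by simp
 qed
 have "fc g m = 0" if "m \<in> A" for m
 proof -
  have m: "m \<in> La" using that A by auto
  have "fc (%th. f th - S th) m = 0"
   using fourier_add[OF f tcont_uminus[OF tS] m] fourier_cmult[OF tS m, of "- 1"] fS[OF m] that by simp
  thus ?thesis by (simp add: g_def[abs_def])
 qed
 hence "avg (%th. g th * cnj (S th)) = 0" using avgS[OF tg] by simp
 moreover have "avg (%th. f th * cnj (S th)) = of_real (\<Sum>l\<in>A. (cmod (fc f l))\<^sup>2)"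
  unfolding avgS[OF f] by (simp only: complex_norm_square of_real_sum mult.commute)
 moreover have "avg (%th. g th * cnj (g th)) = avg (%th. f th * cnj (f th)) - cnj (avg (%th. f th * cnj (S th))) - avg (%th. g th * cnj (S th))"
 proof -
  have e: "(%th. g th * cnj (g th)) = (%th. f th * cnj (f th) - cnj (f th * cnj (S th)) - g th * cnj (S th))"
   by (simp add: fun_eq_iff g_def algebra_simps)
  have ff: "tcont (%th. f th * cnj (f th))" by (intro tcont_mult tcont_cnj f)
  show ?thesis
   unfolding e avg_diff[OF tcont_diff[OF ff tcont_cnj[OF tl[OF f]]] tl[OF tg]]
    avg_diff[OF ff tcont_cnj[OF tl[OF f]]] avg_bounded_linear[OF bounded_linear_cnj tl[OF f]] ..
 qed
 ultimately have "complex_of_real (avg (%th. (cmod (g th))\<^sup>2)) =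
   of_real (avg (%th. (cmod (f th))\<^sup>2) - (\<Sum>l\<in>A. (cmod (fc f l))\<^sup>2))"
  using avg_mult_cnj[OF tg] avg_mult_cnj[OF f] by simp
 hence "avg (%th. (cmod (g th))\<^sup>2) = avg (%th. (cmod (f th))\<^sup>2) - (\<Sum>l\<in>A. (cmod (fc f l))\<^sup>2)"
  by (simp only: of_real_eq_iff)
 moreover have "0 \<le> avg (%th. (cmod (g th))\<^sup>2)"
  using avg_mono[OF tcont_const[of "0 :: real"] tcont_power[OF tcont_norm[OF tg]], of 2]
  by (simp add: avg_const)
 ultimately show ?thesis by simp
qed

lemma bessel:
 assumes "tcont f"
 shows "(%l. (cmod (fc f l))\<^sup>2) summable_on La"
  "(\<Sum>\<^sub>\<infinity>l\<in>La. (cmod (fc f l))\<^sup>2) \<le> avg (%th. (cmod (f th))\<^sup>2)"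
proof -
 show "(%l. (cmod (fc f l))\<^sup>2) summable_on La"
  using bessel_finite[OF assms] by (intro nonneg_bdd_above_summable_on) (auto intro!: bdd_aboveI)
 thus "(\<Sum>\<^sub>\<infinity>l\<in>La. (cmod (fc f l))\<^sup>2) \<le> avg (%th. (cmod (f th))\<^sup>2)"
  using bessel_finite[OF assms] by (intro infsum_le_finite_sums)
qed

lemma Hs_0: "tcont f ==> Hs 0 f"
 using bessel(1) weight_pos by (simp add: Hs_def less_imp_neq[symmetric])

text \<open>A coefficient is the product of its weighted value and the inverse weight of order
  \<open>t / 2\<close>; both are square summable, the second one because \<open>t\<close> exceeds
  half the rank.\<close>

lemma Hs_fourier_summable:
 assumes "Hs t f" "real (dim La) / 2 < t" shows "(%l. cmod (fc f l)) summable_on La"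
proof (rule summable_on_comparison_test)
 show "(%l. weight l powr t * (cmod (fc f l))^2 + weight l powr (- t)) summable_on La"
  using assms by (intro summable_on_add summable_lattice_powr) (simp_all add: Hs_def)
 fix l
 define a where "a = weight l powr (t / 2) * cmod (fc f l)"
 define b where "b = weight l powr (- t / 2)"
 have "a * b = cmod (fc f l)" using weight_pos[of l] by (simp add: a_def b_def flip: powr_add)
 moreover have "a\<^sup>2 = weight l powr t * (cmod (fc f l))^2" "b\<^sup>2 = weight l powr (- t)"
  using weight_pos[of l] by (simp_all add: a_def b_def power_mult_distrib powr_power)
 moreover have "2 * (a * b) \<le> a\<^sup>2 + b\<^sup>2" using sum_squares_bound[of a b] by simp
 moreover have "0 \<le> a * b" by (simp add: a_def b_def)
 ultimately show "cmod (fc f l) \<le> weight l powr t * (cmod (fc f l))^2 + weight l powr (- t)"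
  by linarith
qed simp

section \<open>Absolutely convergent Fourier series\<close>

lemma avg_uniform_limit:
 assumes "uniform_limit UNIV F f net" "\<forall>\<^sub>F n in net. tcont (F n)" "tcont f"
 shows "((%n. avg (F n)) \<longlongrightarrow> avg f) net"
proof (rule tendstoI)
 fix eps :: real assume "eps > 0"
 hence "\<forall>\<^sub>F n in net. \<forall>th\<in>UNIV. dist (F n th) (f th) < eps / 2"
  by (intro uniform_limitD[OF assms(1)]) simp
 thus "\<forall>\<^sub>F n in net. dist (avg (F n)) (avg f) < eps" using assms(2)
 proof eventually_elim
  case (elim n)
  have "norm (avg (%th. F n th - f th)) \<le> eps / 2"
   using elim by (intro norm_avg_le tcont_diff assms(3)) (auto simp: dist_norm less_imp_le)
  thus ?case using \<open>eps > 0\<close> elim by (simp add: avg_diff assms(3) dist_norm)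
 qed
qed

lemma fourier_series_uniform:
 assumes c: "(%l. cmod (c l)) summable_on La"
 shows "uniform_limit UNIV (%X th. \<Sum>l\<in>X. c l * cis (l \<bullet> th)) (%th. \<Sum>\<^sub>\<infinity>l\<in>La. c l * cis (l \<bullet> th))
   (finite_subsets_at_top La)"
 by (rule Weierstrass_m_test_general[OF _ c]) (simp add: norm_mult)

lemma eventually_finite_subset: "\<forall>\<^sub>F X in finite_subsets_at_top La. finite X \<and> X \<subseteq> La"
 by (rule eventually_finite_subsets_at_top_weakI) simp

lemma partial_fourier_sum:
 "X \<subseteq> La ==> tcont (%th. \<Sum>l\<in>X. c l * cis (l \<bullet> th))"
 by (intro tcont_sum tcont_mult tcont_const tcont_cis) auto

lemma tcont_fourier_series:
 assumes c: "(%l. cmod (c l)) summable_on La"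
 shows "tcont (%th. \<Sum>\<^sub>\<infinity>l\<in>La. c l * cis (l \<bullet> th))"
proof (rule tcontI)
 show "continuous_on UNIV (%th. \<Sum>\<^sub>\<infinity>l\<in>La. c l * cis (l \<bullet> th))"
 proof (rule uniform_limit_theorem[OF _ fourier_series_uniform[OF c]])
  show "\<forall>\<^sub>F X in finite_subsets_at_top La. continuous_on UNIV (%th. \<Sum>l\<in>X. c l * cis (l \<bullet> th))"
   using eventually_finite_subset by eventually_elim (intro tcontD(2) partial_fourier_sum; simp)
 qed simp
qed (auto intro!: infsum_cong simp: tcontD(1)[OF tcont_cis])

text \<open>Uniform convergence allows pairing term by term with any continuous \<open>h\<close>.
  Suitable choices of \<open>h\<close> give the coefficients of the series, Parseval's identity, and
  the coefficients of a product.\<close>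

lemma fourier_fourier_series:
 assumes c: "(%l. cmod (c l)) summable_on La" and h: "tcont h"
 shows "((%l. c l * avg (%th. cis (l \<bullet> th) * h th)) has_sum avg (%th. (\<Sum>\<^sub>\<infinity>l\<in>La. c l * cis (l \<bullet> th)) * h th)) La"
proof -
 obtain M where M: "M \<ge> 0" "\<And>th. cmod (h th) \<le> M" using tcont_bounded[OF h] by blast
 have "uniform_limit UNIV (%X th. (\<Sum>l\<in>X. c l * cis (l \<bullet> th)) * h th) (%th. (\<Sum>\<^sub>\<infinity>l\<in>La. c l * cis (l \<bullet> th)) * h th)
   (finite_subsets_at_top La)"
 proof (rule bounded_bilinear.bounded_uniform_limit[OF bounded_bilinear_mult fourier_series_uniform[OF c]
    uniform_limit_const])
  obtain K where "\<And>th. cmod (\<Sum>\<^sub>\<infinity>l\<in>La. c l * cis (l \<bullet> th)) \<le> K"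
   using tcont_bounded[OF tcont_fourier_series[OF c]] by blast
  thus "bounded ((%th. \<Sum>\<^sub>\<infinity>l\<in>La. c l * cis (l \<bullet> th)) ` UNIV)" by (auto intro!: boundedI)
  show "bounded (h ` UNIV)" using M by (auto intro!: boundedI)
 qed
 hence "((%X. avg (%th. (\<Sum>l\<in>X. c l * cis (l \<bullet> th)) * h th)) \<longlongrightarrow>
   avg (%th. (\<Sum>\<^sub>\<infinity>l\<in>La. c l * cis (l \<bullet> th)) * h th)) (finite_subsets_at_top La)"
 proof (rule avg_uniform_limit)
  show "\<forall>\<^sub>F X in finite_subsets_at_top La. tcont (%th. (\<Sum>l\<in>X. c l * cis (l \<bullet> th)) * h th)"
   using eventually_finite_subset by eventually_elim (intro tcont_mult partial_fourier_sum h; simp)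
 qed (intro tcont_mult tcont_fourier_series c h)
 moreover have "\<forall>\<^sub>F X in finite_subsets_at_top La. avg (%th. (\<Sum>l\<in>X. c l * cis (l \<bullet> th)) * h th) =
   (\<Sum>l\<in>X. c l * avg (%th. cis (l \<bullet> th) * h th))"
  using eventually_finite_subset
 proof eventually_elim
  case (elim X)
  have "avg (%th. \<Sum>l\<in>X. c l * (cis (l \<bullet> th) * h th)) = (\<Sum>l\<in>X. c l * avg (%th. cis (l \<bullet> th) * h th))"
   using elim h by (subst avg_sum) (auto intro!: sum.cong avg_mult tcont_mult tcont_const tcont_cis)
  thus ?case by (simp add: sum_distrib_right mult.assoc)
 qed
 ultimately show ?thesis unfolding has_sum_def by (rule Lim_transform_eventually)
qed

lemma fourier_of_series:
 assumes c: "(%l. cmod (c l)) summable_on La" and m: "m \<in> La"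
 shows "fc (%th. \<Sum>\<^sub>\<infinity>l\<in>La. c l * cis (l \<bullet> th)) m = c m"
proof -
 have "((%l. c l * fc (%th. 1 * cis (l \<bullet> th)) m) has_sum fc (%th. \<Sum>\<^sub>\<infinity>l\<in>La. c l * cis (l \<bullet> th)) m) La"
  using fourier_fourier_series[OF c tcont_cis_minus[OF m]] by (simp add: fourier_eq)
 moreover have "((%l. c l * fc (%th. 1 * cis (l \<bullet> th)) m) has_sum c m) La"
  by (rule has_sum_finite_neutralI[of "{m}"]) (use m fourier_cis[of m _ 1] in auto)
 ultimately show ?thesis by (rule has_sum_unique)
qed

lemma fourier_diff:
 assumes "tcont f" "tcont g" "l \<in> La"
 shows "fc (%th. f th - g th) l = fc f l - fc g l"
 using fourier_add[OF assms(1) tcont_uminus[OF assms(2)] assms(3)]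
  fourier_cmult[OF assms(2,3), of "- 1"] by simp

lemma fourier_inversion:
 assumes f: "tcont f" and c: "(%l. cmod (fc f l)) summable_on La"
 shows "f th = (\<Sum>\<^sub>\<infinity>l\<in>La. fc f l * cis (l \<bullet> th))"
proof -
 have "f th - (\<Sum>\<^sub>\<infinity>l\<in>La. fc f l * cis (l \<bullet> th)) = 0"
  by (rule fourier_eq_0_imp)
   (auto intro!: tcont_diff f tcont_fourier_series c
    simp: fourier_diff f tcont_fourier_series c fourier_of_series)
 thus ?thesis by simp
qed

lemma parseval:
 assumes f: "tcont f" and c: "(%l. cmod (fc f l)) summable_on La"
 shows "(\<Sum>\<^sub>\<infinity>l\<in>La. (cmod (fc f l))\<^sup>2) = avg (%th. (cmod (f th))\<^sup>2)"
proof -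
 have "((%l. fc f l * avg (%th. cis (l \<bullet> th) * cnj (f th))) has_sum avg (%th. f th * cnj (f th))) La"
  using fourier_fourier_series[OF c tcont_cnj[OF f]] fourier_inversion[OF f c] by simp
 moreover have "fc f l * avg (%th. cis (l \<bullet> th) * cnj (f th)) = of_real ((cmod (fc f l))^2)"
  if "l \<in> La" for l
 proof -
  have "(%th. cis (l \<bullet> th) * cnj (f th)) = (%th. cnj (f th * cis (- (l \<bullet> th))))"
   by (simp add: fun_eq_iff cis_cnj mult.commute)
  hence "avg (%th. cis (l \<bullet> th) * cnj (f th)) = cnj (fc f l)"
   unfolding fourier_eq
   using avg_bounded_linear[OF bounded_linear_cnj tcont_mult[OF f tcont_cis_minus[OF that]]] by simp
  thus ?thesis by (simp only: complex_norm_square)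
 qed
 ultimately have "((%l. complex_of_real ((cmod (fc f l))^2)) has_sum avg (%th. f th * cnj (f th))) La"
  by (simp cong: has_sum_cong)
 hence "((%l. (cmod (fc f l))\<^sup>2) has_sum avg (%th. (cmod (f th))\<^sup>2)) La"
  unfolding avg_mult_cnj[OF f] has_sum_of_real_iff .
 thus ?thesis by (rule infsumI)
qed

lemma fourier_mult:
 assumes f: "tcont f" and c: "(%l. cmod (fc f l)) summable_on La"
  and g: "tcont g" and l: "l \<in> La"
 shows "((%m. fc f m * fc g (l - m)) has_sum fc (%th. f th * g th) l) La"
proof -
 have "((%m. fc f m * avg (%th. cis (m \<bullet> th) * (g th * cis (- (l \<bullet> th))))) has_sum
   avg (%th. f th * (g th * cis (- (l \<bullet> th))))) La"
  using fourier_fourier_series[OF c tcont_mult[OF g tcont_cis_minus[OF l]]] fourier_inversion[OF f c]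
  by simp
 moreover have "avg (%th. cis (m \<bullet> th) * (g th * cis (- (l \<bullet> th)))) = fc g (l - m)" for m
 proof -
  have e: "cis (m \<bullet> th) * (g th * cis (- (l \<bullet> th))) = g th * cis (- ((l - m) \<bullet> th))" for th
  proof -
   have "cis (- ((l - m) \<bullet> th)) = cis (m \<bullet> th) * cis (- (l \<bullet> th))"
    by (simp add: cis_mult inner_diff_left)
   thus ?thesis by simp
  qed
  show ?thesis by (simp only: fourier_eq e)
 qed
 ultimately show ?thesis by (simp add: fourier_eq mult.assoc)
qed

text \<open>Convolution of a summable with a square summable sequence: Cauchy-Schwarz after writing
  \<open>p\<close> as the square of its root, then an exchange of the two sums.\<close>

lemma young:
 assumes p: "p summable_on La" "\<And>l. 0 \<le> (p l :: real)"
  and q: "(%l. (q l)\<^sup>2) summable_on La" "\<And>l. 0 \<le> (q l :: real)"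
 shows "\<And>l. l \<in> La ==> (%m. p m * q (l - m)) summable_on La"
  "(%l. (\<Sum>\<^sub>\<infinity>m\<in>La. p m * q (l - m))\<^sup>2) summable_on La"
proof -
 define P where "P = (\<Sum>\<^sub>\<infinity>l\<in>La. p l)"
 define Q where "Q = (\<Sum>\<^sub>\<infinity>l\<in>La. (q l)\<^sup>2)"
 have sumP: "sum p X \<le> P" if "finite X" "X \<subseteq> La" for X
  unfolding P_def using p that by (intro finite_sum_le_infsum) auto
 have sumQ: "(\<Sum>l\<in>X. (q l)\<^sup>2) \<le> Q" if "finite X" "X \<subseteq> La" for X
  unfolding Q_def using q that by (intro finite_sum_le_infsum) auto
 have P0: "P \<ge> 0" using sumP[of "{}"] by simp
 have pq2: "(%m. p m * (q (l - m))^2) summable_on La" if l: "l \<in> La" for l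
 proof (rule summable_on_comparison_test)
  show "(%m. Q * p m) summable_on La" by (intro summable_on_cmult_right p)
  show "p m * (q (l - m))^2 \<le> Q * p m" if "m \<in> La" for m
   using sumQ[of "{l - m}"] mult_left_mono[OF _ p(2), of "(q (l - m))^2" Q m] diff_mem[OF l that]
   by (simp add: mult.commute)
 qed (simp add: p)
 define S where "S l = (\<Sum>\<^sub>\<infinity>m\<in>La. p m * (q (l - m))^2)" for l
 have S0: "S l \<ge> 0" for l unfolding S_def by (intro infsum_nonneg) (simp add: p)
 have cs: "(\<Sum>m\<in>X. p m * q (l - m)) \<le> sqrt (P * S l)" if X: "finite X" "X \<subseteq> La" and l: "l \<in> La" for X l
 proof (rule real_le_rsqrt)
  have "(\<Sum>m\<in>X. p m * q (l - m)) = (\<Sum>m\<in>X. sqrt (p m) * (sqrt (p m) * q (l - m)))"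
   by (simp add: mult.assoc[symmetric] p)
  hence "(\<Sum>m\<in>X. p m * q (l - m))^2 \<le> (\<Sum>m\<in>X. (sqrt (p m))\<^sup>2) * (\<Sum>m\<in>X. (sqrt (p m) * q (l - m))\<^sup>2)"
   using Cauchy_Schwarz_ineq_sum[of "%m. sqrt (p m)" "%m. sqrt (p m) * q (l - m)" X] by simp
  also have "... = sum p X * (\<Sum>m\<in>X. p m * (q (l - m))^2)" by (simp add: power_mult_distrib p)
  also have "... \<le> P * S l"
   unfolding S_def
   by (intro mult_mono sumP X P0 finite_sum_le_infsum pq2 l sum_nonneg) (auto simp: p)
  finally show "(\<Sum>m\<in>X. p m * q (l - m))^2 \<le> P * S l" .
 qed
 show sm: "(%m. p m * q (l - m)) summable_on La" if "l \<in> La" for l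
  by (rule nonneg_bdd_above_summable_on) (auto simp: p q intro!: bdd_aboveI cs that)
 have le: "(\<Sum>\<^sub>\<infinity>m\<in>La. p m * q (l - m))^2 \<le> P * S l" if l: "l \<in> La" for l
 proof -
  have "(\<Sum>\<^sub>\<infinity>m\<in>La. p m * q (l - m)) \<le> sqrt (P * S l)"
   by (rule infsum_le_finite_sums[OF sm[OF l]]) (simp add: cs l)
  moreover have "0 \<le> (\<Sum>\<^sub>\<infinity>m\<in>La. p m * q (l - m))" by (intro infsum_nonneg) (simp add: p q)
  ultimately have "(\<Sum>\<^sub>\<infinity>m\<in>La. p m * q (l - m))^2 \<le> (sqrt (P * S l))^2" by (rule power_mono)
  thus ?thesis using P0 S0[of l] by simp
 qed
 show "(%l. (\<Sum>\<^sub>\<infinity>m\<in>La. p m * q (l - m))\<^sup>2) summable_on La"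
 proof (rule nonneg_bdd_above_summable_on)
  show "bdd_above (sum (%l. (\<Sum>\<^sub>\<infinity>m\<in>La. p m * q (l - m))\<^sup>2) ` {F. F \<subseteq> La \<and> finite F})"
  proof (rule bdd_aboveI, clarify)
   fix F assume F: "F \<subseteq> La" "finite F"
   have "(\<Sum>l\<in>F. (\<Sum>\<^sub>\<infinity>m\<in>La. p m * q (l - m))\<^sup>2) \<le> (\<Sum>l\<in>F. P * S l)"
    using F by (intro sum_mono le) auto
   also have "... = P * (\<Sum>\<^sub>\<infinity>m\<in>La. \<Sum>l\<in>F. p m * (q (l - m))^2)"
    using F by (simp add: S_def sum_distrib_left infsum_sum[OF pq2] subset_iff)
   also have "... \<le> P * (\<Sum>\<^sub>\<infinity>m\<in>La. Q * p m)"
   proof (intro mult_left_mono infsum_mono P0)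
    show "(%m. \<Sum>l\<in>F. p m * (q (l - m))^2) summable_on La" using F by (intro summable_on_sum pq2) auto
    show "(%m. Q * p m) summable_on La" by (intro summable_on_cmult_right p)
    fix m assume m: "m \<in> La"
    have "(\<Sum>l\<in>F. (q (l - m))\<^sup>2) = (\<Sum>l\<in>(%l. l - m) ` F. (q l)\<^sup>2)"
     by (subst sum.reindex) (auto simp: inj_on_def)
    also have "... \<le> Q" using F m diff_mem by (intro sumQ) auto
    finally show "(\<Sum>l\<in>F. p m * (q (l - m))^2) \<le> Q * p m"
     unfolding sum_distrib_left[symmetric]
     using mult_right_mono[OF _ p(2), of _ Q m] by (simp add: mult.commute[of "p m"])
   qed
   finally show "(\<Sum>l\<in>F. (\<Sum>\<^sub>\<infinity>m\<in>La. p m * q (l - m))\<^sup>2) \<le> P * (\<Sum>\<^sub>\<infinity>m\<in>La. Q * p m)" .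
  qed
 qed simp
qed

text \<open>Here \<open>norm l \<le> 2 * norm m\<close>, so the weight grows by at most the factor
  4, whose power \<open>t / 2\<close> is the constant.\<close>

lemma weight_triangle:
 assumes "t \<ge> 0" "norm (l - m) \<le> norm m" shows "weight l powr (t / 2) \<le> 2 powr t * weight m powr (t / 2)"
proof -
 have "norm l \<le> norm (l - m) + norm m" using norm_triangle_ineq[of "l - m" m] by simp
 hence "(norm l)^2 \<le> (2 * norm m)^2" using assms by (intro power_mono) auto
 hence "weight l \<le> 4 * weight m" by (simp add: power_mult_distrib)
 hence "weight l powr (t / 2) \<le> (4 * weight m) powr (t / 2)" using assms weight_pos by (intro powr_mono2) (auto simp: less_imp_le)
 also have "... = 4 powr (t / 2) * weight m powr (t / 2)" by (rule powr_mult)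
 also have "4 powr (t / 2) = (2 powr 2) powr (t / 2 :: real)" by simp
 finally show ?thesis unfolding powr_powr by simp
qed

text \<open>Where \<open>|m| \<ge> |l - m|\<close>, moving \<open>s - t\<close> derivatives from \<open>f\<close> to \<open>g\<close> costs nothing and makes the
 coefficients of \<open>g\<close> absolutely summable.\<close>

lemma Hs_mult:
 assumes f: "Hs s f" and g: "Hs t g" and s: "real (dim La) / 2 < s" and t: "0 \<le> t" "t \<le> s"
 shows "Hs t (%th. f th * g th)"
proof -
 have tf: "tcont f" and tg: "tcont g" using f g by (auto simp: Hs_def)
 have c: "(%l. cmod (fc f l)) summable_on La" by (rule Hs_fourier_summable[OF f s])
 define a where "a l = cmod (fc f l)" for l
 \<comment> \<open>\<open>A\<close> and \<open>B\<close> carry the full weights and are square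
   summable. \<open>b\<close> is \<open>B\<close> with weight of order \<open>s / 2\<close> removed,
   hence summable since \<open>s\<close> exceeds half the rank.\<close>
 define A where "A l = weight l powr (s / 2) * a l" for l
 define B where "B l = weight l powr (t / 2) * cmod (fc g l)" for l
 define b where "b l = weight l powr (- s / 2) * B l" for l
 have nonneg: "0 \<le> a l" "0 \<le> A l" "0 \<le> B l" "0 \<le> b l" for l
  by (auto simp: a_def A_def B_def b_def)
 have sq: "(weight l powr (x / 2) * y)^2 = weight l powr x * y\<^sup>2" for l x y
  using weight_pos[of l] by (simp add: power_mult_distrib powr_power)
 have A2: "(%l. (A l)\<^sup>2) summable_on La" and B2: "(%l. (B l)\<^sup>2) summable_on La"
  using f g by (simp_all add: A_def B_def a_def sq Hs_def)
 have b1: "b summable_on La"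
 proof (rule summable_on_comparison_test)
  show "(%l. (B l)\<^sup>2 + weight l powr (- s)) summable_on La"
   by (intro summable_on_add B2 summable_lattice_powr s)
  show "b l \<le> (B l)^2 + weight l powr (- s)" for l
  proof -
   have "2 * (weight l powr (- s / 2) * B l) \<le> weight l powr (- s) + (B l)^2"
    using sum_squares_bound[of "weight l powr (- s / 2)" "B l"] sq[of l "- s" 1] by simp
   thus ?thesis using nonneg(4)[of l] by (simp add: b_def)
  qed
 qed (simp add: nonneg)
 have Y1: "\<And>l. l \<in> La ==> (%m. a m * B (l - m)) summable_on La"
  "(%l. (\<Sum>\<^sub>\<infinity>m\<in>La. a m * B (l - m))\<^sup>2) summable_on La"
  using young[OF c[folded a_def] _ B2] nonneg by auto
 have Y2: "\<And>l. l \<in> La ==> (%m. b m * A (l - m)) summable_on La"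
  "(%l. (\<Sum>\<^sub>\<infinity>m\<in>La. b m * A (l - m))\<^sup>2) summable_on La"
  using young[OF b1 _ A2] nonneg by auto
 \<comment> \<open>Substituting \<open>l - m\<close> for \<open>m\<close> puts the summable factor
   first, as \<open>young\<close> expects.\<close>
 have flip: "bij_betw (%m. l - m) La La" if "l \<in> La" for l
  by (rule bij_betwI[where g = "%m. l - m"]) (use that diff_mem in auto)
 have Y3: "(%m. A m * b (l - m)) summable_on La"
  "(\<Sum>\<^sub>\<infinity>m\<in>La. A m * b (l - m)) = (\<Sum>\<^sub>\<infinity>m\<in>La. b m * A (l - m))" if "l \<in> La" for l
  using summable_on_reindex_bij_betw[OF flip[OF that], of "%m. A m * b (l - m)"]
   infsum_reindex_bij_betw[OF flip[OF that], of "%m. A m * b (l - m)"] Y2(1)[OF that]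
  by (simp_all add: mult.commute)
 define C where "C l = 2 powr t * ((\<Sum>\<^sub>\<infinity>m\<in>La. a m * B (l - m)) + (\<Sum>\<^sub>\<infinity>m\<in>La. b m * A (l - m)))" for l
 have termle: "weight l powr (t / 2) * cmod (fc f m * fc g (l - m)) \<le>
   2 powr t * (a m * B (l - m) + A m * b (l - m))" if "l \<in> La" for l m
 proof (cases "norm (l - m) \<le> norm m")
  case True
  \<comment> \<open>The excess \<open>s - t\<close> of regularity is transferred from the smaller
    frequency to the larger one.\<close>
  have "weight m powr (t / 2) * weight (l - m) powr (s / 2) \<le> weight m powr (s / 2) * weight (l - m) powr (t / 2)"
  proof -
   have "weight (l - m) \<le> weight m" using True by (simp add: power_mono)
   hence "weight (l - m) powr ((s - t) / 2) \<le> weight m powr ((s - t) / 2)"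
    using t weight_pos[of "l - m"] by (intro powr_mono2) auto
   hence "weight m powr (t / 2) * (weight (l - m) powr (t / 2) * weight (l - m) powr ((s - t) / 2)) \<le>
     weight m powr (t / 2) * (weight (l - m) powr (t / 2) * weight m powr ((s - t) / 2))"
    by (intro mult_left_mono) auto
   moreover have "x powr (s / 2) = x powr (t / 2) * x powr ((s - t) / 2)" for x :: real
    by (simp add: diff_divide_distrib flip: powr_add)
   ultimately show ?thesis by (simp add: ac_simps)
  qed
  hence "weight m powr (t / 2) * (weight (l - m) powr (s / 2) * weight (l - m) powr (- s / 2)) \<le>
    weight m powr (s / 2) * weight (l - m) powr (t / 2) * weight (l - m) powr (- s / 2)"
   unfolding mult.assoc[symmetric] by (intro mult_right_mono) auto
  hence w: "weight m powr (t / 2) \<le> weight m powr (s / 2) * (weight (l - m) powr (- s / 2) * weight (l - m) powr (t / 2))"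
   using weight_pos[of "l - m"] by (simp add: ac_simps flip: powr_add)
  have "weight l powr (t / 2) * cmod (fc f m * fc g (l - m)) \<le>
    2 powr t * weight m powr (t / 2) * cmod (fc f m * fc g (l - m))"
   by (intro mult_right_mono weight_triangle True t) auto
  also have "... = 2 powr t * (weight m powr (t / 2) * (a m * cmod (fc g (l - m))))"
   by (simp add: a_def norm_mult)
  also have "... \<le> 2 powr t * (weight m powr (s / 2) * (weight (l - m) powr (- s / 2) * weight (l - m) powr (t / 2))
    * (a m * cmod (fc g (l - m))))"
   by (intro mult_left_mono mult_right_mono w) (auto simp: nonneg)
  also have "... = 2 powr t * (A m * b (l - m))" by (simp add: A_def b_def B_def ac_simps)
  also have "... \<le> 2 powr t * (a m * B (l - m) + A m * b (l - m))" by (simp add: nonneg)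
  finally show ?thesis .
 next
  case False
  hence "norm (l - (l - m)) \<le> norm (l - m)" by simp
  have "weight l powr (t / 2) * cmod (fc f m * fc g (l - m)) \<le>
    2 powr t * weight (l - m) powr (t / 2) * cmod (fc f m * fc g (l - m))"
   using False by (intro mult_right_mono weight_triangle t) auto
  also have "... = 2 powr t * (a m * B (l - m))" by (simp add: a_def B_def norm_mult ac_simps)
  also have "... \<le> 2 powr t * (a m * B (l - m) + A m * b (l - m))" by (simp add: nonneg)
  finally show ?thesis .
 qed
 have bound: "weight l powr (t / 2) * cmod (fc (%th. f th * g th) l) \<le> C l" if l: "l \<in> La" for l
 proof -
  let ?w = "weight l powr (t / 2)"
  let ?h = "%m. 2 powr t * (a m * B (l - m) + A m * b (l - m))"
  have h: "?h summable_on La" by (intro summable_on_cmult_right summable_on_add Y1 Y3 l)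
  have s: "(%m. ?w * cmod (fc f m * fc g (l - m))) summable_on La"
   by (rule summable_on_comparison_test[OF h termle[OF l]]) simp
  have s': "(%m. cmod (fc f m * fc g (l - m))) summable_on La"
   using summable_on_cmult_right[OF s, of "1 / ?w"] weight_pos[of l] by simp
  have "?w * cmod (fc (%th. f th * g th) l) \<le> ?w * (\<Sum>\<^sub>\<infinity>m\<in>La. cmod (fc f m * fc g (l - m)))"
   using norm_infsum_bound[OF s'] infsumI[OF fourier_mult[OF tf c tg l]] by (simp add: mult_left_mono)
  also have "... = (\<Sum>\<^sub>\<infinity>m\<in>La. ?w * cmod (fc f m * fc g (l - m)))"
   by (simp add: infsum_cmult_right')
  also have "... \<le> infsum ?h La" by (rule infsum_mono[OF s h termle[OF l]])
  also have "... = C l"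
   by (simp add: C_def infsum_cmult_right' infsum_add[OF Y1(1)[OF l] Y3(1)[OF l]] Y3(2)[OF l])
  finally show ?thesis .
 qed
 have C2: "(%l. (C l)\<^sup>2) summable_on La"
 proof (rule summable_on_comparison_test)
  let ?x = "%l. (\<Sum>\<^sub>\<infinity>m\<in>La. a m * B (l - m))" and ?y = "%l. (\<Sum>\<^sub>\<infinity>m\<in>La. b m * A (l - m))"
  show "(%l. (2 powr t)\<^sup>2 * 2 * ((?x l)^2 + (?y l)^2)) summable_on La"
   by (intro summable_on_cmult_right summable_on_add Y1 Y2)
  show "(C l)^2 \<le> (2 powr t)^2 * 2 * ((?x l)^2 + (?y l)^2)" for l
  proof -
   have "(?x l + ?y l)^2 \<le> 2 * ((?x l)^2 + (?y l)^2)"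
    using sum_squares_bound[of "?x l" "?y l"] by (simp add: power2_sum)
   thus ?thesis unfolding C_def power_mult_distrib mult.assoc by (intro mult_left_mono) auto
  qed
 qed simp
 have "(%l. weight l powr t * (cmod (fc (%th. f th * g th) l))^2) summable_on La"
 proof (rule summable_on_comparison_test[OF C2])
  fix l assume "l \<in> La"
  hence "(weight l powr (t / 2) * cmod (fc (%th. f th * g th) l))^2 \<le> (C l)^2"
   by (intro power_mono bound) auto
  thus "weight l powr t * (cmod (fc (%th. f th * g th) l))^2 \<le> (C l)^2" by (simp only: sq)
 qed simp
 thus ?thesis using tf tg by (simp add: Hs_def tcont_mult)
qed

lemma Hs_add: assumes "Hs t f" "Hs t g" shows "Hs t (%th. f th + g th)"
proof -
 have tf: "tcont f" and tg: "tcont g" using assms by (auto simp: Hs_def)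
 have "(%l. weight l powr t * (cmod (fc (%th. f th + g th) l))^2) summable_on La"
 proof (rule summable_on_comparison_test)
  show "(%l. 2 * (weight l powr t * (cmod (fc f l))^2 + weight l powr t * (cmod (fc g l))^2)) summable_on La"
   using assms by (intro summable_on_cmult_right summable_on_add) (auto simp: Hs_def)
  fix l assume l: "l \<in> La"
  have "(cmod (fc f l + fc g l))^2 \<le> (cmod (fc f l) + cmod (fc g l))^2"
   by (intro power_mono norm_triangle_ineq) auto
  also have "... \<le> 2 * ((cmod (fc f l))^2 + (cmod (fc g l))^2)"
   using sum_squares_bound[of "cmod (fc f l)" "cmod (fc g l)"] by (simp add: power2_sum)
  finally have "weight l powr t * (cmod (fc f l + fc g l))^2 \<le>
    weight l powr t * (2 * ((cmod (fc f l))^2 + (cmod (fc g l))^2))"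
   by (rule mult_left_mono) simp
  thus "weight l powr t * (cmod (fc (%th. f th + g th) l))^2 \<le>
    2 * (weight l powr t * (cmod (fc f l))^2 + weight l powr t * (cmod (fc g l))^2)"
   by (simp add: fourier_add[OF tf tg l] algebra_simps)
 qed simp
 thus ?thesis using tf tg by (simp add: Hs_def tcont_add)
qed

lemma Hs_trig: "trig f ==> Hs t f"
 using trig_sobolev[of f \<infinity>] by (simp add: sobolev_iff)

lemma Hs_cmult: assumes "Hs t f" shows "Hs t (%th. c * f th)"
proof -
 have tf: "tcont f" using assms by (auto simp: Hs_def)
 have "(%l. (cmod c)\<^sup>2 * (weight l powr t * (cmod (fc f l))^2)) summable_on La"
  using assms by (intro summable_on_cmult_right) (auto simp: Hs_def)
 hence "(%l. weight l powr t * (cmod (fc (%th. c * f th) l))^2) summable_on La"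
  by (rule summable_on_cong[THEN iffD1, rotated])
   (simp add: fourier_cmult[OF tf] norm_mult power_mult_distrib)
 thus ?thesis using tf by (simp add: Hs_def tcont_mult tcont_const)
qed

lemma Hs_sum: "(\<And>i. i \<in> I ==> Hs t (f i)) ==> Hs t (%th. \<Sum>i\<in>I. f i th)"
 by (induction I rule: infinite_finite_induct) (auto intro: Hs_add Hs_trig trig_const)

lemma fourier_cnj:
 assumes "tcont f" "l \<in> La" shows "fc (%th. cnj (f th)) l = cnj (fc f (- l))"
proof -
 have "(%th. cnj (f th) * cis (- (l \<bullet> th))) = (%th. cnj (f th * cis (- ((- l) \<bullet> th))))"
  by (simp add: fun_eq_iff cis_cnj)
 thus ?thesis
  unfolding fourier_eq
  using avg_bounded_linear[OF bounded_linear_cnj tcont_mult[OF assms(1) tcont_cis_minus[OF uminus_mem[OF assms(2)]]]]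
  by simp
qed

lemma Hs_cnj: assumes "Hs t f" shows "Hs t (%th. cnj (f th))"
proof -
 have tf: "tcont f" using assms by (auto simp: Hs_def)
 have bij: "bij_betw uminus La La"
  by (rule bij_betwI[where g = uminus]) (use uminus_mem in auto)
 have "(%l. weight (- l) powr t * (cmod (fc f (- l)))^2) summable_on La"
  using assms by (subst summable_on_reindex_bij_betw[OF bij]) (simp add: Hs_def)
 hence "(%l. weight l powr t * (cmod (fc (%th. cnj (f th)) l))^2) summable_on La"
  by (rule summable_on_cong[THEN iffD1, rotated]) (simp add: fourier_cnj[OF tf])
 thus ?thesis using tf by (simp add: Hs_def tcont_cnj)
qed

section \<open>Differentiation and gain of regularity\<close>

lemma fourier_deriv:
 assumes f: "tcont f" and D: "tcont D" and deriv: "\<And>th. (f has_derivative f' th) (at th)"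
  and f'v: "\<And>th. f' th v = D th" and l: "l \<in> La"
 shows "fc D l = \<i> * of_real (l \<bullet> v) * fc f l"
proof -
 have e: "((%th. f th * cis ((- l) \<bullet> th)) has_derivative
   (%v. f th * (\<i> * of_real ((- l) \<bullet> v) * cis ((- l) \<bullet> th)) + f' th v * cis ((- l) \<bullet> th))) (at th)" for th
  by (rule has_derivative_mult[OF deriv has_derivative_cis_inner])
 have t1: "tcont (%th. f th * cis (- (l \<bullet> th)))" and t2: "tcont (%th. D th * cis (- (l \<bullet> th)))"
  by (intro tcont_mult f D tcont_cis_minus l)+
 have "avg (%th. (- (\<i> * of_real (l \<bullet> v))) * (f th * cis (- (l \<bullet> th))) + D th * cis (- (l \<bullet> th))) = 0"
 proof (rule avg_deriv_eq_0[OF _ _ e, where v = v])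
  show "tcont (%th. f th * cis (- l \<bullet> th))" using t1 by simp
 qed (auto intro!: tcont_diff tcont_mult tcont_const f D tcont_cis_minus l simp: f'v)
 hence "- (\<i> * of_real (l \<bullet> v)) * avg (%th. f th * cis (- (l \<bullet> th))) + avg (%th. D th * cis (- (l \<bullet> th))) = 0"
  unfolding avg_add[OF tcont_mult[OF tcont_const t1] t2] avg_mult[OF t1] .
 thus ?thesis unfolding fourier_eq by (simp add: add_eq_0_iff)
qed

text \<open>The squares of \<open>l \<bullet> b\<close> over the standard basis add up to the
  squared norm of \<open>l\<close>. For \<open>l \<noteq> 0\<close> this is comparable to the
  weight, because lattice vectors are bounded away from 0; the constant mode is estimated
  apart.\<close>

lemma Hs_Suc:
 assumes f: "tcont f" and D: "\<And>b. b \<in> Basis ==> Hs t (D b)"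
  and fD: "\<And>b l. b \<in> Basis ==> l \<in> La ==> fc (D b) l = \<i> * of_real (l \<bullet> b) * fc f l"
 shows "Hs (t + 1) f"
proof -
 obtain eps where eps: "eps > 0" "\<And>l. l \<in> La ==> l \<noteq> 0 ==> eps \<le> norm l" using separated by blast
 define C where "C = 1 + 1 / eps\<^sup>2"
 have "(%l. weight l powr (t + 1) * (cmod (fc f l))^2) summable_on La"
 proof (rule summable_on_comparison_test)
  have "(%l. if l = 0 then (cmod (fc f l))\<^sup>2 else 0) summable_on La"
   by (rule summable_on_cong_neutral[THEN iffD1, OF _ _ _ summable_on_finite[of "{0}"]])
    (use zero_mem in auto)
  thus "(%l. (if l = 0 then (cmod (fc f l))\<^sup>2 else 0) +
    C * (\<Sum>b\<in>Basis. weight l powr t * (cmod (fc (D b) l))^2)) summable_on La"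
   using D by (intro summable_on_add summable_on_cmult_right summable_on_sum) (auto simp: Hs_def)
  fix l assume l: "l \<in> La"
  have "(\<Sum>b\<in>Basis. weight l powr t * (cmod (fc (D b) l))^2) =
    weight l powr t * (\<Sum>b\<in>Basis. (l \<bullet> b)\<^sup>2 * (cmod (fc f l))^2)"
   by (simp add: fD[OF _ l] norm_mult power_mult_distrib sum_distrib_left)
  also have "... = weight l powr t * ((norm l)^2 * (cmod (fc f l))^2)"
   unfolding sum_distrib_right[symmetric] power2_norm_eq_inner[of l]
   by (subst (2) euclidean_inner) (simp add: power2_eq_square)
  finally have e: "(\<Sum>b\<in>Basis. weight l powr t * (cmod (fc (D b) l))^2) =
   weight l powr t * ((norm l)^2 * (cmod (fc f l))^2)" .
  show "weight l powr (t + 1) * (cmod (fc f l))^2 \<le> (if l = 0 then (cmod (fc f l))\<^sup>2 else 0) +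
    C * (\<Sum>b\<in>Basis. weight l powr t * (cmod (fc (D b) l))^2)"
  proof (cases "l = 0")
   case True
   have "0 \<le> C * (\<Sum>b\<in>Basis. weight l powr t * (cmod (fc (D b) l))^2)"
    by (intro mult_nonneg_nonneg sum_nonneg) (auto simp: C_def)
   thus ?thesis using True by simp
  next
   case False
   have "eps\<^sup>2 \<le> (norm l)^2" using eps(1) eps(2)[OF l False] by (intro power_mono) auto
   hence "weight l \<le> C * (norm l)^2" using eps(1) by (simp add: C_def field_simps)
   hence "weight l powr t * weight l * (cmod (fc f l))^2 \<le>
     weight l powr t * (C * (norm l)^2) * (cmod (fc f l))^2"
    by (intro mult_right_mono mult_left_mono) auto
   thus ?thesis using False weight_pos[of l] unfolding e by (simp add: powr_add ac_simps)
  qed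
 qed simp
 thus ?thesis using f by (simp add: Hs_def)
qed

text \<open>One order is spent on the factor \<open>norm l\<close>, so the differentiated series
  still converges absolutely. A finite part is differentiated classically, and the tail is small
  relative to the increment, uniformly in it.\<close>

lemma Hs_differentiable:
 assumes f: "Hs t f" and t: "real (dim La) / 2 + 1 < t"
 obtains f' where "\<And>th. (f has_derivative f' th) (at th)" "\<And>v. tcont (%th. f' th v)"
proof -
 have tf: "tcont f" using f by (simp add: Hs_def)
 define c where "c = fc f"
 have c: "(%l. cmod (c l)) summable_on La" unfolding c_def by (rule Hs_fourier_summable[OF f]) (use t in linarith)
 have lc: "(%l. norm l * cmod (c l)) summable_on La"
 proof (rule summable_on_comparison_test)
  show "(%l. weight l powr t * (cmod (c l))^2 + weight l powr (- (t - 1))) summable_on La"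
   using f t by (intro summable_on_add summable_lattice_powr) (simp_all add: Hs_def c_def)
  fix l
  define a where "a = weight l powr (t / 2) * cmod (c l)"
  define b where "b = weight l powr (- (t - 1) / 2)"
  have "norm l \<le> weight l powr (1 / 2)" using weight_pos[of l] by (simp add: powr_half_sqrt real_le_rsqrt)
  hence "norm l * cmod (c l) \<le> weight l powr (1 / 2) * cmod (c l)" by (rule mult_right_mono) simp
  also have "... = a * b"
  proof -
   have "weight l powr (t / 2) * weight l powr (- (t - 1) / 2) = weight l powr (1 / 2)"
    by (simp only: powr_add[symmetric]) (simp add: field_simps)
   thus ?thesis by (simp add: a_def b_def ac_simps)
  qed
  also have "... \<le> a\<^sup>2 + b\<^sup>2" using sum_squares_bound[of a b] zero_le_power2[of a] zero_le_power2[of b]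
   unfolding mult.assoc by linarith
  also have "a\<^sup>2 = weight l powr t * (cmod (c l))^2" using weight_pos[of l] by (simp add: a_def power_mult_distrib powr_power)
  also have "b\<^sup>2 = weight l powr (- (t - 1))" unfolding b_def by (rule powr_half_sq[OF weight_pos])
  finally show "norm l * cmod (c l) \<le> weight l powr t * (cmod (c l))^2 + weight l powr (- (t - 1))" .
 qed simp
 define E where "E v l = \<i> * of_real (l \<bullet> v) * c l" for v l
 have E: "(%l. cmod (E v l)) summable_on La" for v
 proof (rule summable_on_comparison_test)
  show "(%l. norm v * (norm l * cmod (c l))) summable_on La" by (intro summable_on_cmult_right lc)
  show "cmod (E v l) \<le> norm v * (norm l * cmod (c l))" for l
   using mult_right_mono[OF Cauchy_Schwarz_ineq2[of l v], of "cmod (c l)"] by (simp add: E_def norm_mult ac_simps)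
 qed simp
 define f' where "f' th v = (\<Sum>\<^sub>\<infinity>l\<in>La. E v l * cis (l \<bullet> th))" for th v
 have sumE: "(%l. E v l * cis (l \<bullet> th)) summable_on La" for v th
  by (rule abs_summable_summable) (simp add: norm_mult E)
 have sumc: "(%l. c l * cis (l \<bullet> th)) summable_on La" for th
  by (rule abs_summable_summable) (simp add: norm_mult c)
 have f_eq: "f th = (\<Sum>\<^sub>\<infinity>l\<in>La. c l * cis (l \<bullet> th))" for th
  using fourier_inversion[OF tf] c by (simp add: c_def)
 have "tcont (%th. f' th v)" for v unfolding f'_def by (rule tcont_fourier_series[OF E])
 moreover have "(f has_derivative f' th) (at th)" for th
  unfolding has_derivative_at_alt
 proof (intro conjI allI impI)
  have "linear (f' th)"
  proof (rule linearI)
   show "f' th (x + y) = f' th x + f' th y" for x y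
    unfolding f'_def using infsum_add[OF sumE[of x th] sumE[of y th]]
    by (simp add: E_def inner_add_right algebra_simps)
   show "f' th (r *\<^sub>R x) = r *\<^sub>R f' th x" for r x
    unfolding f'_def by (simp add: E_def scaleR_conv_of_real ac_simps flip: infsum_cmult_right')
  qed
  thus "bounded_linear (f' th)" by (simp add: linear_linear)
  fix eps :: real assume "eps > 0"
  \<comment> \<open>Bound, per unit of increment, for the remainder of one term: the increment of
    the character and its linear part contribute \<open>norm l * cmod (c l)\<close> each.\<close>
  define G where "G l = 2 * (norm l * cmod (c l))" for l
  have G: "G summable_on La" unfolding G_def by (intro summable_on_cmult_right lc)
  obtain X where X: "finite X" "X \<subseteq> La" "dist (sum G X) (infsum G La) \<le> eps / 2"
   using infsum_finite_approximation[OF G, of "eps / 2"] \<open>eps > 0\<close> by auto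
  define r where "r l h = c l * cis (l \<bullet> (th + h)) - c l * cis (l \<bullet> th) - E h l * cis (l \<bullet> th)" for l h
  have "((%et. \<Sum>l\<in>X. c l * cis (l \<bullet> et)) has_derivative (%v. \<Sum>l\<in>X. E v l * cis (l \<bullet> th))) (at th)"
   by (auto intro!: derivative_eq_intros has_derivative_cis_inner
     simp: E_def scaleR_conv_of_real ac_simps)
  then obtain dl where dl: "dl > 0" "\<And>h. norm h < dl ==> norm (\<Sum>l\<in>X. r l h) \<le> eps / 2 * norm h"
  proof -
   assume a: "\<And>dl. 0 < dl ==> (\<And>h. norm h < dl ==> norm (\<Sum>l\<in>X. r l h) \<le> eps / 2 * norm h) ==> thesis"
   assume "((%et. \<Sum>l\<in>X. c l * cis (l \<bullet> et)) has_derivative (%v. \<Sum>l\<in>X. E v l * cis (l \<bullet> th))) (at th)"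
   then obtain dl where dl: "dl > 0" "\<And>et. norm (et - th) < dl ==> norm ((\<Sum>l\<in>X. c l * cis (l \<bullet> et)) -
     (\<Sum>l\<in>X. c l * cis (l \<bullet> th)) - (\<Sum>l\<in>X. E (et - th) l * cis (l \<bullet> th))) \<le> eps / 2 * norm (et - th)"
    unfolding has_derivative_at_alt using half_gt_zero[OF \<open>eps > 0\<close>] by blast
   show thesis using dl(2)[of "th + _"] by (intro a[OF dl(1)]) (simp add: r_def sum_subtractf)
  qed
  have "norm (f et - f th - f' th (et - th)) \<le> eps * norm (et - th)" if "norm (et - th) < dl" for et
  proof -
   define h where "h = et - th"
   have "((%l. r l h) has_sum (f (th + h) - f th - f' th h)) La"
    unfolding r_def f_eq f'_def by (intro has_sum_diff has_sum_infsum sumc sumE)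
   hence sr: "(%l. r l h) summable_on La" and "f et - f th - f' th h = (\<Sum>\<^sub>\<infinity>l\<in>La. r l h)"
    by (auto simp: h_def summable_on_def infsumI)
   note this(2)
   also have "... = (\<Sum>l\<in>X. r l h) + (\<Sum>\<^sub>\<infinity>l\<in>La - X. r l h)"
    using infsum_Diff[OF sr summable_on_finite[OF X(1)] X(2)] X(1) by simp
   finally have e: "f et - f th - f' th h = (\<Sum>l\<in>X. r l h) + (\<Sum>\<^sub>\<infinity>l\<in>La - X. r l h)" .
   have rb: "norm (r l h) \<le> norm h * G l" for l
   proof -
    have "r l h = c l * (cis (l \<bullet> (th + h)) - cis (l \<bullet> th)) - E h l * cis (l \<bullet> th)"
     by (simp add: r_def algebra_simps)
    also have "norm ... \<le> cmod (c l) * \<bar>l \<bullet> h\<bar> + cmod (c l) * \<bar>l \<bullet> h\<bar>"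
    proof (rule order_trans[OF norm_triangle_ineq4 add_mono])
     show "norm (c l * (cis (l \<bullet> (th + h)) - cis (l \<bullet> th))) \<le> cmod (c l) * \<bar>l \<bullet> h\<bar>"
      unfolding norm_mult using cmod_cis_diff_le[of "l \<bullet> (th + h)" "l \<bullet> th"]
      by (intro mult_left_mono) (simp_all add: inner_add_right)
    qed (simp add: E_def norm_mult)
    also have "... \<le> norm h * G l"
     using mult_left_mono[OF Cauchy_Schwarz_ineq2[of l h], of "cmod (c l)"] by (simp add: G_def ac_simps)
    finally show ?thesis .
   qed
   have GX: "G summable_on La - X" by (rule summable_on_subset_banach[OF G]) auto
   have hG: "(%l. norm h * G l) summable_on La - X" by (intro summable_on_cmult_right GX)
   have abs: "(%l. norm (r l h)) summable_on La - X"
    by (rule summable_on_comparison_test[OF hG rb]) simp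
   have "norm (\<Sum>\<^sub>\<infinity>l\<in>La - X. r l h) \<le> (\<Sum>\<^sub>\<infinity>l\<in>La - X. norm (r l h))" by (rule norm_infsum_bound[OF abs])
   also have "... \<le> (\<Sum>\<^sub>\<infinity>l\<in>La - X. norm h * G l)" by (rule infsum_mono[OF abs hG rb])
   also have "... = norm h * (infsum G La - sum G X)"
    using infsum_Diff[OF G summable_on_finite[OF X(1)] X(2)] X(1) by (simp add: infsum_cmult_right')
   also have "... \<le> norm h * (eps / 2)"
    using X(3) unfolding dist_real_def by (intro mult_left_mono) (linarith, simp)
   finally have "norm (\<Sum>\<^sub>\<infinity>l\<in>La - X. r l h) \<le> norm h * (eps / 2)" .
   moreover have "norm (\<Sum>l\<in>X. r l h) \<le> eps / 2 * norm h" using that by (intro dl(2)) (simp add: h_def)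
   ultimately have "norm (f et - f th - f' th h) \<le> eps * norm h"
    unfolding e using norm_triangle_ineq[of "\<Sum>l\<in>X. r l h" "\<Sum>\<^sub>\<infinity>l\<in>La - X. r l h"] by (simp add: algebra_simps)
   thus ?thesis by (simp add: h_def)
  qed
  thus "\<exists>dl>0. \<forall>et. norm (et - th) < dl \<longrightarrow> norm (f et - f th - f' th (et - th)) \<le> eps * norm (et - th)"
   using dl(1) by blast
 qed
 ultimately show thesis using that by blast
qed

lemma sobolev_tcont: "sobolev La s f ==> tcont f"
 by (simp add: sobolev_iff)

lemma sobolev_add: "sobolev La s f ==> sobolev La s g ==> sobolev La s (%th. f th + g th)"
 by (auto simp: sobolev_iff intro: Hs_add tcont_add)

lemma sobolev_cmult: "sobolev La s f ==> sobolev La s (%th. c * f th)"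
 by (auto simp: sobolev_iff intro: Hs_cmult tcont_mult tcont_const)

lemma sobolev_sum: "(\<And>i. i \<in> I ==> sobolev La s (f i)) ==> sobolev La s (%th. \<Sum>i\<in>I. f i th)"
 by (auto simp: sobolev_iff intro: Hs_sum tcont_sum)

lemma sobolev_cnj: "sobolev La s f ==> sobolev La s (%th. cnj (f th))"
 by (auto simp: sobolev_iff intro: Hs_cnj tcont_cnj)

text \<open>\<open>Hs_mult\<close> asks for one real order that lies above half the rank and above
  \<open>t\<close>, also when \<open>s\<close> is infinite.\<close>

lemma sobolev_order_between:
 assumes "ereal (real (dim La) / 2) < s" "ereal t \<le> s"
 obtains t' where "real (dim La) / 2 < t'" "t \<le> t'" "ereal t' \<le> s"
proof -
 obtain r where r: "ereal (real (dim La) / 2) < ereal r" "ereal r < s" using ereal_dense2[OF assms(1)] by blast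
 show ?thesis using r assms(2) by (intro that[of "max r t"]) (auto simp: max_def)
qed

lemma Hs_mult_sobolev:
 assumes f: "sobolev La s f" and s: "ereal (real (dim La) / 2) < s" and g: "Hs t g" and t: "0 \<le> t" "ereal t \<le> s"
 shows "Hs t (%th. f th * g th)"
proof -
 obtain t' where t': "real (dim La) / 2 < t'" "t \<le> t'" "ereal t' \<le> s"
  using sobolev_order_between[OF s t(2)] by blast
 thus ?thesis using f g t by (intro Hs_mult[of t' f t g]) (auto simp: sobolev_iff)
qed

lemma sobolev_mult:
 assumes s: "ereal (real (dim La) / 2) < s" and f: "sobolev La s f" and g: "sobolev La s g"
 shows "sobolev La s (%th. f th * g th)"
 unfolding sobolev_iff
proof (intro conjI allI impI)
 show "tcont (%th. f th * g th)" using f g by (intro tcont_mult) (auto simp: sobolev_iff)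
 fix t assume t: "ereal t \<le> s"
 obtain t' where t': "real (dim La) / 2 < t'" "t \<le> t'" "ereal t' \<le> s"
  using sobolev_order_between[OF s t] by blast
 hence "Hs t' (%th. f th * g th)" using f g
  by (intro Hs_mult_sobolev[OF f s]) (auto simp: sobolev_iff intro: order_trans[OF _ less_imp_le[OF t'(1)]])
 thus "Hs t (%th. f th * g th)" using t'(2) by (rule Hs_mono)
qed

end

section \<open>Zero moment map implies flatness\<close>

lemma entry_has_derivative:
 fixes f :: "'q::euclidean_space => complex^'n::finite^'m::finite"
 assumes "\<And>h k. ((%th. f th $ h $ k) has_derivative (%v. f' v $ h $ k)) (at th)"
 shows "(f has_derivative f') (at th)"
 unfolding has_derivative_componentwise_within[of f]
 by (auto simp: Basis_vec_def inner_axis intro!: has_derivative_inner_left assms)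

lemma continuous_on_entries:
 "continuous_on S (f :: 'a::topological_space => complex^'n::finite^'m::finite) \<longleftrightarrow>
  (\<forall>h k. continuous_on S (%th. f th $ h $ k))"
proof
 assume "\<forall>h k. continuous_on S (%th. f th $ h $ k)"
 hence "continuous_on S (%th. \<chi> h k. f th $ h $ k)" by (intro continuous_on_vec_lambda) auto
 thus "continuous_on S f" by simp
qed (auto intro: continuous_intros)

lemma commutator_simps:
 "commutator (a + b) c = commutator a c + commutator b c"
 "commutator c (a + b) = commutator c a + commutator c b"
 "commutator (r *\<^sub>R a) c = r *\<^sub>R commutator a c"
 "commutator c (r *\<^sub>R a) = r *\<^sub>R commutator c a"
 "commutator a a = 0" "commutator a 0 = 0" "commutator 0 a = 0"
 by (simp_all add: commutator_def mm.add_left mm.add_right mm.scaleR_left mm.scaleR_right algebra_simps)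

lemma commutator_swap: "commutator a b = - commutator b a"
 by (simp add: commutator_def)

lemma adj_commutator: "adj a = - a ==> adj b = - b ==> adj (commutator a b) = - commutator a b"
 by (simp add: commutator_def adj_diff adj_mult mm.minus_left mm.minus_right)

lemma bounded_bilinear_commutator:
 "bounded_bilinear (commutator :: complex^'n::finite^'n => complex^'n^'n => complex^'n^'n)"
proof (rule bounded_bilinear.intro)
 have "norm (commutator a b) \<le> norm a * norm b * 2" for a b :: "complex^'n^'n"
  unfolding commutator_def
  using norm_triangle_ineq4[of "a ** b" "b ** a"] norm_matrix_mult_le[of a b] norm_matrix_mult_le[of b a]
  by (simp add: mult.commute)
 thus "\<exists>K. \<forall>a b :: complex^'n^'n. norm (commutator a b) \<le> norm a * norm b * K" by blast
qed (simp_all add: commutator_simps)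

interpretation cm: bounded_bilinear
 "commutator :: complex^'n::finite^'n => complex^'n^'n => complex^'n^'n"
 by (rule bounded_bilinear_commutator)

lemma torus_integral_eq:
 "discrete_subgroup La ==> torus_integral La f = torus_vol La *\<^sub>R discrete_subgroup.avg La f"
 using discrete_subgroup.torus_vol_pos[of La] by (simp add: discrete_subgroup.avg_def)

context discrete_subgroup begin

lemma tcont_entries:
 "tcont (f :: 'q => complex^'n::finite^'m::finite) \<longleftrightarrow> (\<forall>h k. tcont (%th. f th $ h $ k))"
 unfolding tcont_def torus_fun_iff continuous_on_entries[of UNIV f] vec_eq_iff by blast

lemma tcont_matrix_mult:
 "tcont f ==> tcont g ==> tcont (%th. (f th :: complex^'n::finite^'n) ** (g th :: complex^'n^'n))"
 by (auto simp: tcont_def torus_fun_iff intro!: mm.continuous_on)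

lemma tcont_commutator:
 "tcont f ==> tcont g ==> tcont (%th. commutator (f th) (g th :: complex^'n::finite^'n))"
 unfolding commutator_def by (intro tcont_diff tcont_matrix_mult)

lemma tcont_inner:
 "tcont f ==> tcont g ==> tcont (%th. f th \<bullet> (g th :: 'b::real_inner))"
 by (auto simp: tcont_def torus_fun_iff intro!: continuous_intros)

lemma tcont_trace: "tcont f ==> tcont (%th. trace (f th :: complex^'n::finite^'n))"
 by (rule tcont_bounded_linear[OF bounded_linear_trace])

section \<open>Matrix-valued trigonometric polynomials and the Chern form\<close>

definition mtrig :: "('q => complex^'n::finite^'n) => bool" where
 "mtrig f \<longleftrightarrow> (\<forall>h k. trig (%th. f th $ h $ k))"

lemma mtrig_tcont: "mtrig f ==> tcont f"
 by (simp add: tcont_entries mtrig_def trig_tcont)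

lemma mtrig_has_derivative:
 assumes "mtrig f"
 shows "(f has_derivative (%v. dir_deriv v f th)) (at th)"
  "dir_deriv v f th $ h $ k = dir_deriv v (%th. f th $ h $ k) th"
proof -
 have d: "(f has_derivative (%v. \<chi> h k. dir_deriv v (%th. f th $ h $ k) th)) (at th)"
  by (rule entry_has_derivative) (use assms in \<open>auto simp: mtrig_def intro: trig_has_derivative\<close>)
 thus "dir_deriv v f th $ h $ k = dir_deriv v (%th. f th $ h $ k) th" by (simp add: dir_deriv_eq)
 show "(f has_derivative (%v. dir_deriv v f th)) (at th)"
  using dir_deriv_eq[OF d] d by simp
qed

lemma mtrig_dir_deriv: "mtrig f ==> mtrig (dir_deriv v f)"
 using trig_dir_deriv(1) by (auto simp: mtrig_def mtrig_has_derivative(2))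

lemma mtrig_dir_deriv_commute: "mtrig f ==> dir_deriv v (dir_deriv w f) = dir_deriv w (dir_deriv v f)"
proof -
 assume f: "mtrig f"
 have e: "(%th. dir_deriv w f th $ h $ k) = dir_deriv w (%th. f th $ h $ k)" for w h k
  by (rule ext) (rule mtrig_has_derivative(2)[OF f])
 show ?thesis
  using f mtrig_dir_deriv[OF f]
  by (auto simp: fun_eq_iff vec_eq_iff mtrig_has_derivative(2) e mtrig_def trig_dir_deriv_commute)
qed

lemma mtrig_mult: "mtrig f ==> mtrig g ==> mtrig (%th. f th ** g th)"
 by (auto simp: mtrig_def matrix_mult_nth intro!: trig_sum trig_mult)

lemma mtrig_diff: "mtrig f ==> mtrig g ==> mtrig (%th. f th - g th)"
 by (auto simp: mtrig_def intro!: trig_diff)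

lemma mtrig_commutator: "mtrig f ==> mtrig g ==> mtrig (%th. commutator (f th) (g th))"
 unfolding commutator_def by (intro mtrig_diff mtrig_mult)

definition pair :: "('q => complex^'n::finite^'n) => ('q => complex^'n^'n) => complex" where
 "pair f g = avg (%th. trace (f th ** g th))"

lemma tcont_pair: "tcont f ==> tcont g ==> tcont (%th. trace ((f th :: complex^'n::finite^'n) ** g th))"
 by (intro tcont_trace tcont_matrix_mult)

lemma pair_commute: "pair f g = pair g f"
 unfolding pair_def by (simp add: trace_mult_commute)

lemma pair_add:
 assumes "tcont f" "tcont g" "tcont h"
 shows "pair (%th. f th + g th) h = pair f h + pair g h" "pair h (%th. f th + g th) = pair h f + pair h g"
  "pair (%th. f th - g th) h = pair f h - pair g h" "pair h (%th. f th - g th) = pair h f - pair h g"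
 using assms
 by (simp_all add: pair_def mm.add_left mm.add_right mm.diff_left mm.diff_right trace_add trace_sub
   avg_add avg_diff tcont_pair)

lemma pair_by_parts:
 assumes "mtrig f" "mtrig g" shows "pair (dir_deriv v f) g = - pair f (dir_deriv v g)"
proof -
 have "((%th. trace (f th ** g th)) has_derivative
   (%v. trace (f th ** dir_deriv v g th + dir_deriv v f th ** g th))) (at th)" for th
  by (intro bounded_linear.has_derivative[OF bounded_linear_trace] mm.FDERIV mtrig_has_derivative assms)
 moreover have "tcont (%th. trace (f th ** dir_deriv v g th + dir_deriv v f th ** g th))"
  using assms by (intro tcont_trace tcont_add tcont_matrix_mult mtrig_tcont mtrig_dir_deriv)
 ultimately have "avg (%th. trace (f th ** dir_deriv v g th + dir_deriv v f th ** g th)) = 0"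
  using assms by (intro avg_deriv_eq_0[of "%th. trace (f th ** g th)"] tcont_pair mtrig_tcont) auto
 hence "pair f (dir_deriv v g) + pair (dir_deriv v f) g = 0"
  using assms by (simp add: pair_def trace_add avg_add tcont_pair mtrig_tcont mtrig_dir_deriv)
 thus ?thesis by (simp add: add_eq_0_iff)
qed

text \<open>Two integrations by parts, since mixed derivatives of trigonometric polynomials commute.
  It cancels the terms of the Chern form with two derivatives.\<close>

lemma pair_swap:
 assumes "mtrig f" "mtrig g"
 shows "pair (dir_deriv v f) (dir_deriv w g) = pair (dir_deriv w f) (dir_deriv v g)"
 using assms by (simp add: pair_by_parts mtrig_dir_deriv mtrig_dir_deriv_commute[of g v w])

text \<open>The second Chern form \<open>tr F \<and> F\<close> is exact; in components, the terms of each order in the connection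
 integrate to zero separately.\<close>

lemma chern_form_avg_eq_0:
 fixes B :: "nat => 'q => complex^'n::finite^'n" and u :: "nat => 'q"
 assumes B: "\<And>i. mtrig (B i)"
 defines "F \<equiv> %i j th. dir_deriv (u i) (B j) th - dir_deriv (u j) (B i) th + commutator (B i th) (B j th)"
 shows "pair (F 0 1) (F 2 3) + pair (F 0 2) (F 3 1) + pair (F 0 3) (F 1 2) = 0"
proof -
 define d where "d i j = dir_deriv (u i) (B j)" for i j
 define c where "c i j = (%th. commutator (B i th) (B j th))" for i j
 have md: "mtrig (d i j)" and mc: "mtrig (c i j)" for i j
  unfolding d_def c_def by (intro mtrig_dir_deriv mtrig_commutator B)+
 note t = mtrig_tcont[OF md] mtrig_tcont[OF mc] tcont_diff tcont_add
 have F: "F i j = (%th. d i j th - d j i th + c i j th)" for i j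
  by (simp add: F_def d_def c_def)
 \<comment> \<open>Sorted by order in the connection: four terms with two derivatives, four with a
   derivative and a commutator, and one with two commutators.\<close>
 have exp: "pair (F i j) (F k l) = pair (d i j) (d k l) - pair (d i j) (d l k) - pair (d j i) (d k l)
   + pair (d j i) (d l k) + (pair (d i j) (c k l) - pair (d j i) (c k l)
   + pair (d k l) (c i j) - pair (d l k) (c i j)) + pair (c i j) (c k l)" for i j k l
  unfolding F
  by (simp add: pair_add t pair_commute[of "c i j" "d k l"] pair_commute[of "c i j" "d l k"])
 have sw: "pair (d i j) (d k l) = pair (d k j) (d i l)" for i j k l
  unfolding d_def by (rule pair_swap[OF B B])
 have quad: "pair (d 0 1) (d 2 3) = pair (d 0 3) (d 2 1)" "pair (d 0 1) (d 3 2) = pair (d 0 2) (d 3 1)"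
  "pair (d 1 0) (d 2 3) = pair (d 2 0) (d 1 3)" "pair (d 1 0) (d 3 2) = pair (d 3 0) (d 1 2)"
  "pair (d 0 2) (d 1 3) = pair (d 0 3) (d 1 2)" "pair (d 2 0) (d 3 1) = pair (d 3 0) (d 2 1)"
  using sw by (metis pair_commute)+
 \<comment> \<open>Integration by parts moves the derivative along \<open>u i\<close> onto the
   commutator; the Leibniz rule and cyclicity of the trace then produce the other two terms of the
   cyclic sum.\<close>
 have cub: "pair (d i j) (c k l) + pair (d i k) (c l j) + pair (d i l) (c j k) = 0" for i j k l
 proof -
  have "((%th. commutator (B k th) (B l th)) has_derivative
    (%v. commutator (B k th) (dir_deriv v (B l) th) + commutator (dir_deriv v (B k) th) (B l th))) (at th)" for th
   by (intro cm.FDERIV mtrig_has_derivative B)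
  from dir_deriv_eq[OF this]
  have "dir_deriv (u i) (c k l) = (%th. commutator (B k th) (d i l th) + commutator (d i k th) (B l th))"
   by (simp add: c_def d_def fun_eq_iff)
  hence "pair (d i j) (c k l) =
    - pair (B j) (%th. commutator (B k th) (d i l th) + commutator (d i k th) (B l th))"
   unfolding d_def using pair_by_parts[OF B mc] by simp
  also have "... = - (pair (B j) (%th. commutator (B k th) (d i l th)) + pair (B j) (%th. commutator (d i k th) (B l th)))"
   by (subst pair_add(2)) (intro tcont_commutator mtrig_tcont[OF B] mtrig_tcont[OF md] refl)+
  also have "pair (B j) (%th. commutator (B k th) (d i l th)) = pair (d i l) (c j k)"
  proof -
   have "trace (B j th ** commutator (B k th) (d i l th)) = trace (d i l th ** c j k th)" for th
    using trace_mult_commute[of "B j th ** B k th" "d i l th"] trace_mult_commute[of "B j th" "d i l th ** B k th"]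
    by (simp add: c_def commutator_def mm.diff_right trace_sub matrix_mul_assoc)
   thus ?thesis by (simp add: pair_def)
  qed
  also have "pair (B j) (%th. commutator (d i k th) (B l th)) = pair (d i k) (c l j)"
  proof -
   have "trace (B j th ** commutator (d i k th) (B l th)) = trace (d i k th ** c l j th)" for th
    using trace_mult_commute[of "B j th ** B l th" "d i k th"] trace_mult_commute[of "B j th" "d i k th ** B l th"]
    by (simp add: c_def commutator_def mm.diff_right trace_sub matrix_mul_assoc)
   thus ?thesis by (simp add: pair_def)
  qed
  finally show ?thesis by simp
 qed
 have anti: "pair (d i j) (c k l) = - pair (d i j) (c l k)" for i j k l
 proof -
  have "trace (d i j th ** c k l th) = - trace (d i j th ** c l k th)" for th
   by (simp add: c_def commutator_def mm.diff_right trace_sub)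
  thus ?thesis by (simp add: pair_def avg_uminus tcont_pair t)
 qed
 \<comment> \<open>The Jacobi identity, once cyclicity of the trace has isolated the factor
   \<open>B 0\<close>.\<close>
 have quart: "pair (c 0 1) (c 2 3) + pair (c 0 2) (c 3 1) + pair (c 0 3) (c 1 2) = 0"
 proof -
  have r: "trace (c i j th ** c k l th) = trace (B i th ** commutator (B j th) (c k l th))" for i j k l th
   using trace_mult_commute[of "B j th" "B i th ** c k l th"]
   by (simp add: c_def[of i j] commutator_def mm.diff_right mm.diff_left trace_sub matrix_mul_assoc)
  have "commutator (B 1 th) (c 2 3 th) + commutator (B 2 th) (c 3 1 th) + commutator (B 3 th) (c 1 2 th) = 0" for th
   by (simp add: c_def commutator_def mm.diff_right mm.diff_left matrix_mul_assoc)
  hence "trace (B 0 th ** (commutator (B 1 th) (c 2 3 th) + commutator (B 2 th) (c 3 1 th) +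
    commutator (B 3 th) (c 1 2 th))) = 0" for th
   by (simp add: trace_def)
  hence "trace (c 0 1 th ** c 2 3 th) + trace (c 0 2 th ** c 3 1 th) + trace (c 0 3 th ** c 1 2 th) = 0" for th
   by (simp add: r mm.add_right trace_add)
  hence "avg (%th. trace (c 0 1 th ** c 2 3 th) + trace (c 0 2 th ** c 3 1 th) + trace (c 0 3 th ** c 1 2 th)) = 0"
   by (simp add: avg_const)
  thus ?thesis
   by (simp add: pair_def avg_add tcont_add tcont_pair t)
 qed
 have "pair (d 1 2) (c 0 3) - pair (d 1 0) (c 2 3) - pair (d 1 3) (c 0 2) = 0"
  using cub[of 1 0 2 3] unfolding anti[of 1 2 0 3] by algebra
 moreover have "pair (d 2 3) (c 0 1) - pair (d 2 0) (c 3 1) - pair (d 2 1) (c 0 3) = 0"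
  using cub[of 2 0 3 1] unfolding anti[of 2 3 0 1] by algebra
 moreover have "pair (d 3 1) (c 0 2) - pair (d 3 0) (c 1 2) - pair (d 3 2) (c 0 1) = 0"
  using cub[of 3 0 1 2] unfolding anti[of 3 1 0 2] by algebra
 ultimately show ?thesis
  unfolding exp quad using cub[of 0 1 2 3] quart by algebra
qed

end

section \<open>Contractions in a quaternionic frame\<close>

locale quaternionic_space =
 fixes J :: "nat => 'q::euclidean_space \<Rightarrow>\<^sub>L 'q"
 assumes dim4: "DIM('q) = 4" and hk: "hyperkaehler J"
begin

declare One_nat_def [simp del]

lemma J_simps:
 shows J_inner: "i \<in> {1,2,3} ==> J i x \<bullet> J i y = x \<bullet> y"
  and J_sq: "i \<in> {1,2,3} ==> J i (J i x) = - x"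
  and J12: "J 1 (J 2 x) = J 3 x" and J21: "J 2 (J 1 x) = - J 3 x"
  and J23: "J 2 (J 3 x) = J 1 x" and J32: "J 3 (J 2 x) = - J 1 x"
  and J31: "J 3 (J 1 x) = J 2 x" and J13: "J 1 (J 3 x) = - J 2 x"
proof -
 show "i \<in> {1,2,3} ==> J i x \<bullet> J i y = x \<bullet> y" for i x y
  using hk by (auto simp: hyperkaehler_def ortho_group_def orthogonal_transformation_def)
 have sq: "J i (J i x) = - x" if "i \<in> {1,2,3}" for i x
 proof -
  have "(J i o\<^sub>L J i) x = (- id_blinfun) x" using hk that unfolding hyperkaehler_def by metis
  thus ?thesis by (simp add: uminus_blinfun.rep_eq)
 qed
 thus "i \<in> {1,2,3} ==> J i (J i x) = - x" .
 have c: "J 1 (J 2 x) = J 3 x" for x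
 proof -
  have "(J 1 o\<^sub>L J 2) x = J 3 x" using hk by (simp add: hyperkaehler_def)
  thus ?thesis by simp
 qed
 thus "J 1 (J 2 x) = J 3 x" .
 note neg = blinfun.minus_right
 have a: "J 2 (J 1 (J 2 x)) = J 1 x" for x
  using arg_cong[OF sq[of 3 x], of "J 1"] sq[of 1] by (simp add: c[symmetric] neg)
 show b: "J 2 (J 1 x) = - J 3 x" for x
  using a[of "J 2 x"] sq[of 2 x] by (simp add: neg c minus_equation_iff[of "J 2 (J 1 x)"] equation_minus_iff)
 show "J 2 (J 3 x) = J 1 x" using a by (simp add: c)
 show "J 3 (J 2 x) = - J 1 x" using sq[of 2 x] by (simp add: c[symmetric] neg)
 show "J 3 (J 1 x) = J 2 x" using sq[of 1] b by (simp add: c[symmetric] neg)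
 show "J 1 (J 3 x) = - J 2 x" using sq[of 1] by (simp add: c[symmetric])
qed

text \<open>For a unit vector this is the orthonormal basis adapted to the three complex structures;
  index 0 is the vector itself.\<close>

definition frame :: "'q => nat => 'q" where
 "frame x a = (if a = 0 then x else J a x)"

lemma inner_J_self: "i \<in> {1,2,3} ==> x \<bullet> J i x = 0" "i \<in> {1,2,3} ==> J i x \<bullet> x = 0"
proof -
 assume i: "i \<in> {1,2,3}"
 hence "x \<bullet> J i x = - (J i x \<bullet> x)" using J_inner[OF i, of x "J i x"] J_sq[OF i, of x] by simp
 thus "x \<bullet> J i x = 0" "J i x \<bullet> x = 0" by (simp_all add: inner_commute)
qed

lemma inner_J_J:
 "J 1 x \<bullet> J 2 x = 0" "J 1 x \<bullet> J 3 x = 0" "J 2 x \<bullet> J 3 x = 0"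
 "J 2 x \<bullet> J 1 x = 0" "J 3 x \<bullet> J 1 x = 0" "J 3 x \<bullet> J 2 x = 0"
proof -
 show *: "J 1 x \<bullet> J 2 x = 0" using J_inner[of 1 "J 1 x" "J 2 x"]  by (simp add: J_sq J12 inner_J_self)
 thus "J 2 x \<bullet> J 1 x = 0" by (simp add: inner_commute)
 show *: "J 1 x \<bullet> J 3 x = 0" using J_inner[of 1 "J 1 x" "J 3 x"]  by (simp add: J_sq J13 inner_J_self)
 thus "J 3 x \<bullet> J 1 x = 0" by (simp add: inner_commute)
 show *: "J 2 x \<bullet> J 3 x = 0" using J_inner[of 2 "J 2 x" "J 3 x"]  by (simp add: J_sq J23 inner_J_self)
 thus "J 3 x \<bullet> J 2 x = 0" by (simp add: inner_commute)
qed

lemma less_4_cases: "a < (4::nat) \<longleftrightarrow> a = 0 \<or> a = 1 \<or> a = 2 \<or> a = 3"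
 by auto

lemma inner_frame:
 "a < 4 ==> b < 4 ==> frame x a \<bullet> frame x b = (if a = b then x \<bullet> x else 0)"
 unfolding less_4_cases frame_def
 by (elim disjE) (simp_all add: inner_J_self inner_J_J J_inner)

text \<open>Four nonzero orthogonal vectors exhaust a space of dimension 4.\<close>

lemma frame_orthogonal_eq_0:
 assumes "x \<noteq> 0" "\<And>a. a < 4 ==> w \<bullet> frame x a = 0" shows "w = 0"
proof -
 let ?B = "frame x ` {..<4}"
 have inj: "inj_on (frame x) {..<4}"
 proof (rule inj_onI)
  fix a b assume "a \<in> {..<4}" "b \<in> {..<4}" "frame x a = frame x b"
  thus "a = b" using inner_frame[of a b x] inner_frame[of b b x] assms(1) by (auto split: if_splits)
 qed
 have "pairwise orthogonal ?B"
  unfolding pairwise_def orthogonal_def by (auto simp: inner_frame)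
 moreover have "0 \<notin> ?B" using inner_frame[of _ _ x] assms(1) by force
 ultimately have "independent ?B" by (rule pairwise_orthogonal_independent)
 hence "UNIV \<subseteq> span ?B"
  by (intro card_ge_dim_independent) (simp_all add: card_image[OF inj] dim4)
 hence "w \<in> span ?B" by blast
 moreover have "w \<bullet> y = 0" if "y \<in> span ?B" for y
  using that by (induction rule: span_induct_alt) (auto simp: inner_add_right assms(2))
 ultimately show ?thesis using inner_eq_zero_iff by blast
qed

lemma frame_expansion:
 assumes "norm x = 1" shows "w = (\<Sum>a<4. (w \<bullet> frame x a) *\<^sub>R frame x a)"
proof -
 have "w - (\<Sum>a<4. (w \<bullet> frame x a) *\<^sub>R frame x a) = 0"
 proof (rule frame_orthogonal_eq_0)
  show "x \<noteq> 0" using assms by auto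
  fix b :: nat assume b: "b < 4"
  have "(\<Sum>a<4. (w \<bullet> frame x a) * (frame x a \<bullet> frame x b)) = (\<Sum>a<4. if a = b then w \<bullet> frame x b else 0)"
   by (rule sum.cong) (use assms in \<open>auto simp: inner_frame b norm_eq_1\<close>)
  thus "(w - (\<Sum>a<4. (w \<bullet> frame x a) *\<^sub>R frame x a)) \<bullet> frame x b = 0"
   using b by (simp add: inner_diff_left inner_sum_left)
 qed
 thus ?thesis by simp
qed

text \<open>The contraction is half the trace of the bilinear form \<open>F v (J i w)\<close>, and a
  trace may be taken in any orthonormal basis.\<close>

lemma contract_eq:
 fixes F :: "'q => 'q => 'b::real_vector"
 assumes F: "\<And>v. linear (F v)" "\<And>w. linear (%v. F v w)" and x: "norm x = 1"
 shows "contract J i F = (1/2) *\<^sub>R (\<Sum>a<4. F (frame x a) (J i (frame x a)))"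
proof -
 have Fsum: "F v (\<Sum>k\<in>K. r k *\<^sub>R y k) = (\<Sum>k\<in>K. r k *\<^sub>R F v (y k))"
  "F (\<Sum>k\<in>K. r k *\<^sub>R y k) w = (\<Sum>k\<in>K. r k *\<^sub>R F (y k) w)" for v w K and r :: "'k => real" and y
  by (simp_all add: linear_sum[OF F(1)] linear_sum[OF F(2)] linear_scale[OF F(1)] linear_scale[OF F(2)])
 have "(\<Sum>b\<in>Basis. \<Sum>c\<in>Basis. kaehler_form J i b c *\<^sub>R F b c) = (\<Sum>b\<in>Basis. F b (J i b))"
 proof (rule sum.cong[OF refl])
  fix b :: 'q
  have "F b (J i b) = F b (\<Sum>c\<in>Basis. (J i b \<bullet> c) *\<^sub>R c)" by (simp add: euclidean_representation)
  thus "(\<Sum>c\<in>Basis. kaehler_form J i b c *\<^sub>R F b c) = F b (J i b)"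
   by (simp add: Fsum kaehler_form_def)
 qed
 also have "... = (\<Sum>b\<in>Basis. F (\<Sum>a<4. (b \<bullet> frame x a) *\<^sub>R frame x a) (J i b))"
  using frame_expansion[OF x] by (intro sum.cong arg_cong2[where f = F]) auto
 also have "... = (\<Sum>a<4. \<Sum>b\<in>Basis. (b \<bullet> frame x a) *\<^sub>R F (frame x a) (J i b))"
  unfolding Fsum by (rule sum.swap)
 also have "... = (\<Sum>a<4. F (frame x a) (J i (\<Sum>b\<in>Basis. (frame x a \<bullet> b) *\<^sub>R b)))"
  by (simp only: blinfun.sum_right blinfun.scaleR_right Fsum) (simp add: inner_commute)
 finally show ?thesis by (simp add: contract_def euclidean_representation)
qed

text \<open>In an adapted frame the three contractions are the self-dual components of a two-form,
  so their common vanishing is the anti-self-dual equation.\<close>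

lemma contract_alternating:
 fixes F :: "'q => 'q => 'b::real_vector"
 assumes F: "\<And>v. linear (F v)" "\<And>w. linear (%v. F v w)" and alt: "\<And>v w. F v w = - F w v" and x: "norm x = 1"
 defines "u \<equiv> frame x"
 shows "contract J 1 F = F (u 0) (u 1) + F (u 2) (u 3)"
  "contract J 2 F = F (u 0) (u 2) + F (u 3) (u 1)"
  "contract J 3 F = F (u 0) (u 3) + F (u 1) (u 2)"
proof -
 have sum4: "(\<Sum>a<4. f a) = f 0 + f 1 + f 2 + f (3::nat)" for f :: "nat => 'b"
  by (simp add: eval_nat_numeral lessThan_Suc One_nat_def ac_simps)
 have neg: "F v (- w) = - F v w" for v w using linear_neg[OF F(1)] .
 have half: "(1/2) *\<^sub>R (y + y) = y" for y :: 'b by (simp add: scaleR_2[symmetric])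
 have e: "u 0 = x" "u 1 = J 1 x" "u 2 = J 2 x" "u 3 = J 3 x" by (simp_all add: u_def frame_def)
 have "contract J 1 F = (1/2) *\<^sub>R ((F (u 0) (u 1) + F (u 2) (u 3)) + (F (u 0) (u 1) + F (u 2) (u 3)))"
  unfolding contract_eq[OF F x] sum4
  by (simp add: frame_def J_sq J12 J13 neg alt[of "J 1 x" x] alt[of "J 3 x" "J 2 x"] e ac_simps)
 thus "contract J 1 F = F (u 0) (u 1) + F (u 2) (u 3)" unfolding half .
 have "contract J 2 F = (1/2) *\<^sub>R ((F (u 0) (u 2) + F (u 3) (u 1)) + (F (u 0) (u 2) + F (u 3) (u 1)))"
  unfolding contract_eq[OF F x] sum4
  by (simp add: frame_def J_sq J21 J23 neg alt[of "J 2 x" x] alt[of "J 1 x" "J 3 x"] e ac_simps)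
 thus "contract J 2 F = F (u 0) (u 2) + F (u 3) (u 1)" unfolding half .
 have "contract J 3 F = (1/2) *\<^sub>R ((F (u 0) (u 3) + F (u 1) (u 2)) + (F (u 0) (u 3) + F (u 1) (u 2)))"
  unfolding contract_eq[OF F x] sum4
  by (simp add: frame_def J_sq J31 J32 neg alt[of "J 3 x" x] alt[of "J 2 x" "J 1 x"] e ac_simps)
 thus "contract J 3 F = F (u 0) (u 3) + F (u 1) (u 2)" unfolding half .
qed

end

context discrete_subgroup begin

section \<open>Weak curvature and smoothing\<close>

definition connection :: "('q => 'q => complex^'n::finite^'n) => bool" where
 "connection A \<longleftrightarrow> (\<forall>v. tcont (%th. A th v)) \<and> (\<forall>th. linear (A th)) \<and> (\<forall>th v. adj (A th v) = - A th v)"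

text \<open>The derivatives fall on the test function. The form is a plain function of point and
  direction, which also covers smoothed forms, and the volume factor of \<open>curvature\<close> is
  divided out.\<close>

definition curv :: "('q => 'q => complex^'n::finite^'n) => 'q => 'q => ('q => real) => complex^'n^'n" where
 "curv A v w ps = avg (%th. - dir_deriv v ps th *\<^sub>R A th w + dir_deriv w ps th *\<^sub>R A th v +
   ps th *\<^sub>R commutator (A th v) (A th w))"

abbreviation rtrig :: "('q => real) => bool" where "rtrig ps \<equiv> trig (%th. of_real (ps th))"

lemma connectionD:
 assumes "connection A"
 shows "tcont (%th. A th v)" "linear (A th)" "adj (A th v) = - A th v"
  "A th (v + w) = A th v + A th w" "A th (r *\<^sub>R v) = r *\<^sub>R A th v" "A th 0 = 0"
 using assms linear_add[of "A th"] linear_scale[of "A th"] linear_0[of "A th"]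
 by (auto simp: connection_def)

lemma rtrig_dir_deriv: "rtrig ps ==> rtrig (dir_deriv v ps)"
 using trig_dir_deriv(1)[of "%th. of_real (ps th)" v] trig_real_has_derivative(2)[of ps] by simp

lemma rtrig_dir_deriv_linear:
 assumes "rtrig ps"
 shows "dir_deriv (v + w) ps th = dir_deriv v ps th + dir_deriv w ps th"
  "dir_deriv (r *\<^sub>R v) ps th = r * dir_deriv v ps th"
 using linear_add[OF has_derivative_linear[OF trig_real_has_derivative(1)[OF assms, of th]], of v w]
  linear_scale[OF has_derivative_linear[OF trig_real_has_derivative(1)[OF assms, of th]], of r v]
 by simp_all

lemma tcont_curv:
 assumes "\<And>v. tcont (%th. A th v :: complex^'n::finite^'n)" "rtrig ps"
 shows "tcont (%th. - dir_deriv v ps th *\<^sub>R A th w + dir_deriv w ps th *\<^sub>R A th v +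
  ps th *\<^sub>R commutator (A th v) (A th w))"
 by (intro tcont_add tcont_scaleR tcont_uminus tcont_commutator assms
   tcont_trig_real[OF assms(2)] tcont_trig_real[OF rtrig_dir_deriv[OF assms(2)]])

lemma curv_alternating: "connection A ==> rtrig ps ==> curv A v w ps = - curv A w v ps"
 unfolding curv_def
 by (subst avg_uminus[symmetric, OF tcont_curv[OF connectionD(1)]])
  (simp_all add: commutator_swap[of "A _ v"])

lemma linear_curv:
 assumes A: "connection A" and ps: "rtrig ps"
 shows "linear (%v. curv A v w ps)" "linear (%v. curv A w v ps)"
proof -
 note tc = tcont_curv[OF connectionD(1)[OF A] ps]
 show l: "linear (%v. curv A v w ps)" for w
 proof (rule linearI)
  show "curv A (x + y) w ps = curv A x w ps + curv A y w ps" for x y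
   unfolding curv_def
   by (rule trans[OF _ avg_add[OF tc tc]], rule arg_cong[where f = avg])
    (simp add: fun_eq_iff connectionD[OF A] rtrig_dir_deriv_linear[OF ps] commutator_simps algebra_simps)
  show "curv A (r *\<^sub>R x) w ps = r *\<^sub>R curv A x w ps" for r x
   unfolding curv_def
   by (rule trans[OF _ avg_scaleR[OF tc]], rule arg_cong[where f = avg])
    (simp add: fun_eq_iff connectionD[OF A] rtrig_dir_deriv_linear[OF ps] commutator_simps algebra_simps)
 qed
 show "linear (%v. curv A w v ps)"
  using linear_compose_neg[OF l[of w]] curv_alternating[OF A ps, of w] by simp
qed

lemma conv_dir_deriv_complex:
 fixes f :: "'q => complex"
 assumes k: "rtrig k" and f: "tcont f"
 shows "dir_deriv v (conv k f) th = - avg (%et. dir_deriv v k (et - th) *\<^sub>R f et)"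
proof -
 have shift: "tcont (%et. K (et - th) * f et)" if "trig K" for K th
  using tcont_shift[OF trig_tcont[OF that], of "- th"] by (simp add: tcont_mult f)
 have "((%th. avg (%et. K (et - th) * f et)) has_derivative
   (%v. - avg (%et. dir_deriv v K (et - th) * f et))) (at th)" if "trig K" for K th
  using that
 proof (induction rule: trig.induct)
  case (trig_cis l c)
  define a where "a = c * avg (%et. cis (l \<bullet> et) * f et)"
  have e: "avg (%et. z * (c * cis (l \<bullet> (et - th))) * f et) = z * a * cis ((- l) \<bullet> th)" for th z
  proof -
   have "z * (c * cis (l \<bullet> (et - th))) * f et = (z * c * cis ((- l) \<bullet> th)) * (cis (l \<bullet> et) * f et)" for et
   proof -
    have "cis (l \<bullet> (et - th)) = cis ((- l) \<bullet> th) * cis (l \<bullet> et)" by (simp add: cis_mult inner_diff_right)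
    thus ?thesis by simp
   qed
   hence "avg (%et. z * (c * cis (l \<bullet> (et - th))) * f et) =
     avg (%et. (z * c * cis ((- l) \<bullet> th)) * (cis (l \<bullet> et) * f et))" by presburger
   thus ?thesis
    by (simp add: avg_mult[OF tcont_mult[OF tcont_cis[OF trig_cis] f]] a_def)
  qed
  have "((%th. 1 * a * cis ((- l) \<bullet> th)) has_derivative
    (%v. - (\<i> * of_real (l \<bullet> v) * a * cis ((- l) \<bullet> th)))) (at th)"
   by (rule has_derivative_eq_rhs, rule has_derivative_mult_right[OF has_derivative_cis_inner])
    (simp add: fun_eq_iff)
  thus ?case
   unfolding trig_dir_deriv_cis e using e[of 1] by simp
 next
  case (trig_add K K')
  have "dir_deriv v (%th. K th + K' th) = (%th. dir_deriv v K th + dir_deriv v K' th)" for v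
   using trig_add by (simp add: fun_eq_iff dir_deriv_add trig_differentiable)
  thus ?case
   using has_derivative_add[OF trig_add(3,4)] trig_add(1,2)
   by (simp add: distrib_right avg_add shift trig_dir_deriv)
 qed
 from dir_deriv_eq[OF this[OF k]]
 have "dir_deriv v (%th. avg (%et. of_real (k (et - th)) * f et)) th =
   - avg (%et. of_real (dir_deriv v k (et - th)) * f et)"
  by (simp add: trig_real_has_derivative(2)[OF k])
 moreover have "conv k f = (%th. avg (%et. of_real (k (et - th)) * f et))"
  using conv_eq[OF tcont_trig_real[OF k] f] by (simp add: fun_eq_iff scaleR_conv_of_real)
 ultimately show ?thesis by (simp add: scaleR_conv_of_real)
qed

lemma tcont_shift_diff: "tcont f ==> tcont (%et. f (et - th))"
 using tcont_shift[of f "- th"] by simp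

lemma conv_entry:
 assumes "tcont k" "tcont f"
 shows "conv k f th $ h $ l = conv k (%th. f th $ h $ l :: complex) th"
 by (rule conv_bounded_linear[OF bounded_linear_entry assms])

lemma mtrig_conv: "rtrig k ==> tcont f ==> mtrig (conv k f)"
 by (auto simp: mtrig_def conv_entry tcont_trig_real tcont_entries intro: trig_conv)

lemma conv_dir_deriv:
 assumes k: "rtrig k" and f: "tcont f"
 shows "dir_deriv v (conv k f) th = - avg (%et. dir_deriv v k (et - th) *\<^sub>R (f et :: complex^'n::finite^'n))"
proof -
 have tk: "tcont k" and tk': "tcont (dir_deriv v k)"
  by (intro tcont_trig_real k rtrig_dir_deriv)+
 have "dir_deriv v (conv k f) th $ h $ l = (- avg (%et. dir_deriv v k (et - th) *\<^sub>R f et)) $ h $ l" for h l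
 proof -
  have "dir_deriv v (conv k f) th $ h $ l = dir_deriv v (conv k (%th. f th $ h $ l)) th"
   by (simp add: mtrig_has_derivative(2) mtrig_conv k f conv_entry[OF tk f, abs_def])
  also have "... = - avg (%et. (dir_deriv v k (et - th) *\<^sub>R f et) $ h $ l)"
   using f by (simp add: conv_dir_deriv_complex[OF k] tcont_entries)
  also have "... = (- avg (%et. dir_deriv v k (et - th) *\<^sub>R f et)) $ h $ l"
   using avg_bounded_linear[OF bounded_linear_entry tcont_scaleR[OF tcont_shift_diff[OF tk'] f]]
   by simp
  finally show ?thesis .
 qed
 thus ?thesis by (simp add: vec_eq_iff)
qed

lemma rtrig_shift: "rtrig k ==> rtrig (%et. k (et - th))"
 using trig_shift[of "%th. of_real (k th)" "- th"] by simp

text \<open>Translates of one kernel, used as test functions, turn the weak curvature into the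
  pointwise curvature of the smoothed form, except that the commutator is formed before smoothing.
  This discrepancy is the only error in passing to smooth connections.\<close>

lemma curv_shift_eq:
 assumes A: "connection A" and k: "rtrig k"
 shows "curv A v w (%et. k (et - th)) = dir_deriv v (conv k (%th. A th w)) th - dir_deriv w (conv k (%th. A th v)) th +
  conv k (%th. commutator (A th v) (A th w)) th"
proof -
 have "((%et. k (et - th)) has_derivative (%v. dir_deriv v k (et - th))) (at et)" for et
  by (rule has_derivative_compose[OF _ trig_real_has_derivative(1)[OF k]]) (auto intro!: derivative_eq_intros)
 note d = dir_deriv_eq[OF this]
 note tA = connectionD(1)[OF A]
 have tk: "tcont k" and tk': "tcont (dir_deriv v k)" for v
  by (intro tcont_trig_real k rtrig_dir_deriv)+
 note ts = tcont_scaleR[OF tcont_shift_diff[OF tk'] tA]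
  tcont_scaleR[OF tcont_shift_diff[OF tk] tcont_commutator[OF tA tA]]
 have "curv A v w (%et. k (et - th)) = avg (%et. - (dir_deriv v k (et - th) *\<^sub>R A et w) +
   dir_deriv w k (et - th) *\<^sub>R A et v + k (et - th) *\<^sub>R commutator (A et v) (A et w))"
  by (simp add: curv_def d)
 also have "... = - avg (%et. dir_deriv v k (et - th) *\<^sub>R A et w) + avg (%et. dir_deriv w k (et - th) *\<^sub>R A et v) +
   avg (%et. k (et - th) *\<^sub>R commutator (A et v) (A et w))"
  by (simp only: avg_add avg_uminus tcont_add tcont_uminus ts)
 finally show ?thesis
  by (simp add: conv_dir_deriv[OF k tA] conv_eq[OF tk tcont_commutator[OF tA tA]])
qed

lemma connection_conv:
 assumes A: "connection A" and k: "rtrig k"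
 shows "connection (%th v. conv k (%th. A th v) th)"
 unfolding connection_def
proof (intro conjI allI)
 have tk: "tcont k" by (rule tcont_trig_real[OF k])
 note tA = connectionD(1)[OF A]
 show "tcont (%th. conv k (%th. A th v) th)" for v
  using mtrig_tcont[OF mtrig_conv[OF k tA]] .
 note ts = tcont_scaleR[OF tk tcont_shift_left[OF tA]]
 show "linear (%v. conv k (%th. A th v) th)" for th
  by (rule linearI)
   (simp_all add: conv_def connectionD[OF A] scaleR_add_right avg_add ts avg_scaleR[OF ts, symmetric] mult.commute)
 show "adj (conv k (%th. A th v) th) = - conv k (%th. A th v) th" for th v
  unfolding conv_bounded_linear[OF bounded_linear_adj tk tA] connectionD(3)[OF A]
  by (simp add: conv_def avg_uminus ts)
qed

definition ker :: "nat => 'q => real" where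
 "ker n = (SOME k. kernel (1 / (real n + 1)) k)"

lemma kernel_ker: "kernel (1 / (real n + 1)) (ker n)"
 unfolding ker_def by (rule someI_ex[OF kernel_exists]) simp

lemma rtrig_ker: "rtrig (ker n)"
 using kernel_ker by (simp add: kernel_def)

lemma conv_ker_uniform_limit:
 fixes f :: "'q => 'b::{banach,second_countable_topology}"
 assumes "tcont f" shows "uniform_limit UNIV (%n. conv (ker n) f) f sequentially"
proof (rule uniform_limitI)
 fix eps :: real assume "eps > 0"
 then obtain dl where dl: "dl > 0" "\<And>k th. kernel dl k ==> norm (conv k f th - f th) \<le> eps / 2"
  using conv_uniform[OF assms, of "eps / 2"] by auto
 obtain N :: nat where N: "1 / dl < real N" using reals_Archimedean2 by blast
 have "\<forall>th\<in>UNIV. dist (conv (ker n) f th) (f th) < eps" if "n \<ge> N" for n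
 proof -
  have "real N \<le> real n" using that by simp
  hence "1 / dl \<le> real n + 1" using N by linarith
  hence "1 / (real n + 1) \<le> dl" using dl(1) by (simp add: field_simps)
  hence "kernel dl (ker n)" using kernel_ker[of n] unfolding kernel_def by (meson order_trans)
  from dl(2)[OF this] have "norm (conv (ker n) f th - f th) \<le> eps / 2" for th .
  thus ?thesis using \<open>eps > 0\<close> unfolding dist_norm by (smt (verit) field_sum_of_halves)
 qed
 thus "\<forall>\<^sub>F n in sequentially. \<forall>th\<in>UNIV. dist (conv (ker n) f th) (f th) < eps"
  by (auto simp: eventually_at_top_linorder)
qed

lemma bounded_range_tcont:
 fixes f :: "'q => 'b::real_normed_vector"
 assumes "tcont f" shows "bounded (range f)"
 by (rule tcont_bounded[OF assms]) (auto intro!: boundedI)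

text \<open>The variance of \<open>norm (f th)\<close> is nonnegative.\<close>

lemma avg_norm_sq_le:
 fixes f :: "'q => 'b::real_normed_vector"
 assumes f: "tcont f" shows "(avg (%th. norm (f th)))^2 \<le> avg (%th. (norm (f th))\<^sup>2)"
proof -
 define m where "m = avg (%th. norm (f th))"
 note n = tcont_norm[OF f] and n2 = tcont_power[OF tcont_norm[OF f]]
 have "0 \<le> avg (%th. (norm (f th))\<^sup>2 - (2 * m) *\<^sub>R norm (f th) + m\<^sup>2)"
 proof -
  have "(norm (f th))^2 - (2 * m) *\<^sub>R norm (f th) + m\<^sup>2 = (norm (f th) - m)^2" for th
   by (simp add: power2_diff)
  thus ?thesis
   using avg_mono[OF tcont_const[of "0 :: real"] tcont_power[OF tcont_diff[OF n tcont_const[of m]]], of 2]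
   by (simp add: avg_const)
 qed
 also have "... = avg (%th. (norm (f th))\<^sup>2) - 2 * m * m + m\<^sup>2"
  using n n2[of 2]
  by (simp only: avg_add avg_diff tcont_diff tcont_scaleR tcont_const avg_scaleR avg_const)
   (simp add: m_def)
 finally show ?thesis by (simp add: m_def power2_eq_square)
qed

lemma curv_mtrig:
 assumes B: "\<And>v. mtrig (%th. B th v)" and ps: "rtrig ps"
 shows "curv B v w ps = avg (%th. ps th *\<^sub>R (dir_deriv v (%th. B th w) th - dir_deriv w (%th. B th v) th +
  commutator (B th v) (B th w)))"
proof -
 have tps: "tcont ps" and tps': "tcont (dir_deriv v ps)" for v
  by (intro tcont_trig_real ps rtrig_dir_deriv)+
 have tB: "tcont (%th. B th v)" and tB': "tcont (dir_deriv v (%th. B th w))" for v w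
  by (intro mtrig_tcont B mtrig_dir_deriv)+
 note ts = tcont_scaleR[OF tps' tB] tcont_scaleR[OF tps tB'] tcont_scaleR[OF tps tcont_commutator[OF tB tB]]
 have parts: "avg (%th. ps th *\<^sub>R dir_deriv v (%th. B th w) th) = - avg (%th. dir_deriv v ps th *\<^sub>R B th w)" for v w
 proof -
  have "((%th. ps th *\<^sub>R B th w) has_derivative
    (%v. ps th *\<^sub>R dir_deriv v (%th. B th w) th + dir_deriv v ps th *\<^sub>R B th w)) (at th)" for th
   by (intro has_derivative_scaleR trig_real_has_derivative ps mtrig_has_derivative B)
  hence "avg (%th. ps th *\<^sub>R dir_deriv v (%th. B th w) th + dir_deriv v ps th *\<^sub>R B th w) = 0"
   by (intro avg_deriv_eq_0[where f = "%th. ps th *\<^sub>R B th w"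
      and v = v and f' = "%th v. ps th *\<^sub>R dir_deriv v (%th. B th w) th + dir_deriv v ps th *\<^sub>R B th w"]
     tcont_add ts tcont_scaleR[OF tps tB] refl)
  thus ?thesis by (simp add: avg_add ts add_eq_0_iff)
 qed
 have "curv B v w ps = - avg (%th. dir_deriv v ps th *\<^sub>R B th w) + avg (%th. dir_deriv w ps th *\<^sub>R B th v) +
   avg (%th. ps th *\<^sub>R commutator (B th v) (B th w))"
  unfolding curv_def scaleR_minus_left by (simp only: avg_add avg_uminus tcont_add tcont_uminus ts)
 moreover have "avg (%th. ps th *\<^sub>R (dir_deriv v (%th. B th w) th - dir_deriv w (%th. B th v) th + commutator (B th v) (B th w))) =
   avg (%th. ps th *\<^sub>R dir_deriv v (%th. B th w) th) - avg (%th. ps th *\<^sub>R dir_deriv w (%th. B th v) th) +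
   avg (%th. ps th *\<^sub>R commutator (B th v) (B th w))"
  unfolding scaleR_add_right scaleR_diff_right by (simp only: avg_add avg_diff tcont_add tcont_diff ts)
 ultimately show ?thesis by (simp add: parts)
qed

text \<open>Smoothing keeps the linear part of the self-dual curvature equal to zero, so the self-dual curvature of
 the smoothed connections tends to zero uniformly. As \<open>tr F \<and> F\<close> is exact, the whole curvature then tends
 to zero in mean square.\<close>

lemma flat_of_moment_map_eq_0:
 assumes q: "quaternionic_space J" and A: "connection A"
  and mom: "\<And>i ps. i \<in> {1,2,3} ==> rtrig ps ==> contract J i (%v w. curv A v w ps) = 0"
  and ps: "rtrig ps"
 shows "curv A v w ps = (0 :: complex^'n::finite^'n)"
proof -
 interpret quaternionic_space J by fact
 obtain x :: 'q where x: "norm x = 1" using vector_choose_size[of 1] by auto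
 define u where "u = frame x"
 define B where "B n th v = conv (ker n) (%th. A th v) th" for n th v
 note tA = connectionD(1)[OF A]
 have B: "connection (B n)" for n unfolding B_def by (rule connection_conv[OF A rtrig_ker])
 have mB: "mtrig (%th. B n th v)" for n v unfolding B_def using mtrig_conv[OF rtrig_ker tA] .
 have limB: "uniform_limit UNIV (%n th. B n th v) (%th. A th v) sequentially" for v
  unfolding B_def by (rule conv_ker_uniform_limit[OF tA])
 have limC: "uniform_limit UNIV (%n th. commutator (B n th v) (B n th w)) (%th. commutator (A th v) (A th w)) sequentially" for v w
  by (intro cm.bounded_uniform_limit limB bounded_range_tcont tA)
 \<comment> \<open>What smoothing fails to preserve: the commutator of the smoothed forms minus the
   smoothed commutator. Both tend uniformly to the same limit.\<close>
 define E where "E n v w th = commutator (B n th v) (B n th w) - conv (ker n) (%th. commutator (A th v) (A th w)) th" for n v w th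
 have tE: "tcont (E n v w)" for n v w
  unfolding E_def
  by (intro tcont_diff tcont_commutator mtrig_tcont[OF mB]
    mtrig_tcont[OF mtrig_conv[OF rtrig_ker tcont_commutator[OF tA tA]]])
 have limE: "uniform_limit UNIV (%n. E n v w) (%_. 0) sequentially" for v w
  using uniform_limit_minus[OF limC[of v w] conv_ker_uniform_limit[OF tcont_commutator[OF tA[of v] tA[of w]]]]
  by (simp add: E_def[abs_def])
 define F where "F n v w th = dir_deriv v (%th. B n th w) th - dir_deriv w (%th. B n th v) th + commutator (B n th v) (B n th w)" for n v w th
 have F_eq: "F n v w th = curv A v w (%et. ker n (et - th)) + E n v w th" for n v w th
  unfolding curv_shift_eq[OF A rtrig_ker] by (simp add: F_def E_def B_def[abs_def])
 have tF: "tcont (F n v w)" for n v w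
  unfolding F_def
  by (intro tcont_add tcont_diff tcont_commutator mtrig_tcont[OF mB]
    mtrig_tcont[OF mtrig_dir_deriv[OF mB]])
 \<comment> \<open>Tested against translated kernels the self-dual part of the weak curvature
   vanishes, so the self-dual part of \<open>F\<close> is that of the error.\<close>
 have sd: "F n (u 0) (u 1) th + F n (u 2) (u 3) th = E n (u 0) (u 1) th + E n (u 2) (u 3) th"
  "F n (u 0) (u 2) th + F n (u 3) (u 1) th = E n (u 0) (u 2) th + E n (u 3) (u 1) th"
  "F n (u 0) (u 3) th + F n (u 1) (u 2) th = E n (u 0) (u 3) th + E n (u 1) (u 2) th" for n th
 proof -
  let ?k = "%et. ker n (et - th)"
  have k: "rtrig ?k" by (rule rtrig_shift[OF rtrig_ker])
  note c = contract_alternating[of "%v w. curv A v w ?k", OF linear_curv(2,1)[OF A k] curv_alternating[OF A k] x, folded u_def]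
  show "F n (u 0) (u 1) th + F n (u 2) (u 3) th = E n (u 0) (u 1) th + E n (u 2) (u 3) th"
   using c(1) mom[of 1, OF _ k] by (simp add: F_eq algebra_simps)
  show "F n (u 0) (u 2) th + F n (u 3) (u 1) th = E n (u 0) (u 2) th + E n (u 3) (u 1) th"
   using c(2) mom[of 2, OF _ k] by (simp add: F_eq algebra_simps)
  show "F n (u 0) (u 3) th + F n (u 1) (u 2) th = E n (u 0) (u 3) th + E n (u 1) (u 2) th"
   using c(3) mom[of 3, OF _ k] by (simp add: F_eq algebra_simps)
 qed
 define e where "e n th = (norm (E n (u 0) (u 1) th + E n (u 2) (u 3) th))^2 + (norm (E n (u 0) (u 2) th + E n (u 3) (u 1) th))^2 +
   (norm (E n (u 0) (u 3) th + E n (u 1) (u 2) th))\<^sup>2" for n th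
 have te: "tcont (e n)" for n unfolding e_def by (intro tcont_add tcont_power tcont_norm tE)
 have "(%n. avg (e n)) \<longlonglongrightarrow> avg (%_. 0 :: real)"
 proof (rule avg_uniform_limit)
  have sq: "uniform_limit UNIV (%n th. (norm (E n a b th + E n c d th))\<^sup>2) (%_. (norm (0 + 0 :: complex^'n^'n))\<^sup>2) sequentially" for a b c d
   unfolding power2_eq_square
   by (intro bounded_bilinear.bounded_uniform_limit[OF bounded_bilinear_mult] uniform_limit_norm uniform_limit_add limE) auto
  show "uniform_limit UNIV e (%_. 0) sequentially"
   using uniform_limit_add[OF uniform_limit_add[OF sq[of "u 0" "u 1" "u 2" "u 3"] sq[of "u 0" "u 2" "u 3" "u 1"]] sq[of "u 0" "u 3" "u 1" "u 2"]]
   by (simp add: e_def[abs_def])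
 qed (auto simp: te tcont_const)
 hence lim_e: "(%n. avg (e n)) \<longlonglongrightarrow> 0" by (simp add: avg_const)
 \<comment> \<open>One orientation for each pair of frame directions, listed as three complementary
   pairs.\<close>
 define pairs where "pairs = {(0,1),(2,3),(0,2),(3,1),(0,3),(1::nat,2::nat)}"
 have energy: "avg (%th. (norm (F n (u a) (u b) th))\<^sup>2) \<le> avg (e n)" if "(a, b) \<in> pairs" for n a b
 proof -
  define G where "G i j = F n (u i) (u j)" for i j
  have tG: "tcont (G i j)" for i j by (simp add: G_def tF)
  have skew: "adj (G i j th) = - G i j th" for i j th
  proof -
   have d: "adj (dir_deriv v (%th. B n th w) th) = - dir_deriv v (%th. B n th w) th" for v w
   proof -
    have "((%th. adj (B n th w)) has_derivative (%v. adj (dir_deriv v (%th. B n th w) th))) (at th)"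
     by (intro bounded_linear.has_derivative[OF bounded_linear_adj] mtrig_has_derivative mB)
    moreover have "((%th. - B n th w) has_derivative (%v. - dir_deriv v (%th. B n th w) th)) (at th)"
     by (intro has_derivative_minus mtrig_has_derivative mB)
    ultimately show ?thesis
     using dir_deriv_eq[of "%th. adj (B n th w)" _ th] dir_deriv_eq[of "%th. - B n th w" _ th]
     unfolding connectionD(3)[OF B] by metis
   qed
   show ?thesis
    unfolding G_def F_def
    by (simp add: adj_add adj_diff d adj_commutator connectionD(3)[OF B])
  qed
  define f where "f th = (norm (G 0 1 th))^2 + (norm (G 2 3 th))^2 + (norm (G 0 2 th))^2 + (norm (G 3 1 th))^2 +
   (norm (G 0 3 th))\<^sup>2 + (norm (G 1 2 th))^2" for th
  have tf: "tcont f" unfolding f_def by (intro tcont_add tcont_power tcont_norm tG)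
  define p where "p th = G 0 1 th \<bullet> G 2 3 th + G 0 2 th \<bullet> G 3 1 th + G 0 3 th \<bullet> G 1 2 th" for th
  have tp: "tcont p" unfolding p_def by (intro tcont_add tcont_inner tG)
  \<comment> \<open>The energy of the self-dual part is the full energy plus twice the Chern
    integrand. As the latter averages to zero, the error bounds the whole curvature in mean
    square.\<close>
  have en: "e n = (%th. f th + 2 *\<^sub>R p th)"
   unfolding e_def f_def p_def sd[symmetric] G_def power2_norm_eq_inner
   by (simp add: fun_eq_iff inner_add_left inner_add_right inner_commute)
  have "avg (e n) = avg f + 2 * avg p"
   unfolding en avg_add[OF tf tcont_scaleR[OF tcont_const tp]] avg_scaleR[OF tp] by simp
  moreover have "avg p = 0"
  proof -
   have i: "avg (%th. G i j th \<bullet> G k l th) = - Re (pair (G i j) (G k l))" for i j k l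
   proof -
    have "G i j th \<bullet> G k l th = - Re (trace (G i j th ** G k l th))" for th
     by (simp add: inner_matrix skew mm.minus_left trace_def sum_negf)
    thus ?thesis
     unfolding pair_def
     using avg_bounded_linear[OF bounded_linear_Re tcont_pair[OF tG tG]]
      avg_uminus[OF tcont_bounded_linear[OF bounded_linear_Re tcont_pair[OF tG tG]]] by simp
   qed
   have "pair (G 0 1) (G 2 3) + pair (G 0 2) (G 3 1) + pair (G 0 3) (G 1 2) = 0"
    using chern_form_avg_eq_0[of "%i th. B n th (u i)" u] mB by (simp add: G_def F_def[abs_def])
   hence "Re (pair (G 0 1) (G 2 3)) + Re (pair (G 0 2) (G 3 1)) + Re (pair (G 0 3) (G 1 2)) = 0"
    by (metis plus_complex.sel(1) zero_complex.sel(1))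
   thus ?thesis
    unfolding p_def by (simp add: avg_add tcont_add tcont_inner tG i)
  qed
  moreover have "avg (%th. (norm (F n (u a) (u b) th))\<^sup>2) \<le> avg f"
   by (rule avg_mono[OF tcont_power[OF tcont_norm[OF tF]] tf])
    (use that in \<open>auto simp: f_def G_def pairs_def\<close>)
  ultimately show ?thesis by simp
 qed
 \<comment> \<open>For a fixed test function the weak curvatures of the smoothed forms converge to
   that of \<open>A\<close> by uniform convergence, and to 0 by the energy bound.\<close>
 have basic: "curv A (u a) (u b) ps = 0" if ab: "(a, b) \<in> pairs" for a b
 proof -
  have tps: "tcont ps" and tps': "tcont (dir_deriv v ps)" for v
   by (intro tcont_trig_real ps rtrig_dir_deriv)+
  obtain M where M: "M \<ge> 0" "\<And>th. norm (ps th) \<le> M" using tcont_bounded[OF tps] by blast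
  have "(%n. curv (B n) (u a) (u b) ps) \<longlonglongrightarrow> curv A (u a) (u b) ps"
   unfolding curv_def
  proof (rule avg_uniform_limit)
   show "uniform_limit UNIV (%n th. - dir_deriv (u a) ps th *\<^sub>R B n th (u b) + dir_deriv (u b) ps th *\<^sub>R B n th (u a) +
     ps th *\<^sub>R commutator (B n th (u a)) (B n th (u b)))
    (%th. - dir_deriv (u a) ps th *\<^sub>R A th (u b) + dir_deriv (u b) ps th *\<^sub>R A th (u a) +
     ps th *\<^sub>R commutator (A th (u a)) (A th (u b))) sequentially"
    by (intro uniform_limit_add bounded_bilinear.bounded_uniform_limit[OF bounded_bilinear_scaleR]
      uniform_limit_const limB limC bounded_range_tcont tcont_uminus tps tps' tA tcont_commutator)
  qed (intro always_eventually allI tcont_curv tA ps connectionD(1)[OF B])+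
  moreover have "(%n. curv (B n) (u a) (u b) ps) \<longlonglongrightarrow> 0"
  proof (rule Lim_null_comparison)
   have "norm (curv (B n) (u a) (u b) ps) \<le> M * sqrt (avg (e n))" for n
   proof -
    let ?G = "F n (u a) (u b)"
    have "norm (curv (B n) (u a) (u b) ps) \<le> avg (%th. norm (ps th *\<^sub>R ?G th))"
     unfolding curv_mtrig[OF mB ps] F_def[symmetric]
     by (rule norm_avg_le_avg[OF tcont_scaleR[OF tps tF]])
    also have "... \<le> avg (%th. M *\<^sub>R norm (?G th))"
     by (rule avg_mono) (intro tcont_norm tcont_scaleR tps tF tcont_const,
       intro tcont_norm tcont_scaleR tps tF tcont_const, use M in \<open>simp add: mult_right_mono\<close>)
    also have "... = M * avg (%th. norm (?G th))" using avg_scaleR[OF tcont_norm[OF tF]] by simp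
    also have "avg (%th. norm (?G th)) \<le> sqrt (avg (e n))"
     using avg_norm_sq_le[OF tF[of n "u a" "u b"]] energy[OF ab, of n] by (intro real_le_rsqrt) linarith
    finally show ?thesis using M(1) by (simp add: mult_left_mono)
   qed
   thus "\<forall>\<^sub>F n in sequentially. norm (curv (B n) (u a) (u b) ps) \<le> M * sqrt (avg (e n))" by simp
   show "(%n. M * sqrt (avg (e n))) \<longlonglongrightarrow> 0"
    using tendsto_mult[OF tendsto_const[of M] tendsto_real_sqrt[OF lim_e]] by simp
  qed
  ultimately show ?thesis by (rule LIMSEQ_unique)
 qed
 have all: "curv A (u a) (u b) ps = 0" if "a < 4" "b < 4" for a b
 proof -
  have "curv A (u a) (u a) ps = 0" for a
  proof -
   have "2 *\<^sub>R curv A (u a) (u a) ps = 0"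
    using curv_alternating[OF A ps, of "u a" "u a"] by (simp add: scaleR_2)
   thus ?thesis by simp
  qed
  moreover have "(a, b) \<in> pairs \<or> (b, a) \<in> pairs \<or> a = b" using that by (auto simp: pairs_def less_4_cases)
  ultimately show ?thesis using basic curv_alternating[OF A ps, of "u a" "u b"] by auto
 qed
 have "curv A v w ps = curv A (\<Sum>a<4. (v \<bullet> u a) *\<^sub>R u a) (\<Sum>b<4. (w \<bullet> u b) *\<^sub>R u b) ps"
  using frame_expansion[OF x] unfolding u_def by metis
 also have "... = (\<Sum>b<4. \<Sum>a<4. (w \<bullet> u b) *\<^sub>R (v \<bullet> u a) *\<^sub>R curv A (u a) (u b) ps)"
  by (simp add: linear_sum[OF linear_curv(1)[OF A ps]] linear_sum[OF linear_curv(2)[OF A ps]]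
    linear_scale[OF linear_curv(1)[OF A ps]] linear_scale[OF linear_curv(2)[OF A ps]] scaleR_sum_right)
 also have "... = 0" by (simp add: all)
 finally show ?thesis .
qed

end

section \<open>Parallel frames\<close>

lemma vector_derivative_bound:
 fixes f :: "real => 'b::real_normed_vector"
 assumes "\<And>t. t \<in> {0..1} ==> (f has_vector_derivative f' t) (at t within {0..1})"
  and "\<And>t. t \<in> {0..1} ==> norm (f' t) \<le> B"
 shows "norm (f 1 - f 0) \<le> B"
proof -
 have "norm (f 1 - f 0) \<le> B * norm (1 - 0 :: real)"
 proof (rule differentiable_bound[where f' = "%t h. h *\<^sub>R f' t"])
  show "onorm (%h. h *\<^sub>R f' t) \<le> B" if "t \<in> {0..1}" for t
   using assms(2)[OF that] by (intro onorm_le) (simp add: mult.commute[of B] mult_left_mono)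
 qed (use assms(1) in \<open>auto simp: has_vector_derivative_def\<close>)
 thus ?thesis by simp
qed

lemma integral_diff_bound:
 fixes f :: "real => 'b::banach"
 assumes f: "continuous_on {0..1} f" and "\<And>s. s \<in> {0..1} ==> norm (f s - c) \<le> B"
 shows "norm (integral {0..1} f - c) \<le> B"
proof -
 have "integral {0..1} (%s. f s - c) = integral {0..1} f - c"
  using integral_diff[OF integrable_continuous_real[OF f] integrable_const_ivl[of c 0 1]] by simp
 moreover have "norm (integral {0..1} (%s. f s - c)) \<le> B * (1 - 0)"
  by (rule integral_bound) (auto intro!: continuous_intros f assms(2))
 ultimately show ?thesis by simp
qed

lemma unit_interval_scaled: "norm (t *\<^sub>R x) \<le> norm x" if "t \<in> {0..1::real}" for x :: "'b::real_normed_vector"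
 using that mult_right_mono[of t 1 "norm x"] by simp

text \<open>Picard iteration as a series: \<open>U k\<close> is the \<open>k\<close>-fold iterated
  integral, bounded by a term of an exponential series. The sum converges uniformly and solves the
  integral equation.\<close>

lemma linear_ode:
 fixes a :: "real => complex^'n::finite^'n"
 assumes a: "continuous_on {0..1} a"
 obtains u where "u 0 = mat 1"
  "\<And>t. t \<in> {0..1} ==> (u has_vector_derivative a t ** u t) (at t within {0..1})"
proof -
 obtain M where M: "M > 0" "\<And>t. t \<in> {0..1} ==> norm (a t) \<le> M"
  using compact_imp_bounded[OF compact_continuous_image[OF a compact_Icc]] unfolding bounded_pos by auto
 define c where "c = norm (mat 1 :: complex^'n^'n)"
 define U where "U k = ((%f t. integral {0..t} (%s. a s ** f s)) ^^ k) (%_. mat 1 :: complex^'n^'n)" for k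
 have U0: "U 0 t = mat 1" for t by (simp add: U_def)
 have US: "U (Suc k) t = integral {0..t} (%s. a s ** U k s)" for k t by (simp add: U_def)
 have cU: "continuous_on {0..1} (U k)" for k
 proof (induction k)
  case (Suc k)
  have "continuous_on {0..1} (%t. integral {0..t} (%s. a s ** U k s))"
   by (intro indefinite_integral_continuous_1 integrable_continuous_real mm.continuous_on a Suc)
  thus ?case by (simp add: US[abs_def] cong: continuous_on_cong)
 qed (simp add: U_def)
 have dU: "(U (Suc k) has_vector_derivative a t ** U k t) (at t within {0..1})" if "t \<in> {0..1}" for k t
  using integral_has_vector_derivative[OF mm.continuous_on[OF a cU[of k]] that] by (simp add: US[abs_def])
 define b where "b k t = c * M ^ k * t ^ k / fact k" for k t
 have bU: "norm (U k t) \<le> b k t" if "t \<in> {0..1}" for k t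
  using that
 proof (induction k arbitrary: t)
  case 0 thus ?case by (simp add: U0 b_def c_def)
 next
  case (Suc k)
  have sub: "{0..t} \<subseteq> {0..1}" using Suc.prems by auto
  have i: "((%s. M * b k s) has_integral (b (Suc k) t - b (Suc k) 0)) {0..t}"
  proof (rule fundamental_theorem_of_calculus)
   show "(b (Suc k) has_vector_derivative M * b k s) (at s within {0..t})" for s
    unfolding b_def has_real_derivative_iff_has_vector_derivative[symmetric]
    by (rule derivative_eq_intros refl | simp)+
  qed (use Suc.prems in auto)
  have "norm (integral {0..t} (%s. a s ** U k s)) \<le> integral {0..t} (%s. M * b k s)"
  proof (rule integral_norm_bound_integral)
   show "(%s. a s ** U k s) integrable_on {0..t}"
    by (intro integrable_continuous_real mm.continuous_on continuous_on_subset[OF _ sub] a cU)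
   show "(%s. M * b k s) integrable_on {0..t}" using i by blast
   fix s assume "s \<in> {0..t}"
   hence "s \<in> {0..1}" using sub by auto
   thus "norm (a s ** U k s) \<le> M * b k s"
    using norm_matrix_mult_le[of "a s" "U k s"] M Suc.IH[of s] mult_mono[of "norm (a s)" M "norm (U k s)" "b k s"]
    by fastforce
  qed
  also have "... = b (Suc k) t" using integral_unique[OF i] by (simp add: b_def)
  finally show ?case by (simp add: US)
 qed
 have b1: "norm (U k t) \<le> c * (M ^ k / fact k)" if "t \<in> {0..1}" for k t
 proof -
  have "b k t \<le> c * M ^ k * 1 / fact k"
   unfolding b_def using that M(1)
   by (intro divide_right_mono mult_left_mono power_le_one) (auto simp: c_def)
  thus ?thesis using bU[OF that, of k] by simp
 qed
 have sm: "summable (%k. c * (M ^ k / fact k))"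
  using summable_exp[of M] by (intro summable_mult) (simp add: divide_inverse mult.commute)
 have ul: "uniform_limit {0..1} (%n t. \<Sum>k<n. U k t) (%t. \<Sum>k. U k t) sequentially"
  by (rule Weierstrass_m_test[OF _ sm]) (use b1 in auto)
 define u where "u t = (\<Sum>k. U k t)" for t
 have su: "(%k. U k t) sums u t" if "t \<in> {0..1}" for t
  unfolding u_def by (rule summable_sums[OF summable_comparison_test'[OF sm, of 0]]) (use b1[OF that] in auto)
 have u0: "u 0 = mat 1"
 proof -
  have "U k 0 = (if k = 0 then mat 1 else 0)" for k by (cases k) (simp_all add: U0 US)
  hence "(%k. U k 0) sums mat 1" using sums_If_finite_set[of "{0 :: nat}" "%_. mat 1 :: complex^'n^'n"] by simp
  thus ?thesis using su[of 0] sums_unique2 by force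
 qed
 have "continuous_on {0..1} (%t. u t)"
  unfolding u_def by (rule uniform_limit_theorem[OF _ ul]) (auto intro!: always_eventually continuous_on_sum cU)
 hence ca: "continuous_on {0..1} (%t. a t ** u t)" by (intro mm.continuous_on a)
 have ueq: "u t = mat 1 + integral {0..t} (%s. a s ** u s)" if t: "t \<in> {0..1}" for t
 proof -
  have sub: "{0..t} \<subseteq> {0..1}" using t by auto
  have "uniform_limit {0..t} (%n s. a s ** (\<Sum>k<n. U k s)) (%s. a s ** u s) sequentially"
  proof (rule mm.bounded_uniform_limit)
   show "uniform_limit {0..t} (%n s. \<Sum>k<n. U k s) u sequentially"
    using uniform_limit_on_subset[OF ul sub] by (simp add: u_def[abs_def])
   show "bounded (a ` {0..t})" using M(2) sub by (intro boundedI[of _ M]) auto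
   show "bounded (u ` {0..t})"
    by (rule compact_imp_bounded, rule compact_continuous_image)
     (use \<open>continuous_on {0..1} (%t. u t)\<close> sub in \<open>auto intro: continuous_on_subset\<close>)
  qed (rule uniform_limit_const)
  then obtain I Jl where I: "\<And>n. ((%s. a s ** (\<Sum>k<n. U k s)) has_integral I n) {0..t}"
   "((%s. a s ** u s) has_integral Jl) {0..t}" "I \<longlonglongrightarrow> Jl"
   by (rule uniform_limit_integral)
    (auto intro!: mm.continuous_on continuous_on_sum intro: continuous_on_subset[OF _ sub] a cU)
  have "I n = (\<Sum>k<n. U (Suc k) t)" for n
  proof -
   have "((%s. \<Sum>k<n. a s ** U k s) has_integral (\<Sum>k<n. U (Suc k) t)) {0..t}"
    unfolding US
    by (intro has_integral_sum integrable_integral integrable_continuous_real)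
     (auto intro!: mm.continuous_on continuous_on_subset[OF _ sub] a cU)
   thus ?thesis using I(1)[of n] by (simp add: mm.sum_right has_integral_unique)
  qed
  hence "(%k. U (Suc k) t) sums Jl" using I(3) unfolding sums_def by presburger
  hence "(%k. U k t) sums (Jl + U 0 t)" by (rule sums_Suc)
  thus ?thesis using su[OF t] sums_unique2 I(2) by (fastforce simp: U0 integral_unique add.commute)
 qed
 have "(u has_vector_derivative a t ** u t) (at t within {0..1})" if t: "t \<in> {0..1}" for t
 proof (rule has_vector_derivative_transform[OF t ueq])
  show "((%t. mat 1 + integral {0..t} (%s. a s ** u s)) has_vector_derivative a t ** u t) (at t within {0..1})"
   using has_vector_derivative_add[OF has_vector_derivative_const integral_has_vector_derivative[OF ca t]] by simp
 qed auto
 with u0 show ?thesis using that by blast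
qed

lemma adj_has_vector_derivative:
 "(u has_vector_derivative u') F ==> ((%t. adj (u t)) has_vector_derivative adj (u' :: complex^'n::finite^'n)) F"
 by (rule bounded_linear.has_vector_derivative[OF bounded_linear_adj])

lemma skew_ode_unitary:
 fixes a u :: "real => complex^'n::finite^'n"
 assumes "u 0 = mat 1" "\<And>t. adj (a t) = - a t"
  and u: "\<And>t. t \<in> {0..1} ==> (u has_vector_derivative a t ** u t) (at t within {0..1})"
  and t: "t \<in> {0..1}"
 shows "unitary (u t)"
proof -
 have "((%t. adj (u t) ** u t) has_vector_derivative 0) (at s within {0..1})" if s: "s \<in> {0..1}" for s
  using mm.has_vector_derivative[OF adj_has_vector_derivative[OF u[OF s]] u[OF s]]
  by (simp add: adj_mult assms(2) mm.minus_right mm.minus_left matrix_mul_assoc)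
 then obtain c where "\<And>s. s \<in> {0..1} ==> adj (u s) ** u s = c"
  using has_vector_derivative_zero_constant[of "{0..1}" "%t. adj (u t) ** u t"] by auto
 from this[of 0] this[OF t] show ?thesis by (simp add: assms(1) unitary_def adj_mat)
qed

section \<open>Radial parallel transport\<close>

context discrete_subgroup begin

text \<open>Parallel transport along the segment from 0 to \<open>th\<close>, parametrised by the
  unit interval; the value at time 1 will be the frame at \<open>th\<close>.\<close>

definition solution :: "('q => 'q => complex^'n::finite^'n) => 'q => (real => complex^'n^'n) => bool" where
 "solution A th g \<longleftrightarrow> g 0 = mat 1 \<and> (\<forall>t\<in>{0..1}. unitary (g t) \<and>
   (g has_vector_derivative - A (t *\<^sub>R th) th ** g t) (at t within {0..1}))"

lemma solution_exists:
 assumes A: "connection A" shows "\<exists>g. solution A th g"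
proof -
 have c: "continuous_on {0..1} (%t. - A (t *\<^sub>R th) th)"
  by (intro continuous_on_minus continuous_on_compose2[OF tcontD(2)[OF connectionD(1)[OF A]]] continuous_intros) auto
 from linear_ode[OF this] obtain u where u: "u 0 = mat 1"
  "\<And>t. t \<in> {0..1} ==> (u has_vector_derivative - A (t *\<^sub>R th) th ** u t) (at t within {0..1})" by blast
 moreover have "unitary (u t)" if "t \<in> {0..1}" for t
  by (rule skew_ode_unitary[OF u(1) _ u(2) that]) (simp_all add: connectionD(3)[OF A] adj_uminus)
 ultimately show ?thesis unfolding solution_def by blast
qed

text \<open>The integral of the connection over the segment from \<open>t th\<close> to \<open>t (th + v)\<close>; its derivative in \<open>t\<close>
 is Stokes' theorem on a triangle.\<close>

lemma segment_integral_derivative: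
 fixes B :: "'q => 'q => complex^'n::finite^'n"
 assumes mB: "\<And>x. mtrig (%p. B p x)" and lB: "\<And>p. linear (B p)" and tC: "tcont C"
  and curv: "\<And>p. dir_deriv th (%p. B p v) p - dir_deriv v (%p. B p th) p = - C p"
 shows "((%t. integral {0..1} (%s. t *\<^sub>R B (t *\<^sub>R (th + s *\<^sub>R v)) v)) has_vector_derivative
   B (t *\<^sub>R (th + v)) (th + v) - B (t *\<^sub>R th) th - integral {0..1} (%s. t *\<^sub>R C (t *\<^sub>R (th + s *\<^sub>R v)))) (at t)"
proof -
 let ?p = "%t s. t *\<^sub>R (th + s *\<^sub>R v)"
 let ?D = "%x y p. dir_deriv x (%p. B p y) p"
 have cont: "continuous_on S (%z. f (q z))" if "tcont f" "continuous_on S q"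
  for f :: "'q => complex^'n^'n" and S and q :: "'z::topological_space => 'q"
  by (rule continuous_on_compose2[OF tcontD(2)[OF that(1)] that(2)]) auto
 have tB: "tcont (%p. B p x)" and tD: "tcont (?D x y)" for x y
  by (intro mtrig_tcont mB mtrig_dir_deriv)+
 have dB: "((%p. B p y) has_derivative (%x. ?D x y p)) (at p)" for y p
  by (rule mtrig_has_derivative(1)[OF mB])
 have lD: "?D (x + r *\<^sub>R x') y p = ?D x y p + r *\<^sub>R ?D x' y p" for x x' r y p
  using has_derivative_linear[OF dB[of y p]] by (simp add: linear_add[of "%x. ?D x y p"] linear_scale[of "%x. ?D x y p"])
 have lD': "?D y (x + r *\<^sub>R x') p = ?D y x p + r *\<^sub>R ?D y x' p" for x x' r y p
 proof -
  have "((%p. B p x + r *\<^sub>R B p x') has_derivative (%y. ?D y x p + r *\<^sub>R ?D y x' p)) (at p)"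
   by (intro has_derivative_add has_derivative_scaleR_right dB)
  thus ?thesis using dir_deriv_eq by (simp add: linear_add[OF lB] linear_scale[OF lB])
 qed
 \<comment> \<open>Differentiation under the integral. Afterwards the velocity
   \<open>th + s *\<^sub>R v\<close> is split, and the curvature hypothesis exchanges
   \<open>th\<close> and \<open>v\<close> at the price of \<open>C\<close>.\<close>
 have "((%t. integral (cbox 0 1) (%s. t *\<^sub>R B (?p t s) v)) has_vector_derivative
   integral (cbox 0 1) (%s. B (?p t s) v + t *\<^sub>R ?D (th + s *\<^sub>R v) v (?p t s))) (at t within UNIV)"
 proof (rule leibniz_rule_vector_derivative)
  fix t s :: real
  have "((%t. ?p t s) has_vector_derivative (th + s *\<^sub>R v)) (at t within UNIV)"
   by (auto intro!: derivative_eq_intros simp: has_vector_derivative_def)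
  hence "((%t. B (?p t s) v) has_vector_derivative ?D (th + s *\<^sub>R v) v (?p t s)) (at t within UNIV)"
   using vector_derivative_diff_chain_within[of "%t. ?p t s" "th + s *\<^sub>R v" t UNIV "%p. B p v", OF _ has_derivative_at_withinI[OF dB]] by (simp add: o_def)
  from has_vector_derivative_scaleR[OF DERIV_ident this]
  show "((%t. t *\<^sub>R B (?p t s) v) has_vector_derivative B (?p t s) v + t *\<^sub>R ?D (th + s *\<^sub>R v) v (?p t s)) (at t within UNIV)"
   by (simp add: add.commute)
 next
  fix t :: real
  show "(%s. t *\<^sub>R B (?p t s) v) integrable_on cbox 0 1"
   by (intro integrable_continuous continuous_intros cont[OF tB])
 next
  show "continuous_on (UNIV \<times> cbox 0 1) (%(t, s). B (?p t s) v + t *\<^sub>R ?D (th + s *\<^sub>R v) v (?p t s))"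
   unfolding split_beta lD by (intro continuous_intros cont[OF tB] cont[OF tD])
 qed auto
 also have "integral (cbox 0 1) (%s. B (?p t s) v + t *\<^sub>R ?D (th + s *\<^sub>R v) v (?p t s)) =
   integral (cbox 0 1) (%s. (B (?p t s) v + t *\<^sub>R ?D v (th + s *\<^sub>R v) (?p t s)) - t *\<^sub>R C (?p t s))"
 proof (rule arg_cong[where f = "integral _"], rule ext)
  fix s
  have *: "t *\<^sub>R ?D th v p = t *\<^sub>R ?D v th p - t *\<^sub>R C p" for p
   using curv[of p] by (simp add: scaleR_diff_right[symmetric] algebra_simps del: scaleR_diff_right)
  show "B (?p t s) v + t *\<^sub>R ?D (th + s *\<^sub>R v) v (?p t s) =
    (B (?p t s) v + t *\<^sub>R ?D v (th + s *\<^sub>R v) (?p t s)) - t *\<^sub>R C (?p t s)"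
   unfolding lD lD' scaleR_add_right * by simp
 qed
 also have "... = integral (cbox 0 1) (%s. B (?p t s) v + t *\<^sub>R ?D v (th + s *\<^sub>R v) (?p t s)) - integral (cbox 0 1) (%s. t *\<^sub>R C (?p t s))"
  unfolding lD' by (intro integral_diff integrable_continuous continuous_intros cont[OF tB] cont[OF tD] cont[OF tC])
 \<comment> \<open>After the exchange the integrand is the derivative in \<open>s\<close> of the
   form evaluated on the moving radial direction, which leaves a boundary term.\<close>
 also have "integral (cbox 0 1) (%s. B (?p t s) v + t *\<^sub>R ?D v (th + s *\<^sub>R v) (?p t s)) = B (?p t 1) (th + 1 *\<^sub>R v) - B (?p t 0) (th + 0 *\<^sub>R v)"
  unfolding box_real
 proof (rule integral_unique[OF fundamental_theorem_of_calculus])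
  fix s :: real
  have B_eq: "(%s. B (?p t s) (th + s *\<^sub>R v)) = (%s. B (?p t s) th + s *\<^sub>R B (?p t s) v)"
   by (simp add: linear_add[OF lB] linear_scale[OF lB])
  have "((%s. ?p t s) has_vector_derivative t *\<^sub>R v) (at s within {0..1})"
   by (auto intro!: derivative_eq_intros simp: has_vector_derivative_def)
  hence d: "((%s. B (?p t s) y) has_vector_derivative t *\<^sub>R ?D v y (?p t s)) (at s within {0..1})" for y
   using vector_derivative_diff_chain_within[of "%s. ?p t s" "t *\<^sub>R v" s "{0..1}" "%p. B p y", OF _ has_derivative_at_withinI[OF dB]]
    linear_scale[OF has_derivative_linear[OF dB[of y "?p t s"]], of t v]
   by (simp add: o_def)
  show "((%s. B (?p t s) (th + s *\<^sub>R v)) has_vector_derivative B (?p t s) v + t *\<^sub>R ?D v (th + s *\<^sub>R v) (?p t s)) (at s within {0..1})"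
   unfolding B_eq lD'
   using has_vector_derivative_add[OF d[of th] has_vector_derivative_scaleR[OF DERIV_ident d[of v]]]
   by (simp add: algebra_simps)
 qed simp
 finally show ?thesis by simp
qed

text \<open>The transports along the rays to \<open>th\<close> and \<open>th + v\<close> differ to
  first order by the integral \<open>Y\<close> of the form over the segment between the rays, taken
  for the smooth \<open>B\<close> so that \<open>A\<close> is never differentiated. The corrected
  difference solves the transport equation of \<open>g'\<close> up to a source of size
  \<open>eps * norm v\<close>; multiplication by the adjoint of the unitary \<open>g'\<close>
  removes the transport.\<close>

lemma frame_estimate:
 fixes A B :: "'q => 'q => complex^'n::finite^'n"
 assumes A: "connection A" and mB: "\<And>x. mtrig (%p. B p x)" and lB: "\<And>p. linear (B p)" and tC: "tcont C"
  and curv: "\<And>p. dir_deriv th (%p. B p v) p - dir_deriv v (%p. B p th) p = - C p"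
  and g: "solution A th g" and g': "solution A (th + v) g'"
  and K: "K \<ge> 0" "\<And>p x. norm (A p x) \<le> K * norm x"
  and et: "0 \<le> et" "et \<le> eps" "et \<le> 1" "et * (2 * norm th + norm v) \<le> eps * norm v" "\<And>p x. norm (B p x - A p x) \<le> et * norm x"
  and v: "norm v \<le> eps" "\<And>p q x. dist p q \<le> norm v ==> norm (A p x - A q x) \<le> eps * norm x"
  and C: "\<And>p. norm (C p - commutator (A p th) (A p v)) \<le> eps * norm v"
 shows "norm (g' 1 - g 1 + A th v ** g 1) \<le> eps * norm v * (4 + (norm th + K) * (K + 1) + 8 * K * norm th)"
proof -
 let ?p = "%t s. t *\<^sub>R (th + s *\<^sub>R v)"
 have eps: "eps \<ge> 0" using et by linarith
 have dist_p: "dist (?p t s) (t *\<^sub>R th) \<le> norm v" if "t \<in> {0..1}" "s \<in> {0..1}" for t s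
 proof -
  have "norm (t *\<^sub>R s *\<^sub>R v) \<le> norm v" using unit_interval_scaled[OF that(1), of "s *\<^sub>R v"] unit_interval_scaled[OF that(2), of v] by linarith
  thus ?thesis by (simp add: dist_norm algebra_simps)
 qed
 have tB: "tcont (%p. B p x)" for x by (intro mtrig_tcont mB)
 have cont: "continuous_on {0..1} (%s. t *\<^sub>R f (?p t s))" if "tcont f" for f :: "'q => complex^'n^'n" and t
  by (intro continuous_intros continuous_on_compose2[OF tcontD(2)[OF that]]) auto
 define Y where "Y t = integral {0..1} (%s. t *\<^sub>R B (?p t s) v)" for t
 define R where "R t = integral {0..1} (%s. t *\<^sub>R C (?p t s))" for t
 define a where "a t = A (t *\<^sub>R th) th" for t
 define b where "b t = A (t *\<^sub>R (th + v)) (th + v)" for t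
 define an where "an t = B (t *\<^sub>R th) th" for t
 define bn where "bn t = B (t *\<^sub>R (th + v)) (th + v)" for t
 define y where "y t = t *\<^sub>R A (t *\<^sub>R th) v" for t
 have dY: "(Y has_vector_derivative bn t - an t - R t) (at t within {0..1})" for t
  using segment_integral_derivative[OF mB lB tC curv, of t]
  by (simp add: Y_def[abs_def] R_def an_def bn_def has_vector_derivative_at_within)
 have scal: "norm (t *\<^sub>R x) \<le> e" if "t \<in> {0..1}" "norm x \<le> e" for t e and x :: "complex^'n^'n"
  using unit_interval_scaled[OF that(1), of x] that(2) by linarith
 have Yy: "norm (Y t - y t) \<le> 2 * eps * norm v" if t: "t \<in> {0..1}" for t
  unfolding Y_def y_def
 proof (rule integral_diff_bound[OF cont[OF tB]])
  fix s :: real assume s: "s \<in> {0..1}"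
  have "norm (B (?p t s) v - A (t *\<^sub>R th) v) \<le> norm (B (?p t s) v - A (?p t s) v) + norm (A (?p t s) v - A (t *\<^sub>R th) v)"
   using norm_triangle_ineq[of "B (?p t s) v - A (?p t s) v" "A (?p t s) v - A (t *\<^sub>R th) v"] by simp
  also have "... \<le> et * norm v + eps * norm v"
   by (intro add_mono et(5) v(2) dist_p t s)
  also have "... \<le> 2 * eps * norm v" using mult_right_mono[OF et(2), of "norm v"] by simp
  finally show "norm (t *\<^sub>R B (?p t s) v - t *\<^sub>R A (t *\<^sub>R th) v) \<le> 2 * eps * norm v"
   using scal[OF t, of "B (?p t s) v - A (t *\<^sub>R th) v"] by (simp add: scaleR_diff_right)
 qed
 have Yb: "norm (Y t) \<le> (K + 1) * norm v" if t: "t \<in> {0..1}" for t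
 proof -
  have "norm (Y t - 0) \<le> (K + 1) * norm v"
   unfolding Y_def
  proof (rule integral_diff_bound[OF cont[OF tB]])
   fix s :: real
   have "norm (B (?p t s) v) \<le> norm (B (?p t s) v - A (?p t s) v) + norm (A (?p t s) v)"
    using norm_triangle_ineq[of "B (?p t s) v - A (?p t s) v" "A (?p t s) v"] by simp
   also have "... \<le> et * norm v + K * norm v" by (intro add_mono et(5) K(2))
   also have "... \<le> (K + 1) * norm v" using mult_right_mono[OF et(3), of "norm v"] by (simp add: algebra_simps)
   finally show "norm (t *\<^sub>R B (?p t s) v - 0) \<le> (K + 1) * norm v"
    using scal[OF t, of "B (?p t s) v"] by simp
  qed
  thus ?thesis by simp
 qed
 have cbound: "norm (commutator x z) \<le> 2 * norm x * norm z" for x z :: "complex^'n^'n"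
  unfolding commutator_def
  using norm_triangle_ineq4[of "x ** z" "z ** x"] norm_matrix_mult_le[of x z] norm_matrix_mult_le[of z x] by (simp add: mult.commute[of "norm z"])
 have Rb: "norm (R t - commutator (a t) (y t)) \<le> eps * norm v + 4 * K * norm th * (eps * norm v)" if t: "t \<in> {0..1}" for t
  unfolding R_def
 proof (rule integral_diff_bound[OF cont[OF tC]])
  fix s :: real assume s: "s \<in> {0..1}"
  let ?x = "A (?p t s) th" and ?z = "A (?p t s) v" and ?xo = "A (t *\<^sub>R th) th" and ?zo = "A (t *\<^sub>R th) v"
  have "norm (C (?p t s) - commutator ?xo ?zo) \<le> norm (C (?p t s) - commutator ?x ?z) + norm (commutator (?x - ?xo) ?z) + norm (commutator ?xo (?z - ?zo))"
  proof -
   have "C (?p t s) - commutator ?xo ?zo = (C (?p t s) - commutator ?x ?z) + commutator (?x - ?xo) ?z + commutator ?xo (?z - ?zo)"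
    by (simp add: cm.diff_left cm.diff_right commutator_simps)
   thus ?thesis by (simp only:) (intro order_trans[OF norm_triangle_ineq] add_right_mono norm_triangle_ineq)
  qed
  also have "... \<le> eps * norm v + 2 * (eps * norm th) * (K * norm v) + 2 * (K * norm th) * (eps * norm v)"
  proof (intro add_mono)
   show "norm (C (?p t s) - commutator ?x ?z) \<le> eps * norm v" by (rule C)
   show "norm (commutator (?x - ?xo) ?z) \<le> 2 * (eps * norm th) * (K * norm v)"
    by (intro order_trans[OF cbound] mult_mono mult_left_mono v(2) K(2) dist_p t s) (auto simp: eps K)
   show "norm (commutator ?xo (?z - ?zo)) \<le> 2 * (K * norm th) * (eps * norm v)"
    by (intro order_trans[OF cbound] mult_mono mult_left_mono v(2) K(2) dist_p t s) (auto simp: eps K)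
  qed
  also have "... = eps * norm v + 4 * K * norm th * (eps * norm v)" by (simp add: algebra_simps)
  finally have "norm (t *\<^sub>R (C (?p t s) - commutator ?xo ?zo)) \<le> eps * norm v + 4 * K * norm th * (eps * norm v)"
   by (rule scal[OF t])
  thus "norm (t *\<^sub>R C (?p t s) - commutator (a t) (y t)) \<le> eps * norm v + 4 * K * norm th * (eps * norm v)"
   by (simp add: a_def y_def scaleR_diff_right commutator_simps)
 qed
 \<comment> \<open>The source left after the correction. Its first two differences are smoothing
   errors; the products with \<open>Y\<close> cancel \<open>R\<close> to leading order, because
   \<open>R\<close> integrates the commutator prescribed by flatness.\<close>
 define S where "S t = (bn t - b t) - (an t - a t) + b t ** Y t - Y t ** a t - R t" for t
 have Sb: "norm (S t) \<le> eps * norm v * (2 + (norm th + K) * (K + 1) + 8 * K * norm th)" if t: "t \<in> {0..1}" for t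
 proof -
  have "norm (b t - a t) \<le> norm (A (t *\<^sub>R (th + v)) th - A (t *\<^sub>R th) th) + norm (A (t *\<^sub>R (th + v)) v)"
   unfolding a_def b_def connectionD(4)[OF A]
   by (metis add.commute add_diff_eq norm_triangle_ineq)
  also have "... \<le> eps * norm th + K * norm v"
   using dist_p[OF t, of 1] by (intro add_mono v(2) K(2)) simp
  also have "... \<le> eps * (norm th + K)" using mult_left_mono[OF v(1) K(1)] by (simp add: algebra_simps)
  finally have 1: "norm ((b t - a t) ** Y t) \<le> eps * (norm th + K) * ((K + 1) * norm v)"
   using norm_matrix_mult_le[of "b t - a t" "Y t"] Yb[OF t] mult_mono[of "norm (b t - a t)" "eps * (norm th + K)" "norm (Y t)" "(K + 1) * norm v"]
   by (smt (verit) norm_ge_zero)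
  have 2: "norm (commutator (a t) (Y t - y t)) \<le> 2 * (K * norm th) * (2 * eps * norm v)"
   using K by (intro order_trans[OF cbound] mult_mono mult_left_mono Yy t) (auto simp: a_def)
  have 3: "norm (bn t - b t) \<le> et * norm th + et * norm v"
   unfolding bn_def b_def using et(5)[of "t *\<^sub>R (th + v)" "th + v"] mult_left_mono[OF norm_triangle_ineq[of th v] et(1)] by (simp add: algebra_simps)
  have 4: "norm (an t - a t) \<le> et * norm th" unfolding an_def a_def by (rule et(5))
  have "S t = (bn t - b t) - (an t - a t) + (b t - a t) ** Y t + commutator (a t) (Y t - y t) - (R t - commutator (a t) (y t))"
   by (simp add: S_def commutator_def mm.diff_left mm.diff_right algebra_simps)
  hence "norm (S t) \<le> norm (bn t - b t) + norm (an t - a t) + norm ((b t - a t) ** Y t) + norm (commutator (a t) (Y t - y t)) + norm (R t - commutator (a t) (y t))"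
   by (smt (verit, ccfv_threshold) norm_triangle_ineq norm_triangle_ineq4)
  hence "norm (S t) \<le> et * (2 * norm th + norm v) + eps * (norm th + K) * ((K + 1) * norm v) + 2 * (K * norm th) * (2 * eps * norm v) +
    (eps * norm v + 4 * K * norm th * (eps * norm v))"
   using 1 2 3 4 Rb[OF t] by (simp add: algebra_simps)
  also have "... \<le> eps * norm v * (2 + (norm th + K) * (K + 1) + 8 * K * norm th)"
   using et(4) by (simp add: algebra_simps)
  finally show ?thesis .
 qed
 \<comment> \<open>To first order \<open>g' - g\<close> equals \<open>- (Y ** g)\<close>, so
   \<open>w\<close> should be negligible.\<close>
 define w where "w t = g' t - g t + Y t ** g t" for t
 have sg: "g 0 = mat 1" "g' 0 = mat 1" "\<And>t. t \<in> {0..1} ==> unitary (g t)" "\<And>t. t \<in> {0..1} ==> unitary (g' t)"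
  and dg: "\<And>t. t \<in> {0..1} ==> (g has_vector_derivative - (a t ** g t)) (at t within {0..1})"
  and dg': "\<And>t. t \<in> {0..1} ==> (g' has_vector_derivative - (b t ** g' t)) (at t within {0..1})"
  using g g' unfolding solution_def a_def b_def by (auto simp: mm.minus_left)
 have b_skew: "adj (b t) = - b t" for t unfolding b_def by (rule connectionD(3)[OF A])
 have "norm (adj (g' 1) ** w 1 - adj (g' 0) ** w 0) \<le> eps * norm v * (2 + (norm th + K) * (K + 1) + 8 * K * norm th)"
 proof (rule vector_derivative_bound)
  fix t :: real assume t: "t \<in> {0..1}"
  have dw: "(w has_vector_derivative - (b t ** w t) + S t ** g t) (at t within {0..1})"
   unfolding w_def
  proof (rule has_vector_derivative_eq_rhs)
   show "((%t. g' t - g t + Y t ** g t) has_vector_derivative - (b t ** g' t) - (- (a t ** g t)) + (Y t ** - (a t ** g t) + (bn t - an t - R t) ** g t)) (at t within {0..1})"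
    by (intro has_vector_derivative_add has_vector_derivative_diff dg dg' mm.has_vector_derivative dY t)
   show "- (b t ** g' t) - (- (a t ** g t)) + (Y t ** - (a t ** g t) + (bn t - an t - R t) ** g t) = - (b t ** (g' t - g t + Y t ** g t)) + S t ** g t"
    by (simp add: S_def mm.diff_left mm.diff_right mm.add_left mm.add_right mm.minus_left mm.minus_right matrix_mul_assoc algebra_simps)
  qed
  have "((%t. adj (g' t) ** w t) has_vector_derivative adj (g' t) ** (- (b t ** w t) + S t ** g t) + adj (- (b t ** g' t)) ** w t) (at t within {0..1})"
   by (rule mm.has_vector_derivative[OF adj_has_vector_derivative[OF dg'[OF t]] dw])
  moreover have "adj (g' t) ** (- (b t ** w t) + S t ** g t) + adj (- (b t ** g' t)) ** w t = adj (g' t) ** (S t ** g t)"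
   by (simp add: adj_uminus adj_mult b_skew mm.minus_left mm.minus_right mm.add_right mm.diff_right matrix_mul_assoc)
  ultimately show "((%t. adj (g' t) ** w t) has_vector_derivative adj (g' t) ** (S t ** g t)) (at t within {0..1})"
   by simp
  show "norm (adj (g' t) ** (S t ** g t)) \<le> eps * norm v * (2 + (norm th + K) * (K + 1) + 8 * K * norm th)"
   using Sb[OF t] by (simp add: norm_unitary_mult[OF unitary_adj[OF sg(4)[OF t]]] norm_unitary_mult[OF sg(3)[OF t]])
 qed
 moreover have "w 0 = 0" by (simp add: w_def sg Y_def)
 ultimately have w1: "norm (w 1) \<le> eps * norm v * (2 + (norm th + K) * (K + 1) + 8 * K * norm th)"
  by (simp add: norm_unitary_mult unitary_adj sg)
 have "g' 1 - g 1 + A th v ** g 1 = w 1 - (Y 1 - y 1) ** g 1"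
  by (simp add: w_def y_def mm.diff_left)
 hence "norm (g' 1 - g 1 + A th v ** g 1) \<le> norm (w 1) + norm (Y 1 - y 1)"
  using norm_triangle_ineq4[of "w 1" "(Y 1 - y 1) ** g 1"] by (simp add: norm_unitary_mult sg)
 also have "... \<le> eps * norm v * (2 + (norm th + K) * (K + 1) + 8 * K * norm th) + 2 * eps * norm v"
  by (intro add_mono w1 Yy) simp
 finally show ?thesis by (simp add: algebra_simps)
qed

text \<open>There are four basis vectors, and each contributes a quarter of the bound.\<close>

lemma linear_family_bound:
 fixes D :: "'q => 'b::real_normed_vector"
 assumes "linear D" "\<And>b. b \<in> Basis ==> norm (D b) \<le> et / 4" "DIM('q) = 4"
 shows "norm (D x) \<le> et * norm x"
proof -
 have "norm (D x) = norm (\<Sum>b\<in>Basis. (x \<bullet> b) *\<^sub>R D b)"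
  using linear_sum[OF assms(1), of "%b. (x \<bullet> b) *\<^sub>R b" Basis] by (simp add: euclidean_representation linear_scale[OF assms(1)])
 also have "... \<le> (\<Sum>b\<in>(Basis :: 'q set). norm x * (et / 4))"
 proof (rule order_trans[OF norm_sum], rule sum_mono)
  fix b :: 'q assume "b \<in> Basis"
  thus "norm ((x \<bullet> b) *\<^sub>R D b) \<le> norm x * (et / 4)"
   unfolding norm_scaleR by (intro mult_mono assms(2)) (auto simp: Basis_le_norm)
 qed
 also have "... = et * norm x" by (simp add: assms(3))
 finally show ?thesis .
qed

text \<open>\<open>C\<close> is the smoothed commutator: for a weakly flat connection the derivative
  part of the smoothed curvature is exactly its negative.\<close>

lemma connection_approximation:
 fixes A :: "'q => 'q => complex^'n::finite^'n"
 assumes A: "connection A" and et: "et > 0" and e: "e > 0" and dim: "DIM('q) = 4"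
  and flat: "\<And>v w ps. rtrig ps ==> curv A v w ps = 0"
 obtains B C where "\<And>x. mtrig (%p. B p x)" "\<And>p. linear (B p)" "tcont C"
  "\<And>p. dir_deriv th (%p. B p v) p - dir_deriv v (%p. B p th) p = - C p"
  "\<And>p x. norm (B p x - A p x) \<le> et * norm x"
  "\<And>p. norm (C p - commutator (A p th) (A p v)) \<le> e"
proof -
 note tA = connectionD(1)[OF A]
 define B where "B n p x = conv (ker n) (%p. A p x) p" for n p x
 define C where "C n = conv (ker n) (%p. commutator (A p th) (A p v))" for n
 have "\<forall>\<^sub>F n in sequentially. \<forall>p\<in>UNIV. dist (B n p b) (A p b) < et / 4" for b
  using uniform_limitD[OF conv_ker_uniform_limit[OF tA[of b]], of "et / 4"] et by (simp add: B_def)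
 hence "\<forall>\<^sub>F n in sequentially. \<forall>b\<in>Basis. \<forall>p\<in>UNIV. dist (B n p b) (A p b) < et / 4"
  by (intro eventually_ball_finite) auto
 moreover have "\<forall>\<^sub>F n in sequentially. \<forall>p\<in>UNIV. dist (C n p) (commutator (A p th) (A p v)) < e"
  unfolding C_def using uniform_limitD[OF conv_ker_uniform_limit[OF tcont_commutator[OF tA tA]] e] .
 ultimately have "\<exists>n. (\<forall>b\<in>Basis. \<forall>p\<in>UNIV. dist (B n p b) (A p b) < et / 4) \<and>
   (\<forall>p\<in>UNIV. dist (C n p) (commutator (A p th) (A p v)) < e)"
  by (intro eventually_happens'[OF trivial_limit_sequentially] eventually_conj)
 then obtain n where n: "\<And>b p. b \<in> Basis ==> dist (B n p b) (A p b) < et / 4"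
  "\<And>p. dist (C n p) (commutator (A p th) (A p v)) < e" by blast
 have lB: "linear (B n p)" for p
  using connectionD(2)[OF connection_conv[OF A rtrig_ker]] by (simp add: B_def[abs_def])
 show ?thesis
 proof (rule that[of "B n" "C n"])
  show mB: "mtrig (%p. B n p x)" for x unfolding B_def using mtrig_conv[OF rtrig_ker tA] .
  show "linear (B n p)" for p by (rule lB)
  show "tcont (C n)"
   unfolding C_def by (rule mtrig_tcont[OF mtrig_conv[OF rtrig_ker tcont_commutator[OF tA tA]]])
  show "dir_deriv th (%p. B n p v) p - dir_deriv v (%p. B n p th) p = - C n p" for p
   using curv_shift_eq[OF A rtrig_ker, of th v n p] flat[OF rtrig_shift[OF rtrig_ker]]
   by (simp add: B_def[abs_def] C_def eq_neg_iff_add_eq_0)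
  show "norm (B n p x - A p x) \<le> et * norm x" for p x
  proof (rule linear_family_bound[OF _ _ dim])
   show "linear (%x. B n p x - A p x)" by (intro linear_compose_sub lB connectionD(2)[OF A])
   show "norm (B n p b - A p b) \<le> et / 4" if "b \<in> Basis" for b using n(1)[OF that, of p] by (simp add: dist_norm)
  qed
  show "norm (C n p - commutator (A p th) (A p v)) \<le> e" for p using n(2)[of p] by (simp add: dist_norm)
 qed
qed

text \<open>Radial transport makes sense for a merely continuous connection. Weak flatness is what
  makes its endpoint differentiable in all directions, not only along the ray.\<close>

theorem parallel_frame_exists:
 fixes A :: "'q => 'q => complex^'n::finite^'n"
 assumes A: "connection A" and dim: "DIM('q) = 4"
  and flat: "\<And>v w ps. rtrig ps ==> curv A v w ps = 0"
 obtains G where "G 0 = mat 1" "\<And>th. unitary (G th)"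
  "\<And>th. (G has_derivative (%v. - (A th v ** G th))) (at th)"
proof -
 note tA = connectionD(1)[OF A]
 obtain g where g: "\<And>th. solution A th (g th)" using solution_exists[OF A] by metis
 define G where "G th = g th 1" for th
 have "\<exists>K. \<forall>b\<in>Basis. \<forall>p. norm (A p b) \<le> K"
 proof -
  have "\<forall>b. \<exists>M\<ge>0. \<forall>p. norm (A p b) \<le> M" using tcont_bounded[OF tA] by metis
  then obtain M where M: "\<And>b. M b \<ge> 0" "\<And>b p. norm (A p b) \<le> M b" by metis
  have "norm (A p b) \<le> (\<Sum>b\<in>Basis. M b)" if "b \<in> Basis" for p b
   using M(2)[of p b] member_le_sum[OF that, of M] M(1) by force
  thus ?thesis by blast
 qed
 then obtain K0 where K0: "\<And>b p. b \<in> Basis ==> norm (A p b) \<le> K0" by blast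
 define K where "K = 4 * max K0 0"
 have K: "K \<ge> 0" "norm (A p x) \<le> K * norm x" for p x
  using K0 by (auto simp: K_def intro!: linear_family_bound[OF connectionD(2)[OF A] _ dim] max.coboundedI1)
 have modulus: "\<exists>dl>0. \<forall>p q x. dist p q < dl \<longrightarrow> norm (A p x - A q x) \<le> eps * norm x" if eps: "eps > 0" for eps
 proof -
  have "\<exists>dl>0. \<forall>p q. dist p q < dl \<longrightarrow> norm (A p b - A q b) < eps / 4" for b
   using uniformly_continuous_onE[OF tcont_uniformly_continuous[OF tA[of b]], of "eps / 4"] eps
   unfolding dist_norm[of "A _ _"] by (metis UNIV_I dist_commute divide_pos_pos zero_less_numeral)
  hence "\<forall>b. \<exists>dl>0. \<forall>p q. dist p q < dl \<longrightarrow> norm (A p b - A q b) < eps / 4" by blast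
  then obtain d where d: "\<And>b. d b > 0" "\<And>b p q. dist p q < d b ==> norm (A p b - A q b) < eps / 4" by metis
  show ?thesis
  proof (intro exI conjI allI impI)
   show "Min (d ` Basis) > 0" using d(1) by simp
   fix p q x :: 'q assume *: "dist p q < Min (d ` Basis)"
   show "norm (A p x - A q x) \<le> eps * norm x"
   proof (rule linear_family_bound[OF _ _ dim])
    show "linear (%x. A p x - A q x)" by (intro linear_compose_sub connectionD(2)[OF A])
    show "norm (A p b - A q b) \<le> eps / 4" if "b \<in> Basis" for b using d(2)[of p q b] * that by simp
   qed
  qed
 qed
 have "(G has_derivative (%v. - (A th v ** G th))) (at th)" for th
  unfolding has_derivative_at_alt
 proof (intro conjI allI impI)
  have "linear (%v. - (A th v ** G th))"
   by (rule linearI) (simp_all add: connectionD[OF A] mm.add_left scaleR_mult_left)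
  thus "bounded_linear (%v. - (A th v ** G th))" by (simp add: linear_conv_bounded_linear)
  fix e :: real assume e: "e > 0"
  define M where "M = 4 + (norm th + K) * (K + 1) + 8 * K * norm th"
  have M: "M > 0" using K(1) by (simp add: M_def add_pos_nonneg)
  define eps where "eps = e / M"
  have eps: "eps > 0" using e M by (simp add: eps_def)
  from modulus[OF eps] obtain dl where dl: "dl > 0" "\<And>p q x. dist p q < dl ==> norm (A p x - A q x) \<le> eps * norm x" by blast
  show "\<exists>d>0. \<forall>y. norm (y - th) < d \<longrightarrow> norm (G y - G th - - (A th (y - th) ** G th)) \<le> e * norm (y - th)"
  proof (intro exI conjI allI impI)
   show "min dl eps > 0" using dl(1) eps by simp
   fix y assume y: "norm (y - th) < min dl eps"
   define v where "v = y - th"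
   show "norm (G y - G th - - (A th (y - th) ** G th)) \<le> e * norm (y - th)"
   proof (cases "v = 0")
    case False
    \<comment> \<open>The smoothing may depend on the increment \<open>v\<close>, so its error can
      be demanded small relative to \<open>norm v\<close>.\<close>
    define et where "et = min (min eps 1) (eps * norm v / (2 * norm th + norm v))"
    have pos: "2 * norm th + norm v > 0" using False by (simp add: add_nonneg_pos)
    have "eps * norm v / (2 * norm th + norm v) > 0" using eps False pos by simp
    hence et: "et > 0" "et \<le> eps" "et \<le> 1" "et * (2 * norm th + norm v) \<le> eps * norm v"
     using eps pos by (auto simp: et_def pos_le_divide_eq[symmetric])
    have ev: "eps * norm v > 0" using eps False by simp
    obtain B C where B: "\<And>x. mtrig (%p. B p x)" "\<And>p. linear (B p)" "tcont C"
     "\<And>p. dir_deriv th (%p. B p v) p - dir_deriv v (%p. B p th) p = - C p"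
     "\<And>p x. norm (B p x - A p x) \<le> et * norm x"
     "\<And>p. norm (C p - commutator (A p th) (A p v)) \<le> eps * norm v"
     by (rule connection_approximation[OF A et(1) ev dim flat, of th v]) blast+
    have "norm (g (th + v) 1 - g th 1 + A th v ** g th 1) \<le> eps * norm v * M"
     unfolding M_def
     by (rule frame_estimate[OF A B(1-4) g g K less_imp_le[OF et(1)] et(2-4) B(5) _ _ B(6)])
      (use y dl(2) in \<open>auto simp: v_def\<close>)
    also have "... = e * norm v" using M by (simp add: eps_def)
    finally show ?thesis by (simp add: G_def v_def)
   qed (simp add: v_def connectionD(6)[OF A])
  qed
 qed
 moreover have "unitary (G th)" for th using g[of th] by (simp add: solution_def G_def)
 moreover have "G 0 = mat 1"
 proof -
  have "(g 0 has_vector_derivative 0) (at t within {0..1})" if "t \<in> {0..1}" for t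
   using g[of 0] that by (simp add: solution_def connectionD(6)[OF A])
  then obtain c where c: "\<And>t. t \<in> {0..1} ==> g 0 t = c"
   using has_vector_derivative_zero_constant[of "{0..1}" "g 0"] by auto
  show ?thesis using c[of 0] c[of 1] g[of 0] by (simp add: G_def solution_def)
 qed
 ultimately show ?thesis using that by blast
qed

end

section \<open>Diagonalisation of flat equivariant connections\<close>

definition diag :: "('n::finite => complex) => complex^'n^'n" where
 "diag f = (\<chi> h k. if h = k then f h else 0)"

lemma diag_nth [simp]: "diag f $ h $ k = (if h = k then f h else 0)"
 by (simp add: diag_def)

lemma diag_mult_nth [simp]: "(diag f ** M) $ h $ k = f h * M $ h $ k" "(M ** diag f) $ h $ k = M $ h $ k * f k"
 for M :: "complex^'n::finite^'n"
 by (simp_all add: matrix_matrix_mult_def if_distrib if_distribR cong: if_cong)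

lemma adj_diag: "adj (diag f) = diag (%h. cnj (f h))"
 by (auto simp: vec_eq_iff)

lemma diag_mult: "diag f ** diag g = diag (%h. f h * g h)"
 by (auto simp: vec_eq_iff)

lemma diag_1: "diag (%_. 1) = mat 1"
 by (auto simp: vec_eq_iff mat_def)

lemma linear_span_induct:
 assumes "x \<in> span S" "\<And>s. s \<in> S ==> f s \<in> T" "linear f" "subspace T"
 shows "f x \<in> T"
 using assms(1)
 by (induction rule: span_induct_alt)
  (use assms in \<open>auto simp: linear_0 linear_add linear_scale subspace_0 subspace_add subspace_scale\<close>)

locale flat_orbifold = quaternionic_space J + discrete_subgroup La
 for J :: "nat => 'q::euclidean_space \<Rightarrow>\<^sub>L 'q" and La :: "'q set" +
 fixes e :: "'g::finite => 'q \<Rightarrow>\<^sub>L 'q"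
 assumes e_inj: "inj e" and e_id: "id_blinfun \<in> range e"
  and e_comp: "e h o\<^sub>L e k \<in> range e" and e_inv: "\<exists>k. e k o\<^sub>L e h = id_blinfun"
  and e_inner: "e h v \<bullet> e h w = v \<bullet> w" and e_J: "i \<in> {1,2,3} ==> e h (J i v) = J i (e h v)"
  and e_mem: "l \<in> La ==> e h l \<in> La"
begin

text \<open>The group law is transported to the index type, so that matrix indices serve as group
  elements in \<open>regular_rep\<close>.\<close>

definition mul :: "'g => 'g => 'g" where "mul h k = inv_into UNIV e (e h o\<^sub>L e k)"
definition unit :: 'g where "unit = inv_into UNIV e id_blinfun"
definition invg :: "'g => 'g" where "invg h = (SOME k. e k o\<^sub>L e h = id_blinfun)"

lemma e_mul_blinfun: "e (mul h k) = e h o\<^sub>L e k"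
 unfolding mul_def using e_comp by (rule f_inv_into_f)

lemma e_mul: "e (mul h k) v = e h (e k v)"
 by (simp add: e_mul_blinfun)

lemma e_unit_blinfun: "e unit = id_blinfun"
 unfolding unit_def using e_id by (rule f_inv_into_f)

lemma e_unit: "e unit v = v"
 by (simp add: e_unit_blinfun)

lemma e_eqI: "(\<And>v. e h v = e k v) ==> h = k"
 using e_inj by (meson blinfun_eqI injD)

lemma e_invg: "e (invg h) (e h v) = v"
proof -
 have "e (invg h) o\<^sub>L e h = id_blinfun" unfolding invg_def using e_inv[of h] by (rule someI_ex)
 thus ?thesis by (metis blinfun_apply_blinfun_compose id_blinfun.rep_eq id_apply)
qed

sublocale regular_rep mul unit invg
 by unfold_locales (rule e_eqI, simp add: e_mul e_unit e_invg)+

lemma e_invg': "e h (e (invg h) v) = v"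
 using right_inverse[of h] by (metis e_mul e_unit)

lemma inner_e: "e h v \<bullet> w = v \<bullet> e (invg h) w"
 using e_inner[of h v "e (invg h) w"] by (simp add: e_invg')

lemma norm_e [simp]: "norm (e h v) = norm v"
 by (simp add: norm_eq_sqrt_inner e_inner)

lemma left_mult_e: "left_mult e (e h) = L h"
proof -
 have "e a = e h o\<^sub>L e b \<longleftrightarrow> a = mul h b" for a b
  unfolding e_mul_blinfun[symmetric] using e_inj by (auto dest: injD)
 thus ?thesis by (simp add: left_mult_def L_def)
qed

lemma zero_in_periods: "0 \<in> periods"
 by (auto simp: periods_def intro: exI[of _ 0])

lemma e_periods: "c \<in> periods ==> e h c \<in> periods"
 by (auto simp: periods_def inner_e e_mem)

text \<open>A fixed vector drags its whole quaternionic frame along, since the group commutes with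
  the complex structures.\<close>

lemma e_fixpoint: "e h x = x ==> x \<noteq> 0 ==> h = unit"
proof (rule e_eqI)
 fix v assume x: "e h x = x" "x \<noteq> 0"
 have f: "e h (frame x a) = frame x a" if "a < 4" for a
 proof (cases "a = 0")
  case False
  hence "a \<in> {1,2,3}" using that by auto
  thus ?thesis using False x(1) e_J[of a h x] by (simp add: frame_def)
 qed (simp add: frame_def x(1))
 have "e h v - v = 0"
 proof (rule frame_orthogonal_eq_0[OF x(2)])
  fix a :: nat assume "a < 4"
  hence "e h v \<bullet> frame x a = v \<bullet> frame x a" using e_inner[of h v "frame x a"] f by simp
  thus "(e h v - v) \<bullet> frame x a = 0" by (simp add: inner_diff_left)
 qed
 thus "e h v = e unit v" by (simp add: e_unit)
qed

lemma e_minus_id_surj: "h \<noteq> unit ==> \<exists>x. e h x - x = c"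
proof -
 assume h: "h \<noteq> unit"
 have l: "linear (%x. e h x - x)" by (intro linear_compose_sub bounded_linear.linear[OF blinfun.bounded_linear_right] linear_ident)
 have "inj (%x. e h x - x)"
  unfolding linear_injective_0[OF l] using e_fixpoint[of h] h by auto
 hence "surj (%x. e h x - x)" using l by (intro linear_injective_imp_surjective) auto
 then obtain x where "c = e h x - x" by (rule surjE)
 thus ?thesis by auto
qed

lemma unitary_L: "unitary (L h)" and trace_L: "h \<noteq> unit ==> trace (L h) = 0"
proof -
 show "unitary (L h)" by (simp add: unitary_def L_adj_L)
 assume h: "h \<noteq> unit"
 have "L h $ a $ a = 0" for a
 proof -
  have "h = unit" if "a = mul h a"
  proof (rule e_eqI)
   fix v show "e h v = e unit v"
    using e_mul[of h a "e (invg a) v"] that by (simp add: e_invg' e_unit)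
  qed
  thus ?thesis using h by (auto simp: L_def)
 qed
 thus "trace (L h) = 0" by (simp add: trace_def)
qed

definition conn_equivariant :: "('q => 'q => complex^'g^'g) => bool" where
 "conn_equivariant A \<longleftrightarrow> (\<forall>h th v. A (e h th) (e h v) = L h ** A th v ** adj (L h))"

definition \<sigma>m :: "'q => 'q => complex^'g^'g" where
 "\<sigma>m x v = diag (%h. \<i> * (e h x \<bullet> v))"

section \<open>Holonomy of a flat equivariant connection\<close>

context
 fixes A :: "'q => 'q => complex^'g^'g" and G :: "'q => complex^'g^'g"
 assumes A: "connection A" and eqv: "conn_equivariant A"
  and G0: "G 0 = mat 1" and uG: "\<And>th. unitary (G th)"
  and dG: "\<And>th. (G has_derivative (%v. - (A th v ** G th))) (at th)"
begin

lemma frame_unique: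
 fixes V :: "'q => complex^'g^'g"
 assumes dV: "\<And>th. (V has_derivative (%v. - (A th v ** V th))) (at th)"
 shows "V th = G th ** V 0"
proof -
 have "((%th. adj (G th) ** V th) has_derivative (%_. 0)) (at th within UNIV)" for th
  using mm.FDERIV[OF bounded_linear.has_derivative[OF bounded_linear_adj dG] dV]
  by (simp add: adj_uminus adj_mult connectionD(3)[OF A] mm.minus_left mm.minus_right matrix_mul_assoc)
 then obtain c where "\<And>th. adj (G th) ** V th = c"
  using has_derivative_zero_constant[of UNIV "%th. adj (G th) ** V th"] by auto
 from this[of th] this[of 0] have "adj (G th) ** V th = V 0" by (simp add: G0 adj_mat)
 thus ?thesis using unitary_cancel(2)[OF uG] by metis
qed

text \<open>The translate of \<open>G\<close> by a period is again parallel, so it differs from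
  \<open>G\<close> by a constant factor on the right. Thus \<open>G\<close> is multiplicative on
  periods.\<close>

lemma frame_add_period: "c \<in> periods ==> G (th + c) = G th ** G c"
proof -
 assume c: "c \<in> periods"
 have "((%th. G (th + c)) has_derivative (%v. - (A th v ** G (th + c)))) (at th)" for th
 proof -
  have "((%th. th + c) has_derivative (%v. v)) (at th)" by (auto intro!: derivative_eq_intros)
  from has_derivative_compose[OF this dG] show ?thesis
   by (simp add: tcontD(1)[OF connectionD(1)[OF A] c])
 qed
 from frame_unique[OF this, of th] show ?thesis by simp
qed

lemma frame_equivariant: "G (e h th) = L h ** G th ** adj (L h)"
proof -
 let ?V = "%th. adj (L h) ** (G (e h th) ** L h)"
 have "(?V has_derivative (%v. - (A th v ** ?V th))) (at th)" for th
 proof -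
  have "((%th. G (e h th)) has_derivative (%v. - (A (e h th) (e h v) ** G (e h th)))) (at th)"
   by (rule has_derivative_compose[OF _ dG]) (rule bounded_linear_imp_has_derivative[OF blinfun.bounded_linear_right])
  hence "(?V has_derivative (%v. adj (L h) ** (- (A (e h th) (e h v) ** G (e h th)) ** L h))) (at th)"
   by (intro bounded_linear.has_derivative[OF mm.bounded_linear_right] bounded_linear.has_derivative[OF mm.bounded_linear_left])
  moreover have "adj (L h) ** (- (A (e h th) (e h v) ** G (e h th)) ** L h) = - (A th v ** ?V th)" for v
   using eqv by (simp add: conn_equivariant_def mm.minus_left mm.minus_right matrix_mul_assoc unitaryD[OF unitary_L])
  ultimately show ?thesis by simp
 qed
 from frame_unique[OF this, of th]
 have "adj (L h) ** (G (e h th) ** L h) = G th" by (simp add: G0 blinfun.zero_right unitaryD[OF unitary_L])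
 hence "L h ** (adj (L h) ** (G (e h th) ** L h)) ** adj (L h) = L h ** G th ** adj (L h)" by simp
 thus ?thesis by (simp add: unitary_cancel[OF unitary_L])
qed

text \<open>As \<open>h - 1\<close> is onto, \<open>c = e h th - th\<close> for some
  \<open>th\<close>. Periodicity and equivariance give two expressions for
  \<open>G (e h th)\<close>, and their comparison shows that \<open>G c ** L h\<close> is conjugate
  to \<open>L h\<close>.\<close>

lemma holonomy_trace: "c \<in> periods ==> h \<noteq> unit ==> trace (L h ** G c) = 0"
proof -
 assume c: "c \<in> periods" and h: "h \<noteq> unit"
 obtain th where "e h th - th = c" using e_minus_id_surj[OF h] by blast
 hence "G th ** G c = L h ** G th ** adj (L h)"
  using frame_add_period[OF c, of th] frame_equivariant[of h th] by (simp add: algebra_simps)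
 hence "G c = adj (G th) ** (L h ** G th ** adj (L h))" using unitary_cancel(1)[OF uG] by metis
 hence "G c ** L h = adj (G th) ** (L h ** G th)"
  using unitary_cancel(4)[OF unitary_L] by (simp add: matrix_mul_assoc)
 hence "trace (G c ** L h) = trace (L h)"
  using trace_mult_commute[of "adj (G th)" "L h ** G th"] unitary_cancel(3)[OF uG] by metis
 thus ?thesis using trace_L[OF h] trace_mult_commute[of "L h"] by metis
qed

text \<open>Periods include the normal directions, so this complex span sees the holonomy of the
  torus and the Higgs field together.\<close>

definition hol :: "(complex^'g^'g) set" where
 "hol = span {mat z ** G c | z c. c \<in> periods}"

lemma hol_I: "c \<in> periods ==> mat z ** G c \<in> hol"
 unfolding hol_def by (rule span_base) blast

lemma G_in_hol: "c \<in> periods ==> G c \<in> hol"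
 using hol_I[of c 1] by simp

lemma subspace_hol: "subspace hol"
 by (simp add: hol_def)

lemma hol_linear: "M \<in> hol ==> linear f ==> subspace T ==> (\<And>z c. c \<in> periods ==> f (mat z ** G c) \<in> T) ==> f M \<in> T"
 unfolding hol_def by (erule linear_span_induct) auto

lemma adj_G: "c \<in> periods ==> adj (G c) = G (- c)"
proof -
 assume "c \<in> periods"
 hence "G c ** G (- c) = mat 1"
  using frame_add_period[where c = "- c" and th = c] uminus_periods[of c] by (simp add: G0)
 thus ?thesis using unitary_cancel(1)[OF uG[of c], of "G (- c)"] by simp
qed

text \<open>The periods form an abelian group on which \<open>G\<close> is multiplicative, and
  adjoints correspond to negated periods. Here flatness turns into commutativity.\<close>

lemma star_algebra_hol: "star_algebra hol"
proof -
 have mul_gen: "(mat z ** G c) ** (mat z' ** G c') = mat (z * z') ** G (c + c')" if "c \<in> periods" "c' \<in> periods" for z z' c c'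
 proof -
  have "(mat z ** G c) ** (mat z' ** G c') = mat z ** ((G c ** mat z') ** G c')" by (simp add: matrix_mul_assoc)
  also have "... = (mat z ** mat z') ** (G c ** G c')" by (simp only: mat_commute[of z' "G c", symmetric] matrix_mul_assoc)
  also have "mat z ** mat z' = (mat (z * z') :: complex^'g^'g)" unfolding vec_eq_iff mat_mult_entry by (simp add: mat_def)
  finally show ?thesis by (simp add: frame_add_period that)
 qed
 note lm = bounded_linear.linear[OF mm.bounded_linear_left] bounded_linear.linear[OF mm.bounded_linear_right]
 have lc: "linear (%M. M ** N - N ** M)" for N :: "complex^'g^'g" by (intro linear_compose_sub lm)
 have lc': "linear (%N. M ** N - N ** M)" for M :: "complex^'g^'g" by (intro linear_compose_sub lm)
 have m: "M ** N \<in> hol" if "M \<in> hol" "N \<in> hol" for M N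
  by (rule hol_linear[OF that(1) lm(1) subspace_hol], rule hol_linear[OF that(2) lm(2) subspace_hol])
   (simp add: mul_gen hol_I add_periods)
 have comm: "M ** N - N ** M \<in> {0}" if "M \<in> hol" "N \<in> hol" for M N
  by (rule hol_linear[OF that(1) lc], simp, rule hol_linear[OF that(2) lc'], simp)
   (simp add: mul_gen add.commute mult.commute)
 have a: "adj M \<in> hol" if "M \<in> hol" for M
 proof (rule hol_linear[OF that bounded_linear.linear[OF bounded_linear_adj] subspace_hol])
  fix z c assume "c \<in> periods"
  thus "adj (mat z ** G c) \<in> hol" using hol_I[of "- c" "cnj z"] uminus_periods
   by (simp add: adj_mult adj_mat adj_G mat_commute[symmetric])
 qed
 have z: "mat z ** M \<in> hol" if "M \<in> hol" for M z
  using m[OF _ that, of "mat z"] hol_I[OF zero_in_periods, of z] by (simp add: G0)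
 show ?thesis
  unfolding star_algebra_def
  using subspace_hol hol_I[OF zero_in_periods, of 1] a m comm z by (auto simp: G0)
qed

lemma hol_conj: "M \<in> hol ==> L h ** M ** adj (L h) \<in> hol"
proof -
 assume "M \<in> hol"
 have "linear (%M. L h ** M ** adj (L h))"
  by (rule bounded_linear.linear) (rule bounded_linear_compose[OF mm.bounded_linear_left mm.bounded_linear_right])
 thus ?thesis
 proof (rule hol_linear[OF \<open>M \<in> hol\<close> _ subspace_hol])
  fix z c assume c: "c \<in> periods"
  have "L h ** (mat z ** G c) ** adj (L h) = mat z ** G (e h c)"
   by (simp only: frame_equivariant matrix_mul_assoc mat_commute[of z "L h"])
  thus "L h ** (mat z ** G c) ** adj (L h) \<in> hol" by (simp add: hol_I e_periods c)
 qed
qed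

lemma hol_trace: "M \<in> hol ==> h \<noteq> unit ==> trace (L h ** M) = 0"
proof -
 assume M: "M \<in> hol" and h: "h \<noteq> unit"
 have "linear (%M. trace (L h ** M))"
  by (rule bounded_linear.linear) (rule bounded_linear_compose[OF bounded_linear_trace mm.bounded_linear_right])
 hence "trace (L h ** M) \<in> {0}"
 proof (rule hol_linear[OF M])
  fix z c assume c: "c \<in> periods"
  have "L h ** (mat z ** G c) = mat z ** (L h ** G c)" by (simp only: matrix_mul_assoc mat_commute[of z "L h"])
  thus "trace (L h ** (mat z ** G c)) \<in> {0}" by (simp add: trace_mat_mult holonomy_trace c h)
 qed simp
 thus ?thesis by simp
qed

text \<open>A normal component is, up to sign, the derivative of holonomies along a line of periods.
  That a derivative stays in \<open>hol\<close> is read off from the double orthogonal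
  complement.\<close>

lemma hol_normal_derivative: "w \<in> orthogonal_comp (span La) ==> A 0 w \<in> hol"
proof -
 assume w: "w \<in> orthogonal_comp (span La)"
 have tw: "t *\<^sub>R w \<in> periods" for t
  using w by (intro perp_periods) (simp add: subspace_scale subspace_orthogonal_comp)
 have "((%t::real. t *\<^sub>R w) has_derivative (%t. t *\<^sub>R w)) (at 0)" by (auto intro!: derivative_eq_intros)
 from has_derivative_compose[OF this, of G "%v. - (A 0 v ** G 0)"] dG[of 0]
 have d: "((%t. G (t *\<^sub>R w)) has_derivative (%t. t *\<^sub>R - A 0 w)) (at 0)"
  by (simp add: G0 connectionD(5)[OF A])
 have "A 0 w \<in> orthogonal_comp (orthogonal_comp hol)"
  unfolding orthogonal_comp_def orthogonal_def
 proof (intro CollectI ballI)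
  fix y assume "y \<in> {y. \<forall>x\<in>hol. x \<bullet> y = 0}"
  hence "G (t *\<^sub>R w) \<bullet> y = 0" for t using G_in_hol[OF tw] by blast
  hence "((%t. 0) has_derivative (%t. (t *\<^sub>R - A 0 w) \<bullet> y)) (at (0::real))"
   using has_derivative_inner_left[OF d, of y] by simp
  hence "(%t::real. (t *\<^sub>R - A 0 w) \<bullet> y) = (%_. 0)" by (rule has_derivative_unique) simp
  from fun_cong[OF this, of 1] show "y \<bullet> A 0 w = 0" by (simp add: inner_commute)
 qed
 thus ?thesis using orthogonal_comp_self[OF subspace_hol] by simp
qed

text \<open>On the image of a minimal projection \<open>P\<close> of the holonomy algebra,
  \<open>G\<close> acts by a character \<open>ch\<close>. Translates of \<open>P\<close> coincide or
  are orthogonal and the traces against \<open>L h\<close> vanish, so a unitary intertwiner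
  \<open>U\<close> exists whose column at the unit lies in that image. Equivariance makes the other
  columns eigenvectors for translated characters.\<close>

lemma holonomy_diagonal:
 obtains x U where "unitary U" "\<And>h. L h ** U = U ** L h"
  "\<And>c. c \<in> periods ==> G c ** U = U ** diag (%h. cis (- (e h x \<bullet> c)))"
proof -
 obtain P where P: "P \<in> hol" "projection P" "P \<noteq> 0" "\<And>M. M \<in> hol ==> \<exists>z. M ** P = mat z ** P"
  using minimal_projection[OF star_algebra_hol] by blast
 have alg: "\<And>M N. M \<in> hol ==> N \<in> hol ==> M ** N = N ** M" using star_algebra_hol unfolding star_algebra_def by blast
 note PP = projectionD[OF P(2)]
 have zP: "z = z'" if "mat z ** P = mat z' ** P" for z z'
 proof -
  have "mat (z - z') ** P = 0" using that unfolding vec_eq_iff mat_mult_entry by (simp add: algebra_simps)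
  thus ?thesis using P(3) norm_mat_mult[of "z - z'" P] by simp
 qed
 have matm: "mat z ** (mat z' ** M) = mat (z * z') ** M" for z z' and M :: "complex^'g^'g"
  unfolding vec_eq_iff mat_mult_entry by (simp add: mult.assoc)
 have dich: "L h ** P = P ** L h \<or> P ** L h ** P = 0" for h
 proof -
  \<comment> \<open>The translate of \<open>P\<close>. By minimality \<open>Q ** P\<close> is a
    multiple of \<open>P\<close>, and idempotence makes the factor 0 or 1.\<close>
  define Q where "Q = L h ** P ** adj (L h)"
  have Q: "Q \<in> hol" unfolding Q_def by (rule hol_conj[OF P(1)])
  have QQ: "Q ** Q = Q" "adj Q = Q"
   by (simp_all add: Q_def adj_mult PP matrix_mul_assoc unitary_cancel[OF unitary_L])
    (metis PP(2) matrix_mul_assoc)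
  obtain z where z: "Q ** P = mat z ** P" using P(4)[OF Q] by blast
  have "Q ** (Q ** P) = Q ** P" by (simp add: matrix_mul_assoc QQ)
  hence "mat (z * z) ** P = mat z ** P"
   unfolding z matrix_mul_assoc mat_commute[of z Q, symmetric] by (simp add: z matm flip: matrix_mul_assoc)
  from zP[OF this] consider "z = 0" | "z = 1" by auto
  thus ?thesis
  proof cases
   case 1
   hence "Q ** P = 0" using z by (simp add: mat_0)
   hence "adj (L h) ** (L h ** P ** adj (L h) ** P) = 0" by (simp add: Q_def)
   hence "P ** adj (L h) ** P = 0" by (simp add: matrix_mul_assoc unitaryD[OF unitary_L])
   hence "adj (P ** adj (L h) ** P) = 0" by simp
   thus ?thesis by (simp add: adj_mult PP matrix_mul_assoc)
  next
   case 2
   hence QP: "Q ** P = P" using z by simp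
   have "trace Q = trace P"
    unfolding Q_def using trace_mult_commute[of "L h ** P" "adj (L h)"]
    by (simp add: matrix_mul_assoc unitaryD[OF unitary_L])
   moreover have "adj (Q - P) ** (Q - P) = Q - P"
    using QP alg[OF Q P(1)] by (simp add: adj_diff QQ PP mm.diff_left mm.diff_right)
   ultimately have "(norm (Q - P))^2 = 0" unfolding norm_matrix_sq by (simp add: trace_sub)
   hence "P = L h ** P ** adj (L h)" by (simp add: Q_def)
   hence "P ** L h = L h ** P ** adj (L h) ** L h" by simp
   thus ?thesis by (simp add: unitary_cancel[OF unitary_L])
  qed
 qed
 obtain U where U: "unitary U" "\<And>h. L h ** U = U ** L h" "\<And>a. (P ** U) $ a $ unit = U $ a $ unit"
  using regular_rep_unitary_intertwiner[OF P(2,3) dich hol_trace[OF P(1)]] by blast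
 define ch where "ch c = (SOME z. G c ** P = mat z ** P)" for c
 have ch: "G c ** P = mat (ch c) ** P" if "c \<in> periods" for c
  unfolding ch_def using P(4)[OF G_in_hol[OF that]] by (rule someI_ex)
 have ch_add: "ch (c + c') = ch c * ch c'" if "c \<in> periods" "c' \<in> periods" for c c'
 proof (rule zP)
  have "G (c + c') ** P = G c ** (G c' ** P)" by (simp add: frame_add_period[OF that(2)] matrix_mul_assoc)
  also have "... = mat (ch c * ch c') ** P"
   unfolding ch[OF that(2)] matrix_mul_assoc mat_commute[of _ "G c", symmetric]
   by (simp add: ch[OF that(1)] matm mult.commute flip: matrix_mul_assoc)
  finally show "mat (ch (c + c')) ** P = mat (ch c * ch c') ** P" by (simp add: ch add_periods that)
 qed
 have ch_norm: "cmod (ch c) = 1" if "c \<in> periods" for c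
 proof -
  have "norm P = cmod (ch c) * norm P" using norm_unitary_mult(1)[OF uG[of c], of P] ch[OF that] norm_mat_mult by metis
  thus ?thesis using P(3) by simp
 qed
 obtain x0 where x0: "x0 \<in> span La" "\<And>xi. xi \<in> dual_lattice La ==> ch xi = cis (x0 \<bullet> xi)"
  using dual_lattice_character[of ch] ch_add ch_norm dual_lattice_eq by (metis IntD1)
 define r where "r = trace P"
 have r: "r \<noteq> 0" using norm_matrix_sq[of P] PP P(3) by (auto simp: r_def)
 \<comment> \<open>The eigenvalue of a normal component on the image of \<open>P\<close>, up to the
   factor \<open>- \<i>\<close>; as a trace it is visibly linear in \<open>w\<close>.\<close>
 define \<mu> where "\<mu> w = - Im (trace (A 0 w ** P) / r)" for w
 have sd: "(s *\<^sub>R t) / r = s *\<^sub>R (t / r)" for s t by (simp add: scaleR_conv_of_real)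
 have \<mu>_lin: "linear \<mu>"
  by (rule linearI) (simp_all add: \<mu>_def connectionD[OF A] mm.add_left trace_add add_divide_distrib scaleR_mult_left
    trace_scaleR sd)
 have A_P: "A 0 w ** P = mat (- \<i> * of_real (\<mu> w)) ** P" if w: "w \<in> orthogonal_comp (span La)" for w
 proof -
  obtain z where z: "A 0 w ** P = mat z ** P" using P(4)[OF hol_normal_derivative[OF w]] by blast
  have zr: "trace (A 0 w ** P) / r = z" using r by (simp add: z trace_mat_mult r_def)
  have "adj (P ** (A 0 w ** P)) = - (P ** (A 0 w ** P))"
   by (simp add: adj_mult PP connectionD(3)[OF A] mm.minus_left mm.minus_right matrix_mul_assoc)
  moreover have "P ** (A 0 w ** P) = mat z ** P" unfolding z by (metis mat_commute matrix_mul_assoc PP(2))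
  moreover have "adj (mat z ** P) = mat (cnj z) ** P" by (simp add: adj_mult adj_mat PP mat_commute)
  moreover have "- (mat z ** P) = mat (- z) ** P" by (simp add: vec_eq_iff)
  ultimately have "mat (cnj z) ** P = mat (- z) ** P" by metis
  from zP[OF this] have "Re z = 0" by (simp add: complex_eq_iff)
  hence "z = - \<i> * of_real (\<mu> w)" unfolding \<mu>_def zr by (simp add: complex_eq_iff)
  thus ?thesis using z by simp
 qed
 \<comment> \<open>Along a normal line the frame solves an equation with constant coefficients, so
   multiplication by the opposite phase gives a function constant in \<open>t\<close>.\<close>
 have ch_perp: "ch w = cis (\<mu> w)" if w: "w \<in> orthogonal_comp (span La)" for w
 proof -
  have tw: "t *\<^sub>R w \<in> periods" for t
   using w by (intro perp_periods) (simp add: subspace_scale subspace_orthogonal_comp)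
  define F where "F t = mat (cis (- (t * \<mu> w))) ** (G (t *\<^sub>R w) ** P)" for t
  have "(F has_vector_derivative 0) (at t within UNIV)" for t
  proof -
   have "((%t::real. t *\<^sub>R w) has_derivative (%t. t *\<^sub>R w)) (at t)" by (auto intro!: derivative_eq_intros)
   from has_derivative_compose[OF this dG]
   have "((%t. G (t *\<^sub>R w)) has_vector_derivative - (A 0 w ** G (t *\<^sub>R w))) (at t)"
    using tcontD(1)[OF connectionD(1)[OF A] tw, of 0]
    by (simp add: has_vector_derivative_def connectionD(5)[OF A] scaleR_mult_left)
   from bounded_linear.has_vector_derivative[OF mm.bounded_linear_left[of P] this]
   have "((%t. G (t *\<^sub>R w) ** P) has_vector_derivative - (A 0 w ** G (t *\<^sub>R w)) ** P) (at t)" .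
   moreover have "- (A 0 w ** G (t *\<^sub>R w)) ** P = mat (\<i> * of_real (\<mu> w)) ** (G (t *\<^sub>R w) ** P)"
   proof -
    have "A 0 w ** G (t *\<^sub>R w) ** P = G (t *\<^sub>R w) ** (A 0 w ** P)"
     using alg[OF hol_normal_derivative[OF w] G_in_hol[OF tw[of t]]] by (simp add: matrix_mul_assoc)
    thus ?thesis
     unfolding A_P[OF w] matrix_mul_assoc mat_commute[of _ "G _", symmetric] mm.minus_left
     by (simp add: vec_eq_iff flip: matrix_mul_assoc)
   qed
   ultimately have "((%t. (G (t *\<^sub>R w) ** P) $ a $ b) has_vector_derivative \<i> * of_real (\<mu> w) * (G (t *\<^sub>R w) ** P) $ a $ b) (at t)" for a b
    using bounded_linear.has_vector_derivative[OF bounded_linear_entry[of a b]] by fastforce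
   moreover have "((%t. cis (- (t * \<mu> w))) has_vector_derivative - \<mu> w *\<^sub>R (\<i> * cis (- (t * \<mu> w)))) (at t)"
    unfolding has_vector_derivative_def by (auto intro!: derivative_eq_intros simp: scaleR_conv_of_real algebra_simps)
   ultimately have "((%t. F t $ a $ b) has_vector_derivative 0) (at t)" for a b
    unfolding F_def mat_mult_entry
    by (rule has_vector_derivative_eq_rhs[OF has_vector_derivative_mult[rotated]]) (simp add: scaleR_conv_of_real algebra_simps)
   thus ?thesis
    unfolding has_vector_derivative_def by (intro entry_has_derivative) simp
  qed
  then obtain c where "\<And>t. F t = c" using has_vector_derivative_zero_constant[of UNIV F] by auto
  hence "F 1 = F 0" by simp
  hence "mat (cis (- \<mu> w)) ** (mat (ch w) ** P) = mat 1 ** P"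
   using ch[OF tw[of 1]] by (simp add: F_def G0)
  hence "cis (- \<mu> w) * ch w = 1" unfolding matm by (rule zP)
  hence "cis (\<mu> w) * (cis (- \<mu> w) * ch w) = cis (\<mu> w)" by simp
  thus ?thesis by (simp add: cis_mult flip: mult.assoc)
 qed
 \<comment> \<open>The vector that represents \<open>\<mu>\<close> on normal directions and is
   orthogonal to \<open>span La\<close>; with \<open>x0\<close> it gives the character on all
   periods.\<close>
 define y where "y = (\<Sum>b\<in>Basis. \<mu> (b - proj b) *\<^sub>R b)"
 have y: "y \<bullet> v = \<mu> (v - proj v)" for v
 proof -
  have l: "linear (%v. \<mu> (v - proj v))"
   using linear_compose[OF linear_compose_sub[OF linear_ident linear_proj] \<mu>_lin] by (simp add: o_def)
  have "\<mu> (v - proj v) = (\<Sum>b\<in>Basis. (v \<bullet> b) * \<mu> (b - proj b))"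
   using linear_sum[OF l, of "%b. (v \<bullet> b) *\<^sub>R b" Basis] by (simp add: euclidean_representation linear_scale[OF l])
  moreover have "y \<bullet> v = (\<Sum>b\<in>Basis. \<mu> (b - proj b) * (b \<bullet> v))" by (simp add: y_def inner_sum_left)
  ultimately show ?thesis by (simp add: inner_commute[of v] mult.commute)
 qed
 have ch_eq: "ch c = cis ((x0 + y) \<bullet> c)" if c: "c \<in> periods" for c
 proof -
  have p: "proj c \<in> dual_lattice La" "c - proj c \<in> orthogonal_comp (span La)" using proj_periods[OF c] proj_perp by auto
  have "ch c = ch (proj c) * ch (c - proj c)"
   using ch_add[of "proj c" "c - proj c"] p perp_periods by (simp add: dual_lattice_eq)
  also have "... = cis (x0 \<bullet> proj c + \<mu> (c - proj c))" using x0(2)[OF p(1)] ch_perp[OF p(2)] by (simp add: cis_mult)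
  also have "x0 \<bullet> proj c = x0 \<bullet> c"
   using p(2) x0(1) inner_perp[of "c - proj c" x0] by (simp add: inner_diff_left inner_commute[of x0])
  finally show ?thesis by (simp add: y inner_add_left)
 qed
 show ?thesis
 \<comment> \<open>The sign arises because parallel transport uses the negative of the connection
   form.\<close>
 proof (rule that[of U "- (x0 + y)"])
  fix c assume c: "c \<in> periods"
  \<comment> \<open>Column \<open>h\<close> is a translate of the column at the unit, and moving
    \<open>G c\<close> past the translation replaces \<open>c\<close> by
    \<open>e (invg h) c\<close>.\<close>
  have "(G c ** U) $ a $ h = U $ a $ h * cis ((x0 + y) \<bullet> e (invg h) c)" for a h
  proof -
   define c' where "c' = e (invg h) c"
   have c': "c' \<in> periods" "e h c' = c" by (simp_all add: c'_def e_periods c e_invg')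
   have col: "(G c' ** U) $ b $ unit = ch c' * U $ b $ unit" for b
   proof -
    have "(G c' ** U) $ b $ unit = (G c' ** (P ** U)) $ b $ unit"
     by (simp add: matrix_mult_nth[of "G c'"] U(3))
    also have "... = ch c' * U $ b $ unit"
     by (simp add: matrix_mul_assoc ch[OF c'(1)]) (simp add: U(3) flip: matrix_mul_assoc)
    finally show ?thesis .
   qed
   have "G c ** L h = L h ** G c'"
    using frame_equivariant[of h c'] c'(2) unitary_cancel(4)[OF unitary_L] by (simp add: matrix_mul_assoc)
   hence "(G c ** U) ** L h = L h ** (G c' ** U)" by (metis U(2) matrix_mul_assoc)
   hence "(G c ** U) $ a $ h = (L h ** (G c' ** U)) $ a $ unit"
    using mult_L_nth[of "G c ** U" h a unit] by (simp add: right_neutral)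
   also have "... = ch c' * (L h ** U) $ a $ unit" by (simp add: L_mult_nth col)
   also have "(L h ** U) $ a $ unit = U $ a $ h" by (simp add: U(2) mult_L_nth right_neutral)
   finally show ?thesis unfolding ch_eq[OF c'(1)] by (simp add: c'_def mult.commute)
  qed
  thus "G c ** U = U ** diag (%h. cis (- (e h (- (x0 + y)) \<bullet> c)))"
   by (simp add: vec_eq_iff inner_e blinfun.minus_right inner_diff_left inner_add_left add.commute)
 qed (use U in auto)
qed

end

end

section \<open>The gauge group and gauge fixing\<close>

locale gauge_setting = flat_orbifold J La e
 for J :: "nat => 'q::euclidean_space \<Rightarrow>\<^sub>L 'q" and La and e :: "'g::finite => 'q \<Rightarrow>\<^sub>L 'q" +
 fixes s :: ereal
 assumes s_large: "ereal (real (dim La) / 2) < s"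
begin

definition msob :: "ereal => ('q => complex^'g^'g) => bool" where
 "msob t f \<longleftrightarrow> (\<forall>h k. sobolev La t (%th. f th $ h $ k))"

abbreviation "gm \<equiv> gauge_maps La e (s + 1)"

lemma s_Suc: "ereal (real (dim La) / 2) + 1 < s + 1" and s_Suc_large: "ereal (real (dim La) / 2) < s + 1"
proof -
 show *: "ereal (real (dim La) / 2) + 1 < s + 1" using s_large by (cases s) auto
 have "ereal (real (dim La) / 2) \<le> ereal (real (dim La) / 2) + 1" by simp
 thus "ereal (real (dim La) / 2) < s + 1" using * by (rule le_less_trans)
qed

lemma msob_tcont: "msob t f ==> tcont f"
 unfolding msob_def tcont_entries using sobolev_tcont by blast

lemma msob_mult:
 "ereal (real (dim La) / 2) < t ==> msob t f ==> msob t g ==> msob t (%th. f th ** g th)"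
 by (auto simp: msob_def matrix_mult_nth intro!: sobolev_sum sobolev_mult)

lemma msob_adj: "msob t f ==> msob t (%th. adj (f th))"
 by (auto simp: msob_def intro!: sobolev_cnj)

lemma sobolev_trig: "trig f ==> sobolev La t f"
 by (simp add: sobolev_iff trig_tcont Hs_trig)

lemma msob_mtrig: "mtrig f ==> msob t f"
 by (simp add: msob_def mtrig_def sobolev_trig)

lemma mtrig_const: "mtrig (%_. M)"
 by (simp add: mtrig_def trig_const)

text \<open>Some real order strictly between half the rank plus 1 and \<open>s + 1\<close> gives
  classical derivatives, also for infinite \<open>s\<close>.\<close>

lemma msob_deriv:
 assumes "msob (s + 1) f"
 shows "(f has_derivative (%v. dir_deriv v f th)) (at th)" "tcont (dir_deriv v f)"
proof -
 have "\<exists>f'. (\<forall>th. ((%th. f th $ h $ k) has_derivative f' th) (at th)) \<and> (\<forall>v. tcont (%th. f' th v))" for h k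
 proof -
  obtain r where r: "ereal (real (dim La) / 2) + 1 < ereal r" "ereal r < s + 1" using ereal_dense2[OF s_Suc] by blast
  have "Hs r (%th. f th $ h $ k)" using assms r(2) by (auto simp: msob_def sobolev_iff)
  moreover have "real (dim La) / 2 + 1 < r" using r(1) by (simp add: one_ereal_def)
  ultimately show ?thesis by (metis Hs_differentiable)
 qed
 then obtain f' where f': "\<And>h k th. ((%th. f th $ h $ k) has_derivative f' h k th) (at th)" "\<And>h k v. tcont (%th. f' h k th v)"
  by metis
 have d: "(f has_derivative (%v. \<chi> h k. f' h k th v)) (at th)" for th
  by (rule entry_has_derivative) (simp add: f')
 have e: "dir_deriv v f th = (\<chi> h k. f' h k th v)" for v th using dir_deriv_eq[OF d] .
 show "(f has_derivative (%v. dir_deriv v f th)) (at th)" unfolding e by (rule d)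
 show "tcont (dir_deriv v f)" unfolding tcont_entries by (simp add: e f')
qed

lemma gm_iff: "g \<in> gm \<longleftrightarrow> msob (s + 1) g \<and> (\<forall>th. unitary (g th)) \<and> (\<forall>h th. g (e h th) = L h ** g th ** adj (L h))"
 by (auto simp: gauge_maps_def msob_def unitary_def equivariant_End_def left_mult_e Ad_def matrix_inv_unitary[OF unitary_L])

lemma gmD:
 assumes "g \<in> gm"
 shows "msob (s + 1) g" "unitary (g th)" "g (e h th) = L h ** g th ** adj (L h)"
  "(g has_derivative (%v. dir_deriv v g th)) (at th)"
 using assms msob_deriv(1) by (auto simp: gm_iff)

lemma gm_mult: "g \<in> gm ==> k \<in> gm ==> (%th. g th ** k th) \<in> gm"
 by (simp add: gm_iff msob_mult[OF s_Suc_large] unitary_mult matrix_mul_assoc unitary_cancel[OF unitary_L])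

lemma gm_adj: "g \<in> gm ==> (%th. adj (g th)) \<in> gm"
 by (simp add: gm_iff msob_adj unitary_adj adj_mult matrix_mul_assoc)

lemma gm_const: "cmod c = 1 ==> (%_. mat c) \<in> gm"
 by (simp add: gm_iff msob_mtrig mtrig_const unitary_mat mat_commute[of c "L _", symmetric] unitary_cancel[OF unitary_L])

text \<open>\<open>Blinfun\<close> is faithful only on bounded linear maps; differentiability of
  gauge transformations supplies this.\<close>

lemma gauge_act_apply:
 assumes g: "g \<in> gm"
 shows "gauge_act g X th v = adj (g th) ** X th v ** g th + adj (g th) ** dir_deriv v g th"
proof -
 have "bounded_linear (%v. adj (g th) ** X th v ** g th + adj (g th) ** dir_deriv v g th)"
  by (intro bounded_linear_add bounded_linear_compose[OF mm.bounded_linear_left] bounded_linear_compose[OF mm.bounded_linear_right]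
    blinfun.bounded_linear_right has_derivative_bounded_linear[OF gmD(4)[OF g]])
 thus ?thesis by (simp add: gauge_act_def bounded_linear_Blinfun_apply matrix_inv_unitary[OF gmD(2)[OF g]])
qed

lemma dir_deriv_mult:
 fixes f g :: "'q => complex^'g^'g"
 assumes "(f has_derivative (%v. dir_deriv v f th)) (at th)" "(g has_derivative (%v. dir_deriv v g th)) (at th)"
 shows "dir_deriv v (%th. f th ** g th) th = f th ** dir_deriv v g th + dir_deriv v f th ** (g th :: complex^'g^'g)"
 using dir_deriv_eq[OF mm.FDERIV[OF assms]] .

lemma gauge_act_mult:
 assumes g: "g \<in> gm" and k: "k \<in> gm"
 shows "gauge_act k (gauge_act g X) = gauge_act (%th. g th ** k th) X"
proof (intro ext blinfun_eqI)
 fix th v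
 show "gauge_act k (gauge_act g X) th v = gauge_act (%th. g th ** k th) X th v"
  unfolding gauge_act_apply[OF k] gauge_act_apply[OF g] gauge_act_apply[OF gm_mult[OF g k]] dir_deriv_mult[OF gmD(4)[OF g] gmD(4)[OF k]]
  using unitary_cancel(1)[OF gmD(2)[OF g]] by (simp add: adj_mult mm.add_left mm.add_right flip: matrix_mul_assoc)
qed

lemma gauge_act_1: "gauge_act (%_. mat 1) X = (X :: ('q, 'g) field)"
proof (intro ext blinfun_eqI)
 fix th :: 'q and v
 have "dir_deriv v (%_. mat 1 :: complex^'g^'g) th = 0" by (rule dir_deriv_eq) simp
 thus "gauge_act (%_. mat 1) X th v = X th v" using gauge_act_apply[OF gm_const[of 1]] by (simp add: adj_mat)
qed

lemma gauge_orbit_eq: "gauge_orbit La e s X = {gauge_act g X | g. g \<in> gm}"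
proof -
 have "k \<in> gm" if "g \<in> gm" "k \<in> scalar_coset g" for g k
  using that gm_mult[OF gm_const that(1)] by (auto simp: scalar_coset_def)
 moreover have "g \<in> scalar_coset g" for g :: "'q => complex^'g^'g" by (auto simp: scalar_coset_def intro!: exI[of _ 1])
 ultimately show ?thesis unfolding gauge_orbit_def gauge_group_def by blast
qed

lemma gauge_orbit_act: "g \<in> gm ==> gauge_orbit La e s (gauge_act g X) = gauge_orbit La e s (X :: ('q, 'g) field)"
proof -
 assume g: "g \<in> gm"
 have "gauge_act k X = gauge_act (%th. adj (g th) ** k th) (gauge_act g X)" if "k \<in> gm" for k
  using gauge_act_mult[OF g gm_mult[OF gm_adj[OF g] that], of X] by (simp add: unitary_cancel(2)[OF gmD(2)[OF g]])
 thus ?thesis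
  unfolding gauge_orbit_eq using gauge_act_mult[OF g] gm_mult[OF g] gm_mult[OF gm_adj[OF g]] by blast
qed

lemma gauge_orbit_self: "X \<in> gauge_orbit La e s X"
 unfolding gauge_orbit_eq using gm_const[of 1] gauge_act_1[of X, symmetric] by auto

text \<open>The equation for the derivative contains no derivative of \<open>g\<close>, so order
  \<open>t \<le> s\<close> of \<open>g\<close> passes to its derivative and gives order
  \<open>t + 1\<close> of \<open>g\<close>. Starting from continuity, steps of length 1 reach
  \<open>s + 1\<close>.\<close>

lemma msob_bootstrap:
 fixes g X :: "'q => _"
 assumes g: "tcont g" and dg: "\<And>th. (g has_derivative (%v. g th ** S v - X th v ** g th)) (at th)"
  and X: "\<And>v. msob s (%th. X th v)"
 shows "msob (s + 1) (g :: 'q => complex^'g^'g)"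
proof -
 define H where "H t \<longleftrightarrow> (\<forall>h k. Hs t (%th. g th $ h $ k))" for t
 have step: "H (t + 1)" if t: "0 \<le> t" "ereal t \<le> s" and H: "H t" for t
  unfolding H_def
 proof (intro allI)
  fix h k
  define D where "D b th = (\<Sum>m\<in>UNIV. S b $ m $ k * g th $ h $ m) + (- 1) * (\<Sum>m\<in>UNIV. X th b $ h $ m * g th $ m $ k)" for b th
  have D: "Hs t (D b)" for b
   unfolding D_def
   by (intro Hs_add Hs_sum Hs_cmult Hs_mult_sobolev[OF _ s_large] t) (use X H in \<open>auto simp: msob_def H_def\<close>)
  have De: "D b th = (g th ** S b - X th b ** g th) $ h $ k" for b th
   by (simp add: D_def matrix_mult_nth mult.commute)
  have d: "((%th. g th $ h $ k) has_derivative (%b. D b th)) (at th)" for th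
   unfolding De by (rule bounded_linear.has_derivative[OF bounded_linear_entry dg])
  have tg: "tcont (%th. g th $ h $ k)" using g by (simp add: tcont_entries)
  show "Hs (t + 1) (%th. g th $ h $ k)"
  proof (rule Hs_Suc[OF tg D])
   show "fc (D b) l = \<i> * of_real (l \<bullet> b) * fc (%th. g th $ h $ k) l" if "l \<in> La" for b l
    by (rule fourier_deriv[OF tg _ d]) (use D that in \<open>auto simp: Hs_def\<close>)
  qed
 qed
 have H0: "H 0" using g by (simp add: H_def Hs_0 tcont_entries)
 have s0: "0 \<le> s" using order.strict_trans1[OF _ s_large, of 0] by simp
 have H1: "H 1" using step[of 0] H0 s0 by (simp add: zero_ereal_def)
 have mono: "H t'" if "H t" "t' \<le> t" for t t' using that Hs_mono unfolding H_def by blast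
 \<comment> \<open>Orders up to 1 come from order 0, so the induction subtracts 1 only from orders
   above 1, where the result is nonnegative and at most \<open>s\<close>.\<close>
 have "H t" if "ereal t \<le> s + 1" "t \<le> real n" for t n
  using that
 proof (induction n arbitrary: t)
  case 0 thus ?case using mono[OF H0] by simp
 next
  case (Suc n)
  show ?case
  proof (cases "t \<le> 1")
   case True thus ?thesis using mono[OF H1] by simp
  next
   case False
   have ts: "ereal (t - 1) \<le> s" using Suc.prems(1) by (cases s) auto
   hence "ereal (t - 1) \<le> s + 1" using s0 by (cases s) auto
   hence "H (t - 1)" using Suc by (intro Suc.IH) auto
   thus ?thesis using step[of "t - 1"] ts False by simp
  qed
 qed
 hence "H t" if "ereal t \<le> s + 1" for t using that real_arch_simple by blast
 thus ?thesis using g by (simp add: msob_def sobolev_iff H_def tcont_entries)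
qed

definition sig :: "'q => ('q, 'g) field" where
 "sig x = (%th. Blinfun (\<sigma>m x))"

lemma sig_apply: "sig x th v = diag (%h. \<i> * of_real (e h x \<bullet> v))"
proof -
 have "linear (\<sigma>m x)"
  by (rule linearI) (simp_all add: \<sigma>m_def vec_eq_iff inner_add_right algebra_simps scaleR_conv_of_real[where 'a = complex])
 thus ?thesis by (simp add: sig_def bounded_linear_Blinfun_apply linear_conv_bounded_linear \<sigma>m_def)
qed

lemma diag_conj_L: "L h ** diag f ** adj (L h) = diag (%a. f (mul (invg h) a))"
 unfolding vec_eq_iff
proof (intro allI)
 fix a b
 have i: "mul (invg h) a = mul (invg h) b \<longleftrightarrow> a = b" by (metis assoc group_left_neutral right_inverse)
 show "(L h ** diag f ** adj (L h)) $ a $ b = diag (%a. f (mul (invg h) a)) $ a $ b"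
  unfolding adj_L mult_L_nth L_mult_nth by (simp add: i)
qed

lemma inner_e_mul: "e (mul (invg h) a) x \<bullet> v = e a x \<bullet> e h v"
 using inner_e[of "invg h" "e a x" v] by (simp add: e_mul inner_e[of "invg h"])

text \<open>The adjoint of an isometry in the group is its inverse, which moves the twist of
  \<open>vec_act\<close> to the argument.\<close>

lemma equivariant_iff: "equivariant e X \<longleftrightarrow> (\<forall>h th v. X (e h th) (e h v) = L h ** X th v ** adj (L h))"
proof -
 have adj_e: "adjoint (blinfun_apply (e h)) v = e (invg h) v" for h v
 proof -
  have "adjoint (blinfun_apply (e h)) = blinfun_apply (e (invg h))"
   by (rule adjoint_unique) (simp add: inner_e)
  thus ?thesis by simp
 qed
 have va: "vec_act (e h) x v = x (e (invg h) v)" for h v and x :: "('q, 'g) matvec"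
 proof -
  have "adjoint (blinfun_apply (e h)) = blinfun_apply (e (invg h))" using adj_e by blast
  thus ?thesis by (simp add: vec_act_def blinfun_apply_inverse)
 qed
 show ?thesis
  unfolding equivariant_def ball_simps left_mult_e va Ad_def matrix_inv_unitary[OF unitary_L]
  by (metis e_invg e_invg')
qed

lemma sig_equivariant: "equivariant e (sig x)"
 unfolding equivariant_iff sig_apply diag_conj_L inner_e_mul by simp

lemma fields_iff: "X \<in> fields La e s \<longleftrightarrow>
  (\<forall>v. msob s (%th. X th v)) \<and> (\<forall>th v. adj (X th v) = - X th v) \<and> equivariant e X"
 by (auto simp: fields_def msob_def)

lemma sig_fields: "sig x \<in> fields La e s"
 unfolding fields_iff by (auto simp: sig_equivariant sig_apply adj_diag vec_eq_iff intro: msob_mtrig mtrig_const)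

lemma test_fun_trig: "trig (%th. of_real (ps th)) ==> test_fun La ps"
 by (simp add: test_fun_def sobolev_trig)

lemma contract_scaleR: "contract J i (%v w. r *\<^sub>R F v w) = r *\<^sub>R contract J i F"
 by (simp add: contract_def scaleR_sum_right mult.left_commute mult.commute)

lemma zero_level_connection:
 assumes "X \<in> zero_level J La e s"
 shows "connection (%th. X th)" "conn_equivariant (%th. X th)" "rtrig ps ==> curv (%th. X th) v w ps = 0"
proof -
 have X: "X \<in> fields La e s" and mm0: "\<And>i ps. i \<in> {1,2,3} ==> test_fun La ps ==> moment_map J La i X ps = 0"
  using assms by (auto simp: zero_level_def)
 show A: "connection (%th. X th)"
  using X msob_tcont by (auto simp: connection_def fields_iff bounded_linear.linear[OF blinfun.bounded_linear_right])
 show "conn_equivariant (%th. X th)" using X by (simp add: conn_equivariant_def fields_iff equivariant_iff)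
 have "contract J i (%v w. curv (%th. X th) v w ps) = 0" if "i \<in> {1,2,3}" "rtrig ps" for i ps
 proof -
  have "torus_vol La *\<^sub>R contract J i (%v w. curv (%th. X th) v w ps) = 0"
   using mm0[OF that(1) test_fun_trig[OF that(2)]]
   by (simp add: moment_map_def curvature_def torus_integral_eq[OF discrete_subgroup_axioms] contract_scaleR curv_def)
  thus ?thesis using torus_vol_pos by simp
 qed
 thus "rtrig ps ==> curv (%th. X th) v w ps = 0"
  using flat_of_moment_map_eq_0[OF quaternionic_space_axioms A] by blast
qed

text \<open>The parallel frame trivialises the connection but is not periodic. \<open>U\<close>
  diagonalises its periods, and the multiplicative function \<open>D\<close> compensates them; the
  logarithmic derivative of \<open>D\<close> is what creates \<open>sig x\<close>. Regularity is
  recovered afterwards from the equation satisfied by \<open>g\<close>.\<close>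

theorem gauge_fixing:
 assumes X: "X \<in> zero_level J La e s"
 obtains x g where "g \<in> gm" "gauge_act g X = sig x"
proof -
 note A = zero_level_connection[OF X]
 obtain G where G: "G 0 = mat 1" "\<And>th. unitary (G th)" "\<And>th. (G has_derivative (%v. - (X th v ** G th))) (at th)"
  using parallel_frame_exists[OF A(1) dim4 A(3)] by blast
 obtain x U where U: "unitary U" "\<And>h. L h ** U = U ** L h"
  "\<And>c. c \<in> periods ==> G c ** U = U ** diag (%h. cis (- (e h x \<bullet> c)))"
  by (rule holonomy_diagonal[OF A(1,2) G]) blast
 define D where "D th = diag (%h. cis (e h x \<bullet> th))" for th
 define g where "g th = G th ** U ** D th" for th
 have dD: "(D has_derivative (%v. D th ** sig x th v)) (at th)" for th
 proof (rule entry_has_derivative)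
  fix h k
  show "((%th. D th $ h $ k) has_derivative (%v. (D th ** sig x th v) $ h $ k)) (at th)"
   using has_derivative_cis_inner[of "e h x" th]
   by (cases "h = k") (simp_all add: D_def sig_apply mult.commute)
 qed
 have "(g has_derivative (%v. (G th ** U) ** (D th ** sig x th v) + (- (X th v ** G th) ** U) ** D th)) (at th)" for th
  unfolding g_def by (intro mm.FDERIV dD bounded_linear.has_derivative[OF mm.bounded_linear_left G(3)])
 hence dg: "(g has_derivative (%v. g th ** sig x th v - X th v ** g th)) (at th)" for th
  by (simp add: g_def matrix_mul_assoc mm.minus_left)
 have D_add: "D (th + c) = D c ** D th" for th c by (simp add: D_def diag_mult inner_add_right cis_mult add.commute)
 have D_inv: "diag (%h. cis (- (e h x \<bullet> c))) ** D c = mat 1" for c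
  by (simp add: D_def diag_mult cis_mult flip: diag_1)
 have g_per: "g (th + c) = g th" if c: "c \<in> periods" for th c
 proof -
  have "g (th + c) = G th ** (G c ** U) ** D c ** D th"
   by (simp add: g_def frame_add_period[OF A(1,2) G c] D_add matrix_mul_assoc)
  also have "... = G th ** U ** (diag (%h. cis (- (e h x \<bullet> c))) ** D c) ** D th"
   by (simp add: U(3)[OF c] matrix_mul_assoc)
  finally show ?thesis by (simp add: D_inv g_def)
 qed
 have tg: "tcont g"
  using has_derivative_continuous[OF dg] g_per by (intro tcontI) (auto simp: continuous_on_eq_continuous_at)
 have ms: "msob (s + 1) g"
  by (rule msob_bootstrap[OF tg dg[unfolded sig_def]]) (use X in \<open>auto simp: zero_level_def fields_iff\<close>)
 have "unitary (D th)" for th by (simp add: unitary_def D_def adj_diag diag_mult cis_cnj cis_mult flip: diag_1)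
 hence ug: "unitary (g th)" for th unfolding g_def by (intro unitary_mult G(2) U(1))
 have "g (e h th) = L h ** g th ** adj (L h)" for h th
 proof -
  have "D (e h th) = L h ** D th ** adj (L h)" unfolding D_def diag_conj_L inner_e_mul ..
  hence "g (e h th) = L h ** G th ** (adj (L h) ** (U ** L h)) ** D th ** adj (L h)"
   by (simp add: g_def frame_equivariant[OF A(1,2) G] matrix_mul_assoc)
  thus ?thesis by (simp add: U(2)[symmetric] g_def matrix_mul_assoc unitary_cancel[OF unitary_L] unitaryD[OF unitary_L])
 qed
 hence g: "g \<in> gm" using ms ug by (simp add: gm_iff)
 moreover have "gauge_act g X = sig x"
 proof (intro ext blinfun_eqI)
  fix th v
  show "gauge_act g X th v = sig x th v"
   unfolding gauge_act_apply[OF g] dir_deriv_eq[OF dg] mm.diff_right using unitary_cancel(1)[OF ug] by (simp add: matrix_mul_assoc)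
 qed
 ultimately show ?thesis using that by blast
qed

end

section \<open>Comparison of gauge orbits\<close>

context discrete_subgroup begin

lemma Hs_deriv:
 assumes f: "Hs (t + 1) f" and D: "tcont D"
  and deriv: "\<And>th. (f has_derivative f' th) (at th)" "\<And>th. f' th v = D th"
 shows "Hs t D"
proof -
 have tf: "tcont f" using f by (simp add: Hs_def)
 have "(%l. (norm v)\<^sup>2 * (weight l powr (t + 1) * (cmod (fc f l))^2)) summable_on La"
  using f by (intro summable_on_cmult_right) (simp add: Hs_def)
 hence "(%l. weight l powr t * (cmod (fc D l))^2) summable_on La"
 proof (rule summable_on_comparison_test)
  fix l assume l: "l \<in> La"
  have w: "weight l > 0" by (simp add: add_pos_nonneg)
  have "(l \<bullet> v)^2 \<le> (norm l * norm v)^2"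
   using Cauchy_Schwarz_ineq2[of l v] by (intro abs_le_square_iff[THEN iffD1]) simp
  also have "... \<le> (norm v)^2 * weight l" by (simp add: power_mult_distrib algebra_simps)
  finally have "weight l powr t * ((l \<bullet> v)^2 * (cmod (fc f l))^2) \<le> weight l powr t * ((norm v)^2 * weight l * (cmod (fc f l))^2)"
   by (intro mult_left_mono mult_right_mono) auto
  thus "weight l powr t * (cmod (fc D l))^2 \<le> (norm v)^2 * (weight l powr (t + 1) * (cmod (fc f l))^2)"
   using w by (simp add: fourier_deriv[OF tf D deriv l] norm_mult power_mult_distrib powr_add mult_ac)
 qed auto
 thus ?thesis using D by (simp add: Hs_def)
qed

end

context gauge_setting begin

lemma msob_mono: "msob (s + 1) f ==> msob s f"
proof -
 have "s \<le> s + 1" by (cases s) auto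
 thus "msob (s + 1) f ==> msob s f" unfolding msob_def sobolev_iff by (meson order_trans)
qed

lemma msob_dir_deriv: "msob (s + 1) f ==> msob s (dir_deriv v f)"
 unfolding msob_def sobolev_iff
proof (intro allI conjI impI)
 assume "\<forall>h k. tcont (%th. f th $ h $ k) \<and> (\<forall>t. ereal t \<le> s + 1 \<longrightarrow> Hs t (%th. f th $ h $ k))"
 hence f: "msob (s + 1) f" by (simp add: msob_def sobolev_iff)
 fix h k
 show tD: "tcont (%th. dir_deriv v f th $ h $ k)" using msob_deriv(2)[OF f] by (simp add: tcont_entries)
 fix t assume "ereal t \<le> s"
 hence "ereal (t + 1) \<le> s + 1" by (cases s) auto
 hence "Hs (t + 1) (%th. f th $ h $ k)" using f unfolding msob_def sobolev_iff by blast
 thus "Hs t (%th. dir_deriv v f th $ h $ k)"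
  by (rule Hs_deriv[OF _ tD bounded_linear.has_derivative[OF bounded_linear_entry msob_deriv(1)[OF f]] refl])
qed

lemma msob_gauge_act:
 fixes X :: "('q, 'g) field"
 assumes g: "g \<in> gm" and X: "\<And>v. msob s (%th. X th v)" shows "msob s (%th. gauge_act g X th v)"
proof -
 have a: "msob s (%th. f th + k th)" if "msob s f" "msob s k" for f k
  using that by (auto simp: msob_def intro!: sobolev_add)
 show ?thesis
  unfolding gauge_act_apply[OF g]
  by (intro a msob_mult[OF s_large] msob_adj msob_mono gmD(1)[OF g] X msob_dir_deriv)
qed

lemma gauge_act_eqD:
 "g \<in> gm ==> gauge_act g X = Y ==> dir_deriv v g th = g th ** Y th v - X th v ** g th"
 using unitary_cancel(2)[OF gmD(2)[of g]]
 by (auto simp: gauge_act_apply mm.add_right matrix_mul_assoc unitaryD gmD(2))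

lemma gauge_act_eqI:
 fixes X Y :: "('q, 'g) field"
 assumes g: "g \<in> gm" and d: "\<And>th v. dir_deriv v g th = g th ** Y th v - X th v ** g th"
 shows "gauge_act g X = Y"
proof (intro ext blinfun_eqI)
 fix th v show "gauge_act g X th v = Y th v"
  unfolding gauge_act_apply[OF g] d mm.diff_right using unitary_cancel(1)[OF gmD(2)[OF g]] by (simp add: matrix_mul_assoc)
qed

lemma gauge_act_adj: "g \<in> gm ==> gauge_act (%th. adj (g th)) (gauge_act g X) = X"
 using gauge_act_mult[OF _ gm_adj, of g g X] by (simp add: unitaryD gmD(2) gauge_act_1)

text \<open>Right multiplication by \<open>m\<close> as a permutation matrix, times characters whose
  frequencies \<open>e h l\<close> vary equivariantly. It realises the affine map with linear part
  \<open>e m\<close> and translation \<open>l\<close> on model parameters.\<close>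

definition orbit_gauge :: "'g => 'q => 'q => complex^'g^'g" where
 "orbit_gauge m l th = (\<chi> a h. if a = mul h m then cis (e h l \<bullet> th) else 0)"

lemma orbit_gauge_act:
 assumes l: "l \<in> La"
 shows "orbit_gauge m l \<in> gm" "gauge_act (orbit_gauge m l) (sig x) = sig (e m x + l)"
proof -
 let ?g = "orbit_gauge m l"
 have mt: "mtrig ?g"
  unfolding mtrig_def
 proof (intro allI)
  fix a h
  show "trig (%th. ?g th $ a $ h)"
   using trig_cis[OF e_mem[OF l], of 1 h] by (cases "a = mul h m") (simp_all add: orbit_gauge_def trig_const)
 qed
 have inj: "mul h m = mul k m \<longleftrightarrow> h = k" for h k by (metis assoc right_inverse right_neutral)
 have u: "unitary (?g th)" for th
 proof -
  have "(adj (?g th) ** ?g th) $ h $ k = (if h = k then 1 else 0)" for h k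
  proof -
   have "(adj (?g th) ** ?g th) $ h $ k = (\<Sum>a\<in>UNIV. if a = mul h m then (if h = k then 1 else 0) else 0)"
    unfolding matrix_mult_nth
    by (rule sum.cong) (auto simp: orbit_gauge_def inj cis_cnj cis_mult)
   thus ?thesis by simp
  qed
  thus ?thesis by (simp add: unitary_def vec_eq_iff mat_def)
 qed
 have "?g (e k th) $ a $ h = (L k ** ?g th ** adj (L k)) $ a $ h" for k th a h
 proof -
  have "mul (invg k) a = mul (mul (invg k) h) m \<longleftrightarrow> a = mul h m" by (metis assoc group_left_neutral right_inverse)
  thus ?thesis
   by (simp add: adj_L mult_L_nth L_mult_nth) (simp add: orbit_gauge_def inner_e_mul)
 qed
 thus g: "?g \<in> gm" using msob_mtrig[OF mt] u by (simp add: gm_iff vec_eq_iff)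
 show "gauge_act ?g (sig x) = sig (e m x + l)"
 proof (rule gauge_act_eqI[OF g])
  fix th v
  have "dir_deriv v ?g th $ a $ h = (?g th ** sig (e m x + l) th v - sig x th v ** ?g th) $ a $ h" for a h
   unfolding mtrig_has_derivative(2)[OF mt]
  proof (cases "a = mul h m")
   case True
   thus "dir_deriv v (%th. ?g th $ a $ h) th = (?g th ** sig (e m x + l) th v - sig x th v ** ?g th) $ a $ h"
    using trig_dir_deriv_cis[of v 1 "e h l" th]
    by (simp add: orbit_gauge_def sig_apply e_mul blinfun.add_right inner_add_left algebra_simps)
  next
   case False
   thus "dir_deriv v (%th. ?g th $ a $ h) th = (?g th ** sig (e m x + l) th v - sig x th v ** ?g th) $ a $ h"
    by (simp add: orbit_gauge_def sig_apply dir_deriv_eq[OF has_derivative_const])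
  qed
  thus "dir_deriv v ?g th = ?g th ** sig (e m x + l) th v - sig x th v ** ?g th" by (simp add: vec_eq_iff)
 qed
qed

lemma sig_orbit: "l \<in> La ==> gauge_orbit La e s (sig (e m x + l)) = gauge_orbit La e s (sig x)"
 using gauge_orbit_act[OF orbit_gauge_act(1)] orbit_gauge_act(2) by metis

text \<open>Each entry of \<open>k ** g\<close> satisfies a scalar equation with constant
  coefficients, whose symbol at \<open>l\<close> is the gap between \<open>l\<close> and
  \<open>e h y - e m x\<close>; the inhomogeneity carries \<open>X - Y\<close>. Exact gauge
  equivalence and mere closeness of fields are thus treated together.\<close>

lemma intertwiner_fourier:
 assumes k: "k \<in> gm" "gauge_act k (sig x) = X" and g: "g \<in> gm" "gauge_act g Y = sig y"
  and XY: "tcont (%th. X th v - Y th v)" and l: "l \<in> La"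
 shows "fc (%th. (k th ** (X th v - Y th v) ** g th) $ m $ h) l =
  \<i> * of_real ((l - (e h y - e m x)) \<bullet> v) * fc (%th. (k th ** g th) $ m $ h) l"
proof -
 let ?u = "%th. k th ** g th" and ?E = "%th. k th ** (X th v - Y th v) ** g th"
 have u: "?u \<in> gm" by (rule gm_mult[OF k(1) g(1)])
 have tu: "tcont (%th. ?u th $ m $ h)" using msob_tcont[OF gmD(1)[OF u]] by (simp add: tcont_entries)
 have tE: "tcont (%th. ?E th $ m $ h)"
  using tcont_matrix_mult[OF tcont_matrix_mult[OF msob_tcont[OF gmD(1)[OF k(1)]] XY] msob_tcont[OF gmD(1)[OF g(1)]]]
  by (simp add: tcont_entries)
 have "dir_deriv v ?u th $ m $ h = ?E th $ m $ h + (\<i> * of_real ((e h y - e m x) \<bullet> v)) * ?u th $ m $ h" for th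
 proof -
  have *: "dir_deriv v ?u th = ?E th + (?u th ** sig y th v - sig x th v ** ?u th)"
   unfolding dir_deriv_mult[OF gmD(4)[OF k(1)] gmD(4)[OF g(1)]] gauge_act_eqD[OF k] gauge_act_eqD[OF g]
   by (simp add: mm.diff_left mm.diff_right matrix_mul_assoc)
  show ?thesis unfolding * by (simp add: sig_apply inner_diff_left algebra_simps)
 qed
 hence eq: "((%th. ?E th $ m $ h + (\<i> * of_real ((e h y - e m x) \<bullet> v)) * ?u th $ m $ h)) = (%th. dir_deriv v ?u th $ m $ h)" by simp
 have "fc (%th. dir_deriv v ?u th $ m $ h) l = \<i> * of_real (l \<bullet> v) * fc (%th. ?u th $ m $ h) l"
  using msob_deriv(2)[OF gmD(1)[OF u]]
  by (intro fourier_deriv[OF tu _ bounded_linear.has_derivative[OF bounded_linear_entry gmD(4)[OF u]] refl l]) (simp add: tcont_entries)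
 hence "fc (%th. ?E th $ m $ h) l + (\<i> * of_real ((e h y - e m x) \<bullet> v)) * fc (%th. ?u th $ m $ h) l =
   \<i> * of_real (l \<bullet> v) * fc (%th. ?u th $ m $ h) l"
  unfolding eq[symmetric] fourier_add[OF tE tcont_mult[OF tcont_const tu] l] fourier_cmult[OF tu l] .
 thus ?thesis by (simp add: inner_diff_left algebra_simps)
qed

text \<open>The homogeneous case, tested in the direction of the gap itself.\<close>

lemma intertwiner_coefficients:
 assumes u: "u \<in> gm" "gauge_act u (sig x) = sig y" and l: "l \<in> La" "e m x + l \<noteq> e h y"
 shows "fc (%th. u th $ m $ h) l = 0"
proof -
 let ?q = "l - (e h y - e m x)"
 have "tcont (%th. sig x th ?q - sig x th ?q)" by (simp add: tcont_const)
 from intertwiner_fourier[OF gm_const[of 1] gauge_act_1 u this l(1), of m h]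
 have "0 = \<i> * of_real (?q \<bullet> ?q) * fc (%th. u th $ m $ h) l"
  by (simp add: fourier_eq avg_const)
 moreover have "?q \<noteq> 0" using l(2) by (auto simp: algebra_simps)
 hence "?q \<bullet> ?q \<noteq> 0" unfolding inner_eq_zero_iff .
 ultimately show ?thesis by simp
qed

text \<open>If no gap vanished, all Fourier coefficients of the intertwiner would, and it would be
  zero instead of unitary.\<close>

lemma sig_orbit_inj:
 assumes "gauge_orbit La e s (sig x) = gauge_orbit La e s (sig y)"
 shows "\<exists>m h. \<exists>l\<in>La. e m x + l = e h y"
proof (rule ccontr)
 assume *: "\<not> ?thesis"
 have "sig y \<in> gauge_orbit La e s (sig x)" using gauge_orbit_self assms by simp
 then obtain u where u: "u \<in> gm" "gauge_act u (sig x) = sig y" unfolding gauge_orbit_eq by force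
 have "u 0 $ m $ h = 0" for m h
  using msob_tcont[OF gmD(1)[OF u(1)]]
  by (intro fourier_eq_0_imp[of "%th. u th $ m $ h"] intertwiner_coefficients[OF u]) (use * in \<open>auto simp: tcont_entries\<close>)
 hence "u 0 = 0" by (simp add: vec_eq_iff)
 thus False using norm_unitary_sq[OF gmD(2)[OF u(1), of 0]] by simp
qed

lemma avg_norm_sq_matrix:
 fixes f :: "'q => complex^'g^'g"
 assumes "tcont f"
 shows "avg (%th. (norm (f th))\<^sup>2) = (\<Sum>m\<in>UNIV. \<Sum>h\<in>UNIV. avg (%th. (cmod (f th $ m $ h))\<^sup>2))"
 unfolding norm_matrix_sq_sum
 using assms by (simp add: avg_sum tcont_sum tcont_power tcont_norm tcont_entries)

lemma parseval_sobolev: "sobolev La t f ==> ereal (real (dim La) / 2) < t ==>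
  (\<Sum>\<^sub>\<infinity>l\<in>La. (cmod (fc f l))\<^sup>2) = avg (%th. (cmod (f th))\<^sup>2)"
proof -
 assume f: "sobolev La t f" and t: "ereal (real (dim La) / 2) < t"
 obtain r where r: "ereal (real (dim La) / 2) < ereal r" "ereal r < t" using ereal_dense2[OF t] by blast
 have "Hs r f" using f r(2) by (simp add: sobolev_iff)
 thus ?thesis using f r(1) by (intro parseval Hs_fourier_summable[of r]) (auto simp: sobolev_iff)
qed

lemma sobolev_norm_0_sq:
 fixes W :: "('q, 'g) field"
 assumes W: "\<And>v. msob s (%th. W th v)"
 shows "(sobolev_norm La 0 W)^2 = (\<Sum>b\<in>Basis. avg (%th. (norm (W th b))\<^sup>2))"
proof -
 have w: "(1 + (norm l)^2) powr 0 = 1" for l :: 'q using add_pos_nonneg[of 1 "(norm l)^2"] by simp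
 have "sobolev_norm La 0 W = sqrt (\<Sum>b\<in>Basis. \<Sum>h\<in>UNIV. \<Sum>k\<in>UNIV. avg (%th. (cmod (W th b $ h $ k))\<^sup>2))"
  unfolding sobolev_norm_def w using parseval_sobolev[OF _ s_large] W by (simp add: msob_def)
 moreover have "avg (%th. (cmod (W th b $ h $ k))\<^sup>2) \<ge> 0" for b h k
  using parseval_sobolev[OF _ s_large, of "%th. W th b $ h $ k"] W infsum_nonneg[of La "%l. (cmod (fc (%th. W th b $ h $ k) l))\<^sup>2"]
  by (simp add: msob_def)
 ultimately show ?thesis
  by (simp add: sum_nonneg avg_norm_sq_matrix[OF msob_tcont[OF W]])
qed

text \<open>Fourier coefficients of an intertwiner can be large only where the spectra of the two flat connections
 nearly agree.\<close>

lemma intertwiner_near: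
 assumes k: "k \<in> gm" "gauge_act k (sig x) = X" and g: "g \<in> gm" "gauge_act g Y = sig y"
  and Y: "Y \<in> fields La e s" and dl: "dl > 0" and near: "sobolev_norm La 0 (%th. Y th - X th) < dl"
 shows "\<exists>m h. \<exists>l\<in>La. norm (l - (e h y - e m x)) < dl"
proof (rule ccontr)
 assume "\<not> ?thesis"
 hence far: "dl \<le> norm (l - (e h y - e m x))" if "l \<in> La" for l m h using that by (meson not_le)
 let ?u = "%th. k th ** g th" and ?E = "%v th. k th ** (X th v - Y th v) ** g th"
 have u: "?u \<in> gm" by (rule gm_mult[OF k(1) g(1)])
 have mX: "msob s (%th. X th v)" for v
  using msob_gauge_act[OF k(1), of "sig x"] sig_fields[of x] by (simp add: k(2) fields_iff)
 have mY: "msob s (%th. Y th v)" for v using Y by (simp add: fields_iff)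
 have mW: "msob s (%th. (Y th - X th) v)" for v
  using mX[of v] mY[of v] sobolev_add[OF _ sobolev_cmult[of _ _ "- 1"]]
  unfolding msob_def by (simp add: blinfun.diff_left)
 have tXY: "tcont (%th. X th v - Y th v)" for v by (intro tcont_diff msob_tcont[OF mX] msob_tcont[OF mY])
 have tE: "tcont (?E v)" for v
  by (intro tcont_matrix_mult tXY msob_tcont[OF gmD(1)[OF k(1)]] msob_tcont[OF gmD(1)[OF g(1)]])
 \<comment> \<open>Squaring the coefficient equations and summing over the directions produces the
   squared gap, at least \<open>dl\<^sup>2\<close> at every frequency. Parseval is used for the
   intertwiner and Bessel for the inhomogeneity.\<close>
 have entry: "dl\<^sup>2 * avg (%th. (cmod (?u th $ m $ h))\<^sup>2) \<le> (\<Sum>b\<in>Basis. avg (%th. (cmod (?E b th $ m $ h))\<^sup>2))" for m h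
 proof -
  let ?uh = "%l. fc (%th. ?u th $ m $ h) l" and ?Eh = "%b l. fc (%th. ?E b th $ m $ h) l"
  have tu: "tcont (%th. ?u th $ m $ h)" using msob_tcont[OF gmD(1)[OF u]] by (simp add: tcont_entries)
  have tEh: "tcont (%th. ?E b th $ m $ h)" for b using tE[of b] by (simp add: tcont_entries)
  have "dl\<^sup>2 * avg (%th. (cmod (?u th $ m $ h))\<^sup>2) = (\<Sum>\<^sub>\<infinity>l\<in>La. dl\<^sup>2 * (cmod (?uh l))^2)"
   using parseval_sobolev[OF _ s_Suc_large] gmD(1)[OF u] bessel(1)[OF tu]
   by (simp add: msob_def infsum_cmult_right)
  also have "... \<le> (\<Sum>\<^sub>\<infinity>l\<in>La. \<Sum>b\<in>Basis. (cmod (?Eh b l))\<^sup>2)"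
  proof (rule infsum_mono)
   show "(%l. dl\<^sup>2 * (cmod (?uh l))^2) summable_on La" by (intro summable_on_cmult_right bessel(1) tu)
   show "(%l. \<Sum>b\<in>Basis. (cmod (?Eh b l))\<^sup>2) summable_on La" by (intro summable_on_sum bessel(1) tEh)
   fix l assume l: "l \<in> La"
   let ?q = "l - (e h y - e m x)"
   have "(\<Sum>b\<in>Basis. (cmod (?Eh b l))\<^sup>2) = (\<Sum>b\<in>Basis. (?q \<bullet> b)\<^sup>2) * (cmod (?uh l))^2"
    unfolding intertwiner_fourier[OF k g tXY l] by (simp add: norm_mult power_mult_distrib sum_distrib_right)
   also have "(\<Sum>b\<in>Basis. (?q \<bullet> b)\<^sup>2) = (norm ?q)^2"
    unfolding power2_norm_eq_inner by (subst euclidean_inner[of ?q ?q]) (simp only: power2_eq_square)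
   finally show "dl\<^sup>2 * (cmod (?uh l))^2 \<le> (\<Sum>b\<in>Basis. (cmod (?Eh b l))\<^sup>2)"
    using far[OF l, of h m] dl by (simp add: mult_right_mono power_mono)
  qed
  also have "... = (\<Sum>b\<in>Basis. \<Sum>\<^sub>\<infinity>l\<in>La. (cmod (?Eh b l))\<^sup>2)" by (intro infsum_sum bessel(1) tEh)
  also have "... \<le> (\<Sum>b\<in>Basis. avg (%th. (cmod (?E b th $ m $ h))\<^sup>2))" by (intro sum_mono bessel(2) tEh)
  finally show ?thesis .
 qed
 \<comment> \<open>A unitary matrix has squared norm \<open>CARD('g)\<close>, so the estimate would
   force \<open>CARD('g) < 1\<close>.\<close>
 have "dl\<^sup>2 * real CARD('g) = dl\<^sup>2 * avg (%th. (norm (?u th))\<^sup>2)"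
  by (simp add: norm_unitary_sq[OF gmD(2)[OF u]] avg_const)
 also have "... = (\<Sum>m\<in>UNIV. \<Sum>h\<in>UNIV. dl\<^sup>2 * avg (%th. (cmod (?u th $ m $ h))\<^sup>2))"
  by (simp add: avg_norm_sq_matrix[OF msob_tcont[OF gmD(1)[OF u]]] sum_distrib_left)
 also have "... \<le> (\<Sum>m\<in>UNIV. \<Sum>h\<in>UNIV. \<Sum>b\<in>Basis. avg (%th. (cmod (?E b th $ m $ h))\<^sup>2))"
  by (intro sum_mono entry)
 also have "... = (\<Sum>b\<in>Basis. avg (%th. (norm (?E b th))\<^sup>2))"
  unfolding avg_norm_sq_matrix[OF tE] by (simp only: sum.swap[of _ Basis])
 also have "... = (sobolev_norm La 0 (%th. Y th - X th))^2"
  unfolding sobolev_norm_0_sq[OF mW]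
  by (simp add: norm_unitary_mult[OF gmD(2)[OF k(1)]] norm_unitary_mult[OF gmD(2)[OF g(1)]] blinfun.diff_left norm_minus_commute)
 also have "... < dl\<^sup>2"
  using near by (intro power_strict_mono) (auto simp: sobolev_norm_def intro!: real_sqrt_ge_zero sum_nonneg infsum_nonneg)
 finally have "dl\<^sup>2 * real CARD('g) < dl\<^sup>2 * 1" by simp
 hence "real CARD('g) < 1" using dl by (simp only: mult_less_cancel_left_pos zero_less_power)
 thus False by simp
qed

text \<open>At such a point the gap vanishes only at frequency 0 on the diagonal, so
  \<open>u\<close> is constant and diagonal; equivariance equates the diagonal entries.\<close>

lemma free_stabilizer:
 assumes free: "\<And>m l. l \<in> La ==> e m x + l = x ==> m = unit \<and> l = 0"
  and u: "u \<in> gm" "gauge_act u (sig x) = sig x"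
 obtains c where "cmod c = 1" "u = (%_. mat c)"
proof -
 have tu: "tcont (%th. u th $ m $ h)" for m h
  using msob_tcont[OF gmD(1)[OF u(1)]] by (simp add: tcont_entries)
 have z: "fc (%th. u th $ m $ h) l = 0" if l: "l \<in> La" "m \<noteq> h \<or> l \<noteq> 0" for m h l
 proof (rule intertwiner_coefficients[OF u l(1)], rule notI)
  assume "e m x + l = e h x"
  hence "e (invg h) (e m x + l) = x" by (simp add: e_invg)
  hence "e (mul (invg h) m) x + e (invg h) l = x" by (simp add: e_mul blinfun.add_right)
  from free[OF e_mem[OF l(1)] this] have "mul (invg h) m = unit" "e (invg h) l = 0" by auto
  hence "m = h" "l = 0"
   using e_invg'[of h l] by (metis assoc group_left_neutral right_inverse right_neutral, simp)
  with l(2) show False by simp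
 qed
 have const: "u th $ m $ h = fc (%th. u th $ m $ h) 0" for th m h
 proof -
  let ?c = "fc (%th. u th $ m $ h) 0"
  have "u th $ m $ h - ?c = 0"
  proof (rule fourier_eq_0_imp[of "%th. u th $ m $ h - ?c"])
   show "tcont (%th. u th $ m $ h - ?c)" by (intro tcont_diff tu tcont_const)
   fix l assume l: "l \<in> La"
   show "fc (%th. u th $ m $ h - ?c) l = 0"
    using fourier_cis[OF l zero_mem, of ?c] z[OF l, of m h] by (auto simp: fourier_diff[OF tu tcont_const l])
  qed
  thus ?thesis by simp
 qed
 have c: "u th = u 0" for th unfolding vec_eq_iff using const by metis
 have off: "u 0 $ m $ h = 0" if "m \<noteq> h" for m h using const[of 0 m h] z[OF zero_mem, of m h] that by simp
 have di: "u 0 $ h $ h = u 0 $ unit $ unit" for h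
  using gmD(3)[OF u(1), of h 0] c[of "e h 0"] by (simp add: adj_L vec_eq_iff mult_L_nth L_mult_nth) (metis left_inverse)
 have u0: "u 0 = mat (u 0 $ unit $ unit)" unfolding vec_eq_iff mat_def using off di by auto
 have "norm (u 0 ** mat 1) = norm (mat 1 :: complex^'g^'g)" by (rule norm_unitary_mult(1)[OF gmD(2)[OF u(1)]])
 hence "cmod (u 0 $ unit $ unit) * norm (mat 1 :: complex^'g^'g) = norm (mat 1 :: complex^'g^'g)"
  using u0 norm_mat_mult by metis
 moreover have "norm (mat 1 :: complex^'g^'g) \<noteq> 0"
  using norm_unitary_sq[OF unitary_mat[of 1], where 'n = 'g] by auto
 ultimately have "cmod (u 0 $ unit $ unit) = 1" by simp
 thus ?thesis using that u0 c by (metis ext)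
qed

text \<open>Stabilizers along an orbit are conjugate, which reduces one direction to the model
  itself. Conversely an affine map fixing \<open>x\<close> yields a stabilizing
  \<open>orbit_gauge\<close>, which is scalar only if \<open>m\<close> is the unit.\<close>

lemma stabilizer_trivial_iff:
 "(\<forall>m. \<forall>l\<in>La. e m x + l = x \<longrightarrow> m = unit \<and> l = 0) \<longleftrightarrow>
  (\<forall>X\<in>gauge_orbit La e s (sig x). gauge_stabilizer La e s X = {scalar_coset (%_. mat 1)})"
 (is "?free \<longleftrightarrow> ?triv")
proof
 have matm: "mat c ** mat c' = (mat (c * c') :: complex^'g^'g)" for c c'
  unfolding vec_eq_iff mat_mult_entry by (simp add: mat_def)
 have coset: "scalar_coset (%_::'q. mat c :: complex^'g^'g) = scalar_coset (%_. mat 1)" if "cmod c = 1" for c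
 proof -
  have "\<exists>d. mat b = (mat (d * c) :: complex^'g^'g) \<and> cmod d = 1" if "cmod b = 1" for b
   using \<open>cmod c = 1\<close> that by (intro exI[of _ "b / c"]) (auto simp: norm_divide)
  thus ?thesis using that by (auto simp: scalar_coset_def matm norm_mult)
 qed
 {
  assume free: ?free
  show ?triv
  proof
   fix X assume "X \<in> gauge_orbit La e s (sig x)"
   then obtain k where k: "k \<in> gm" "X = gauge_act k (sig x)" unfolding gauge_orbit_eq by blast
   have "G = scalar_coset (%_. mat 1)" if G: "G \<in> gauge_stabilizer La e s X" for G
   proof -
    obtain g0 g where g: "g0 \<in> gm" "G = scalar_coset g0" "g \<in> G" "gauge_act g X = X"
     using G by (auto simp: gauge_stabilizer_def gauge_group_def)
    obtain c where c: "cmod c = 1" "g = (%th. mat c ** g0 th)" using g(2,3) by (auto simp: scalar_coset_def)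
    have g': "g \<in> gm" unfolding c(2) by (rule gm_mult[OF gm_const[OF c(1)] g(1)])
    let ?u = "%th. (k th ** g th) ** adj (k th)"
    have "gauge_act ?u (sig x) = sig x"
     using gauge_act_mult[OF gm_mult[OF k(1) g'] gm_adj[OF k(1)], of "sig x"] gauge_act_mult[OF k(1) g', of "sig x"]
      g(4) gauge_act_adj[OF k(1)] by (simp add: k(2))
    then obtain d where d: "cmod d = 1" "?u = (%_. mat d)"
     using free_stabilizer[of x ?u] free gm_mult[OF gm_mult[OF k(1) g'] gm_adj[OF k(1)]] by blast
    have gd: "g th = mat d" for th
    proof -
     have "adj (k th) ** (?u th ** k th) = g th" by (simp add: unitary_cancel[OF gmD(2)[OF k(1)]] unitaryD[OF gmD(2)[OF k(1)]] flip: matrix_mul_assoc)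
     thus ?thesis using fun_cong[OF d(2), of th] mat_commute[of d "k th"] unitary_cancel(1)[OF gmD(2)[OF k(1)]] by simp
    qed
    have "g0 = (%_. mat (cnj c * d))"
    proof (intro ext)
     fix th
     have "cnj c * c = 1" using c(1) complex_norm_square[of c] by (simp add: mult.commute)
     moreover have "mat (cnj c) ** (mat c ** g0 th) = mat (cnj c) ** mat d" using gd[of th] by (simp add: c(2))
     ultimately show "g0 th = mat (cnj c * d)" by (simp add: matrix_mul_assoc matm)
    qed
    thus ?thesis using g(2) coset[of "cnj c * d"] c d by (simp add: norm_mult)
   qed
   moreover have "scalar_coset (%_. mat 1) \<in> gauge_stabilizer La e s X"
   proof -
    have "scalar_coset (%_::'q. mat 1) \<in> scalar_coset ` gm" using gm_const[of 1] by (intro imageI) simp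
    moreover have "(%_. mat 1) \<in> scalar_coset (%_::'q. mat 1 :: complex^'g^'g)"
     by (auto simp: scalar_coset_def intro!: exI[of _ 1])
    ultimately show ?thesis using gauge_act_1[of X] unfolding gauge_stabilizer_def gauge_group_def by blast
   qed
   ultimately show "gauge_stabilizer La e s X = {scalar_coset (%_. mat 1)}" by blast
  qed
 next
  assume triv: ?triv
  show ?free
  proof (intro allI ballI impI)
   fix m l assume l: "l \<in> La" and fx: "e m x + l = x"
   let ?g = "orbit_gauge m l"
   have "gauge_act ?g (sig x) = sig x" using orbit_gauge_act(2)[OF l, of m x] fx by simp
   moreover have "?g \<in> scalar_coset ?g" by (auto simp: scalar_coset_def intro!: exI[of _ 1])
   ultimately have "scalar_coset ?g \<in> gauge_stabilizer La e s (sig x)"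
    using orbit_gauge_act(1)[OF l, of m] by (auto simp: gauge_stabilizer_def gauge_group_def)
   hence "?g \<in> scalar_coset (%_. mat 1)"
    using triv gauge_orbit_self \<open>?g \<in> scalar_coset ?g\<close> by blast
   then obtain c where "?g = (%_. mat c)" by (auto simp: scalar_coset_def)
   hence "?g 0 $ mul unit m $ unit = mat c $ mul unit m $ unit" by simp
   hence "m = unit" by (auto simp: orbit_gauge_def mat_def group_left_neutral split: if_splits)
   thus "m = unit \<and> l = 0" using fx by (simp add: e_unit)
  qed
 }
qed

end

section \<open>Horizontal spaces at the model solutions\<close>

text \<open>The trace of a bilinear form does not depend on the orthonormal basis; \<open>T'\<close>
  is the adjoint of \<open>T\<close>.\<close>

lemma sum_orthonormal_change:
 fixes F :: "'q::euclidean_space => 'q => 'b::real_vector"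
 assumes F: "\<And>v. linear (F v)" "\<And>w. linear (%v. F v w)"
  and T: "\<And>v w. T v \<bullet> w = v \<bullet> T' w" "\<And>v w. T' v \<bullet> T' w = v \<bullet> w"
 shows "(\<Sum>b\<in>Basis. F (T b) (T b)) = (\<Sum>b\<in>Basis. F b b)"
proof -
 have ex: "F v w = (\<Sum>c\<in>Basis. \<Sum>d\<in>Basis. ((v \<bullet> c) * (w \<bullet> d)) *\<^sub>R F c d)" for v w
 proof -
  have "F (\<Sum>c\<in>Basis. (v \<bullet> c) *\<^sub>R c) (\<Sum>d\<in>Basis. (w \<bullet> d) *\<^sub>R d) = (\<Sum>d\<in>Basis. \<Sum>c\<in>Basis. (w \<bullet> d) *\<^sub>R (v \<bullet> c) *\<^sub>R F c d)"
   by (simp add: linear_sum[OF F(1)] linear_sum[OF F(2)] linear_scale[OF F(1)] linear_scale[OF F(2)] scaleR_sum_right del: euclidean_representation)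
  thus ?thesis by (subst sum.swap) (simp add: euclidean_representation mult.commute)
 qed
 have "(\<Sum>b\<in>Basis. F (T b) (T b)) = (\<Sum>c\<in>Basis. \<Sum>d\<in>Basis. (\<Sum>b\<in>Basis. (T b \<bullet> c) * (T b \<bullet> d)) *\<^sub>R F c d)"
  unfolding ex[of "T _"] scaleR_sum_left by (subst sum.swap, rule sum.cong[OF refl], rule sum.swap)
 also have "... = (\<Sum>c\<in>Basis. \<Sum>d\<in>Basis. (c \<bullet> d) *\<^sub>R F c d)"
 proof (intro sum.cong refl arg_cong2[where f = scaleR])
  fix c d
  show "(\<Sum>b\<in>Basis. (T b \<bullet> c) * (T b \<bullet> d)) = c \<bullet> d"
   unfolding T(1) using T(2)[of c d] euclidean_inner[of "T' c" "T' d"] by (simp add: inner_commute)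
 qed
 also have "... = (\<Sum>c\<in>Basis. F c c)"
  by (intro sum.cong refl) (simp add: inner_Basis if_distrib if_distribR cong: if_cong)
 finally show ?thesis .
qed

context gauge_setting begin

lemma test_fun_derivative:
 assumes "test_fun La ps"
 shows "tcont (dir_deriv v ps)" "avg (dir_deriv v ps) = 0"
proof -
 have "Hs (real (dim La) / 2 + 2) (%th. of_real (ps th))" using assms by (auto simp: test_fun_def sobolev_iff)
 then obtain f' where f': "\<And>th. ((%th. complex_of_real (ps th)) has_derivative f' th) (at th)" "\<And>v. tcont (%th. f' th v)"
  by (rule Hs_differentiable) auto
 have d: "(ps has_derivative (%v. Re (f' th v))) (at th)" for th
  using bounded_linear.has_derivative[OF bounded_linear_Re f'(1)] by simp
 have e: "dir_deriv v ps = (%th. Re (f' th v))" for v using dir_deriv_eq[OF d] by auto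
 show "tcont (dir_deriv v ps)" unfolding e by (rule tcont_bounded_linear[OF bounded_linear_Re f'(2)])
 moreover have "tcont ps"
  using assms tcont_bounded_linear[OF bounded_linear_Re sobolev_tcont] by (fastforce simp: test_fun_def)
 ultimately show "avg (dir_deriv v ps) = 0" by (intro avg_deriv_eq_0[OF _ _ d]) (simp_all add: e)
qed

lemma avg_test_deriv:
 assumes ps: "test_fun La ps"
 shows "avg (%th. - dir_deriv v ps th *\<^sub>R (M :: complex^'g^'g) + dir_deriv w ps th *\<^sub>R N) = 0"
proof -
 have "avg (%th. dir_deriv v ps th *\<^sub>R M) = 0" for v and M :: "complex^'g^'g"
  using avg_bounded_linear[OF bounded_linear_scaleR_left test_fun_derivative(1)[OF ps]] by (simp add: test_fun_derivative(2)[OF ps])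
 thus ?thesis
  using test_fun_derivative(1)[OF ps]
  by (simp add: avg_add avg_diff avg_uminus tcont_uminus tcont_scaleR tcont_const)
qed

lemma commutator_diag: "commutator (diag f) (diag g) = 0"
 by (simp add: commutator_def diag_mult mult.commute)

lemma commutator_diag_nth: "commutator (diag f) M $ h $ k = (f h - f k) * M $ h $ k" for M :: "complex^'g^'g"
 by (simp add: commutator_def algebra_simps)

text \<open>The matrices are constant and commute, so only derivatives of the test function remain,
  and these average to zero.\<close>

lemma sig_zero_level: "sig x \<in> zero_level J La e s"
proof -
 have "moment_map J La i (sig x) ps = 0" if "test_fun La ps" for i ps
  unfolding moment_map_def curvature_def torus_integral_eq[OF discrete_subgroup_axioms] sig_apply commutator_diag
  by (simp add: avg_test_deriv[OF that, simplified] contract_def)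
 thus ?thesis by (simp add: zero_level_def sig_fields)
qed

lemma J_skew: "i \<in> {1,2,3} ==> J i a \<bullet> b = - (a \<bullet> J i b)"
 using J_inner[of i a "J i b"] J_sq[of i b] by simp

text \<open>As \<open>J i\<close> is skew, the two halves of the wedge contribute equally and absorb
  the factor 1/2. Linearised moment maps thereby become conditions along
  \<open>J i a\<close>.\<close>

lemma contract_wedge:
 assumes i: "i \<in> {1,2,3}"
 shows "contract J i (%v w. (a \<bullet> v) *\<^sub>R Z w - (a \<bullet> w) *\<^sub>R Z v) = (\<Sum>c\<in>Basis. (J i a \<bullet> c) *\<^sub>R (Z c :: 'b::real_vector))"
proof -
 let ?S = "\<Sum>c\<in>Basis. (J i a \<bullet> c) *\<^sub>R Z c"
 have e: "(\<Sum>b\<in>Basis. (a \<bullet> b) * (b \<bullet> w)) = a \<bullet> w" for w :: 'q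
  using euclidean_inner[of a w] by (simp add: inner_commute)
 have "(\<Sum>b\<in>Basis. \<Sum>c\<in>Basis. (J i b \<bullet> c) *\<^sub>R ((a \<bullet> b) *\<^sub>R Z c)) = (\<Sum>c\<in>Basis. (\<Sum>b\<in>Basis. (a \<bullet> b) * (b \<bullet> - J i c)) *\<^sub>R Z c)"
  unfolding scaleR_sum_left by (subst sum.swap) (simp add: J_skew[OF i] mult.commute)
 also have "... = ?S" unfolding e by (simp add: J_skew[OF i])
 finally have 1: "(\<Sum>b\<in>Basis. \<Sum>c\<in>Basis. (J i b \<bullet> c) *\<^sub>R ((a \<bullet> b) *\<^sub>R Z c)) = ?S" .
 have "(\<Sum>b\<in>Basis. \<Sum>c\<in>Basis. (J i b \<bullet> c) *\<^sub>R ((a \<bullet> c) *\<^sub>R Z b)) = (\<Sum>b\<in>Basis. (\<Sum>c\<in>Basis. (a \<bullet> c) * (c \<bullet> J i b)) *\<^sub>R Z b)"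
  unfolding scaleR_sum_left by (simp add: inner_commute mult.commute)
 also have "... = - ?S" unfolding e by (simp add: J_skew[OF i] sum_negf)
 finally have 2: "(\<Sum>b\<in>Basis. \<Sum>c\<in>Basis. (J i b \<bullet> c) *\<^sub>R ((a \<bullet> c) *\<^sub>R Z b)) = - ?S" .
 show ?thesis
  unfolding contract_def kaehler_form_def scaleR_diff_right sum_subtractf 1 2 by (simp flip: scaleR_2)
qed

text \<open>Clear for characters, since the group maps nonzero frequencies to nonzero ones; uniform
  approximation by trigonometric polynomials does the rest.\<close>

lemma avg_e:
 assumes f: "tcont (f :: 'q => complex)" shows "tcont (%th. f (e h th))" "avg (%th. f (e h th)) = avg f"
proof -
 have te: "tcont (%th. f (e h th))" if "tcont f" for f :: "'q => complex"
 proof (rule tcontI)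
  show "f (e h (th + c)) = f (e h th)" if "c \<in> periods" for th c
   by (simp add: blinfun.add_right tcontD(1)[OF \<open>tcont f\<close> e_periods[OF that]])
  show "continuous_on UNIV (%th. f (e h th))"
   by (rule continuous_on_compose2[OF tcontD(2)[OF that, of UNIV] blinfun.continuous_on[OF continuous_on_const continuous_on_id]]) simp
 qed
 thus "tcont (%th. f (e h th))" using f .
 have tr: "avg (%th. f (e h th)) = avg f" if "trig f" for f
  using that
 proof (induction rule: trig.induct)
  case (trig_cis l c)
  have "l \<bullet> e h th = e (invg h) l \<bullet> th" for th using inner_e[of h th l] by (simp add: inner_commute)
  hence "avg (%th. cis (l \<bullet> e h th)) = avg (%th. cis (e (invg h) l \<bullet> th))" by simp
  also have "... = (if l = 0 then 1 else 0)"
   using avg_cis[OF e_mem[OF trig_cis], of "invg h"] by (metis norm_e norm_eq_zero)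
  also have "... = avg (%th. cis (l \<bullet> th))" by (simp add: avg_cis[OF trig_cis])
  finally show ?case by (simp only: avg_mult te[OF tcont_cis[OF trig_cis]] tcont_cis[OF trig_cis])
 next
  case (trig_add f g)
  thus ?case by (simp add: avg_add te trig_tcont)
 qed
 let ?f = "%n. conv (ker n) f"
 have t: "trig (?f n)" for n by (rule trig_conv[OF rtrig_ker f])
 have u: "uniform_limit UNIV ?f f sequentially" by (rule conv_ker_uniform_limit[OF f])
 have "(%n. avg (%th. ?f n (e h th))) \<longlonglongrightarrow> avg (%th. f (e h th))"
 proof (rule avg_uniform_limit)
  show "uniform_limit UNIV (%n th. ?f n (e h th)) (%th. f (e h th)) sequentially"
   using uniform_limit_compose'[OF u, of "e h" UNIV] by simp
 qed (intro always_eventually allI te trig_tcont[OF t] f)+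
 moreover have "(%n. avg (?f n)) \<longlonglongrightarrow> avg f"
  by (rule avg_uniform_limit[OF u]) (intro always_eventually allI trig_tcont[OF t] f)+
 ultimately show "avg (%th. f (e h th)) = avg f" by (simp add: tr t LIMSEQ_unique)
qed

text \<open>The covariant derivative at the model solution: infinitesimal gauge transformations act
  by it.\<close>

definition cov :: "'q => 'q => ('q => complex^'g^'g) => 'q => complex^'g^'g" where
 "cov x v xi th = dir_deriv v xi th + commutator (sig x th v) (xi th)"

lemma linear_cov: "mtrig xi ==> linear (%v. cov x v xi th)"
proof -
 assume xi: "mtrig xi"
 note l = has_derivative_linear[OF mtrig_has_derivative(1)[OF xi]]
 show ?thesis
  by (rule linearI)
   (simp_all add: cov_def linear_add[OF l] linear_scale[OF l] blinfun.add_right blinfun.scaleR_right commutator_simps algebra_simps)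
qed

lemma orbit_tangent_mtrig:
 assumes "mtrig xi" "\<And>th. adj (xi th) = - xi th" "\<And>h th. xi (e h th) = L h ** xi th ** adj (L h)"
 shows "(%th. Blinfun (%v. cov x v xi th)) \<in> orbit_tangent La e s (sig x)"
 unfolding orbit_tangent_def cov_def
proof (rule CollectI, rule exI[of _ xi], intro conjI)
 show "\<forall>h k. sobolev La (s + 1) (%th. xi th $ h $ k)" using msob_mtrig[OF assms(1)] unfolding msob_def .
 show "equivariant_End e xi"
  unfolding equivariant_End_def ball_simps left_mult_e Ad_def matrix_inv_unitary[OF unitary_L] using assms(3) by blast
 show "\<forall>th. adj (xi th) = - xi th" using assms(2) by blast
qed (rule refl)

text \<open>Equivariance of the model lets the group act on a variation and on its covariant
  derivative in the same way, which prepares averaging over the group.\<close>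

lemma cov_translate:
 assumes xi: "mtrig xi"
 shows "mtrig (%th. L m ** xi (e (invg m) th) ** adj (L m))"
  "cov x v (%th. L m ** xi (e (invg m) th) ** adj (L m)) th = L m ** cov x (e (invg m) v) xi (e (invg m) th) ** adj (L m)"
proof -
 have "mtrig (%th. xi (e (invg m) th))"
  unfolding mtrig_def
 proof (intro allI)
  fix a b
  have l: "linear (blinfun_apply (e (invg m)))" by (rule bounded_linear.linear[OF blinfun.bounded_linear_right])
  have "adjoint (blinfun_apply (e (invg m))) = blinfun_apply (e m)"
   by (rule adjoint_unique) (metis inner_e inner_commute)
  hence "adjoint (blinfun_apply (e (invg m))) l \<in> La" if "l \<in> La" for l using e_mem[OF that] by simp
  from trig_linear[OF l this, of "%th. xi th $ a $ b"] show "trig (%th. xi (e (invg m) th) $ a $ b)"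
   using xi by (simp add: mtrig_def)
 qed
 thus "mtrig (%th. L m ** xi (e (invg m) th) ** adj (L m))" by (intro mtrig_mult mtrig_const)
 have "((%th. L m ** xi (e (invg m) th) ** adj (L m)) has_derivative
   (%v. L m ** dir_deriv (e (invg m) v) xi (e (invg m) th) ** adj (L m))) (at th)"
  by (rule bounded_linear.has_derivative[OF mm.bounded_linear_left], rule bounded_linear.has_derivative[OF mm.bounded_linear_right],
    rule has_derivative_compose[OF bounded_linear_imp_has_derivative[OF blinfun.bounded_linear_right] mtrig_has_derivative(1)[OF xi]])
 moreover have "commutator (sig x th v) (L m ** M ** adj (L m)) = L m ** commutator (sig x (e (invg m) th) (e (invg m) v)) M ** adj (L m)" for M
 proof -
  have "sig x th v = L m ** sig x (e (invg m) th) (e (invg m) v) ** adj (L m)"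
   using sig_equivariant[of x] unfolding equivariant_iff by (metis e_invg')
  thus ?thesis
   by (simp add: commutator_def mm.diff_left mm.diff_right matrix_mul_assoc unitary_cancel[OF unitary_L])
 qed
 ultimately show "cov x v (%th. L m ** xi (e (invg m) th) ** adj (L m)) th = L m ** cov x (e (invg m) v) xi (e (invg m) th) ** adj (L m)"
  by (simp add: cov_def dir_deriv_eq mm.add_left mm.add_right)
qed

lemma tcont_cov: "mtrig xi ==> tcont (cov x v xi)"
 unfolding cov_def
 by (intro tcont_add mtrig_tcont[OF mtrig_dir_deriv] tcont_commutator[OF _ mtrig_tcont])
  (simp_all add: sig_apply tcont_const)

definition orb :: "('q => complex^'g^'g) => 'g => 'q => complex^'g^'g" where
 "orb xi m th = L m ** xi (e (invg m) th) ** adj (L m)"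

text \<open>Orthogonality to the equivariant variations implies orthogonality to all of them, by averaging over the
 group.\<close>

lemma horizontal_cov:
 assumes Y: "Y \<in> horizontal J La e s (sig x)" and xi: "mtrig xi" "\<And>th. adj (xi th) = - xi th"
 shows "Re (avg (%th. \<Sum>b\<in>Basis. trace (Y th b ** cov x b xi th))) = 0"
proof -
 have Yf: "Y \<in> fields La e s" and Yo: "\<And>Z. Z \<in> orbit_tangent La e s (sig x) ==> field_metric La Y Z = 0"
  using Y by (auto simp: horizontal_def)
 have tY: "tcont (%th. Y th v)" for v using Yf msob_tcont by (auto simp: fields_iff)
 note o = cov_translate[OF xi(1), folded orb_def]
 \<comment> \<open>The sum over the group, left unnormalised, is an equivariant variation, to which
   horizontality applies.\<close>
 define \<Xi> where "\<Xi> th = (\<Sum>m\<in>UNIV. orb xi m th)" for th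
 have ms: "mtrig \<Xi>" using o(1) by (auto simp: \<Xi>_def mtrig_def orb_def intro!: trig_sum)
 have c\<Xi>: "cov x v \<Xi> th = (\<Sum>m\<in>UNIV. cov x v (orb xi m) th)" for v th
 proof -
  have "(\<Xi> has_derivative (%v. \<Sum>m\<in>UNIV. dir_deriv v (orb xi m) th)) (at th)"
   unfolding \<Xi>_def[abs_def] by (intro has_derivative_sum mtrig_has_derivative) (use o(1) in \<open>simp add: orb_def[abs_def]\<close>)
  thus ?thesis unfolding cov_def by (simp add: dir_deriv_eq sum.distrib \<Xi>_def cm.sum_right)
 qed
 have sk: "adj (\<Xi> th) = - \<Xi> th" for th
  by (simp add: \<Xi>_def orb_def adj_sum adj_mult xi(2) mm.minus_left mm.minus_right matrix_mul_assoc sum_negf)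
 have eq: "\<Xi> (e h th) = L h ** \<Xi> th ** adj (L h)" for h th
 proof -
  have b: "bij (mul h)" by (rule bijI'[of "mul h"]) (metis assoc group_left_neutral left_inverse right_inverse)+
  have "L h ** \<Xi> th ** adj (L h) = (\<Sum>m\<in>UNIV. orb xi (mul h m) (e h th))"
   unfolding \<Xi>_def mm.sum_right mm.sum_left
  proof (rule sum.cong[OF refl])
   fix m
   have "e (invg (mul h m)) (e h th) = e (invg m) th" by (simp add: inverse_distrib_swap e_mul e_invg)
   thus "L h ** orb xi m th ** adj (L h) = orb xi (mul h m) (e h th)"
    by (simp add: orb_def adj_mult matrix_mul_assoc flip: L_mult)
  qed
  also have "... = \<Xi> (e h th)" unfolding \<Xi>_def by (rule sum.reindex_bij_betw[OF b])
  finally show ?thesis by simp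
 qed
 define f where "f th = (\<Sum>b\<in>Basis. trace (Y th b ** cov x b xi th))" for th
 have tf: "tcont f" unfolding f_def
  by (intro tcont_sum tcont_trace tcont_matrix_mult tY tcont_cov xi)
 \<comment> \<open>Traces are invariant under conjugation and the sum over directions under
   rotation, so a translated variation gives the same integrand at a moved point.\<close>
 have fm: "(\<Sum>b\<in>Basis. trace (Y th b ** cov x b (orb xi m) th)) = f (e (invg m) th)" for m th
 proof -
  let ?T = "%v. e (invg m) v" and ?th = "e (invg m) th"
  have "trace (Y th b ** cov x b (orb xi m) th) = trace (Y ?th (?T b) ** cov x (?T b) xi ?th)" for b
  proof -
   have "Y th b = L m ** Y ?th (?T b) ** adj (L m)"
    using Yf unfolding fields_iff equivariant_iff by (metis e_invg')
   hence "Y th b ** cov x b (orb xi m) th = L m ** (Y ?th (?T b) ** cov x (?T b) xi ?th ** adj (L m))"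
    using o(2)[of x b m th] by (simp add: orb_def[abs_def] matrix_mul_assoc unitary_cancel[OF unitary_L])
   thus ?thesis
    using trace_mult_commute[of "L m"] by (simp add: unitary_cancel[OF unitary_L] flip: matrix_mul_assoc) (simp add: unitaryD[OF unitary_L])
  qed
  hence "(\<Sum>b\<in>Basis. trace (Y th b ** cov x b (orb xi m) th)) = (\<Sum>b\<in>Basis. trace (Y ?th (?T b) ** cov x (?T b) xi ?th))" by simp
  also have "... = f ?th"
   unfolding f_def
  proof (rule sum_orthonormal_change[of "%v w. trace (Y ?th v ** cov x w xi ?th)" ?T "%v. e m v"])
   show "linear (%w. trace (Y ?th v ** cov x w xi ?th))" for v
    using linear_compose[OF linear_cov[OF xi(1)] bounded_linear.linear[OF bounded_linear_compose[OF bounded_linear_trace mm.bounded_linear_right]]]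
    by (simp add: o_def)
   show "linear (%v. trace (Y ?th v ** cov x w xi ?th))" for w
    by (intro bounded_linear.linear bounded_linear_compose[OF bounded_linear_trace] bounded_linear_compose[OF mm.bounded_linear_left] blinfun.bounded_linear_right)
  qed (simp_all add: e_inner inner_e[of m] inner_commute[of "e (invg m) _"], metis inner_e inner_commute)
  finally show ?thesis .
 qed
 have "0 = avg (%th. Re (\<Sum>b\<in>Basis. trace (Y th b ** cov x b \<Xi> th)))"
  using Yo[OF orbit_tangent_mtrig[OF ms sk eq, of x]] torus_vol_pos
  by (simp add: field_metric_def torus_integral_eq[OF discrete_subgroup_axioms] bounded_linear_Blinfun_apply linear_cov[OF ms] flip: linear_conv_bounded_linear)
 also have "(\<Sum>b\<in>Basis. trace (Y th b ** cov x b \<Xi> th)) = (\<Sum>m\<in>UNIV. f (e (invg m) th))" for th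
  unfolding c\<Xi> fm[symmetric] mm.sum_right trace_sum by (rule sum.swap)
 hence "avg (%th. Re (\<Sum>b\<in>Basis. trace (Y th b ** cov x b \<Xi> th))) = avg (%th. Re (\<Sum>m\<in>UNIV. f (e (invg m) th)))"
  by (simp only:)
 also have "... = Re (avg (%th. \<Sum>m\<in>UNIV. f (e (invg m) th)))"
  by (intro avg_bounded_linear bounded_linear_Re tcont_sum avg_e(1) tf)
 also have "... = real CARD('g) * Re (avg f)" by (simp add: avg_sum avg_e tf)
 finally show ?thesis by (simp add: f_def[abs_def])
qed

end

lemma trace_uminus: "trace (- M) = - trace (M :: complex^'n::finite^'n)"
 by (simp add: trace_def sum_negf)

context gauge_setting begin

text \<open>The variation has one matrix entry and one frequency, made skew-Hermitian; the factors 1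
  and \<open>\<i>\<close> give the two real equations. The outcome is the Coulomb condition at a
  single frequency.\<close>

lemma horizontal_coulomb:
 fixes h k :: 'g
 assumes Y: "Y \<in> horizontal J La e s (sig x)" and l: "l \<in> La"
 defines "p \<equiv> l + e h x - e k x"
 shows "(\<Sum>b\<in>Basis. of_real (p \<bullet> b) * fc (%th. Y th b $ h $ k) l) = 0"
proof -
 let ?S = "\<Sum>b\<in>Basis. of_real (p \<bullet> b) * fc (%th. Y th b $ h $ k) l"
 have Yf: "Y \<in> fields La e s" using Y by (simp add: horizontal_def)
 have tY: "tcont (%th. Y th v $ a $ b)" for v a b
  using Yf msob_tcont[of s "%th. Y th v"] by (simp add: fields_iff tcont_entries)
 have *: "Re (- \<i> * z * ?S) = 0" for z
 proof -
  define N where "N th = (\<chi> a b. if a = k \<and> b = h then z * cis ((- l) \<bullet> th) else 0)" for th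
  have Ne: "(%th. N th $ a $ b) = (if a = k \<and> b = h then (%th. z * cis ((- l) \<bullet> th)) else (%_. 0))" for a b
   by (auto simp: N_def)
  have mN: "mtrig N"
   unfolding mtrig_def Ne using trig_cis[OF uminus_mem[OF l], of z] trig_const by simp
  have mA: "mtrig (%th. adj (N th))" using mN by (auto simp: mtrig_def intro: trig_cnj)
  \<comment> \<open>On this mode the covariant derivative is multiplication by the gap
    \<open>p\<close>, up to the factor \<open>- \<i>\<close>.\<close>
  have covN: "cov x v N th = mat (- \<i> * of_real (p \<bullet> v)) ** N th" for v th
  proof -
   have "dir_deriv v N th $ a $ b = (if a = k \<and> b = h then \<i> * of_real ((- l) \<bullet> v) * (z * cis ((- l) \<bullet> th)) else 0)" for a b
    unfolding mtrig_has_derivative(2)[OF mN] Ne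
    by (simp add: trig_dir_deriv_cis dir_deriv_eq[OF has_derivative_const] del: inner_minus_left)
   thus ?thesis
    unfolding vec_eq_iff mat_mult_entry cov_def sig_apply
    by (auto simp: commutator_diag_nth N_def p_def inner_diff_left inner_add_left algebra_simps)
  qed
  have covA: "cov x v (%th. adj (N th)) th = adj (cov x v N th)" for v th
  proof -
   have "dir_deriv v (%th. adj (N th)) th = adj (dir_deriv v N th)"
    by (rule dir_deriv_eq[OF bounded_linear.has_derivative[OF bounded_linear_adj mtrig_has_derivative(1)[OF mN]]])
   moreover have "adj (sig x th v) = - sig x th v" using sig_fields[of x] by (simp add: fields_iff)
   hence "adj (commutator (sig x th v) (N th)) = commutator (sig x th v) (adj (N th))"
    by (simp add: commutator_def adj_diff adj_mult mm.minus_left mm.minus_right)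
   ultimately show ?thesis by (simp add: cov_def adj_add)
  qed
  let ?xi = "%th. N th - adj (N th)"
  have mxi: "mtrig ?xi" by (rule mtrig_diff[OF mN mA])
  have "dir_deriv v ?xi th = dir_deriv v N th - dir_deriv v (%th. adj (N th)) th" for v th
   by (rule dir_deriv_eq[OF has_derivative_diff[OF mtrig_has_derivative(1)[OF mN] mtrig_has_derivative(1)[OF mA]]])
  hence covxi: "cov x v ?xi th = cov x v N th - adj (cov x v N th)" for v th
   unfolding covA[symmetric] by (simp add: cov_def cm.diff_right)
  have tr: "Re (trace (Y th b ** cov x b ?xi th)) = 2 * Re (- \<i> * z * of_real (p \<bullet> b) * (Y th b $ h $ k * cis (- (l \<bullet> th))))" for th b
  proof -
   let ?M = "cov x b N th"
   have "Y th b ** adj ?M = - adj (?M ** Y th b)"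
    using Yf by (simp add: adj_mult fields_iff mm.minus_left)
   hence "trace (Y th b ** adj ?M) = - cnj (trace (Y th b ** ?M))"
    using trace_mult_commute[of "Y th b" ?M] by (simp add: trace_uminus trace_adj)
   hence "Re (trace (Y th b ** cov x b ?xi th)) = 2 * Re (trace (Y th b ** ?M))"
    by (simp add: covxi mm.diff_right trace_sub)
   also have "trace (Y th b ** ?M) = - \<i> * of_real (p \<bullet> b) * trace (Y th b ** N th)"
    unfolding covN trace_mult_commute[of "Y th b"] by (simp add: trace_mat_mult flip: matrix_mul_assoc)
   also have "trace (Y th b ** N th) = Y th b $ h $ k * (z * cis ((- l) \<bullet> th))"
   proof -
    have "(Y th b ** N th) $ a $ a = (if a = h then Y th b $ h $ k * (z * cis ((- l) \<bullet> th)) else 0)" for a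
     by (simp add: matrix_mult_nth N_def if_distrib cong: if_cong)
    thus ?thesis by (simp add: trace_def)
   qed
   finally show ?thesis by (simp add: algebra_simps)
  qed
  have tE: "tcont (%th. Y th b $ h $ k * cis (- (l \<bullet> th)))" for b by (intro tcont_mult tY tcont_cis_minus l)
  have tT: "tcont (%th. \<Sum>b\<in>Basis. trace (Y th b ** cov x b ?xi th))"
   using tY by (intro tcont_sum tcont_trace tcont_matrix_mult tcont_cov[OF mxi]) (simp add: tcont_entries)
  have "0 = avg (%th. Re (\<Sum>b\<in>Basis. trace (Y th b ** cov x b ?xi th)))"
   using horizontal_cov[OF Y mxi] avg_bounded_linear[OF bounded_linear_Re tT] by (simp add: adj_diff)
  also have "... = avg (%th. 2 *\<^sub>R Re (\<Sum>b\<in>Basis. - \<i> * z * of_real (p \<bullet> b) * (Y th b $ h $ k * cis (- (l \<bullet> th)))))"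
   by (simp only: Re_sum tr) (simp add: sum_distrib_left)
  also have "... = 2 *\<^sub>R Re (avg (%th. \<Sum>b\<in>Basis. - \<i> * z * of_real (p \<bullet> b) * (Y th b $ h $ k * cis (- (l \<bullet> th)))))"
   using avg_bounded_linear[OF bounded_linear_compose[OF bounded_linear_scaleR_right bounded_linear_Re]
     tcont_sum[of Basis "%b th. - \<i> * z * of_real (p \<bullet> b) * (Y th b $ h $ k * cis (- (l \<bullet> th)))"], of 2]
    tcont_mult[OF tcont_const tE] by blast
  also have "avg (%th. \<Sum>b\<in>Basis. - \<i> * z * of_real (p \<bullet> b) * (Y th b $ h $ k * cis (- (l \<bullet> th)))) = - \<i> * z * ?S"
   unfolding avg_sum[OF tcont_mult[OF tcont_const tE]] avg_mult[OF tE] fourier_eq[symmetric]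
   by (simp add: sum_distrib_left mult_ac)
  finally show ?thesis unfolding real_scaleR_def by linarith
 qed
 have a: "Re (- \<i> * 1 * w) = Im w" "Re (- \<i> * \<i> * w) = Re w" for w by simp_all
 show ?thesis
  by (rule complex_eqI) (use *[of 1] *[of \<i>] in \<open>simp_all only: a zero_complex.sel\<close>)
qed

text \<open>The hypothesis on the derivative of \<open>ps\<close> fits the cosine and the sine of
  \<open>l \<bullet> th\<close>, which differentiate into each other: test functions are real, so a
  complex character has to be reached in two halves.\<close>

lemma moment_map_lin_entry:
 fixes h k :: 'g and Y :: "('q, 'g) field" and x :: 'q
 assumes Y: "\<And>v. tcont (%th. Y th v)" and ps: "rtrig ps" and i: "i \<in> {1,2,3}"
  and d: "\<And>v th. dir_deriv v ps th = - (l \<bullet> v) * ps' th" and ps': "tcont ps'"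
 defines "q \<equiv> e h x - e k x"
 shows "moment_map_lin J La i (sig x) Y ps $ h $ k = torus_vol La *\<^sub>R
  ((\<Sum>c\<in>Basis. (J i l \<bullet> c) *\<^sub>R avg (%th. ps' th *\<^sub>R Y th c $ h $ k)) +
   \<i> * (\<Sum>c\<in>Basis. (J i q \<bullet> c) *\<^sub>R avg (%th. ps th *\<^sub>R Y th c $ h $ k)))"
proof -
 let ?y = "%v th. Y th v $ h $ k"
 have ty: "tcont (?y v)" for v using Y[of v] by (simp add: tcont_entries)
 have tps: "tcont ps" by (rule tcont_trig_real[OF ps])
 define F where "F v w th = - dir_deriv v ps th *\<^sub>R Y th w + dir_deriv w ps th *\<^sub>R Y th v +
  ps th *\<^sub>R (commutator (sig x th v) (Y th w) + commutator (Y th v) (sig x th w))" for v w th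
 have tF: "tcont (F v w)" for v w
  unfolding F_def sig_apply
  by (intro tcont_add tcont_scaleR tcont_uminus tcont_commutator Y tps tcont_const
    tcont_trig_real[OF rtrig_dir_deriv[OF ps]])
 have Fe: "F v w th $ h $ k = ((l \<bullet> v) *\<^sub>R (ps' th *\<^sub>R ?y w th) - (l \<bullet> w) *\<^sub>R (ps' th *\<^sub>R ?y v th)) +
   \<i> * ((q \<bullet> v) *\<^sub>R (ps th *\<^sub>R ?y w th) - (q \<bullet> w) *\<^sub>R (ps th *\<^sub>R ?y v th))" for v w th
  unfolding F_def d sig_apply commutator_swap[of "Y th v"]
  by (simp add: commutator_diag_nth q_def scaleR_conv_of_real[where 'a = complex] inner_diff_left algebra_simps)
 have avgF: "avg (F v w) $ h $ k = ((l \<bullet> v) *\<^sub>R avg (%th. ps' th *\<^sub>R ?y w th) - (l \<bullet> w) *\<^sub>R avg (%th. ps' th *\<^sub>R ?y v th)) +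
   \<i> * ((q \<bullet> v) *\<^sub>R avg (%th. ps th *\<^sub>R ?y w th) - (q \<bullet> w) *\<^sub>R avg (%th. ps th *\<^sub>R ?y v th))" for v w
 proof -
  note t = tcont_scaleR[OF ps' ty] tcont_scaleR[OF tps ty]
  have "avg (F v w) $ h $ k = avg (%th. F v w th $ h $ k)" by (rule avg_bounded_linear[OF bounded_linear_entry tF, symmetric])
  thus ?thesis
   unfolding Fe by (simp only: avg_add avg_diff avg_scaleR avg_mult t tcont_add tcont_diff tcont_mult tcont_const
    tcont_scaleR[OF tcont_const])
 qed
 have "curvature_lin La (sig x) Y v w ps = torus_vol La *\<^sub>R avg (F v w)" for v w
  unfolding curvature_lin_def torus_integral_eq[OF discrete_subgroup_axioms] F_def ..
 hence "moment_map_lin J La i (sig x) Y ps $ h $ k = torus_vol La *\<^sub>R contract J i (%v w. avg (F v w) $ h $ k)"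
  by (simp add: moment_map_lin_def contract_scaleR) (simp add: contract_def)
 also have "contract J i (%v w. avg (F v w) $ h $ k) = contract J i (%v w. (l \<bullet> v) *\<^sub>R avg (%th. ps' th *\<^sub>R ?y w th) - (l \<bullet> w) *\<^sub>R avg (%th. ps' th *\<^sub>R ?y v th)) +
   \<i> * contract J i (%v w. (q \<bullet> v) *\<^sub>R avg (%th. ps th *\<^sub>R ?y w th) - (q \<bullet> w) *\<^sub>R avg (%th. ps th *\<^sub>R ?y v th))"
  unfolding avgF contract_def by (simp add: scaleR_add_right sum.distrib sum_distrib_left del: scaleR_conv_of_real)
 finally show ?thesis unfolding contract_wedge[OF i] .
qed

text \<open>The Coulomb condition and the three linearised moment maps say that a Fourier
  coefficient, viewed as a vector, is orthogonal to the quaternionic frame of \<open>p\<close>. This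
  is invertibility of the symbol of a Dirac operator wherever \<open>p \<noteq> 0\<close>.\<close>

lemma horizontal_coefficients:
 assumes Y: "Y \<in> horizontal J La e s (sig x)" and l: "l \<in> La" and p: "l + e h x - e k x \<noteq> 0" and b: "b \<in> Basis"
 shows "fc (%th. Y th b $ h $ k) l = 0"
proof -
 let ?p = "l + e h x - e k x" and ?q = "e h x - e k x" and ?y = "%b. fc (%th. Y th b $ h $ k) l"
 have tY: "tcont (%th. Y th v)" for v
  using Y msob_tcont by (auto simp: horizontal_def fields_iff)
 hence ty: "tcont (%th. Y th v $ h $ k)" for v by (simp add: tcont_entries)
 have tc: "rtrig (%th. cos (l \<bullet> th))" and ts: "rtrig (%th. sin (l \<bullet> th))" using trig_cos[OF l] trig_sin[OF l] by simp_all
 note tt = tcont_trig_real[OF tc] tcont_trig_real[OF ts]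
 define M where "M i a Z = (\<Sum>c\<in>Basis. (J i a \<bullet> c) *\<^sub>R (Z c :: complex))" for i a and Z :: "'q => complex"
 define C where "C c = avg (%th. cos (l \<bullet> th) *\<^sub>R Y th c $ h $ k)" for c
 define S where "S c = avg (%th. sin (l \<bullet> th) *\<^sub>R Y th c $ h $ k)" for c
 have y: "?y c = C c - \<i> * S c" for c
 proof -
  have "Y th c $ h $ k * cis (- (l \<bullet> th)) = cos (l \<bullet> th) *\<^sub>R Y th c $ h $ k - \<i> * (sin (l \<bullet> th) *\<^sub>R Y th c $ h $ k)" for th
   by (simp add: complex_eq_iff cis.code)
  thus ?thesis
   unfolding fourier_eq C_def S_def
   by (simp only: avg_diff avg_mult tcont_scaleR[OF tt(1) ty] tcont_scaleR[OF tt(2) ty] tcont_mult tcont_const)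
 qed
 have mom: "moment_map_lin J La i (sig x) Y ps = 0" if "i \<in> {1,2,3}" "rtrig ps" for i ps
  using Y that test_fun_trig by (auto simp: horizontal_def)
 have Jp: "M i ?p ?y = 0" if i: "i \<in> {1,2,3}" for i
 proof -
  have dc: "dir_deriv v (%th. cos (l \<bullet> th)) th = - (l \<bullet> v) * sin (l \<bullet> th)" for v th
   by (rule dir_deriv_eq) (auto intro!: derivative_eq_intros)
  have ds: "dir_deriv v (%th. sin (l \<bullet> th)) th = - (l \<bullet> v) * (- cos (l \<bullet> th))" for v th
   by (subst dir_deriv_eq[where f' = "%v. cos (l \<bullet> th) * (l \<bullet> v)"]) (auto intro!: derivative_eq_intros)
  have "M i l S + \<i> * M i ?q C = 0"
   using moment_map_lin_entry[OF tY tc i dc tt(2), where h = h and k = k and x = x] mom[OF i tc] torus_vol_pos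
   by (simp add: M_def C_def S_def)
  moreover have "- M i l C + \<i> * M i ?q S = 0"
   using moment_map_lin_entry[OF tY ts i ds tcont_uminus[OF tt(1)], where h = h and k = k and x = x] mom[OF i ts] torus_vol_pos
    avg_uminus[OF tcont_scaleR[OF tt(1) ty]]
   by (simp add: M_def C_def S_def sum_negf)
  \<comment> \<open>As the coefficient is \<open>C c - \<i> * S c\<close>, the cosine and sine
    equations recombine into one for \<open>p\<close>, the sum of \<open>l\<close> and
    \<open>?q\<close>.\<close>
  moreover have "M i ?p ?y = M i l C - \<i> * M i l S + (M i ?q C - \<i> * M i ?q S)"
   unfolding y M_def
   by (simp add: add_diff_eq[symmetric] blinfun.add_right inner_add_left scaleR_add_left scaleR_diff_right sum.distrib sum_subtractf sum_distrib_left del: add_diff_eq)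
  ultimately show ?thesis by (simp add: complex_eq_iff)
 qed
 have frame0: "(\<Sum>c\<in>Basis. (frame ?p a \<bullet> c) *\<^sub>R ?y c) = 0" if "a < 4" for a
 proof (cases "a = 0")
  case True
  thus ?thesis using horizontal_coulomb[OF Y l, of h k] by (simp add: frame_def scaleR_conv_of_real)
 next
  case False
  hence "a \<in> {1,2,3}" using that by auto
  thus ?thesis using Jp[of a] False by (simp add: frame_def M_def)
 qed
 \<comment> \<open>Real-linear functionals separate real and imaginary parts, since the frame
   argument is about real vectors.\<close>
 have z: "(\<Sum>c\<in>Basis. f (?y c) *\<^sub>R c) = 0" if f: "bounded_linear f" for f :: "complex => real"
 proof (rule frame_orthogonal_eq_0[OF p])
  fix a :: nat assume "a < 4"
  from arg_cong[OF frame0[OF this], of f]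
  show "(\<Sum>c\<in>Basis. f (?y c) *\<^sub>R c) \<bullet> frame ?p a = 0"
   by (simp add: linear_sum[OF bounded_linear.linear[OF f]] linear_scale[OF bounded_linear.linear[OF f]]
     linear_0[OF bounded_linear.linear[OF f]] inner_sum_left inner_commute[of "frame ?p a"] mult.commute)
 qed
 have "f (?y b) = 0" if "bounded_linear f" for f :: "complex => real"
  using arg_cong[OF z[OF that], of "%v. v \<bullet> b"] b by (simp add: inner_sum_left inner_Basis if_distrib cong: if_cong)
 from this[OF bounded_linear_Re] this[OF bounded_linear_Im] show ?thesis by (simp add: complex_eq_iff)
qed

end

context gauge_setting begin

lemma field_metric_eq: "field_metric La Y Z = - (1 / real CARD('g)) * avg (%th. Re (\<Sum>b\<in>Basis. trace (Y th b ** Z th b)))"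
 for Y Z :: "('q, 'g) field"
 using torus_vol_pos by (simp add: field_metric_def torus_integral_eq[OF discrete_subgroup_axioms])

lemma trace_diag: "trace (diag f) = (\<Sum>h\<in>UNIV. f h)"
 by (simp add: trace_def)

lemma sig_add: "sig (x + y) th = sig x th + sig y th" and sig_scaleR: "sig (r *\<^sub>R x) th = r *\<^sub>R sig x th"
 and sig_diff: "sig (x - y) th = sig x th - sig y th"
 by (rule blinfun_eqI, simp add: sig_apply blinfun.add_left blinfun.add_right blinfun.scaleR_left blinfun.scaleR_right
   blinfun.diff_left blinfun.diff_right inner_add_left inner_diff_left vec_eq_iff algebra_simps scaleR_conv_of_real[where 'a = complex])+

text \<open>Against a gauge variation only the derivative part survives, because a commutator with a
  diagonal matrix has zero diagonal; and derivatives average to zero.\<close>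

lemma sig_horizontal: "sig v \<in> horizontal J La e s (sig x)"
proof -
 have "moment_map_lin J La i (sig x) (sig v) ps = 0" if "test_fun La ps" for i ps
  unfolding moment_map_lin_def curvature_lin_def torus_integral_eq[OF discrete_subgroup_axioms] sig_apply commutator_diag
  by (simp add: avg_test_deriv[OF that, simplified] contract_def)
 moreover have "field_metric La (sig v) Z = 0" if Z: "Z \<in> orbit_tangent La e s (sig x)" for Z
 proof -
  obtain xi where xi: "Z = (%th. Blinfun (%v. dir_deriv v xi th + commutator (sig x th v) (xi th)))" "msob (s + 1) xi"
   using Z by (auto simp: orbit_tangent_def msob_def)
  have "bounded_linear (%v. dir_deriv v xi th + commutator (sig x th v) (xi th))" for th
   by (intro bounded_linear_add has_derivative_bounded_linear[OF msob_deriv(1)[OF xi(2)]]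
     bounded_linear_compose[OF cm.bounded_linear_left] blinfun.bounded_linear_right)
  hence Zb: "Z th b = dir_deriv b xi th + commutator (sig x th b) (xi th)" for th b
   by (simp add: xi(1) bounded_linear_Blinfun_apply)
  have tr: "trace (sig v th b ** Z th b) = trace (sig v 0 b ** dir_deriv b xi th)" for th b
  proof -
   have "trace (diag f ** commutator (diag g) M) = 0" for f g and M :: "complex^'g^'g"
    by (simp add: trace_def commutator_diag_nth)
   thus ?thesis unfolding Zb sig_apply mm.add_right trace_add by simp
  qed
  have t: "tcont (dir_deriv b xi)" for b by (rule msob_deriv(2)[OF xi(2)])
  have bl: "bounded_linear (%M. Re (trace (sig v 0 b ** M)))" for b
   by (intro bounded_linear_compose[OF bounded_linear_Re] bounded_linear_compose[OF bounded_linear_trace] mm.bounded_linear_right)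
  have "avg (dir_deriv b xi) = 0" for b
   by (rule avg_deriv_eq_0[OF msob_tcont[OF xi(2)] t msob_deriv(1)[OF xi(2)] refl])
  hence "avg (%th. Re (trace (sig v 0 b ** dir_deriv b xi th))) = 0" for b
   using avg_bounded_linear[OF bl t[of b]] linear_0[OF bounded_linear.linear[OF bl]] by metis
  moreover have "avg (%th. \<Sum>b\<in>Basis. Re (trace (sig v 0 b ** dir_deriv b xi th))) =
    (\<Sum>b\<in>Basis. avg (%th. Re (trace (sig v 0 b ** dir_deriv b xi th))))"
   by (intro avg_sum tcont_bounded_linear[OF bl t])
  ultimately show ?thesis unfolding field_metric_eq Re_sum tr by simp
 qed
 ultimately show ?thesis by (simp add: horizontal_def sig_fields)
qed

text \<open>At a point with trivial stabilizer the gap vanishes only on constant diagonal modes.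
  Equivariance determines such a field by its entry at the unit, which is imaginary since the field
  is skew-Hermitian.\<close>

lemma horizontal_sig:
 assumes free: "\<And>m l. l \<in> La ==> e m x + l = x ==> m = unit \<and> l = 0"
  and Y: "Y \<in> horizontal J La e s (sig x)"
 shows "Y \<in> range sig"
proof -
 have Yf: "Y \<in> fields La e s" using Y by (simp add: horizontal_def)
 have tY: "tcont (%th. Y th v $ a $ b)" for v a b
  using Yf msob_tcont[of s "%th. Y th v"] by (simp add: fields_iff tcont_entries)
 have coef: "fc (%th. Y th b $ h $ k) l = 0" if l: "l \<in> La" "h \<noteq> k \<or> l \<noteq> 0" and b: "b \<in> Basis" for b h k l
 proof (rule horizontal_coefficients[OF Y l(1) _ b], rule notI)
  assume *: "l + e h x - e k x = 0"
  have "e (mul (invg k) h) x + e (invg k) l = e (invg k) (e h x + l)" by (simp add: e_mul blinfun.add_right)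
  also have "... = x" using * by (simp add: e_invg add.commute)
  finally have "mul (invg k) h = unit" "e (invg k) l = 0" using free e_mem[OF l(1)] by blast+
  hence "h = k" "l = 0"
   using e_invg'[of k l] by (metis assoc group_left_neutral right_inverse right_neutral, simp)
  with l(2) show False by simp
 qed
 have const: "Y th b $ h $ k = fc (%th. Y th b $ h $ k) 0" if b: "b \<in> Basis" for th b h k
 proof -
  let ?c = "fc (%th. Y th b $ h $ k) 0"
  have "Y th b $ h $ k - ?c = 0"
  proof (rule fourier_eq_0_imp[of "%th. Y th b $ h $ k - ?c"])
   show "tcont (%th. Y th b $ h $ k - ?c)" by (intro tcont_diff tY tcont_const)
   show "fc (%th. Y th b $ h $ k - ?c) l = 0" if l: "l \<in> La" for l
    using fourier_cis[OF l zero_mem, of ?c] coef[OF l _ b, of h k] by (auto simp: fourier_diff[OF tY tcont_const l])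
  qed
  thus ?thesis by simp
 qed
 have c: "Y th = Y 0" for th
  by (rule blinfun_euclidean_eqI) (use const in \<open>metis vec_eq_iff\<close>)
 have off: "Y 0 w $ h $ k = 0" if "h \<noteq> k" for w h k
 proof -
  have l: "linear (%w. Y 0 w $ h $ k)"
   by (intro bounded_linear.linear bounded_linear_compose[OF bounded_linear_entry] blinfun.bounded_linear_right)
  have "Y 0 w $ h $ k = (\<Sum>b\<in>Basis. (w \<bullet> b) *\<^sub>R Y 0 b $ h $ k)"
   using linear_sum[OF l, of "%b. (w \<bullet> b) *\<^sub>R b" Basis] by (simp add: euclidean_representation blinfun.scaleR_right)
  also have "... = 0" using const[of _ 0 h k] coef[OF zero_mem, of h k] that by (intro sum.neutral) simp
  finally show ?thesis .
 qed
 define \<mu> where "\<mu> w = Im (Y 0 w $ unit $ unit)" for w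
 define v where "v = (\<Sum>b\<in>Basis. \<mu> b *\<^sub>R b)"
 have \<mu>: "\<mu> w = v \<bullet> w" for w
 proof -
  have l: "linear \<mu>"
   unfolding \<mu>_def by (intro bounded_linear.linear bounded_linear_compose[OF bounded_linear_Im] bounded_linear_compose[OF bounded_linear_entry] blinfun.bounded_linear_right)
  have "\<mu> w = (\<Sum>b\<in>Basis. (w \<bullet> b) * \<mu> b)"
   using linear_sum[OF l, of "%b. (w \<bullet> b) *\<^sub>R b" Basis] by (simp add: euclidean_representation linear_scale[OF l])
  also have "... = v \<bullet> w" by (simp add: v_def inner_sum_left inner_commute[of w] mult.commute)
  finally show ?thesis .
 qed
 have unit: "Y 0 w $ unit $ unit = \<i> * of_real (v \<bullet> w)" for w
 proof -
  have "adj (Y 0 w) $ unit $ unit = (- Y 0 w) $ unit $ unit" using Yf by (simp add: fields_iff)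
  thus ?thesis unfolding \<mu>[symmetric] \<mu>_def by (simp add: complex_eq_iff)
 qed
 have "Y th w $ h $ h = \<i> * of_real (e h v \<bullet> w)" for th w h
 proof -
  have "Y (e h 0) (e h (e (invg h) w)) = L h ** Y 0 (e (invg h) w) ** adj (L h)"
   using Yf unfolding fields_iff equivariant_iff by blast
  hence "Y 0 w $ h $ h = Y 0 (e (invg h) w) $ unit $ unit"
   by (simp add: e_invg' c[of "e h 0"] adj_L mult_L_nth L_mult_nth left_inverse)
  thus ?thesis by (simp add: c[of th] unit inner_e)
 qed
 hence "Y th w $ h $ k = sig v th w $ h $ k" for th w h k
  using off[of h k w] by (cases "h = k") (simp_all add: sig_apply c[of th])
 hence "Y = sig v" by (intro ext blinfun_eqI) (simp add: vec_eq_iff)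
 thus ?thesis by blast
qed

lemma trace_sig: "trace (sig v th b ** sig w th c) = - of_real (\<Sum>h\<in>UNIV. (e h v \<bullet> b) * (e h w \<bullet> c))"
 by (simp add: sig_apply diag_mult trace_diag sum_negf algebra_simps)

lemma inj_sig: "inj sig"
proof (rule injI)
 fix v w assume eq: "sig v = sig w"
 have "v \<bullet> b = w \<bullet> b" for b
  using arg_cong[OF eq, of "%X. X 0 b $ unit $ unit"] by (simp add: sig_apply e_unit)
 thus "v = w" by (metis euclidean_eqI)
qed

text \<open>\<open>sig\<close> is linear and already horizontal, hence its own horizontal part. Each
  of the \<open>CARD('g)\<close> diagonal entries contributes \<open>v \<bullet> w\<close>, which
  the normalisation of the metric divides out.\<close>

lemma hk_isomorphism_sig:
 assumes free: "\<And>m l. l \<in> La ==> e m x + l = x ==> m = unit \<and> l = 0"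
 shows "hk_isomorphism J La e s (sig x) sig"
 unfolding hk_isomorphism_def
proof (intro exI[of _ sig] conjI allI ballI)
 show "linear (%v. sig v th)" for th by (rule linearI) (simp_all add: sig_add sig_scaleR)
 show "bij_betw sig UNIV (horizontal J La e s (sig x))"
  unfolding bij_betw_def using inj_sig sig_horizontal horizontal_sig[OF free] by blast
 show "(%th. sig v th - sig v th) \<in> orbit_tangent La e s (sig x)" for v
 proof -
  have m0: "mtrig (%_. 0)" by (rule mtrig_const)
  have "cov x v (%_. 0) th = 0" for v th by (simp add: cov_def dir_deriv_eq[OF has_derivative_const] commutator_simps)
  hence "(%th. Blinfun (%v. cov x v (%_. 0) th)) = (%th. sig v th - sig v th)"
   by (simp add: fun_eq_iff zero_blinfun_def)
  with orbit_tangent_mtrig[OF m0, of x] show ?thesis by simp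
 qed
 have e: "(\<Sum>b\<in>Basis. (a \<bullet> b) * (w \<bullet> b)) = a \<bullet> w" for a w :: 'q
  using euclidean_inner[of a w] by simp
 show "field_metric La (sig v) (sig w) = v \<bullet> w" for v w
 proof -
  have "(\<Sum>b\<in>Basis. trace (sig v th b ** sig w th b)) = - of_real (real CARD('g) * (v \<bullet> w))" for th
   unfolding trace_sig sum_negf of_real_sum[symmetric]
   by (subst sum.swap) (simp add: e e_inner)
  thus ?thesis by (simp add: field_metric_eq avg_const)
 qed
 fix i :: nat assume i: "i \<in> {1,2,3}"
 show "sig (J i v) = (%th. vec_act (J i) (sig v th))" for v
 proof (intro ext blinfun_eqI)
  fix th w
  have "adjoint (blinfun_apply (J i)) = blinfun_apply (- J i)"
   by (rule adjoint_unique) (simp add: J_skew[OF i] blinfun.minus_left)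
  hence "vec_act (J i) (sig v th) w = sig v th (- J i w)"
   by (simp add: vec_act_def blinfun_apply_inverse blinfun.minus_left)
  thus "sig (J i v) th w = vec_act (J i) (sig v th) w" by (simp add: sig_apply e_J[OF i] J_skew[OF i])
 qed
 show "field_kaehler_form J La i (sig v) (sig w) = kaehler_form J i v w" for v w
 proof -
  have "(\<Sum>b\<in>Basis. \<Sum>c\<in>Basis. kaehler_form J i b c * ((a \<bullet> b) * (a' \<bullet> c))) = J i a \<bullet> a'" for a a' :: 'q
  proof -
   have "(\<Sum>c\<in>Basis. kaehler_form J i b c * ((a \<bullet> b) * (a' \<bullet> c))) = (a \<bullet> b) * (- J i a' \<bullet> b)" for b
   proof -
    have "(\<Sum>c\<in>Basis. kaehler_form J i b c * ((a \<bullet> b) * (a' \<bullet> c))) = (a \<bullet> b) * (\<Sum>c\<in>Basis. (J i b \<bullet> c) * (a' \<bullet> c))"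
     by (simp add: kaehler_form_def sum_distrib_left mult.left_commute)
    thus ?thesis unfolding e using J_skew[OF i, of b a'] by (simp add: inner_commute)
   qed
   thus ?thesis using e[of a "- J i a'"] J_skew[OF i, of a a'] by simp
  qed
  hence s: "(\<Sum>b\<in>Basis. \<Sum>c\<in>Basis. kaehler_form J i b c * (\<Sum>h\<in>UNIV. (e h v \<bullet> b) * (e h w \<bullet> c))) = real CARD('g) * (J i v \<bullet> w)"
   by (simp add: sum_distrib_left sum.swap[of _ UNIV]) (simp add: e_J[OF i, symmetric] e_inner flip: sum_distrib_left)
  have "Re (\<Sum>b\<in>Basis. \<Sum>c\<in>Basis. kaehler_form J i b c *\<^sub>R trace (sig v th b ** sig w th c)) = - (real CARD('g) * (J i v \<bullet> w))" for th
   unfolding trace_sig s[symmetric] by (simp add: sum_negf)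
  thus ?thesis
   using torus_vol_pos by (simp add: field_kaehler_form_def torus_integral_eq[OF discrete_subgroup_axioms] avg_const kaehler_form_def)
 qed
qed

text \<open>Constants have only frequency 0, where every weight is 1, so all orders give the same
  norm.\<close>

lemma sobolev_norm_sig: "sobolev_norm La t (sig v) = sqrt (\<Sum>b\<in>Basis. \<Sum>h\<in>UNIV. \<Sum>k\<in>UNIV. (cmod (sig v 0 b $ h $ k))\<^sup>2)"
proof -
 have "(\<Sum>\<^sub>\<infinity>l\<in>La. (1 + (norm l)^2) powr t * (cmod (fc (%th. c) l))^2) = (cmod c)^2" for c
 proof -
  have "fc (%th. c) l = (if l = 0 then c else 0)" if "l \<in> La" for l
   using fourier_cis[OF that zero_mem, of c] by simp
  hence "(\<Sum>\<^sub>\<infinity>l\<in>La. (1 + (norm l)^2) powr t * (cmod (fc (%th. c) l))^2) = (\<Sum>\<^sub>\<infinity>l\<in>{0 :: 'q}. (cmod c)\<^sup>2)"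
   by (intro infsum_cong_neutral) (auto simp: zero_mem)
  thus ?thesis by simp
 qed
 thus ?thesis unfolding sobolev_norm_def sig_apply by simp
qed

lemma zero_fields: "(%_. 0) \<in> fields La e s"
 using sig_fields[of 0] sig_diff[of 0 0] by (metis (no_types, lifting) cancel_comm_monoid_add_class.diff_cancel ext)

lemma sobolev_norm_zero: "sobolev_norm La t (%_. 0 :: ('q, 'g) matvec) = 0"
 by (simp add: sobolev_norm_def fourier_eq avg_const)

text \<open>By linearity \<open>sig\<close> is its own derivative and the remainder is exactly
  zero.\<close>

lemma family_deriv_sig: "family_has_deriv La e s sig sig x"
proof -
 have "linear (%v. sig v th)" for th by (rule linearI) (simp_all add: sig_add sig_scaleR)
 thus ?thesis by (simp add: family_has_deriv_def sig_fields sobolev_norm_zero sig_diff)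
qed

lemma family_Ck_const: "X \<in> fields La e s ==> family_Ck La e s U n (%_. X)"
proof (induction n arbitrary: X)
 case 0 thus ?case by (simp add: family_continuous_def sobolev_norm_zero)
next
 case (Suc n)
 have "family_has_deriv La e s (%_. X) (%_ _. 0) x" for x
  using Suc.prems zero_fields by (simp add: family_has_deriv_def sobolev_norm_zero linear_zero)
 thus ?case using Suc.IH[OF zero_fields] by (auto intro!: exI[of _ "%_ _ _. 0"])
qed

lemma smooth_sig: "smooth_family La e s U sig"
 unfolding smooth_family_def
proof
 fix n show "family_Ck La e s U n sig"
 proof (cases n)
  case 0
  have "((%y. sobolev_norm La t (%th. sig y th - sig x th)) \<longlongrightarrow> 0) (at x)" for t x
  proof -
   have "((%y. sobolev_norm La t (sig (y - x))) \<longlongrightarrow> sobolev_norm La t (sig (x - x))) (at x)"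
    unfolding sobolev_norm_sig
   proof (intro tendsto_real_sqrt tendsto_sum tendsto_power tendsto_norm)
    fix b h k
    have "linear (%v. sig v 0 b $ h $ k)" by (rule linearI) (simp_all add: sig_add sig_scaleR blinfun.add_left blinfun.scaleR_left)
    hence "bounded_linear (%v. sig v 0 b $ h $ k)" by (simp add: linear_conv_bounded_linear)
    thus "((%y. sig (y - x) 0 b $ h $ k) \<longlongrightarrow> sig (x - x) 0 b $ h $ k) (at x)"
     by (rule bounded_linear.tendsto) (intro tendsto_intros)
   qed
   moreover have "sig (x - x) = (%_. 0)" using sig_diff[of x x] by auto
   moreover have "(%th. sig y th - sig x th) = sig (y - x)" for y by (rule ext) (rule sig_diff[symmetric])
   ultimately show ?thesis by (simp only: sobolev_norm_zero)
  qed
  thus ?thesis using 0 by (simp add: family_continuous_def sig_fields)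
 next
  case (Suc m)
  thus ?thesis
   using family_deriv_sig family_Ck_const[OF sig_fields] by (auto intro!: exI[of _ "%_. sig"])
 qed
qed

end

section \<open>The orbifold\<close>

locale orbifold_setting = gauge_setting J La e s
 for J :: "nat => 'q::euclidean_space \<Rightarrow>\<^sub>L 'q" and La and e :: "'g::finite => 'q \<Rightarrow>\<^sub>L 'q" and s +
 fixes \<Gamma>h :: "'q aff set" and \<Gamma> :: "('q \<Rightarrow>\<^sub>L 'q) set"
 assumes range_e: "range e = \<Gamma>" and \<Gamma>h_eq: "\<Gamma>h = La \<times> \<Gamma>"
begin

lemma mem_orbit_iff: "y \<in> aff_orbit \<Gamma>h x \<longleftrightarrow> (\<exists>m. \<exists>l\<in>La. y = e m x + l)"
 by (force simp: aff_orbit_def aff_act_def \<Gamma>h_eq range_e[symmetric])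

lemma orbit_eqI: "y \<in> aff_orbit \<Gamma>h x ==> aff_orbit \<Gamma>h y = aff_orbit \<Gamma>h x"
proof -
 have sub: "aff_orbit \<Gamma>h y \<subseteq> aff_orbit \<Gamma>h x" if y: "y \<in> aff_orbit \<Gamma>h x" for x y
 proof
  fix z assume "z \<in> aff_orbit \<Gamma>h y"
  then obtain a l' where a: "l' \<in> La" "z = e a y + l'" by (auto simp: mem_orbit_iff)
  obtain m l where m: "l \<in> La" "y = e m x + l" using y by (auto simp: mem_orbit_iff)
  have "z = e (mul a m) x + (e a l + l')" by (simp add: a m e_mul blinfun.add_right add.assoc)
  thus "z \<in> aff_orbit \<Gamma>h x" unfolding mem_orbit_iff using add_mem[OF e_mem[OF m(1)] a(1)] by blast
 qed
 assume y: "y \<in> aff_orbit \<Gamma>h x"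
 then obtain m l where m: "l \<in> La" "y = e m x + l" by (auto simp: mem_orbit_iff)
 have "x = e (invg m) y + e (invg m) (- l)" by (simp add: m e_invg blinfun.add_right flip: blinfun.add_right)
 hence "x \<in> aff_orbit \<Gamma>h y" unfolding mem_orbit_iff using e_mem[OF uminus_mem[OF m(1)]] by blast
 thus ?thesis using sub y by blast
qed

lemma orbit_self: "x \<in> aff_orbit \<Gamma>h x"
 unfolding mem_orbit_iff using e_unit zero_mem by (metis add.right_neutral)

lemma orbit_meet: "z \<in> aff_orbit \<Gamma>h x ==> z \<in> aff_orbit \<Gamma>h y ==> aff_orbit \<Gamma>h x = aff_orbit \<Gamma>h y"
 using orbit_eqI by metis

lemma free_iff: "x \<in> free_locus \<Gamma>h \<longleftrightarrow> (\<forall>m. \<forall>l\<in>La. e m x + l = x \<longrightarrow> m = unit \<and> l = 0)"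
proof -
 have "e m = id_blinfun \<longleftrightarrow> m = unit" for m using e_inj e_unit_blinfun by (metis injD)
 thus ?thesis by (auto simp: free_locus_def aff_act_def \<Gamma>h_eq range_e[symmetric] Aff_def)
qed

text \<open>Only finitely many nontrivial \<open>m\<close> occur, and for each one
  \<open>x - e m x\<close> has to avoid the closed set \<open>La\<close>; translations alone have no
  fixed points.\<close>

lemma open_free: "open (free_locus \<Gamma>h)"
proof -
 have "x \<in> free_locus \<Gamma>h \<longleftrightarrow> (\<forall>m\<in>- {unit}. x - e m x \<notin> La)" for x
 proof
  assume f: "x \<in> free_locus \<Gamma>h"
  show "\<forall>m\<in>- {unit}. x - e m x \<notin> La"
  proof (intro ballI notI)
   fix m assume m: "m \<in> - {unit}" and "x - e m x \<in> La"
   moreover have "e m x + (x - e m x) = x" by simp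
   ultimately show False using f unfolding free_iff by blast
  qed
 next
  assume f: "\<forall>m\<in>- {unit}. x - e m x \<notin> La"
  show "x \<in> free_locus \<Gamma>h"
   unfolding free_iff
  proof (intro allI ballI impI)
   fix m l assume l: "l \<in> La" "e m x + l = x"
   hence "x - e m x \<in> La" by (metis add_diff_cancel_left')
   hence "m = unit" using f by blast
   thus "m = unit \<and> l = 0" using l(2) by (simp add: e_unit)
  qed
 qed
 hence "free_locus \<Gamma>h = (\<Inter>m\<in>- {unit}. {x. x - e m x \<in> - La})" by auto
 moreover have "open {x. x - e m x \<in> - La}" for m
  using open_vimage[of "- La" "%x. x - e m x"] closed_mem
  by (simp add: vimage_def open_Compl continuous_intros blinfun.continuous_on)
 ultimately show ?thesis by auto
qed

text \<open>An arbitrary representative is chosen; \<open>sig_orbit\<close> makes the value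
  independent of it.\<close>

definition \<Phi> :: "'q set => ('q, 'g) field set" where
 "\<Phi> O1 = gauge_orbit La e s (sig (SOME x. x \<in> O1))"

lemma \<Phi>_orbit: "\<Phi> (aff_orbit \<Gamma>h x) = gauge_orbit La e s (sig x)"
proof -
 have "(SOME y. y \<in> aff_orbit \<Gamma>h x) \<in> aff_orbit \<Gamma>h x" using orbit_self by (rule someI)
 thus ?thesis unfolding \<Phi>_def mem_orbit_iff using sig_orbit by metis
qed

lemma \<Phi>_bij: "bij_betw \<Phi> (orbifold \<Gamma>h) (hk_quotient J La e s)"
 unfolding bij_betw_def
proof
 show "inj_on \<Phi> (orbifold \<Gamma>h)"
 proof (rule inj_onI)
  fix A B assume "A \<in> orbifold \<Gamma>h" "B \<in> orbifold \<Gamma>h" and eq: "\<Phi> A = \<Phi> B"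
  then obtain x y where xy: "A = aff_orbit \<Gamma>h x" "B = aff_orbit \<Gamma>h y" by (auto simp: orbifold_def)
  obtain m h l where l: "l \<in> La" "e m x + l = e h y" using sig_orbit_inj eq by (metis xy \<Phi>_orbit)
  have "e m x + l \<in> aff_orbit \<Gamma>h x" "e h y + 0 \<in> aff_orbit \<Gamma>h y"
   unfolding mem_orbit_iff using l(1) zero_mem by blast+
  thus "A = B" using orbit_meet l(2) by (simp add: xy)
 qed
 show "\<Phi> ` orbifold \<Gamma>h = hk_quotient J La e s"
 proof
  show "\<Phi> ` orbifold \<Gamma>h \<subseteq> hk_quotient J La e s"
   using sig_zero_level by (auto simp: orbifold_def hk_quotient_def \<Phi>_orbit)
  show "hk_quotient J La e s \<subseteq> \<Phi> ` orbifold \<Gamma>h"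
  proof
   fix K assume "K \<in> hk_quotient J La e s"
   then obtain X where X: "X \<in> zero_level J La e s" "K = gauge_orbit La e s X" by (auto simp: hk_quotient_def)
   obtain x g where "g \<in> gm" "gauge_act g X = sig x" by (rule gauge_fixing[OF X(1)])
   hence "K = \<Phi> (aff_orbit \<Gamma>h x)" using gauge_orbit_act X(2) by (metis \<Phi>_orbit)
   thus "K \<in> \<Phi> ` orbifold \<Gamma>h" by (auto simp: orbifold_def)
  qed
 qed
qed

lemma \<Phi>_compatible: "hk_compatible J \<Gamma>h La e s \<Phi>"
 unfolding hk_compatible_def \<Phi>_orbit
proof (intro conjI allI ballI impI)
 show "x \<in> free_locus \<Gamma>h \<longleftrightarrow> (\<forall>X\<in>gauge_orbit La e s (sig x). gauge_stabilizer La e s X = {scalar_coset (%_. mat 1)})" for x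
  unfolding free_iff by (rule stabilizer_trivial_iff)
next
 fix x assume x: "x \<in> free_locus \<Gamma>h"
 have "hk_isomorphism J La e s (sig y) sig" if "y \<in> free_locus \<Gamma>h" for y
  using hk_isomorphism_sig[of y] that unfolding free_iff by blast
 \<comment> \<open>\<open>sig\<close> lifts the map globally, so the whole free locus serves as the
   neighbourhood of each of its points.\<close>
 thus "\<exists>U \<sigma>. open U \<and> x \<in> U \<and> U \<subseteq> free_locus \<Gamma>h \<and> smooth_family La e s U \<sigma> \<and>
    (\<forall>y\<in>U. \<sigma> y \<in> zero_level J La e s \<and> gauge_orbit La e s (sig y) = gauge_orbit La e s (\<sigma> y) \<and>
      (\<exists>D. family_has_deriv La e s \<sigma> D y \<and> hk_isomorphism J La e s (\<sigma> y) D))"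
  using open_free x smooth_sig sig_zero_level family_deriv_sig
  by (intro exI[of _ "free_locus \<Gamma>h"] exI[of _ sig]) blast
next
 fix U x X assume U: "open U \<and> U \<subseteq> free_locus \<Gamma>h" "x \<in> U" and X: "X \<in> gauge_orbit La e s (sig x)"
 obtain k where k: "k \<in> gm" "gauge_act k (sig x) = X" using X unfolding gauge_orbit_eq by blast
 obtain dl where dl: "dl > 0" "ball x dl \<subseteq> U" using U open_contains_ball by blast
 have s0: "ereal 0 \<le> s" using order.strict_trans1[OF _ s_large, of 0] by (simp add: zero_ereal_def)
 show "\<exists>t dl. ereal t \<le> s \<and> dl > 0 \<and> (\<forall>Y\<in>zero_level J La e s. sobolev_norm La t (%th. Y th - X th) < dl \<longrightarrow>
   (\<exists>y\<in>U. Y \<in> gauge_orbit La e s (sig y)))"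
 \<comment> \<open>Order 0 is enough for openness: closeness in mean square already forces the
   parameters to be close modulo the group.\<close>
 proof (rule exI[of _ 0], rule exI[of _ dl], intro conjI s0 dl(1) ballI impI)
  fix Y assume Y: "Y \<in> zero_level J La e s" and near: "sobolev_norm La 0 (%th. Y th - X th) < dl"
  obtain y g where g: "g \<in> gm" "gauge_act g Y = sig y" by (rule gauge_fixing[OF Y])
  have "Y \<in> fields La e s" using Y by (simp add: zero_level_def)
  from intertwiner_near[OF k g this dl(1) near]
  obtain m h l where l: "l \<in> La" "norm (l - (e h y - e m x)) < dl" by blast
  \<comment> \<open>The representative of the parameter of \<open>Y\<close> that is near
    \<open>x\<close>: it solves \<open>e m ?y = e h y - l\<close>, and \<open>e m\<close> is an
    isometry.\<close>
  let ?y = "e (mul (invg m) h) y + e (invg m) (- l)"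
  have em: "e m ?y = e h y - l" by (simp add: e_mul e_invg' blinfun.add_right blinfun.diff_right blinfun.minus_right)
  have "norm (x - ?y) = norm (e m (x - ?y))" by simp
  also have "... = norm (l - (e h y - e m x))" unfolding blinfun.diff_right em by (simp add: algebra_simps)
  finally have "?y \<in> U" using l(2) dl(2) by (auto simp: dist_norm)
  moreover have "Y \<in> gauge_orbit La e s (sig ?y)"
   using gauge_orbit_self[of Y] gauge_orbit_act[OF g(1), of Y] g(2) sig_orbit[OF e_mem[OF uminus_mem[OF l(1)]], of "mul (invg m) h" y] by simp
  ultimately show "\<exists>y\<in>U. Y \<in> gauge_orbit La e s (sig y)" by blast
 qed
qed

section \<open>The orbifold as a quotient of the torus times the normal space\<close>

definition split :: "'q => ('q set \<times> 'q) set" where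
 "split x = split_orbit \<Gamma> (torus_coset La (proj x), x - proj x)"

lemma mem_split_orbit: "p \<in> split_orbit \<Gamma> (C, w) \<longleftrightarrow> (\<exists>m. p = (e m ` C, e m w))"
 by (auto simp: split_orbit_def range_e[symmetric])

lemma split_orbit_e: "split_orbit \<Gamma> (e m ` C, e m w) = split_orbit \<Gamma> (C, w)"
proof -
 have "\<exists>b. (e a ` e m ` C, e a (e m w)) = (e b ` C, e b w)" for a
  by (intro exI[of _ "mul a m"]) (simp add: e_mul image_image)
 moreover have "\<exists>b. (e a ` C, e a w) = (e b ` e m ` C, e b (e m w))" for a
  by (intro exI[of _ "mul a (invg m)"]) (simp add: e_mul image_image e_invg)
 ultimately show ?thesis unfolding set_eq_iff mem_split_orbit by metis
qed

lemma e_span: "u \<in> span La ==> e m u \<in> span La"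
 by (rule linear_span_induct[of u]) (auto intro: span_base e_mem simp: bounded_linear.linear[OF blinfun.bounded_linear_right])

lemma e_perp: "w \<in> orthogonal_comp (span La) ==> e m w \<in> orthogonal_comp (span La)"
 unfolding orthogonal_comp_def orthogonal_def
proof (intro CollectI ballI)
 fix y assume "w \<in> {w. \<forall>y\<in>span La. y \<bullet> w = 0}" "y \<in> span La"
 hence "e (invg m) y \<bullet> w = 0" using e_span by blast
 thus "y \<bullet> e m w = 0" using inner_e[of m w y] by (simp add: inner_commute)
qed

lemma proj_e: "l \<in> La ==> proj (e m x + l) = e m (proj x) + l"
proof (rule proj_eqI)
 assume l: "l \<in> La"
 show "e m (proj x) + l \<in> span La" by (intro span_add e_span proj_span span_base l)
 have "e m x + l - (e m (proj x) + l) = e m (x - proj x)" by (simp add: blinfun.diff_right)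
 thus "e m x + l - (e m (proj x) + l) \<in> orthogonal_comp (span La)" using e_perp[OF proj_perp] by simp
qed

lemma torus_coset_e: "l \<in> La ==> torus_coset La (e m u + l) = e m ` torus_coset La u"
proof -
 assume l: "l \<in> La"
 have "\<exists>k\<in>La. e m u + l + a = e m (u + k)" if "a \<in> La" for a
  by (rule bexI[of _ "e (invg m) (l + a)"]) (simp_all add: blinfun.add_right[of "e m"] e_invg' e_mem add_mem l that)
 moreover have "\<exists>a\<in>La. e m (u + k) = e m u + l + a" if "k \<in> La" for k
  by (rule bexI[of _ "e m k - l"]) (simp_all add: blinfun.add_right e_mem diff_mem l that)
 ultimately show ?thesis by (auto simp: torus_coset_def image_iff)
qed

text \<open>The group respects the orthogonal splitting. Lattice translations change only the
  tangential part and are absorbed by the coset, and linear parts are absorbed by the orbit.\<close>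

lemma split_e: "l \<in> La ==> split (e m x + l) = split x"
 unfolding split_def by (simp add: proj_e torus_coset_e split_orbit_e flip: blinfun.diff_right)

lemma split_inj: "split x = split y ==> aff_orbit \<Gamma>h x = aff_orbit \<Gamma>h y"
proof -
 assume eq: "split x = split y"
 have "(torus_coset La (proj y), y - proj y) \<in> split y"
  unfolding split_def mem_split_orbit by (intro exI[of _ unit]) (simp add: e_unit)
 then obtain m where m: "torus_coset La (proj y) = e m ` torus_coset La (proj x)" "y - proj y = e m (x - proj x)"
  unfolding eq[symmetric] unfolding split_def mem_split_orbit by auto
 have "proj y + 0 \<in> torus_coset La (proj y)" unfolding torus_coset_def using zero_mem by blast
 then obtain l where l: "l \<in> La" "proj y = e m (proj x + l)" unfolding m(1) by (auto simp: torus_coset_def)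
 have "y = e m x + e m l" using m(2) l(2) by (simp add: blinfun.add_right blinfun.diff_right algebra_simps)
 hence "y \<in> aff_orbit \<Gamma>h x" unfolding mem_orbit_iff using e_mem[OF l(1)] by blast
 thus ?thesis using orbit_eqI by simp
qed

lemma split_orbifold_bij:
 "\<exists>\<Psi>. bij_betw \<Psi> (orbifold \<Gamma>h) (split_orbifold \<Gamma> La) \<and>
  (\<forall>u\<in>span La. \<forall>w\<in>orthogonal_comp (span La). \<Psi> (aff_orbit \<Gamma>h (u + w)) = split_orbit \<Gamma> (torus_coset La u, w))"
proof -
 define \<Psi> where "\<Psi> O1 = split (SOME x. x \<in> O1)" for O1
 have \<Psi>: "\<Psi> (aff_orbit \<Gamma>h x) = split x" for x
 proof -
  have "(SOME y. y \<in> aff_orbit \<Gamma>h x) \<in> aff_orbit \<Gamma>h x" using orbit_self by (rule someI)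
  thus ?thesis unfolding \<Psi>_def mem_orbit_iff using split_e by metis
 qed
 have uw: "split (u + w) = split_orbit \<Gamma> (torus_coset La u, w)" if "u \<in> span La" "w \<in> orthogonal_comp (span La)" for u w
  using proj_eqI[of u "u + w"] that by (simp add: split_def)
 have "bij_betw \<Psi> (orbifold \<Gamma>h) (split_orbifold \<Gamma> La)"
  unfolding bij_betw_def
 proof
  show "inj_on \<Psi> (orbifold \<Gamma>h)" unfolding orbifold_def using split_inj \<Psi> by (intro inj_onI) (metis rangeE)
  show "\<Psi> ` orbifold \<Gamma>h = split_orbifold \<Gamma> La"
  proof
   show "\<Psi> ` orbifold \<Gamma>h \<subseteq> split_orbifold \<Gamma> La"
    using proj_span proj_perp by (auto simp: orbifold_def split_orbifold_def torus_def \<Psi> split_def)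
   show "split_orbifold \<Gamma> La \<subseteq> \<Psi> ` orbifold \<Gamma>h"
    using uw by (auto simp: orbifold_def split_orbifold_def torus_def image_image \<Psi> image_iff)
  qed
 qed
 thus ?thesis using \<Psi> uw by auto
qed

end

theorem mainTheorem1:
  fixes J :: "nat \<Rightarrow> 'q::euclidean_space \<Rightarrow>\<^sub>L 'q"
    and \<Gamma>h :: "('q \<times> ('q \<Rightarrow>\<^sub>L 'q)) set"
    and \<Gamma> :: "('q \<Rightarrow>\<^sub>L 'q) set"
    and \<Lambda> :: "'q set"
    and e :: "'g::finite \<Rightarrow> 'q \<Rightarrow>\<^sub>L 'q"
    and s :: ereal
  assumes "DIM('q) = 4"
    and "hyperkaehler J"
    and "linear_action \<Gamma>h \<Gamma> \<Lambda>"
    and "\<Gamma> \<subseteq> Sp J"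
    and "\<Gamma> \<noteq> {id_blinfun}"
    and "bij_betw e UNIV \<Gamma>"
    and "ereal (real (dim \<Lambda>) / 2) < s"
  shows "(\<exists>\<Phi>. bij_betw \<Phi> (orbifold \<Gamma>h) (hk_quotient J \<Lambda> e s) \<and> hk_compatible J \<Gamma>h \<Lambda> e s \<Phi>) \<and>
         (\<exists>\<Psi>. bij_betw \<Psi> (orbifold \<Gamma>h) (split_orbifold \<Gamma> \<Lambda>) \<and>
            (\<forall>u\<in>span \<Lambda>. \<forall>w\<in>orthogonal_comp (span \<Lambda>).
               \<Psi> (aff_orbit \<Gamma>h (u + w)) = split_orbit \<Gamma> (torus_coset \<Lambda> u, w)))"
proof -
 have sub: "subgroup \<Gamma>h Aff" and dis: "discrete \<Gamma>h" and \<Gamma>h: "\<Gamma>h = \<Lambda> \<times> \<Gamma>"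
  using assms(3) by (auto simp: linear_action_def)
 have range_e: "range e = \<Gamma>" and e_inj: "inj e" using assms(6) by (auto simp: bij_betw_def)
 have mult: "(v + A w, A o\<^sub>L B) \<in> \<Gamma>h" if "(v, A) \<in> \<Gamma>h" "(w, B) \<in> \<Gamma>h" for v w A B
  using subgroup.m_closed[OF sub that] by (simp add: Aff_def)
 have one: "(0, id_blinfun) \<in> \<Gamma>h" using subgroup.one_closed[OF sub] by (simp add: Aff_def)
 have idl: "id_blinfun o\<^sub>L B = B" "B o\<^sub>L id_blinfun = B" for B :: "'q \<Rightarrow>\<^sub>L 'q" by (rule blinfun_eqI, simp)+
 \<comment> \<open>\<open>subgroup\<close> gives closure under the abstract inverse of
   \<open>Aff\<close>, which therefore has to be computed for translations.\<close>
 have neg: "- l \<in> \<Lambda>" if l: "l \<in> \<Lambda>" for l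
 proof -
  have "inv\<^bsub>Aff\<^esub> (l, id_blinfun) = (- l, id_blinfun)"
   unfolding m_inv_def
   by (rule the_equality) (auto simp: Aff_def idl ortho_group_def orthogonal_transformation_id eq_neg_iff_add_eq_0 add.commute)
  moreover have "(l, id_blinfun) \<in> \<Gamma>h" using l one by (simp add: \<Gamma>h)
  ultimately show ?thesis using subgroup.m_inv_closed[OF sub] by (fastforce simp: \<Gamma>h)
 qed
 have "discrete_subgroup \<Lambda>"
 proof
  show "0 \<in> \<Lambda>" using one by (simp add: \<Gamma>h)
  show "x - y \<in> \<Lambda>" if "x \<in> \<Lambda>" "y \<in> \<Lambda>" for x y
   using mult[of x id_blinfun "- y" id_blinfun] that neg one by (simp add: \<Gamma>h)
  \<comment> \<open>Isolation of the identity in \<open>\<Gamma>h\<close> provides the separation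
    constant of the lattice.\<close>
  obtain T where T: "open T" "T \<inter> \<Gamma>h = {(0, id_blinfun)}"
   using dis one unfolding discrete_def isolated_in_def by blast
  then obtain eps where eps: "eps > 0" "ball (0, id_blinfun) eps \<subseteq> T" by (metis IntD1 insertI1 open_contains_ball)
  have "eps \<le> norm l" if l: "l \<in> \<Lambda>" "l \<noteq> 0" for l
  proof (rule ccontr)
   assume "\<not> ?thesis"
   hence "(l, id_blinfun) \<in> ball (0, id_blinfun) eps" by (simp add: dist_Pair_Pair)
   hence "(l, id_blinfun) \<in> T \<inter> \<Gamma>h" using eps(2) l(1) one by (auto simp: \<Gamma>h)
   thus False using T(2) l(2) by auto
  qed
  thus "\<exists>eps>0. \<forall>l\<in>\<Lambda>. l \<noteq> 0 \<longrightarrow> eps \<le> norm l" using eps(1) by blast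
 qed
 then interpret discrete_subgroup \<Lambda> .
 have eSp: "e h \<in> Sp J" for h using assms(4) range_e by auto
 hence e_orth: "orthogonal_transformation (blinfun_apply (e h))" for h by (simp add: Sp_def ortho_group_def)
 have e0: "(0, e h) \<in> \<Gamma>h" for h using one range_e by (auto simp: \<Gamma>h)
 have comp: "A o\<^sub>L B \<in> \<Gamma>" if "A \<in> \<Gamma>" "B \<in> \<Gamma>" for A B
  using mult[of 0 A 0 B] that zero_mem by (simp add: \<Gamma>h)
 interpret orbifold_setting J \<Lambda> e s \<Gamma>h \<Gamma>
 proof
  show "DIM('q) = 4" "hyperkaehler J" "inj e" "range e = \<Gamma>" "\<Gamma>h = \<Lambda> \<times> \<Gamma>" "ereal (real (dim \<Lambda>) / 2) < s"
   by (fact assms(1,2,7) e_inj range_e \<Gamma>h)+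
  show "id_blinfun \<in> range e" using one range_e by (auto simp: \<Gamma>h)
  show "e h o\<^sub>L e k \<in> range e" for h k using comp range_e by auto
  show "e h v \<bullet> e h w = v \<bullet> w" for h v w using e_orth by (simp add: orthogonal_transformation_def)
  show "e h (J i v) = J i (e h v)" if "i \<in> {1,2,3}" for i h v
  proof -
   have "e h o\<^sub>L J i = J i o\<^sub>L e h" using eSp[of h] that unfolding Sp_def by blast
   thus ?thesis by (metis blinfun_apply_blinfun_compose)
  qed
  show "e h l \<in> \<Lambda>" if "l \<in> \<Lambda>" for h l using mult[OF e0[of h], of l id_blinfun] that one by (simp add: \<Gamma>h)
  \<comment> \<open>A finite set of invertible maps closed under composition contains inverses:
    right multiplication by \<open>e h\<close> is injective on it, hence onto.\<close>
  show "\<exists>k. e k o\<^sub>L e h = id_blinfun" for h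
  proof -
   have "inj_on (%B. B o\<^sub>L e h) \<Gamma>"
   proof (rule inj_onI)
    fix B C assume "B o\<^sub>L e h = C o\<^sub>L e h"
    hence "B (e h v) = C (e h v)" for v by (metis blinfun_apply_blinfun_compose)
    thus "B = C" using orthogonal_transformation_surj[OF e_orth[of h]] by (metis blinfun_eqI surjD)
   qed
   moreover have "(%B. B o\<^sub>L e h) ` \<Gamma> \<subseteq> \<Gamma>" using comp range_e by auto
   moreover have "finite \<Gamma>" using range_e by (metis finite finite_imageI)
   ultimately have "(%B. B o\<^sub>L e h) ` \<Gamma> = \<Gamma>" by (simp add: endo_inj_surj)
   moreover have "id_blinfun \<in> \<Gamma>" using one by (simp add: \<Gamma>h)
   ultimately show ?thesis using range_e by (metis (no_types, lifting) imageE)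
  qed
 qed
 show ?thesis using \<Phi>_bij \<Phi>_compatible split_orbifold_bij by blast
qed

end
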